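(* Let $n\ge2$ and let $\{\chi_j\}_{j\in\{1,\dots,n\}}$ be the partition of unity in frequency space described in the context. There exists a constant $C>0$, not depending on $z$, such that for every $z\in\rho(-\Delta)=\mathbb{C}\setminus[0,+\infty)$, every $f\in L^1_{x_j}L^2_{\widehat{x}_j}(\mathbb{R}^n)$ and every $j,k\in\{1,\dots,n\}$, $$\big\|\chi_j(|z|^{-1/2}D)\,R_{-\Delta}(z)f\big\|_{L^\infty_{x_j}L^2_{\widehat{x}_j}}\le C\,|z|^{-1/2}\,\|f\|_{L^1_{x_j}L^2_{\widehat{x}_j}},$$ $$\big\|\chi_j(|z|^{-1/2}D)\,\partial_k R_{-\Delta}(z)f\big\|_{L^\infty_{x_j}L^2_{\widehat{x}_j}}\le C\,\|f\|_{L^1_{x_j}L^2_{\widehat{x}_j}}.$$ In particular, it follows that $$\|R_{-\Delta}(z)\|_{X\to X^*}\le C|z|^{-1/2},\qquad \|\partial_kR_{-\Delta}(z)\|_{X\to X^*}\le C .$$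
   Context: $R_{-\Delta}(z)=(-\Delta-z)^{-1}$ is the resolvent of the Laplacian on $\mathbb{R}^n$, i.e. the Fourier multiplier with symbol $(|\xi|^2-z)^{-1}$, and $\partial_k=\partial/\partial x_k$. For $x\in\mathbb{R}^n$ and $j\in\{1,\dots,n\}$, $\widehat{x}_j:=(x_1,\dots,x_{j-1},x_{j+1},\dots,x_n)\in\mathbb{R}^{n-1}$ (similarly $\widehat{\xi}_j$). The mixed norm $\|f\|_{L^p_{x_j}L^q_{\widehat{x}_j}}$ is the $L^p(\mathbb{R},dx_j)$ norm of the function $x_j\mapsto\|f(x_j,\cdot)\|_{L^q(\mathbb{R}^{n-1},d\widehat{x}_j)}$. Set $$X:=\bigcap_{j=1}^nL^1_{x_j}L^2_{\widehat{x}_j}(\mathbb{R}^n),\qquad \|f\|_X=\max_{j\in\{1,\dots,n\}}\|f\|_{L^1_{x_j}L^2_{\widehat{x}_j}},$$ $$X^*:=\sum_{j=1}^nL^\infty_{x_j}L^2_{\widehat{x}_j}(\mathbb{R}^n),\qquad \|f\|_{X^*}=\inf\Big\{\sum_{j=1}^n\|f_j\|_{L^\infty_{x_j}L^2_{\widehat{x}_j}}: f=\sum_{j=1}^nf_j\Big\}.$$ Partition of unity: fix constants $r,R,\delta>0$ such that $1<r<R$ and $\sqrt{R^2-1}<\delta<1$, and consider the open cover $\mathcal{S}=\{\mathcal{S}^+_j,\mathcal{S}^-_j,\mathcal{S}_\infty\}_{j\in\{1,\dots,n\}}$ of the space $\mathbb{R}^n$ defined by $$\mathcal{S}^\pm_j=\{\xi\in\mathbb{R}^n:\pm\xi_j>\delta|\widehat{\xi}_j|,\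 |\xi|<R\},\qquad \mathcal{S}_\infty=\{\xi\in\mathbb{R}^n:|\xi|>r\}.$$ Let $\{\chi_j^+,\chi_j^-,\chi_\infty\}_{j\in\{1,\dots,n\}}$ be a smooth partition of unity subordinate to $\mathcal{S}$, i.e. a family of smooth positive (that is, non-negative) functions such that $\mathrm{supp}\,\chi_j^\pm\subset\mathcal{S}_j^\pm$, $\mathrm{supp}\,\chi_\infty\subset\mathcal{S}_\infty$, and $\chi_\infty+\sum_{j=1}^n[\chi_j^++\chi_j^-]\equiv1$. Define the smooth partition of unity $$\chi_j:=\chi_j^++\chi_j^-+\tfrac1n\chi_\infty,\qquad j\in\{1,\dots,n\},$$ and the Fourier multipliers $\chi_j(|z|^{-1/2}D)f=\mathcal{F}^{-1}_\xi[\chi_j(|z|^{-1/2}\xi)\,\mathcal{F}_xf]$, where $\mathcal{F}_x$ is the Fourier transform on $\mathbb{R}^n$ and $\mathcal{F}^{-1}_\xi$ its inverse.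
   Formalization: The origin lies in none of the sets S_j^±, S_∞, so no partition of unity on all of R^n is subordinate to them; here smoothness, supports and the condition that the sum is 1 are required only on R^n without the origin. *)

theory Defs
  imports "HOL-Analysis.Analysis" "HOL-Probability.Essential_Supremum"
    "HOL-Library.Nonpos_Ints"
begin

definition enn_powr :: "ennreal \<Rightarrow> real \<Rightarrow> ennreal" where
  "enn_powr a s = (if a = \<infinity> then \<infinity> else ennreal (enn2real a powr s))"

text \<open>Exponents are meant to lie in \<open>[1, \<infinity>]\<close>.\<close>

definition Lp_norm :: "ennreal \<Rightarrow> 'a measure \<Rightarrow> ('a \<Rightarrow> ennreal) \<Rightarrow> ennreal" where
  "Lp_norm p M g =
     (if p = \<infinity> then esssup M g
      else enn_powr (\<integral>\<^sup>+ x. enn_powr (g x) (enn2real p) \<partial>M) (1 / enn2real p))"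

text \<open>\<open>join_coord j t y\<close> is the point whose \<open>j\<close>-th coordinate is \<open>t\<close> and whose other
  coordinates are those of \<open>y\<close>. The space of the variables other than \<open>x\<^sub>j\<close> is the product of
  copies of \<open>lborel\<close> over the index set \<open>UNIV - {j}\<close>.\<close>

definition join_coord :: "'n \<Rightarrow> real \<Rightarrow> ('n \<Rightarrow> real) \<Rightarrow> real ^ 'n" where
  "join_coord j t y = (\<chi> i. if i = j then t else y i)"

definition mixed_norm ::
    "ennreal \<Rightarrow> ennreal \<Rightarrow> 'n \<Rightarrow> (real ^ 'n::finite \<Rightarrow> complex) \<Rightarrow> ennreal" where
  "mixed_norm p q j f =
     Lp_norm p lborel (\<lambda>t.
       Lp_norm q (\<Pi>\<^sub>M i\<in>UNIV - {j}. lborel) (\<lambda>y. ennreal (norm (f (join_coord j t y)))))"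

text \<open>Elements of the function spaces are represented by Borel functions; every class modulo
  null sets has such a representative, and the norms do not depend on its choice.\<close>

definition mixed_space ::
    "ennreal \<Rightarrow> ennreal \<Rightarrow> 'n \<Rightarrow> (real ^ 'n::finite \<Rightarrow> complex) set" where
  "mixed_space p q j = {f \<in> borel_measurable lborel. mixed_norm p q j f < \<infinity>}"

definition X_norm :: "(real ^ 'n::finite \<Rightarrow> complex) \<Rightarrow> ennreal" where
  "X_norm f = Max (range (\<lambda>j. mixed_norm 1 2 j f))"

definition X_space :: "(real ^ 'n::finite \<Rightarrow> complex) set" where
  "X_space = (\<Inter>j. mixed_space 1 2 j)"

text \<open>The value is \<open>\<infinity>\<close> outside \<open>X\<^sup>*\<close>.\<close>

definition Xstar_norm :: "(real ^ 'n::finite \<Rightarrow> complex) \<Rightarrow> ennreal" where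
  "Xstar_norm f =
     (INF g \<in> {g. (\<forall>j. g j \<in> borel_measurable lborel) \<and> (AE x in lborel. f x = (\<Sum>j\<in>UNIV. g j x))}.
        \<Sum>j\<in>UNIV. mixed_norm \<infinity> 2 j (g j))"

definition pderiv_at :: "'n \<Rightarrow> (real ^ 'n::finite \<Rightarrow> 'b::real_normed_vector) \<Rightarrow> real ^ 'n \<Rightarrow> 'b" where
  "pderiv_at k f x = frechet_derivative f (at x) (axis k 1)"

primrec pderivs :: "'n list \<Rightarrow> (real ^ 'n::finite \<Rightarrow> 'b::real_normed_vector) \<Rightarrow> real ^ 'n \<Rightarrow> 'b" where
  "pderivs [] f = f"
| "pderivs (k # ks) f = pderiv_at k (pderivs ks f)"

text \<open>For open \<open>U\<close> this is \<open>C\<^sup>\<infinity>\<close> on \<open>U\<close>: differentiability of all iterated partial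
  derivatives makes them all continuous.\<close>

definition smooth_on :: "(real ^ 'n::finite) set \<Rightarrow> (real ^ 'n \<Rightarrow> 'b::real_normed_vector) \<Rightarrow> bool" where
  "smooth_on U f \<longleftrightarrow> (\<forall>ks. \<forall>x\<in>U. pderivs ks f differentiable (at x))"

definition schwartz :: "(real ^ 'n::finite \<Rightarrow> complex) set" where
  "schwartz =
     {\<phi>. smooth_on UNIV \<phi> \<and>
         (\<forall>ks N. bounded (range (\<lambda>x. (1 + norm x) ^ N *\<^sub>R pderivs ks \<phi> x)))}"

text \<open>The tempered distributions that occur are all given by functions \<open>f\<close>, acting by
  \<open>\<phi> \<mapsto> \<integral> f \<phi>\<close>. Operators are relations between such functions; the output is
  determined up to a null set.\<close>

definition tempered_fun :: "(real ^ 'n::finite \<Rightarrow> complex) \<Rightarrow> bool" where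
  "tempered_fun f \<longleftrightarrow>
     f \<in> borel_measurable lborel \<and> (\<forall>\<phi>\<in>schwartz. integrable lborel (\<lambda>x. f x * \<phi> x))"

definition fourier :: "(real ^ 'n::finite \<Rightarrow> complex) \<Rightarrow> real ^ 'n \<Rightarrow> complex" where
  "fourier \<phi> \<xi> = (\<integral>x. exp (- (\<i> * complex_of_real (x \<bullet> \<xi>))) * \<phi> x \<partial>lborel)"

definition has_fourier ::
    "(real ^ 'n::finite \<Rightarrow> complex) \<Rightarrow> (real ^ 'n \<Rightarrow> complex) \<Rightarrow> bool" where
  "has_fourier f g \<longleftrightarrow>
     tempered_fun f \<and> tempered_fun g \<and>
     (\<forall>\<phi>\<in>schwartz. (\<integral>\<xi>. g \<xi> * \<phi> \<xi> \<partial>lborel) = (\<integral>x. f x * fourier \<phi> x \<partial>lborel))"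

text \<open>\<open>u\<close> is the inverse Fourier transform of \<open>m\<close> times the Fourier transform of \<open>f\<close>.\<close>

definition fourier_multiplier ::
    "(real ^ 'n::finite \<Rightarrow> complex) \<Rightarrow> (real ^ 'n \<Rightarrow> complex) \<Rightarrow> (real ^ 'n \<Rightarrow> complex) \<Rightarrow> bool" where
  "fourier_multiplier m f u \<longleftrightarrow> (\<exists>g. has_fourier f g \<and> has_fourier u (\<lambda>\<xi>. m \<xi> * g \<xi>))"

definition resolvent_laplacian ::
    "complex \<Rightarrow> (real ^ 'n::finite \<Rightarrow> complex) \<Rightarrow> (real ^ 'n \<Rightarrow> complex) \<Rightarrow> bool" where
  "resolvent_laplacian z = fourier_multiplier (\<lambda>\<xi>. 1 / (complex_of_real ((norm \<xi>)\<^sup>2) - z))"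

definition weak_pderiv ::
    "'n \<Rightarrow> (real ^ 'n::finite \<Rightarrow> complex) \<Rightarrow> (real ^ 'n \<Rightarrow> complex) \<Rightarrow> bool" where
  "weak_pderiv k v w \<longleftrightarrow>
     tempered_fun v \<and> tempered_fun w \<and>
     (\<forall>\<phi>\<in>schwartz. (\<integral>x. w x * \<phi> x \<partial>lborel) = - (\<integral>x. v x * pderiv_at k \<phi> x \<partial>lborel))"

text \<open>Operator norm from \<open>X\<close> to \<open>X\<^sup>*\<close>. It is \<open>\<infinity>\<close> if some \<open>f\<close> in the unit ball of \<open>X\<close> has no
  image, since the infimum of the empty set is \<open>\<infinity>\<close>; otherwise the inner infimum
  is over almost everywhere equal functions.\<close>

definition opnorm_X_Xstar ::
    "((real ^ 'n::finite \<Rightarrow> complex) \<Rightarrow> (real ^ 'n \<Rightarrow> complex) \<Rightarrow> bool) \<Rightarrow> ennreal" where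
  "opnorm_X_Xstar T =
     (SUP f \<in> {f \<in> X_space. X_norm f \<le> 1}. INF u \<in> {u. T f u}. Xstar_norm u)"

definition hat_norm :: "'n \<Rightarrow> real ^ 'n::finite \<Rightarrow> real" where
  "hat_norm j \<xi> = L2_set (\<lambda>i. \<xi> $ i) (UNIV - {j})"

definition S_plus :: "real \<Rightarrow> real \<Rightarrow> 'n \<Rightarrow> (real ^ 'n::finite) set" where
  "S_plus R \<delta> j = {\<xi>. \<xi> $ j > \<delta> * hat_norm j \<xi> \<and> norm \<xi> < R}"

definition S_minus :: "real \<Rightarrow> real \<Rightarrow> 'n \<Rightarrow> (real ^ 'n::finite) set" where
  "S_minus R \<delta> j = {\<xi>. - (\<xi> $ j) > \<delta> * hat_norm j \<xi> \<and> norm \<xi> < R}"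

definition S_infty :: "real \<Rightarrow> (real ^ 'n::finite) set" where
  "S_infty r = {\<xi>. norm \<xi> > r}"

lemma zero_not_in_cover:
  "0 \<notin> S_plus R \<delta> j" "0 \<notin> S_minus R \<delta> j" "r > 0 \<Longrightarrow> 0 \<notin> S_infty r"
  by (simp_all add: S_plus_def S_minus_def S_infty_def hat_norm_def L2_set_def)

text \<open>Since the origin lies in none of these sets, they can only cover the space minus the
  origin, and no family with supports in them sums to \<open>1\<close> at the origin. The partition of unity
  is therefore one on \<open>U = - {0}\<close>: smoothness, closedness of supports and the sum condition are
  relative to \<open>U\<close>, and the values at the origin, a null set, are irrelevant. These conditions
  are implied by the corresponding ones with \<open>U = UNIV\<close>.\<close>

definition subordinate_on ::
    "(real ^ 'n::finite) set \<Rightarrow> (real ^ 'n) set \<Rightarrow> (real ^ 'n \<Rightarrow> real) \<Rightarrow> bool" where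
  "subordinate_on U S g \<longleftrightarrow>
     smooth_on U g \<and> (\<forall>\<xi>\<in>U. 0 \<le> g \<xi>) \<and> U \<inter> closure (support_on U g) \<subseteq> S"

definition frequency_partition ::
    "real \<Rightarrow> real \<Rightarrow> real \<Rightarrow> ('n \<Rightarrow> real ^ 'n::finite \<Rightarrow> real) \<Rightarrow> ('n \<Rightarrow> real ^ 'n \<Rightarrow> real)
      \<Rightarrow> (real ^ 'n \<Rightarrow> real) \<Rightarrow> bool" where
  "frequency_partition r R \<delta> chip chim chiinf \<longleftrightarrow>
     (\<forall>j. subordinate_on (- {0}) (S_plus R \<delta> j) (chip j)) \<and>
     (\<forall>j. subordinate_on (- {0}) (S_minus R \<delta> j) (chim j)) \<and>
     subordinate_on (- {0}) (S_infty r) chiinf \<and>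
     (\<forall>\<xi>\<in>- {0}. chiinf \<xi> + (\<Sum>j\<in>UNIV. chip j \<xi> + chim j \<xi>) = 1)"

definition chi ::
    "('n \<Rightarrow> real ^ 'n::finite \<Rightarrow> real) \<Rightarrow> ('n \<Rightarrow> real ^ 'n \<Rightarrow> real) \<Rightarrow> (real ^ 'n \<Rightarrow> real)
      \<Rightarrow> 'n \<Rightarrow> real ^ 'n \<Rightarrow> real" where
  "chi chip chim chiinf j \<xi> = chip j \<xi> + chim j \<xi> + 1 / real CARD('n) * chiinf \<xi>"

definition scaled_multiplier ::
    "complex \<Rightarrow> (real ^ 'n::finite \<Rightarrow> real) \<Rightarrow> (real ^ 'n \<Rightarrow> complex) \<Rightarrow> (real ^ 'n \<Rightarrow> complex) \<Rightarrow> bool" where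
  "scaled_multiplier z m =
     fourier_multiplier (\<lambda>\<xi>. complex_of_real (m ((cmod z powr (-1/2)) *\<^sub>R \<xi>)))"

end

theory Submission imports Defs "HOL-Probability.Probability" begin

text \<open>
  Let \<open>m\<close> be the symbol of \<open>\<chi>\<^sub>j(|z|\<^bsup>-1/2\<^esup>D) R(z)\<close> or \<open>\<chi>\<^sub>j(|z|\<^bsup>-1/2\<^esup>D) \<partial>\<^sub>kR(z)\<close>. A Fourier transform
  in the variables other than \<open>x\<^sub>j\<close> turns the multiplier into a family of convolutions in \<open>x\<^sub>j\<close>, so
  by Plancherel's formula and duality its norm from \<open>L\<^sup>1L\<^sup>2\<close> to \<open>L\<^sup>\<infinity>L\<^sup>2\<close> is at most the supremum, over
  \<open>t\<close>, \<open>\<eta>\<close> and large \<open>M\<close>, of the absolute value of the integral of \<open>e\<^sup>i\<^sup>t\<^sup>\<tau> m(\<tau>, \<eta>)\<close> over \<open>|\<tau>| \<le> M\<close>.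
  Scaling reduces to \<open>|z| = 1\<close>, where \<open>m\<close> has the denominator \<open>\<tau>\<^sup>2 - \<kappa>\<^sup>2\<close> with \<open>\<kappa>\<^sup>2 = z - |\<eta>|\<^sup>2\<close>.
  On the supports of \<open>\<chi>\<^sub>j\<^sup>+\<close> and \<open>\<chi>\<^sub>j\<^sup>-\<close> the condition on \<open>\<delta>\<close> keeps \<open>|\<eta>|\<close> below a constant less than \<open>1\<close>,
  so \<open>\<kappa>\<close> stays away from \<open>0\<close>, the poles are simple, and subtracting the value of the smooth factor
  at \<open>Re \<kappa>\<close> leaves the truncated Fourier transform of \<open>1 / (\<tau> - \<kappa>)\<close>, which is bounded uniformly in \<open>\<kappa>\<close>.
  On the support of \<open>\<chi>\<^sub>\<infinity>\<close> the denominator is comparable to \<open>1 + |\<xi>|\<^sup>2\<close>; only the numerator \<open>\<xi>\<^sub>j\<close> fails to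
  give an absolutely convergent integral, and there the symbol is compared with the conjugate
  Poisson kernel.
\<close>

text \<open>Functions in L^1L^2 need not lie in L^2, so even the Fourier transform g of f has to be
  constructed. The duality estimate itself does this: applied to (1 + |\<xi>|)^(-2), whose integral
  along each line is at most \<pi>, it bounds g / (1 + |\<xi>|) in L^2. For fixed z the symbols of
  R(z) and \<partial>_k R(z) times 1 + |\<xi>| are bounded, so all outputs are L^2 functions and
  only their mixed norms remain to be estimated. Bounds that depend on z serve existence and
  integrability; the uniform constants come from line integrals alone. The partition of unity is
  smooth only off the origin and may have no limit there. Lipschitz bounds along a line are
  therefore taken only from a base point (Re \<kappa>, \<eta>) at distance at least 1/2 from the
  origin; if that point is nearer, then |Im \<kappa>|^2 is at least 3/4 and the integrand is
  bounded. Bessel's inequality in the variables other than x_j has the constant (2 \<pi>)^(n-1),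
  which is less than the (2 \<pi>)^n of the inversion formula, so a bound on the lines passes
  unchanged to the operator.\<close>

lemma integrable_times_pair:
  fixes f :: "'a \<Rightarrow> complex" and g :: "'b \<Rightarrow> complex"
  assumes M: "sigma_finite_measure M" "sigma_finite_measure N"
    and f: "integrable M f" and g: "integrable N g"
  shows "integrable (M \<Otimes>\<^sub>M N) (\<lambda>(x, y). f x * g y)"
proof -
  interpret pair_sigma_finite M N using M by (simp add: pair_sigma_finite_def)
  have [measurable]: "f \<in> borel_measurable M" "g \<in> borel_measurable N"
    using f g by auto
  show ?thesis
    by (rule Fubini_integrable) (auto simp: norm_mult intro!: integrable_mult_right integrable_mult_left integrable_norm f g)
qed

lemma borel_measurable_cnj [measurable]: "cnj \<in> borel_measurable borel"
  by (intro borel_measurable_continuous_onI continuous_intros)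

lemma borel_measurable_cis [measurable]: "cis \<in> borel_measurable borel"
  by (intro borel_measurable_continuous_onI continuous_intros)

section \<open>Square integrable functions\<close>

text \<open>The square of the norm, with values in [0, \<infinity>]: sums, limits and majorants can
  be handled without finiteness conditions, and roots enter only with the mixed norms.\<close>

definition L2_sq :: "'a measure \<Rightarrow> ('a \<Rightarrow> complex) \<Rightarrow> ennreal" where
  "L2_sq M f = (\<integral>\<^sup>+x. (ennreal (norm (f x)))\<^sup>2 \<partial>M)"

definition L2 :: "'a measure \<Rightarrow> ('a \<Rightarrow> complex) set" where
  "L2 M = {f \<in> borel_measurable M. L2_sq M f < \<infinity>}"

lemma L2_sq_finite: "f \<in> L2 M \<Longrightarrow> L2_sq M f < \<infinity>"
  by (simp add: L2_def)

lemma L2_iff_integrable: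
  "f \<in> L2 M \<longleftrightarrow> f \<in> borel_measurable M \<and> integrable M (\<lambda>x. (norm (f x))\<^sup>2)"
  by (auto simp: L2_def L2_sq_def integrable_iff_bounded ennreal_power)

lemma nn_Cauchy_Schwarz_L2:
  assumes [measurable]: "f \<in> borel_measurable M" "g \<in> borel_measurable M"
  shows "(\<integral>\<^sup>+x. ennreal (norm (f x * g x)) \<partial>M)\<^sup>2 \<le> L2_sq M f * L2_sq M g"
  unfolding L2_sq_def norm_mult ennreal_mult'[OF norm_ge_zero]
  by (rule Cauchy_Schwarz_nn_integral) measurable

lemma ennreal_square_finite: "(a::ennreal)\<^sup>2 < \<top> \<Longrightarrow> a < \<top>"
  by (cases a) (auto simp: power2_eq_square)

lemma L2_mult_integrable:
  assumes "f \<in> L2 M" "g \<in> L2 M"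
  shows "integrable M (\<lambda>x. f x * g x)"
proof -
  have [measurable]: "f \<in> borel_measurable M" "g \<in> borel_measurable M"
    using assms by (auto simp: L2_def)
  have "(\<integral>\<^sup>+x. ennreal (norm (f x * g x)) \<partial>M)\<^sup>2 < \<infinity>"
    using le_less_trans[OF nn_Cauchy_Schwarz_L2[of f M g]] assms[THEN L2_sq_finite]
    by (simp add: ennreal_mult_less_top)
  then show ?thesis
    using ennreal_square_finite[of "\<integral>\<^sup>+x. ennreal (norm (f x * g x)) \<partial>M"]
    by (simp only: integrable_iff_bounded infinity_ennreal_def) simp
qed

lemma norm_L2_pairing_le:
  assumes "f \<in> L2 M" "g \<in> L2 M"
  shows "(ennreal (norm (\<integral>x. f x * g x \<partial>M)))\<^sup>2 \<le> L2_sq M f * L2_sq M g"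
proof -
  have "ennreal (norm (\<integral>x. f x * g x \<partial>M)) \<le> (\<integral>\<^sup>+x. ennreal (norm (f x * g x)) \<partial>M)"
    by (rule integral_norm_bound_ennreal[OF L2_mult_integrable[OF assms]])
  then have "(ennreal (norm (\<integral>x. f x * g x \<partial>M)))\<^sup>2 \<le> (\<integral>\<^sup>+x. ennreal (norm (f x * g x)) \<partial>M)\<^sup>2"
    by (rule power_mono) simp
  also have "\<dots> \<le> L2_sq M f * L2_sq M g"
    using assms by (intro nn_Cauchy_Schwarz_L2) (auto simp: L2_def)
  finally show ?thesis .
qed

text \<open>After the triangle inequality the two sides differ by (|a| - |b|)^2. This stands in for
  Minkowski's inequality; the lost factor 2 is harmless.\<close>

lemma norm_add_square_le:
  fixes a b :: "'a::real_normed_vector"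
  shows "(norm (a + b))\<^sup>2 \<le> 2 * (norm a)\<^sup>2 + 2 * (norm b)\<^sup>2"
proof -
  have "(norm (a + b))\<^sup>2 \<le> (norm a + norm b)\<^sup>2"
    by (intro power_mono norm_triangle_ineq) auto
  also have "\<dots> \<le> 2 * (norm a)\<^sup>2 + 2 * (norm b)\<^sup>2"
    using sum_squares_ge_zero[of "norm a - norm b" 0] by (simp add: power2_eq_square algebra_simps)
  finally show ?thesis .
qed

lemma L2_sq_add_le:
  assumes [measurable]: "f \<in> borel_measurable M" "g \<in> borel_measurable M"
  shows "L2_sq M (\<lambda>x. f x + g x) \<le> 2 * L2_sq M f + 2 * L2_sq M g"
proof -
  have "L2_sq M (\<lambda>x. f x + g x)
      \<le> (\<integral>\<^sup>+x. 2 * (ennreal (norm (f x)))\<^sup>2 + 2 * (ennreal (norm (g x)))\<^sup>2 \<partial>M)"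
    unfolding L2_sq_def
    by (intro nn_integral_mono)
       (simp add: ennreal_power norm_add_square_le flip: ennreal_plus ennreal_numeral ennreal_mult)
  also have "\<dots> = 2 * L2_sq M f + 2 * L2_sq M g"
    unfolding L2_sq_def by (subst nn_integral_add) (auto simp: nn_integral_cmult)
  finally show ?thesis .
qed

lemma L2_sq_mono:
  assumes "\<And>x. x \<in> space M \<Longrightarrow> norm (f x) \<le> norm (g x)"
  shows "L2_sq M f \<le> L2_sq M g"
  unfolding L2_sq_def using assms by (intro nn_integral_mono power_mono ennreal_leI) auto

lemma L2_add: "f \<in> L2 M \<Longrightarrow> g \<in> L2 M \<Longrightarrow> (\<lambda>x. f x + g x) \<in> L2 M"
  using L2_sq_add_le[of f M g] unfolding L2_def
  by (auto simp: ennreal_mult_less_top intro: le_less_trans)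

lemma L2_bound:
  assumes "f \<in> L2 M" "g \<in> borel_measurable M" "\<And>x. x \<in> space M \<Longrightarrow> norm (g x) \<le> norm (f x)"
  shows "g \<in> L2 M"
  using assms L2_sq_mono[of M g f] by (auto simp: L2_def)

lemma L2_sq_cmult:
  "f \<in> borel_measurable M \<Longrightarrow> L2_sq M (\<lambda>x. c * f x) = (ennreal (norm c))\<^sup>2 * L2_sq M f"
  unfolding L2_sq_def by (subst nn_integral_cmult[symmetric])
    (auto simp: norm_mult ennreal_mult power_mult_distrib)

lemma L2_cmult: "f \<in> L2 M \<Longrightarrow> (\<lambda>x. c * f x) \<in> L2 M"
  by (auto simp: L2_def L2_sq_cmult ennreal_mult_less_top ennreal_power)

lemma L2_diff: "f \<in> L2 M \<Longrightarrow> g \<in> L2 M \<Longrightarrow> (\<lambda>x. f x - g x) \<in> L2 M"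
  using L2_add[OF _ L2_cmult[of g M "-1"], of f] by simp

text \<open>Cauchy-Schwarz applied to the difference. Every duality formula below is proved for
  truncations and carried to the limit by this convergence.\<close>

lemma L2_pairing_tendsto:
  assumes f: "\<And>k. f k \<in> L2 M" "F \<in> L2 M" and h: "h \<in> L2 M"
    and lim: "(\<lambda>k. L2_sq M (\<lambda>x. f k x - F x)) \<longlonglongrightarrow> 0"
  shows "(\<lambda>k. \<integral>x. f k x * h x \<partial>M) \<longlonglongrightarrow> (\<integral>x. F x * h x \<partial>M)"
proof -
  have "(\<lambda>k. L2_sq M (\<lambda>x. f k x - F x) * L2_sq M h) \<longlonglongrightarrow> 0 * L2_sq M h"
    using L2_sq_finite[OF h] by (intro tendsto_mult_ennreal lim tendsto_const) auto
  then have hl: "(\<lambda>k. L2_sq M (\<lambda>x. f k x - F x) * L2_sq M h) \<longlonglongrightarrow> 0"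
    by simp
  have le: "(ennreal (norm (\<integral>x. (f k x - F x) * h x \<partial>M)))\<^sup>2 \<le> L2_sq M (\<lambda>x. f k x - F x) * L2_sq M h" for k
    by (intro norm_L2_pairing_le L2_diff f h)
  have "(\<lambda>k. (ennreal (norm (\<integral>x. (f k x - F x) * h x \<partial>M)))\<^sup>2) \<longlonglongrightarrow> 0"
    by (rule tendsto_sandwich[OF _ _ tendsto_const hl]) (simp_all add: le)
  then have "(\<lambda>k. ennreal ((norm (\<integral>x. (f k x - F x) * h x \<partial>M))\<^sup>2)) \<longlonglongrightarrow> ennreal 0"
    by (simp add: ennreal_power)
  then have "(\<lambda>k. (norm (\<integral>x. (f k x - F x) * h x \<partial>M))\<^sup>2) \<longlonglongrightarrow> 0"
    by (subst (asm) tendsto_ennreal_iff) auto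
  then have "(\<lambda>k. sqrt ((norm (\<integral>x. (f k x - F x) * h x \<partial>M))\<^sup>2)) \<longlonglongrightarrow> sqrt 0"
    by (rule tendsto_real_sqrt)
  then have "(\<lambda>k. (\<integral>x. (f k x - F x) * h x \<partial>M)) \<longlonglongrightarrow> 0"
    by (simp add: tendsto_norm_zero_iff)
  then have "(\<lambda>k. (\<integral>x. f k x * h x \<partial>M) - (\<integral>x. F x * h x \<partial>M)) \<longlonglongrightarrow> 0"
    by (simp add: left_diff_distrib Bochner_Integration.integral_diff[OF L2_mult_integrable L2_mult_integrable] f h)
  then show ?thesis
    by (simp add: LIM_zero_iff)
qed

section \<open>Plancherel's formula by Gaussian regularization\<close>

text \<open>What Plancherel's formula uses of the exponential: integrable regularizers
  \<open>\<gamma> n\<close> tending to 1 whose transforms are nonnegative kernels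
  \<open>\<kappa> n\<close> of mass \<open>c\<close>. In this form one proof serves the whole space,
  the space of the variables other than x_j, and the line.\<close>

locale fourier_pairing =
  fixes M :: "'a measure" and p :: "'a \<Rightarrow> 'a \<Rightarrow> real" and \<gamma> :: "nat \<Rightarrow> 'a \<Rightarrow> real"
    and \<kappa> :: "nat \<Rightarrow> 'a \<Rightarrow> 'a \<Rightarrow> real" and c :: real
  assumes sf: "sigma_finite_measure M"
    and p_measurable [measurable]: "(\<lambda>(x, y). p x y) \<in> borel_measurable (M \<Otimes>\<^sub>M M)"
    and \<gamma>_integrable: "integrable M (\<gamma> n)"
    and \<gamma>_bounds: "0 \<le> \<gamma> n \<xi>" "\<gamma> n \<xi> \<le> 1"
    and \<gamma>_lim: "(\<lambda>n. \<gamma> n \<xi>) \<longlonglongrightarrow> 1"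
    and \<kappa>_measurable [measurable]: "(\<lambda>(x, y). \<kappa> n x y) \<in> borel_measurable (M \<Otimes>\<^sub>M M)"
    and \<kappa>_nonneg: "0 \<le> \<kappa> n x y"
    and \<kappa>_int: "x \<in> space M \<Longrightarrow> (\<integral>\<^sup>+y. ennreal (\<kappa> n x y) \<partial>M) = ennreal c"
      "y \<in> space M \<Longrightarrow> (\<integral>\<^sup>+x. ennreal (\<kappa> n x y) \<partial>M) = ennreal c"
    and \<kappa>_eq: "x \<in> space M \<Longrightarrow> y \<in> space M \<Longrightarrow>
        (\<integral>\<xi>. cis (p y \<xi> - p x \<xi>) * complex_of_real (\<gamma> n \<xi>) \<partial>M) = complex_of_real (\<kappa> n x y)"
    and c_nonneg: "0 \<le> c"
begin

definition ft :: "('a \<Rightarrow> complex) \<Rightarrow> 'a \<Rightarrow> complex" where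
  "ft f \<xi> = (\<integral>x. cis (- p x \<xi>) * f x \<partial>M)"

sublocale pair_sigma_finite M M
  by (simp add: pair_sigma_finite_def sf)

lemma ft_measurable [measurable]:
  assumes [measurable]: "f \<in> borel_measurable M"
  shows "ft f \<in> borel_measurable M"
  unfolding ft_def by measurable

lemma \<gamma>_measurable [measurable]: "\<gamma> n \<in> borel_measurable M"
  using \<gamma>_integrable by auto

lemma norm_ft_le:
  "norm (ft f \<xi>) \<le> (\<integral>x. norm (f x) \<partial>M)"
  unfolding ft_def by (rule order_trans[OF integral_norm_bound]) (simp add: norm_mult)

lemma ft_integrand_integrable:
  assumes "integrable M f" "\<xi> \<in> space M"
  shows "integrable M (\<lambda>x. cis (- p x \<xi>) * f x)"
proof -
  have [measurable]: "f \<in> borel_measurable M" using assms by auto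
  show ?thesis
    by (rule Bochner_Integration.integrable_bound[OF assms(1)])
      (use assms(2) in \<open>auto simp: norm_mult\<close>)
qed

text \<open>Fubini's theorem on a triple product, where the integrand has modulus |w(\<xi>) f(x)
  g(y)|. Besides the Gaussian weights, \<open>w\<close> will be a truncated symbol on a line, and
  the inner integral is then its convolution kernel.\<close>

lemma weighted_parseval:
  assumes f: "integrable M f" and g: "integrable M g" and w: "integrable M w"
  shows "(\<integral>\<xi>. ft f \<xi> * cnj (ft g \<xi>) * w \<xi> \<partial>M)
    = (\<integral>z. f (fst z) * cnj (g (snd z)) * (\<integral>\<xi>. cis (p (snd z) \<xi> - p (fst z) \<xi>) * w \<xi> \<partial>M) \<partial>(M \<Otimes>\<^sub>M M))"
proof -
  have [measurable]: "f \<in> borel_measurable M" "g \<in> borel_measurable M" "w \<in> borel_measurable M" using f g w by auto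
  interpret Q: pair_sigma_finite M "M \<Otimes>\<^sub>M M"
    by (simp add: pair_sigma_finite_def sf sigma_finite_measure_axioms)
  define H where "H \<xi> z = w \<xi> *
     ((cis (- p (fst z) \<xi>) * f (fst z)) * cnj (cis (- p (snd z) \<xi>) * g (snd z)))" for \<xi> z
  have fg: "integrable (M \<Otimes>\<^sub>M M) (\<lambda>(x, y). f x * cnj (g y))"
    using f g by (intro integrable_times_pair sf) auto
  have "integrable (M \<Otimes>\<^sub>M (M \<Otimes>\<^sub>M M)) (\<lambda>(\<xi>, z). w \<xi> * (\<lambda>(x, y). f x * cnj (g y)) z)"
    by (intro integrable_times_pair sf sigma_finite_measure_axioms fg)
       (rule w)
  then have H: "integrable (M \<Otimes>\<^sub>M (M \<Otimes>\<^sub>M M)) (\<lambda>(\<xi>, z). H \<xi> z)"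
    by (rule Bochner_Integration.integrable_bound)
       (auto simp: H_def norm_mult split: prod.splits)
  have 1: "(\<integral>z. H \<xi> z \<partial>(M \<Otimes>\<^sub>M M)) = ft f \<xi> * cnj (ft g \<xi>) * w \<xi>"
    if \<xi>: "\<xi> \<in> space M" for \<xi>
  proof -
    have i: "integrable M (\<lambda>x. cis (- p x \<xi>) * f x)" "integrable M (\<lambda>x. cnj (cis (- p x \<xi>) * g x))"
      using ft_integrand_integrable[OF f \<xi>] ft_integrand_integrable[OF g \<xi>]
      by (auto simp del: complex_cnj_mult)
    have "(\<integral>z. H \<xi> z \<partial>(M \<Otimes>\<^sub>M M)) = w \<xi> *
      (\<integral>z. (\<lambda>(x, y). (cis (- p x \<xi>) * f x) * cnj (cis (- p y \<xi>) * g y)) z \<partial>(M \<Otimes>\<^sub>M M))"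
      unfolding H_def by (simp add: case_prod_beta)
    also have "(\<integral>z. (\<lambda>(x, y). (cis (- p x \<xi>) * f x) * cnj (cis (- p y \<xi>) * g y)) z \<partial>(M \<Otimes>\<^sub>M M))
        = (\<integral>x. (\<integral>y. (cis (- p x \<xi>) * f x) * cnj (cis (- p y \<xi>) * g y) \<partial>M) \<partial>M)"
      by (subst integral_fst'[symmetric])
         (use integrable_times_pair[OF sf sf i] in \<open>auto\<close>)
    also have "\<dots> = ft f \<xi> * cnj (ft g \<xi>)"
      unfolding ft_def Bochner_Integration.integral_cnj[symmetric] by (simp del: complex_cnj_mult)
    finally show ?thesis by (simp add: mult.commute)
  qed
  have 2: "(\<integral>\<xi>. H \<xi> z \<partial>M) = f (fst z) * cnj (g (snd z)) * (\<integral>\<xi>. cis (p (snd z) \<xi> - p (fst z) \<xi>) * w \<xi> \<partial>M)"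
    if z: "z \<in> space (M \<Otimes>\<^sub>M M)" for z
  proof -
    have xy: "fst z \<in> space M" "snd z \<in> space M" using z by (auto simp: space_pair_measure)
    have c1: "cis (- a) * cnj (cis (- b)) = cis (b - a)" for a b
      by (simp add: cis_cnj cis_mult)
    have "(\<integral>\<xi>. H \<xi> z \<partial>M) = (\<integral>\<xi>. f (fst z) * cnj (g (snd z)) *
        (cis (p (snd z) \<xi> - p (fst z) \<xi>) * w \<xi>) \<partial>M)"
      by (rule Bochner_Integration.integral_cong)
         (simp_all add: H_def flip: c1)
    also have "\<dots> = f (fst z) * cnj (g (snd z)) * (\<integral>\<xi>. cis (p (snd z) \<xi> - p (fst z) \<xi>) * w \<xi> \<partial>M)"
      by simp
    finally show ?thesis .
  qed
  have "(\<integral>\<xi>. ft f \<xi> * cnj (ft g \<xi>) * w \<xi> \<partial>M) = (\<integral>\<xi>. (\<integral>z. H \<xi> z \<partial>(M \<Otimes>\<^sub>M M)) \<partial>M)"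
    by (intro Bochner_Integration.integral_cong) (auto simp: 1)
  also have "\<dots> = (\<integral>z. (\<integral>\<xi>. H \<xi> z \<partial>M) \<partial>(M \<Otimes>\<^sub>M M))"
    by (rule Q.Fubini_integral[OF H, symmetric])
  also have "\<dots> = (\<integral>z. f (fst z) * cnj (g (snd z)) * (\<integral>\<xi>. cis (p (snd z) \<xi> - p (fst z) \<xi>) * w \<xi> \<partial>M) \<partial>(M \<Otimes>\<^sub>M M))"
    by (intro Bochner_Integration.integral_cong) (auto simp: 2)
  finally show ?thesis .
qed

lemma regularized_parseval:
  assumes f: "integrable M f" and g: "integrable M g"
  shows "(\<integral>\<xi>. ft f \<xi> * cnj (ft g \<xi>) * complex_of_real (\<gamma> n \<xi>) \<partial>M)
    = (\<integral>z. f (fst z) * cnj (g (snd z)) * complex_of_real (\<kappa> n (fst z) (snd z)) \<partial>(M \<Otimes>\<^sub>M M))"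
proof -
  have w: "integrable M (\<lambda>\<xi>. complex_of_real (\<gamma> n \<xi>))" using \<gamma>_integrable by simp
  show ?thesis
    unfolding weighted_parseval[OF f g w]
    by (rule Bochner_Integration.integral_cong) (auto simp: \<kappa>_eq space_pair_measure)
qed

text \<open>Schur's test for the kernel \<open>\<kappa> n\<close> bounds the regularized integral; Fatou's lemma removes
  the regularization.\<close>

lemma bessel:
  assumes f: "integrable M f" and f2: "f \<in> L2 M"
  shows "L2_sq M (ft f) \<le> ennreal c * L2_sq M f"
proof -
  have [measurable]: "f \<in> borel_measurable M" using f by auto
  have bd: "(\<integral>\<^sup>+\<xi>. (ennreal (norm (ft f \<xi>)))\<^sup>2 * ennreal (\<gamma> n \<xi>) \<partial>M) \<le> ennreal c * L2_sq M f" for n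
  proof -
    define S where "S = (\<integral>\<xi>. (norm (ft f \<xi>))\<^sup>2 * \<gamma> n \<xi> \<partial>M)"
    define B where "B = (\<integral>x. norm (f x) \<partial>M)"
    have "integrable M (\<lambda>\<xi>. (norm (ft f \<xi>))\<^sup>2 * \<gamma> n \<xi>)"
    proof (rule Bochner_Integration.integrable_bound[OF integrable_mult_right[of "B\<^sup>2", OF \<gamma>_integrable[of n]]])
      show "AE x in M. norm ((cmod (ft f x))\<^sup>2 * \<gamma> n x) \<le> norm (B\<^sup>2 * \<gamma> n x)"
        using norm_ft_le[of f] \<gamma>_bounds by (intro AE_I2) (auto simp: B_def abs_mult intro!: mult_mono power_mono)
    qed measurable
    then have S: "(\<integral>\<^sup>+\<xi>. (ennreal (norm (ft f \<xi>)))\<^sup>2 * ennreal (\<gamma> n \<xi>) \<partial>M) = ennreal S"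
      unfolding S_def by (subst nn_integral_eq_integral[symmetric])
        (auto simp: \<gamma>_bounds ennreal_mult ennreal_power)
    have S0: "0 \<le> S" unfolding S_def by (rule integral_nonneg_AE) (simp add: \<gamma>_bounds)
    have "complex_of_real S = (\<integral>\<xi>. ft f \<xi> * cnj (ft f \<xi>) * complex_of_real (\<gamma> n \<xi>) \<partial>M)"
      unfolding S_def integral_complex_of_real[symmetric]
      by (intro Bochner_Integration.integral_cong refl) (simp only: complex_norm_square of_real_mult)
    also have "\<dots> = (\<integral>z. f (fst z) * cnj (f (snd z)) * complex_of_real (\<kappa> n (fst z) (snd z)) \<partial>(M \<Otimes>\<^sub>M M))"
      by (rule regularized_parseval[OF f f])
    finally have "ennreal S = ennreal (norm (\<integral>z. f (fst z) * cnj (f (snd z)) * complex_of_real (\<kappa> n (fst z) (snd z)) \<partial>(M \<Otimes>\<^sub>M M)))"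
      using S0 by (metis abs_of_nonneg norm_of_real)
    also have "\<dots> \<le> (\<integral>\<^sup>+z. norm (f (fst z) * cnj (f (snd z)) * complex_of_real (\<kappa> n (fst z) (snd z))) \<partial>(M \<Otimes>\<^sub>M M))"
    \<comment> \<open>If the integrand is not integrable, its Bochner integral is 0 by convention
      and the bound is trivial.\<close>
    proof (cases "integrable (M \<Otimes>\<^sub>M M) (\<lambda>z. f (fst z) * cnj (f (snd z)) * complex_of_real (\<kappa> n (fst z) (snd z)))")
      case True then show ?thesis by (rule integral_norm_bound_ennreal)
    qed (simp add: not_integrable_integral_eq)
    also have "\<dots> = (\<integral>\<^sup>+x. \<integral>\<^sup>+y. norm (f x * cnj (f y) * complex_of_real (\<kappa> n x y)) \<partial>M \<partial>M)"
      by (subst sigma_finite_measure.nn_integral_fst[OF sf, symmetric]) auto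
    \<comment> \<open>The inequality 2ab \<le> a^2 + b^2 separates the variables: in each half one
      variable meets only the kernel and integrates to \<open>c\<close>.\<close>
    also have "\<dots> \<le> (\<integral>\<^sup>+x. \<integral>\<^sup>+y. ennreal (1/2) * ((ennreal (norm (f x)))\<^sup>2 * ennreal (\<kappa> n x y)) +
         ennreal (1/2) * ((ennreal (norm (f y)))\<^sup>2 * ennreal (\<kappa> n x y)) \<partial>M \<partial>M)"
    proof (intro nn_integral_mono)
      fix x y
      have half: "ennreal h * ((ennreal a)\<^sup>2 * ennreal k) = ennreal (h * (a\<^sup>2 * k))"
        if "0 \<le> h" "0 \<le> a" "0 \<le> k" for a h k
        using that by (simp add: ennreal_power flip: ennreal_mult)
      have "norm (f x) * norm (f y) \<le> 1/2 * (norm (f x))\<^sup>2 + 1/2 * (norm (f y))\<^sup>2"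
        using sum_squares_ge_zero[of "norm (f x) - norm (f y)" 0] by (simp add: power2_eq_square algebra_simps)
      then have "norm (f x) * norm (f y) * \<kappa> n x y \<le> (1/2 * (norm (f x))\<^sup>2 + 1/2 * (norm (f y))\<^sup>2) * \<kappa> n x y"
        using \<kappa>_nonneg by (intro mult_right_mono) auto
      then show "ennreal (norm (f x * cnj (f y) * complex_of_real (\<kappa> n x y)))
         \<le> ennreal (1/2) * ((ennreal (norm (f x)))\<^sup>2 * ennreal (\<kappa> n x y)) +
         ennreal (1/2) * ((ennreal (norm (f y)))\<^sup>2 * ennreal (\<kappa> n x y))"
        using \<kappa>_nonneg[of n x y]
        by (subst (1 2) half) (simp_all add: norm_mult distrib_right flip: ennreal_plus)
    qed
    also have "\<dots> = ennreal (1/2) * (\<integral>\<^sup>+x. \<integral>\<^sup>+y. (ennreal (norm (f x)))\<^sup>2 * ennreal (\<kappa> n x y) \<partial>M \<partial>M)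
      + ennreal (1/2) * (\<integral>\<^sup>+x. \<integral>\<^sup>+y. (ennreal (norm (f y)))\<^sup>2 * ennreal (\<kappa> n x y) \<partial>M \<partial>M)"
    proof -
      have [measurable]: "(\<lambda>x. \<integral>\<^sup>+y. (ennreal (norm (f x)))\<^sup>2 * ennreal (\<kappa> n x y) \<partial>M) \<in> borel_measurable M"
        "(\<lambda>x. \<integral>\<^sup>+y. (ennreal (norm (f y)))\<^sup>2 * ennreal (\<kappa> n x y) \<partial>M) \<in> borel_measurable M"
        by measurable
      have "(\<integral>\<^sup>+y. ennreal (1/2) * ((ennreal (norm (f x)))\<^sup>2 * ennreal (\<kappa> n x y)) +
         ennreal (1/2) * ((ennreal (norm (f y)))\<^sup>2 * ennreal (\<kappa> n x y)) \<partial>M)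
        = ennreal (1/2) * (\<integral>\<^sup>+y. (ennreal (norm (f x)))\<^sup>2 * ennreal (\<kappa> n x y) \<partial>M) +
          ennreal (1/2) * (\<integral>\<^sup>+y. (ennreal (norm (f y)))\<^sup>2 * ennreal (\<kappa> n x y) \<partial>M)"
        if [measurable]: "x \<in> space M" for x
        by (subst nn_integral_add) (measurable, simp add: nn_integral_cmult)
      then show ?thesis
        by (simp add: nn_integral_add nn_integral_cmult cong: nn_integral_cong)
    qed
    also have "(\<integral>\<^sup>+x. \<integral>\<^sup>+y. (ennreal (norm (f x)))\<^sup>2 * ennreal (\<kappa> n x y) \<partial>M \<partial>M) = ennreal c * L2_sq M f"
      by (simp add: nn_integral_cmult \<kappa>_int L2_sq_def nn_integral_multc mult.commute cong: nn_integral_cong)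
    also have "(\<integral>\<^sup>+x. \<integral>\<^sup>+y. (ennreal (norm (f y)))\<^sup>2 * ennreal (\<kappa> n x y) \<partial>M \<partial>M)
      = (\<integral>\<^sup>+y. \<integral>\<^sup>+x. (ennreal (norm (f y)))\<^sup>2 * ennreal (\<kappa> n x y) \<partial>M \<partial>M)"
      by (rule Fubini'[symmetric]) measurable
    also have "\<dots> = ennreal c * L2_sq M f"
      by (simp add: nn_integral_cmult \<kappa>_int L2_sq_def nn_integral_multc mult.commute cong: nn_integral_cong)
    also have "ennreal (1/2) * (ennreal c * L2_sq M f) + ennreal (1/2) * (ennreal c * L2_sq M f) = ennreal c * L2_sq M f"
      by (subst distrib_right[symmetric], subst ennreal_plus[symmetric]) simp_all
    finally show ?thesis unfolding S .
  qed
  have "L2_sq M (ft f) = (\<integral>\<^sup>+\<xi>. liminf (\<lambda>n. (ennreal (norm (ft f \<xi>)))\<^sup>2 * ennreal (\<gamma> n \<xi>)) \<partial>M)"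
    unfolding L2_sq_def
  proof (rule nn_integral_cong)
    fix \<xi>
    have "(\<lambda>n. (ennreal (norm (ft f \<xi>)))\<^sup>2 * ennreal (\<gamma> n \<xi>)) \<longlonglongrightarrow> (ennreal (norm (ft f \<xi>)))\<^sup>2 * ennreal 1"
      by (intro tendsto_mult_ennreal tendsto_const tendsto_ennrealI \<gamma>_lim) (auto simp: ennreal_power)
    then show "(ennreal (norm (ft f \<xi>)))\<^sup>2 = liminf (\<lambda>n. (ennreal (norm (ft f \<xi>)))\<^sup>2 * ennreal (\<gamma> n \<xi>))"
      by (simp add: lim_imp_Liminf)
  qed
  also have "\<dots> \<le> liminf (\<lambda>n. \<integral>\<^sup>+\<xi>. (ennreal (norm (ft f \<xi>)))\<^sup>2 * ennreal (\<gamma> n \<xi>) \<partial>M)"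
    by (rule nn_integral_liminf) measurable
  also have "\<dots> \<le> ennreal c * L2_sq M f"
    by (rule Liminf_le) (use bd in auto)
  finally show ?thesis .
qed

lemma ft_L2: "integrable M f \<Longrightarrow> f \<in> L2 M \<Longrightarrow> ft f \<in> L2 M"
  using bessel[of f] by (auto simp: L2_def ennreal_mult_less_top le_less_trans)

text \<open>Equality, as opposed to Bessel's inequality, needs the kernels to act on
  \<open>g\<close> as an approximate identity. The regularization is then removed by dominated
  convergence on both sides, with majorants |\<open>ft f\<close>| |\<open>ft g\<close>| and B c
  |f|.\<close>

lemma parseval:
  assumes f: "integrable M f" "f \<in> L2 M" and g: "integrable M g" "g \<in> L2 M"
    and B: "\<And>x. x \<in> space M \<Longrightarrow> norm (g x) \<le> B"
    and lim: "\<And>x. x \<in> space M \<Longrightarrow>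
        (\<lambda>n. \<integral>y. g y * complex_of_real (\<kappa> n x y) \<partial>M) \<longlonglongrightarrow> complex_of_real c * g x"
  shows "(\<integral>\<xi>. ft f \<xi> * cnj (ft g \<xi>) \<partial>M) = complex_of_real c * (\<integral>x. f x * cnj (g x) \<partial>M)"
proof -
  have [measurable]: "f \<in> borel_measurable M" "g \<in> borel_measurable M" using f g by auto
  have cnj_L2: "(\<lambda>x. cnj (h x)) \<in> L2 M" if "h \<in> L2 M" for h
    using that by (auto simp: L2_def L2_sq_def)
  define G where "G n x = (\<integral>y. cnj (g y) * complex_of_real (\<kappa> n x y) \<partial>M)" for n x
  have "(\<lambda>n. \<integral>\<xi>. ft f \<xi> * cnj (ft g \<xi>) * complex_of_real (\<gamma> n \<xi>) \<partial>M) \<longlonglongrightarrow> (\<integral>\<xi>. ft f \<xi> * cnj (ft g \<xi>) \<partial>M)"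
  proof (rule integral_dominated_convergence[where w="\<lambda>\<xi>. norm (ft f \<xi> * cnj (ft g \<xi>))"])
    show "integrable M (\<lambda>\<xi>. norm (ft f \<xi> * cnj (ft g \<xi>)))"
      by (intro integrable_norm L2_mult_integrable cnj_L2 ft_L2 f g)
    show "AE x in M. (\<lambda>i. ft f x * cnj (ft g x) * complex_of_real (\<gamma> i x)) \<longlonglongrightarrow> ft f x * cnj (ft g x)"
    proof (intro AE_I2)
      fix x
      show "(\<lambda>i. ft f x * cnj (ft g x) * complex_of_real (\<gamma> i x)) \<longlonglongrightarrow> ft f x * cnj (ft g x)"
        using tendsto_mult[OF tendsto_const[of "ft f x * cnj (ft g x)"] tendsto_of_real[OF \<gamma>_lim[of x], where 'a=complex]] by simp
    qed
    show "AE x in M. norm (ft f x * cnj (ft g x) * complex_of_real (\<gamma> i x)) \<le> norm (ft f x * cnj (ft g x))" for i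
      using \<gamma>_bounds[of i] by (auto simp: norm_mult intro!: mult_left_le)
  qed measurable
  moreover have "(\<integral>\<xi>. ft f \<xi> * cnj (ft g \<xi>) * complex_of_real (\<gamma> n \<xi>) \<partial>M) = (\<integral>x. f x * G n x \<partial>M)" for n
  proof -
    have "(\<integral>\<^sup>+x. \<integral>\<^sup>+y. norm (f x * cnj (g y) * complex_of_real (\<kappa> n x y)) \<partial>M \<partial>M)
       \<le> (\<integral>\<^sup>+x. \<integral>\<^sup>+y. (ennreal (norm (f x)) * ennreal B) * ennreal (\<kappa> n x y) \<partial>M \<partial>M)"
      using B \<kappa>_nonneg by (intro nn_integral_mono)
        (auto simp: norm_mult ennreal_mult'' intro!: mult_mono ennreal_leI)
    also have "\<dots> = (\<integral>\<^sup>+x. ennreal (norm (f x)) * (ennreal B * ennreal c) \<partial>M)"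
      by (simp add: nn_integral_cmult \<kappa>_int mult.assoc cong: nn_integral_cong)
    also have "\<dots> < \<infinity>"
      using f by (simp add: nn_integral_multc integrable_iff_bounded ennreal_mult_less_top)
    finally have i: "integrable (M \<Otimes>\<^sub>M M) (\<lambda>(x, y). f x * cnj (g y) * complex_of_real (\<kappa> n x y))"
      by (auto simp: integrable_iff_bounded sigma_finite_measure.nn_integral_fst[OF sf, symmetric] split_beta')
    have "(\<integral>z. f (fst z) * cnj (g (snd z)) * complex_of_real (\<kappa> n (fst z) (snd z)) \<partial>(M \<Otimes>\<^sub>M M))
       = (\<integral>x. \<integral>y. f x * cnj (g y) * complex_of_real (\<kappa> n x y) \<partial>M \<partial>M)"
      using integral_fst'[OF i] by (simp add: split_beta')
    also have "\<dots> = (\<integral>x. f x * G n x \<partial>M)"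
      by (simp add: G_def mult.assoc)
    finally show ?thesis unfolding regularized_parseval[OF f(1) g(1)] .
  qed
  moreover have "(\<lambda>n. \<integral>x. f x * G n x \<partial>M) \<longlonglongrightarrow> (\<integral>x. f x * (complex_of_real c * cnj (g x)) \<partial>M)"
  proof (rule integral_dominated_convergence[where w="\<lambda>x. norm (f x) * (B * c)"])
    show "integrable M (\<lambda>x. norm (f x) * (B * c))" using f by auto
    show "AE x in M. (\<lambda>i. f x * G i x) \<longlonglongrightarrow> f x * (complex_of_real c * cnj (g x))"
    proof (intro AE_I2 tendsto_mult tendsto_const)
      fix x assume xM: "x \<in> space M"
      have G_cnj: "G i x = cnj (\<integral>y. g y * complex_of_real (\<kappa> i x y) \<partial>M)" for i
        unfolding G_def by (subst Bochner_Integration.integral_cnj[of M "\<lambda>y. g y * complex_of_real (\<kappa> i x y)", symmetric])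
          (simp only: complex_cnj_mult complex_cnj_complex_of_real)
      from tendsto_cnj[OF lim[OF xM]]
      show "(\<lambda>i. G i x) \<longlonglongrightarrow> complex_of_real c * cnj (g x)"
        by (simp add: G_cnj)
    qed
    show "AE x in M. norm (f x * G i x) \<le> norm (f x) * (B * c)" for i
    proof (intro AE_I2)
      fix x assume x: "x \<in> space M"
      have k: "integrable M (\<kappa> i x)"
        using \<kappa>_int(1)[OF x, of i] \<kappa>_nonneg measurable_Pair2[OF \<kappa>_measurable x, of i]
        by (auto simp: integrable_iff_bounded)
      have kc: "(\<integral>y. \<kappa> i x y \<partial>M) = c"
        using \<kappa>_int(1)[OF x, of i] nn_integral_eq_integral[OF k] \<kappa>_nonneg c_nonneg
        by (auto simp: ennreal_inj integral_nonneg_AE)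
      have "norm (G i x) \<le> (\<integral>y. B * \<kappa> i x y \<partial>M)"
        unfolding G_def
      proof (rule order_trans[OF integral_norm_bound], rule integral_mono_AE')
        show "integrable M (\<lambda>y. B * \<kappa> i x y)" using k by simp
        show "AE y in M. norm (cnj (g y) * complex_of_real (\<kappa> i x y)) \<le> B * \<kappa> i x y"
          using B \<kappa>_nonneg by (intro AE_I2) (auto simp: norm_mult intro!: mult_right_mono)
        show "AE y in M. 0 \<le> B * \<kappa> i x y"
          using \<kappa>_nonneg order_trans[OF norm_ge_zero B[OF x]] by simp
      qed
      then have "norm (G i x) \<le> B * c" by (simp add: kc)
      then show "norm (f x * G i x) \<le> norm (f x) * (B * c)"
        by (auto simp: norm_mult intro!: mult_left_mono)
    qed
    show "(\<lambda>x. f x * G i x) \<in> borel_measurable M" for i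
      unfolding G_def by measurable
  qed measurable
  ultimately have "(\<integral>\<xi>. ft f \<xi> * cnj (ft g \<xi>) \<partial>M) = (\<integral>x. f x * (complex_of_real c * cnj (g x)) \<partial>M)"
    by (simp add: LIMSEQ_unique)
  also have "\<dots> = complex_of_real c * (\<integral>x. f x * cnj (g x) \<partial>M)"
    by (subst integral_mult_right_zero[symmetric]) (simp add: mult_ac)
  finally show ?thesis .
qed

lemma multiplication_formula:
  assumes f: "integrable M f" and g: "integrable M g"
    and p_sym: "\<And>x y. p x y = p y x"
  shows "(\<integral>\<xi>. ft f \<xi> * g \<xi> \<partial>M) = (\<integral>x. f x * ft g x \<partial>M)"
proof -
  have [measurable]: "f \<in> borel_measurable M" "g \<in> borel_measurable M" using f g by auto
  have i: "integrable (M \<Otimes>\<^sub>M M) (\<lambda>(x, \<xi>). cis (- p x \<xi>) * f x * g \<xi>)"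
    by (rule Bochner_Integration.integrable_bound[OF integrable_times_pair[OF sf sf f g]])
       (auto simp: norm_mult)
  have "(\<integral>\<xi>. ft f \<xi> * g \<xi> \<partial>M) = (\<integral>\<xi>. \<integral>x. cis (- p x \<xi>) * f x * g \<xi> \<partial>M \<partial>M)"
    by (simp add: ft_def)
  also have "\<dots> = (\<integral>x. \<integral>\<xi>. cis (- p x \<xi>) * f x * g \<xi> \<partial>M \<partial>M)"
    by (rule Fubini_integral[OF i])
  also have "\<dots> = (\<integral>x. \<integral>\<xi>. f x * (cis (- p \<xi> x) * g \<xi>) \<partial>M \<partial>M)"
    by (simp add: mult_ac p_sym)
  also have "\<dots> = (\<integral>x. f x * ft g x \<partial>M)"
    by (simp add: ft_def)
  finally show ?thesis .
qed

end

text \<open>After rescaling by s this is the characteristic function of the standard normal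
  distribution. The result is 2 \<pi> times a probability density in t, which is where the mass 2
  \<pi> per coordinate comes from.\<close>

lemma integral_cis_gauss:
  fixes s t :: real
  assumes s: "0 < s"
  shows "integrable lborel (\<lambda>x. cis (t * x) * complex_of_real (exp (- (s * x)\<^sup>2 / 2)))"
    and "(\<integral>x. cis (t * x) * complex_of_real (exp (- (s * x)\<^sup>2 / 2)) \<partial>lborel)
      = complex_of_real (2 * pi * normal_density 0 s t)"
proof -
  have E: "integrable lborel (\<lambda>x::real. exp (- x\<^sup>2 / 2))"
  proof -
    have "exp (- x\<^sup>2 / 2) = sqrt (2 * pi) * std_normal_density x" for x :: real
      by (simp add: std_normal_density_def)
    then show ?thesis by (simp only:) (intro integrable_mult_right integrable_normal_density, simp)
  qed
  then have "integrable lborel (\<lambda>x::real. exp (- (0 + s * x)\<^sup>2 / 2))"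
    using s by (subst lborel_integrable_real_affine_iff[where f="\<lambda>x::real. exp (- x\<^sup>2 / 2)"]) auto
  then show "integrable lborel (\<lambda>x. cis (t * x) * complex_of_real (exp (- (s * x)\<^sup>2 / 2)))"
    by (rule Bochner_Integration.integrable_bound) (auto simp: norm_mult)
  have "(\<integral>x. cis (t * x) * complex_of_real (exp (- (s * x)\<^sup>2 / 2)) \<partial>lborel)
     = \<bar>1 / s\<bar> *\<^sub>R (\<integral>x. cis (t * (0 + 1 / s * x)) * complex_of_real (exp (- (s * (0 + 1 / s * x))\<^sup>2 / 2)) \<partial>lborel)"
    by (rule lborel_integral_real_affine) (use s in auto)
  also have "\<dots> = complex_of_real (1 / s) * (\<integral>x. cis (t / s * x) * complex_of_real (exp (- x\<^sup>2 / 2)) \<partial>lborel)"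
    using s by (simp add: scaleR_conv_of_real)
  also have "(\<integral>x. cis (t / s * x) * complex_of_real (exp (- x\<^sup>2 / 2)) \<partial>lborel)
    = (\<integral>x. complex_of_real (sqrt (2 * pi)) * (std_normal_density x *\<^sub>R cis (t / s * x)) \<partial>lborel)"
    by (intro Bochner_Integration.integral_cong) (auto simp: std_normal_density_def scaleR_conv_of_real)
  also have "\<dots> = complex_of_real (sqrt (2 * pi)) * (\<integral>x. std_normal_density x *\<^sub>R cis (t / s * x) \<partial>lborel)"
    by (rule Bochner_Integration.integral_mult_right_zero)
  also have "\<dots> = complex_of_real (sqrt (2 * pi)) * char std_normal_distribution (t / s)"
    unfolding char_def by (subst integral_density) (auto simp: cis_conv_exp)
  also have "\<dots> = complex_of_real (sqrt (2 * pi) * exp (- (t / s)\<^sup>2 / 2))"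
    by (simp add: char_std_normal_distribution)
  also have "complex_of_real (1 / s) * complex_of_real (sqrt (2 * pi) * exp (- (t / s)\<^sup>2 / 2))
     = complex_of_real (2 * pi * normal_density 0 s t)"
  proof -
    have *: "sqrt (2 * pi) * sqrt (2 * pi) = 2 * pi" by simp
    have "sqrt (2 * pi) / s = 2 * pi * (1 / sqrt (2 * pi * s\<^sup>2))"
      using s by (simp add: real_sqrt_mult field_simps del: real_sqrt_mult_self)
        (use * in \<open>simp add: real_sqrt_mult\<close>)
    then have "sqrt (2 * pi) / s * exp (- (t / s)\<^sup>2 / 2) = 2 * pi * (1 / sqrt (2 * pi * s\<^sup>2)) * exp (- (t / s)\<^sup>2 / 2)"
      by (simp only:)
    moreover have "2 * pi * normal_density 0 s t = 2 * pi * (1 / sqrt (2 * pi * s\<^sup>2)) * exp (- (t / s)\<^sup>2 / 2)"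
      by (simp add: normal_density_def power_divide mult.commute)
    ultimately have "1 / s * (sqrt (2 * pi) * exp (- (t / s)\<^sup>2 / 2)) = 2 * pi * normal_density 0 s t"
      by simp
    then show ?thesis by (simp only: of_real_mult[symmetric])
  qed
  finally show "(\<integral>x. cis (t * x) * complex_of_real (exp (- (s * x)\<^sup>2 / 2)) \<partial>lborel)
      = complex_of_real (2 * pi * normal_density 0 s t)" .
qed

section \<open>Gaussian weights on spaces with coordinates\<close>

lemma cis_sum: "finite I \<Longrightarrow> cis (\<Sum>i\<in>I. f i) = (\<Prod>i\<in>I. cis (f i))"
  by (induction I rule: finite_induct) (auto simp: cis_mult[symmetric])

text \<open>Gaussians and exponentials are products over the coordinates, so factorization of
  integrals of products is all that must be known of the measure. Finite products of lines,
  Euclidean space and the line itself qualify.\<close>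

locale coordinates =
  fixes M :: "'a measure" and I :: "'i set" and X :: "'i \<Rightarrow> 'a \<Rightarrow> real"
  assumes finite_I: "finite I"
    and sf_M: "sigma_finite_measure M"
    and X_measurable [measurable]: "i \<in> I \<Longrightarrow> X i \<in> borel_measurable M"
    and nn_prod: "(\<And>i. i \<in> I \<Longrightarrow> g i \<in> borel_measurable lborel) \<Longrightarrow>
      (\<integral>\<^sup>+x. (\<Prod>i\<in>I. g i (X i x)) \<partial>M) = (\<Prod>i\<in>I. \<integral>\<^sup>+t. g i t \<partial>lborel)"
    and integral_prod: "(\<And>i. i \<in> I \<Longrightarrow> integrable lborel (h i)) \<Longrightarrow>
      (\<integral>x. (\<Prod>i\<in>I. h i (X i x)) \<partial>M) = (\<Prod>i\<in>I. \<integral>t. h i t \<partial>lborel :: complex)"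
begin

definition pairing :: "'a \<Rightarrow> 'a \<Rightarrow> real" where
  "pairing x y = (\<Sum>i\<in>I. X i x * X i y)"

definition weight :: "nat \<Rightarrow> 'a \<Rightarrow> real" where
  "weight n \<xi> = (\<Prod>i\<in>I. exp (- (1 / real (Suc n) * X i \<xi>)\<^sup>2 / 2))"

text \<open>By \<open>integral_cis_gauss\<close> the Fourier transform of \<open>weight n\<close>,
  with mass 2 \<pi> per coordinate; it concentrates on the diagonal as n grows.\<close>

definition kernel :: "nat \<Rightarrow> 'a \<Rightarrow> 'a \<Rightarrow> real" where
  "kernel n x y = (\<Prod>i\<in>I. 2 * pi * normal_density 0 (1 / real (Suc n)) (X i y - X i x))"

lemma integrable_prod:
  assumes "\<And>i. i \<in> I \<Longrightarrow> integrable lborel (f i :: real \<Rightarrow> real)"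
  shows "integrable M (\<lambda>x. \<Prod>i\<in>I. f i (X i x))"
proof -
  have [measurable]: "\<And>i. i \<in> I \<Longrightarrow> f i \<in> borel_measurable lborel" using assms by auto
  have "(\<integral>\<^sup>+x. (\<Prod>i\<in>I. ennreal \<bar>f i (X i x)\<bar>) \<partial>M) = (\<Prod>i\<in>I. \<integral>\<^sup>+t. ennreal \<bar>f i t\<bar> \<partial>lborel)"
    by (rule nn_prod) measurable
  also have "\<dots> < \<infinity>"
    using assms by (simp add: less_top[symmetric] ennreal_prod_eq_top integrable_iff_bounded)
  finally show ?thesis
    unfolding integrable_iff_bounded by (auto simp: abs_prod prod_ennreal)
qed

sublocale fourier_pairing M pairing weight kernel "(2 * pi) ^ card I"
proof (rule fourier_pairing.intro)
  fix n :: nat and x y \<xi> :: 'a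
  have pos: "0 < 1 / real (Suc n)" by simp
  interpret sigma_finite_measure M by (rule sf_M)
  show "sigma_finite_measure M" by (rule sf_M)
  show "(\<lambda>(x, y). pairing x y) \<in> borel_measurable (M \<Otimes>\<^sub>M M)"
    unfolding pairing_def by measurable
  show "(\<lambda>(x, y). kernel n x y) \<in> borel_measurable (M \<Otimes>\<^sub>M M)"
    unfolding kernel_def by measurable
  show "integrable M (weight n)"
    unfolding weight_def
  proof (rule integrable_prod)
    show "integrable lborel (\<lambda>a. exp (- (1 / real (Suc n) * a)\<^sup>2 / 2))"
      using integrable_norm[OF integral_cis_gauss(1)[OF pos, of 0]] by (simp add: norm_mult)
  qed
  show "0 \<le> weight n \<xi>" "weight n \<xi> \<le> 1"
    unfolding weight_def by (auto intro!: prod_nonneg prod_le_1)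
  have "(\<lambda>n. weight n \<xi>) \<longlonglongrightarrow> (\<Prod>i\<in>I. exp (- (0 * X i \<xi>)\<^sup>2 / 2))"
    unfolding weight_def by (intro tendsto_intros LIMSEQ_Suc lim_1_over_n) auto
  then show "(\<lambda>n. weight n \<xi>) \<longlonglongrightarrow> 1" by simp
  show "0 \<le> kernel n x y" unfolding kernel_def by (auto intro!: prod_nonneg)
  have ek: "ennreal (kernel n x y) = (\<Prod>i\<in>I. ennreal (2 * pi * normal_density 0 (1 / real (Suc n)) (X i y - X i x)))" for x y
    unfolding kernel_def by (rule prod_ennreal[symmetric]) auto
  have nd: "(\<integral>\<^sup>+t. ennreal (2 * pi * normal_density 0 s (t - a)) \<partial>lborel) = ennreal (2 * pi)"
    "(\<integral>\<^sup>+t. ennreal (2 * pi * normal_density 0 s (a - t)) \<partial>lborel) = ennreal (2 * pi)" if "0 < s" for a s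
  proof -
    have *: "(\<integral>\<^sup>+t. ennreal (2 * pi * normal_density 0 s t) \<partial>lborel) = ennreal (2 * pi)"
      using that by (subst nn_integral_eq_integral) auto
    show "(\<integral>\<^sup>+t. ennreal (2 * pi * normal_density 0 s (t - a)) \<partial>lborel) = ennreal (2 * pi)"
      unfolding *[symmetric]
      by (subst nn_integral_real_affine[where c=1 and t=a]) auto
    show "(\<integral>\<^sup>+t. ennreal (2 * pi * normal_density 0 s (a - t)) \<partial>lborel) = ennreal (2 * pi)"
      unfolding *[symmetric]
      by (subst nn_integral_real_affine[where c="-1" and t=a]) auto
  qed
  show "(\<integral>\<^sup>+y. ennreal (kernel n x y) \<partial>M) = ennreal ((2 * pi) ^ card I)" if "x \<in> space M"
    unfolding ek
    by (subst nn_prod[where g="\<lambda>i t. ennreal (2 * pi * normal_density 0 (1 / real (Suc n)) (t - X i x))"])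
       (simp_all add: nd ennreal_power)
  show "(\<integral>\<^sup>+x. ennreal (kernel n x y) \<partial>M) = ennreal ((2 * pi) ^ card I)" if "y \<in> space M"
    unfolding ek
    by (subst nn_prod[where g="\<lambda>i t. ennreal (2 * pi * normal_density 0 (1 / real (Suc n)) (X i y - t))"])
       (simp_all add: nd ennreal_power)
  show "(\<integral>\<xi>. cis (pairing y \<xi> - pairing x \<xi>) * complex_of_real (weight n \<xi>) \<partial>M) = complex_of_real (kernel n x y)"
    if "x \<in> space M" "y \<in> space M"
  proof -
    have "(\<integral>\<xi>. cis (pairing y \<xi> - pairing x \<xi>) * complex_of_real (weight n \<xi>) \<partial>M)
      = (\<integral>\<xi>. (\<Prod>i\<in>I. cis ((X i y - X i x) * X i \<xi>) * complex_of_real (exp (- (1 / real (Suc n) * X i \<xi>)\<^sup>2 / 2))) \<partial>M)"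
      unfolding weight_def pairing_def
      by (simp add: prod.distrib cis_sum[OF finite_I, symmetric] sum_subtractf left_diff_distrib)
    also have "\<dots> = complex_of_real (kernel n x y)"
      unfolding kernel_def of_real_prod
      by (subst integral_prod[where h="\<lambda>i t. cis ((X i y - X i x) * t) * complex_of_real (exp (- (1 / real (Suc n) * t)\<^sup>2 / 2))"])
         (simp_all only: integral_cis_gauss[OF pos])
    finally show ?thesis .
  qed
qed simp

end

section \<open>Coordinates on Euclidean space\<close>

abbreviation hat_measure :: "'n \<Rightarrow> ('n::finite \<Rightarrow> real) measure" where
  "hat_measure j \<equiv> \<Pi>\<^sub>M i\<in>UNIV - {j}. lborel"

lemma coordinates_PiM: "finite I \<Longrightarrow> coordinates (\<Pi>\<^sub>M i\<in>I. lborel) I (\<lambda>i x. x i)"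
proof (rule coordinates.intro)
  assume I: "finite I"
  interpret P: product_sigma_finite "\<lambda>_. lborel :: real measure" by standard
  interpret Q: finite_product_sigma_finite "\<lambda>_. lborel :: real measure" I by standard (rule I)
  show "finite I" by (rule I)
  show "sigma_finite_measure (Pi\<^sub>M I (\<lambda>i. lborel :: real measure))" by (rule Q.sigma_finite_measure_axioms)
  show "(\<lambda>x. x i) \<in> borel_measurable (Pi\<^sub>M I (\<lambda>i. lborel))" if "i \<in> I" for i
    using that by measurable
  show "(\<integral>\<^sup>+x. (\<Prod>i\<in>I. g i (x i)) \<partial>(\<Pi>\<^sub>M i\<in>I. lborel)) = (\<Prod>i\<in>I. \<integral>\<^sup>+t. g i t \<partial>lborel)"
    if "\<And>i. i \<in> I \<Longrightarrow> g i \<in> borel_measurable lborel" for g :: "_ \<Rightarrow> real \<Rightarrow> ennreal"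
    by (rule P.product_nn_integral_prod[OF I that])
  show "(\<integral>x. (\<Prod>i\<in>I. h i (x i)) \<partial>(\<Pi>\<^sub>M i\<in>I. lborel)) = (\<Prod>i\<in>I. \<integral>t. h i t \<partial>lborel)"
    if "\<And>i. i \<in> I \<Longrightarrow> integrable lborel (h i)" for h :: "_ \<Rightarrow> real \<Rightarrow> complex"
    by (rule P.product_integral_prod[OF I that])
qed

lemma Basis_vec_real: "(Basis :: (real ^ 'n::finite) set) = range (\<lambda>i. axis i 1)"
  by (auto simp: Basis_vec_def)

lemma prod_Basis_vec:
  "(\<Prod>b\<in>(Basis :: (real ^ 'n::finite) set). f b) = (\<Prod>i\<in>UNIV. f (axis i 1))"
  unfolding Basis_vec_real by (rule prod.reindex[unfolded comp_def]) (auto simp: inj_on_def axis_eq_axis)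

lemma borel_measurable_vecI:
  fixes f :: "'a \<Rightarrow> real ^ 'n::finite"
  assumes "\<And>i. (\<lambda>x. f x $ i) \<in> borel_measurable M"
  shows "f \<in> borel_measurable M"
  by (subst borel_measurable_euclidean_space) (auto simp: Basis_vec_real inner_axis intro: assms)

lemma lborel_eqI_vec:
  fixes M :: "(real ^ 'n::finite) measure"
  assumes "\<And>l u. (\<And>i. l $ i \<le> u $ i) \<Longrightarrow> emeasure M (box l u) = (\<Prod>i\<in>UNIV. ennreal (u $ i - l $ i))"
    and "sets M = sets borel"
  shows "lborel = M"
proof (rule lborel_eqI)
  fix l u :: "real ^ 'n" assume "\<And>b. b \<in> Basis \<Longrightarrow> l \<bullet> b \<le> u \<bullet> b"
  from this[of "axis _ 1"] have le: "l $ i \<le> u $ i" for i by (auto simp: Basis_vec_real inner_axis)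
  show "emeasure M (box l u) = ennreal (\<Prod>b\<in>Basis. (u - l) \<bullet> b)"
    using assms(1)[of l u] le by (simp add: prod_Basis_vec inner_axis prod_ennreal)
qed fact

lemma vec_lambda_measurable [measurable]:
  "vec_lambda \<in> measurable (\<Pi>\<^sub>M i\<in>(UNIV::'n::finite set). lborel) (borel :: (real ^ 'n) measure)"
  by (rule borel_measurable_vecI) simp

lemma lborel_vec: "(lborel :: (real ^ 'n::finite) measure) = distr (\<Pi>\<^sub>M i\<in>UNIV. lborel) borel vec_lambda"
proof (rule lborel_eqI_vec)
  interpret P: product_sigma_finite "\<lambda>_::'n. lborel :: real measure" by standard
  fix l u :: "real ^ 'n" assume le: "\<And>i. l $ i \<le> u $ i"
  have "vec_lambda -` box l u \<inter> space (\<Pi>\<^sub>M i\<in>(UNIV::'n set). lborel) = (\<Pi>\<^sub>E i\<in>UNIV. {l $ i <..< u $ i})"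
    by (auto simp: space_PiM mem_box_cart PiE_iff)
  then show "emeasure (distr (\<Pi>\<^sub>M i\<in>UNIV. lborel) borel vec_lambda) (box l u) = (\<Prod>i\<in>UNIV. ennreal (u $ i - l $ i))"
    using le by (simp add: emeasure_distr P.emeasure_PiM)
qed simp

lemma coordinates_vec: "coordinates (lborel :: (real ^ 'n::finite) measure) UNIV (\<lambda>i x. x $ i)"
proof (rule coordinates.intro)
  interpret C: coordinates "\<Pi>\<^sub>M i\<in>(UNIV::'n set). lborel" UNIV "\<lambda>i x. x i"
    by (rule coordinates_PiM) simp
  show "sigma_finite_measure (lborel :: (real ^ 'n) measure)" by standard
  show "(\<integral>\<^sup>+x. (\<Prod>i\<in>UNIV. g i (x $ i)) \<partial>(lborel :: (real ^ 'n) measure)) = (\<Prod>i\<in>UNIV. \<integral>\<^sup>+t. g i t \<partial>lborel)"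
    if "\<And>i. i \<in> UNIV \<Longrightarrow> g i \<in> borel_measurable lborel" for g :: "_ \<Rightarrow> real \<Rightarrow> ennreal"
  proof -
    have [measurable]: "g i \<in> borel_measurable borel" for i using that[of i] by simp
    show ?thesis
      unfolding lborel_vec by (subst nn_integral_distr) (use C.nn_prod[of g] that in auto)
  qed
  show "(\<integral>x. (\<Prod>i\<in>UNIV. h i (x $ i)) \<partial>(lborel :: (real ^ 'n) measure)) = (\<Prod>i\<in>UNIV. \<integral>t. h i t \<partial>lborel)"
    if "\<And>i. i \<in> UNIV \<Longrightarrow> integrable lborel (h i)" for h :: "_ \<Rightarrow> real \<Rightarrow> complex"
  proof -
    have [measurable]: "h i \<in> borel_measurable borel" for i using that[of i] by auto
    show ?thesis
      unfolding lborel_vec by (subst integral_distr) (use C.integral_prod[of h] that in auto)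
  qed
qed auto

global_interpretation vec: coordinates "lborel :: (real ^ 'n::finite) measure" UNIV "\<lambda>i x. x $ i"
  by (rule coordinates_vec)

global_interpretation hat: coordinates "hat_measure j" "UNIV - {j}" "\<lambda>i x. x i" for j :: "'n::finite"
  by (rule coordinates_PiM) simp

declare hat.X_measurable [measurable del]

lemma vec_pairing_eq: "vec.pairing x y = x \<bullet> y"
  by (simp add: vec.pairing_def inner_vec_def)

lemma fourier_eq_ft: "fourier f = vec.ft f"
  by (rule ext) (simp add: fourier_def vec.ft_def vec_pairing_eq cis_conv_exp)

lemma join_measurable [measurable]:
  "(\<lambda>(t, y). join_coord j t y) \<in> borel_measurable (lborel \<Otimes>\<^sub>M hat_measure j)"
proof (rule borel_measurable_vecI)
  fix i
  show "(\<lambda>x. (case x of (t, y) \<Rightarrow> join_coord j t y) $ i) \<in> borel_measurable (lborel \<Otimes>\<^sub>M hat_measure j)"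
    by (cases "i = j") (simp_all add: join_coord_def split_beta')
qed

lemma join_line_measurable [measurable]: "(\<lambda>t. join_coord j t y) \<in> borel_measurable borel"
  by (rule borel_measurable_vecI) (auto simp: join_coord_def)

text \<open>Agreement on boxes determines the measure. Through this identification integrals over
  the space become iterated integrals over x_j and the remaining variables, in either order.\<close>

lemma lborel_join:
  "(lborel :: (real ^ 'n::finite) measure) = distr (lborel \<Otimes>\<^sub>M hat_measure j) borel (\<lambda>(t, y). join_coord j t y)"
proof (rule lborel_eqI_vec)
  interpret P: product_sigma_finite "\<lambda>_::'n. lborel :: real measure" by standard
  fix l u :: "real ^ 'n" assume le: "\<And>i. l $ i \<le> u $ i"
  have *: "(\<lambda>(t, y). join_coord j t y) -` box l u \<inter> space (lborel \<Otimes>\<^sub>M hat_measure j)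
      = {l $ j <..< u $ j} \<times> (\<Pi>\<^sub>E i\<in>UNIV - {j}. {l $ i <..< u $ i})"
  proof -
    have "join_coord j t y \<in> box l u \<longleftrightarrow> t \<in> {l $ j <..< u $ j} \<and> (\<forall>i\<in>UNIV - {j}. y i \<in> {l $ i <..< u $ i})" for t y
    proof
      assume "join_coord j t y \<in> box l u"
      then have b: "l $ i < (if i = j then t else y i) \<and> (if i = j then t else y i) < u $ i" for i
        by (simp add: mem_box_cart join_coord_def)
      show "t \<in> {l $ j <..< u $ j} \<and> (\<forall>i\<in>UNIV - {j}. y i \<in> {l $ i <..< u $ i})"
      proof (intro conjI ballI)
        show "t \<in> {l $ j <..< u $ j}" using b[of j] by simp
        show "y i \<in> {l $ i <..< u $ i}" if "i \<in> UNIV - {j}" for i using b[of i] that by simp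
      qed
    qed (simp add: mem_box_cart join_coord_def)
    note this [simp]
    show ?thesis
    proof (rule set_eqI)
      fix z
      show "z \<in> (\<lambda>(t, y). join_coord j t y) -` box l u \<inter> space (lborel \<Otimes>\<^sub>M hat_measure j)
        \<longleftrightarrow> z \<in> {l $ j <..< u $ j} \<times> (\<Pi>\<^sub>E i\<in>UNIV - {j}. {l $ i <..< u $ i})"
        by (cases z) (auto simp: space_pair_measure space_PiM PiE_iff simp del: greaterThanLessThan_iff)
    qed
  qed
  have "emeasure (distr (lborel \<Otimes>\<^sub>M hat_measure j) borel (\<lambda>(t, y). join_coord j t y)) (box l u)
      = emeasure (lborel \<Otimes>\<^sub>M hat_measure j) ({l $ j <..< u $ j} \<times> (\<Pi>\<^sub>E i\<in>UNIV - {j}. {l $ i <..< u $ i}))"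
    unfolding *[symmetric] by (rule emeasure_distr[OF join_measurable]) simp
  also have "\<dots> = emeasure lborel {l $ j <..< u $ j} * emeasure (hat_measure j) (\<Pi>\<^sub>E i\<in>UNIV - {j}. {l $ i <..< u $ i})"
    by (rule sigma_finite_measure.emeasure_pair_measure_Times[OF hat.sf_M]) (auto intro!: sets_PiM_I_finite)
  also have "emeasure (hat_measure j) (\<Pi>\<^sub>E i\<in>UNIV - {j}. {l $ i <..< u $ i}) = (\<Prod>i\<in>UNIV - {j}. ennreal (u $ i - l $ i))"
    using le by (subst P.emeasure_PiM) auto
  also have "emeasure lborel {l $ j <..< u $ j} = ennreal (u $ j - l $ j)"
    using le by simp
  also have "ennreal (u $ j - l $ j) * (\<Prod>i\<in>UNIV - {j}. ennreal (u $ i - l $ i)) = (\<Prod>i\<in>UNIV. ennreal (u $ i - l $ i))"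
    by (rule prod.remove[symmetric]) auto
  finally show "emeasure (distr (lborel \<Otimes>\<^sub>M hat_measure j) borel (\<lambda>(t, y). join_coord j t y)) (box l u)
      = (\<Prod>i\<in>UNIV. ennreal (u $ i - l $ i))" .
qed simp

lemma nn_integral_join:
  fixes F :: "real ^ 'n::finite \<Rightarrow> ennreal"
  assumes [measurable]: "F \<in> borel_measurable borel"
  shows "(\<integral>\<^sup>+x. F x \<partial>lborel) = (\<integral>\<^sup>+t. \<integral>\<^sup>+y. F (join_coord j t y) \<partial>hat_measure j \<partial>lborel)"
    and "(\<integral>\<^sup>+x. F x \<partial>lborel) = (\<integral>\<^sup>+y. \<integral>\<^sup>+t. F (join_coord j t y) \<partial>lborel \<partial>hat_measure j)"
proof -
  interpret pair_sigma_finite lborel "hat_measure j"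
    by (simp add: pair_sigma_finite_def hat.sf_M lborel.sigma_finite_measure_axioms)
  show 1: "(\<integral>\<^sup>+x. F x \<partial>lborel) = (\<integral>\<^sup>+t. \<integral>\<^sup>+y. F (join_coord j t y) \<partial>hat_measure j \<partial>lborel)"
    by (subst lborel_join[of j], subst nn_integral_distr)
       (simp_all add: sigma_finite_measure.nn_integral_fst[OF hat.sf_M, symmetric] split_beta')
  show "(\<integral>\<^sup>+x. F x \<partial>lborel) = (\<integral>\<^sup>+y. \<integral>\<^sup>+t. F (join_coord j t y) \<partial>lborel \<partial>hat_measure j)"
    unfolding 1 by (rule Fubini'[symmetric]) (simp add: split_beta')
qed

lemma integral_join:
  fixes F :: "real ^ 'n::finite \<Rightarrow> complex"
  assumes F: "integrable lborel F"
  shows "integrable (lborel \<Otimes>\<^sub>M hat_measure j) (\<lambda>(t, y). F (join_coord j t y))"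
    and "(\<integral>x. F x \<partial>lborel) = (\<integral>t. \<integral>y. F (join_coord j t y) \<partial>hat_measure j \<partial>lborel)"
    and "(\<integral>x. F x \<partial>lborel) = (\<integral>y. \<integral>t. F (join_coord j t y) \<partial>lborel \<partial>hat_measure j)"
proof -
  interpret pair_sigma_finite lborel "hat_measure j"
    by (simp add: pair_sigma_finite_def hat.sf_M lborel.sigma_finite_measure_axioms)
  have [measurable]: "F \<in> borel_measurable borel" using F by auto
  show 1: "integrable (lborel \<Otimes>\<^sub>M hat_measure j) (\<lambda>(t, y). F (join_coord j t y))"
    using F by (subst (asm) lborel_join[of j], subst (asm) integrable_distr_eq) (auto simp: split_beta')
  have 2: "(\<integral>x. F x \<partial>lborel) = (\<integral>z. (\<lambda>(t, y). F (join_coord j t y)) z \<partial>(lborel \<Otimes>\<^sub>M hat_measure j))"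
    by (subst lborel_join[of j], subst integral_distr) (auto simp: split_beta')
  show "(\<integral>x. F x \<partial>lborel) = (\<integral>t. \<integral>y. F (join_coord j t y) \<partial>hat_measure j \<partial>lborel)"
    unfolding 2 by (subst integral_fst'[OF 1, symmetric]) simp
  show "(\<integral>x. F x \<partial>lborel) = (\<integral>y. \<integral>t. F (join_coord j t y) \<partial>lborel \<partial>hat_measure j)"
    unfolding 2 by (subst integral_snd[OF 1, symmetric]) simp
qed

lemma inner_join: "join_coord j t y \<bullet> join_coord j s \<eta> = t * s + hat.pairing j y \<eta>"
  by (simp add: inner_vec_def join_coord_def hat.pairing_def sum.remove[of UNIV j])

text \<open>The substitution y = x + v / (n + 1) turns the kernel into the fixed density
  \<open>K\<close>; continuity then gives pointwise convergence of g(x + v / (n + 1)), and B K is a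
  majorant.\<close>

lemma gauss_approximation:
  fixes g :: "real ^ 'n::finite \<Rightarrow> complex"
  assumes cont: "continuous_on UNIV g" and B: "\<And>x. norm (g x) \<le> B"
  shows "(\<lambda>n. \<integral>y. g y * complex_of_real (vec.kernel n x y) \<partial>lborel)
    \<longlonglongrightarrow> complex_of_real ((2 * pi) ^ CARD('n)) * g x"
proof -
  define K where "K v = (\<Prod>i\<in>UNIV. 2 * pi * std_normal_density (v $ i))" for v :: "real ^ 'n"
  have [measurable]: "g \<in> borel_measurable borel" by (rule borel_measurable_continuous_onI[OF cont])
  have [measurable]: "K \<in> borel_measurable borel" unfolding K_def by measurable
  have K: "integrable lborel K"
    unfolding K_def by (rule vec.integrable_prod) simp
  have K0: "0 \<le> K v" for v unfolding K_def by (auto intro!: prod_nonneg)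
  have "(\<integral>v. complex_of_real (K v) \<partial>lborel) = (\<Prod>i\<in>(UNIV::'n set). \<integral>t. complex_of_real (2 * pi * std_normal_density t) \<partial>lborel)"
    unfolding K_def of_real_prod
    by (rule vec.integral_prod[where h="\<lambda>_ t. complex_of_real (2 * pi * std_normal_density t)"]) simp
  then have K1: "(\<integral>v. complex_of_real (K v) \<partial>lborel) = complex_of_real ((2 * pi) ^ CARD('n))"
    by (simp only: integral_complex_of_real integral_mult_right_zero integral_normal_density) simp
  define s where "s n = 1 / real (Suc n)" for n
  have s: "0 < s n" for n by (simp add: s_def)
  have scale: "s n ^ CARD('n) * vec.kernel n x (x + s n *\<^sub>R v) = K v" for n v
  proof -
    have *: "s n * (2 * pi * normal_density 0 (s n) (s n * t)) = 2 * pi * std_normal_density t" for t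
      using s[of n] by (simp add: normal_density_def power_mult_distrib real_sqrt_mult)
    have "s n ^ CARD('n) * vec.kernel n x (x + s n *\<^sub>R v)
      = (\<Prod>i\<in>UNIV. s n * (2 * pi * normal_density 0 (s n) (s n * v $ i)))"
      unfolding vec.kernel_def s_def[symmetric] by (subst prod.distrib) simp
    then show ?thesis unfolding * K_def .
  qed
  have eq: "(\<integral>y. g y * complex_of_real (vec.kernel n x y) \<partial>lborel)
     = (\<integral>v. g (x + s n *\<^sub>R v) * complex_of_real (K v) \<partial>lborel)" for n
  proof -
    have [measurable]: "vec.kernel n x \<in> borel_measurable borel" unfolding vec.kernel_def by measurable
    have "(\<integral>y. g y * complex_of_real (vec.kernel n x y) \<partial>lborel)
      = (\<integral>v. s n ^ CARD('n) *\<^sub>R (g (x + s n *\<^sub>R v) * complex_of_real (vec.kernel n x (x + s n *\<^sub>R v))) \<partial>lborel)"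
      using s[of n] by (subst lborel_affine[of "s n" x])
        (simp_all add: integral_density integral_distr)
    also have "\<dots> = (\<integral>v. g (x + s n *\<^sub>R v) * complex_of_real (K v) \<partial>lborel)"
      unfolding scale[of n, symmetric] by (simp add: scaleR_conv_of_real mult_ac)
    finally show ?thesis .
  qed
  have "(\<lambda>n. \<integral>v. g (x + s n *\<^sub>R v) * complex_of_real (K v) \<partial>lborel) \<longlonglongrightarrow> (\<integral>v. g x * complex_of_real (K v) \<partial>lborel)"
  proof (rule integral_dominated_convergence[where w="\<lambda>v. B * K v"])
    show "integrable lborel (\<lambda>v. B * K v)" using K by simp
    have "(\<lambda>n. g (x + s n *\<^sub>R v)) \<longlonglongrightarrow> g (x + 0 *\<^sub>R v)" for v
      unfolding s_def
      by (rule continuous_on_tendsto_compose[OF cont])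
         (intro tendsto_intros LIMSEQ_Suc lim_1_over_n, auto)
    then show "AE v in lborel. (\<lambda>n. g (x + s n *\<^sub>R v) * complex_of_real (K v)) \<longlonglongrightarrow> g x * complex_of_real (K v)"
      by (intro AE_I2 tendsto_intros) simp
    show "AE v in lborel. norm (g (x + s n *\<^sub>R v) * complex_of_real (K v)) \<le> B * K v" for n
      using B K0 by (intro AE_I2) (auto simp: norm_mult intro!: mult_right_mono)
  qed measurable
  moreover have "(\<integral>v. g x * complex_of_real (K v) \<partial>lborel) = complex_of_real ((2 * pi) ^ CARD('n)) * g x"
    unfolding Bochner_Integration.integral_mult_right_zero K1 by (rule mult.commute)
  ultimately show ?thesis
    unfolding eq by (simp only:)
qed

section \<open>The Fourier transform of square integrable functions\<close>

text \<open>The weights \<open>2\<^sup>i\<close> absorb the factor \<open>2\<close> lost in each use of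
  \<open>(a + b)\<^sup>2 \<le> 2 a\<^sup>2 + 2 b\<^sup>2\<close>, so no triangle inequality for the \<open>L\<^sup>2\<close> norm is needed.\<close>

lemma norm_telescope_square_le:
  fixes h :: "nat \<Rightarrow> complex"
  shows "(norm (h (k + m) - h k))\<^sup>2 \<le> 2 * (\<Sum>i<m. 2 ^ i * (norm (h (Suc (k + i)) - h (k + i)))\<^sup>2)"
proof (induction m arbitrary: k)
  case (Suc m)
  have "(norm (h (k + Suc m) - h k))\<^sup>2 = (norm ((h (Suc k) - h k) + (h (Suc k + m) - h (Suc k))))\<^sup>2"
    by simp
  also have "\<dots> \<le> 2 * (norm (h (Suc k) - h k))\<^sup>2 + 2 * (norm (h (Suc k + m) - h (Suc k)))\<^sup>2"
    by (rule norm_add_square_le)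
  also have "\<dots> \<le> 2 * (norm (h (Suc k) - h k))\<^sup>2
      + 2 * (2 * (\<Sum>i<m. 2 ^ i * (norm (h (Suc (Suc k + i)) - h (Suc k + i)))\<^sup>2))"
    using Suc.IH[of "Suc k"] by simp
  also have "\<dots> = 2 * (\<Sum>i<Suc m. 2 ^ i * (norm (h (Suc (k + i)) - h (k + i)))\<^sup>2)"
    by (simp add: sum.lessThan_Suc_shift sum_distrib_left mult.assoc del: sum.lessThan_Suc)
  finally show ?case .
qed simp

text \<open>Completeness of L^2 for sequences so fast that no subsequence has to be chosen. The sum
  \<open>E k\<close> of the squared increments from k on, weighted by 2^i, has integral of order
  16^(-k); it is thus finite almost everywhere and controls both the pointwise limit and the
  distance to it.\<close>

lemma L2_fast_Cauchy_limit:
  fixes h :: "nat \<Rightarrow> 'a \<Rightarrow> complex"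
  assumes h: "\<And>k. h k \<in> L2 M"
    and fast: "\<And>k. L2_sq M (\<lambda>x. h (Suc k) x - h k x) \<le> ennreal (C * (1/16) ^ k)"
    and C: "0 \<le> C"
  obtains H where "H \<in> L2 M" "(\<lambda>k. L2_sq M (\<lambda>x. h k x - H x)) \<longlonglongrightarrow> 0"
proof -
  have [measurable]: "h k \<in> borel_measurable M" for k using h[of k] by (simp add: L2_def)
  define d where "d k x = (norm (h (Suc k) x - h k x))\<^sup>2" for k x
  define E where "E k x = (\<Sum>i. ennreal (2 ^ i * d (k + i) x))" for k x
  \<comment> \<open>The values at points where the sequence diverges are arbitrary; these points
    form a null set.\<close>
  define H where "H x = lim (\<lambda>k. h k x)" for x
  have [measurable]: "d k \<in> borel_measurable M" for k unfolding d_def by measurable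
  have d0: "0 \<le> d k x" for k x by (simp add: d_def)
  have [measurable]: "E k \<in> borel_measurable M" for k unfolding E_def by measurable
  have [measurable]: "H \<in> borel_measurable M" unfolding H_def by measurable
  have E_int: "(\<integral>\<^sup>+x. E k x \<partial>M) \<le> ennreal (2 * C * (1/16) ^ k)" for k
  proof -
    have "(\<integral>\<^sup>+x. E k x \<partial>M) = (\<Sum>i. \<integral>\<^sup>+x. ennreal (2 ^ i * d (k + i) x) \<partial>M)"
      unfolding E_def by (rule nn_integral_suminf) measurable
    also have "\<dots> \<le> (\<Sum>i. ennreal (C * (1/16) ^ k * (1/2) ^ i))"
    proof (intro suminf_le summableI)
      fix i
      have "(\<integral>\<^sup>+x. ennreal (2 ^ i * d (k + i) x) \<partial>M) = ennreal (2 ^ i) * L2_sq M (\<lambda>x. h (Suc (k + i)) x - h (k + i) x)"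
        unfolding L2_sq_def d_def
        by (subst nn_integral_cmult[symmetric]) (auto simp: ennreal_mult ennreal_power intro!: nn_integral_cong)
      also have "\<dots> \<le> ennreal (2 ^ i) * ennreal (C * (1/16) ^ (k + i))"
        by (intro mult_left_mono fast) simp
      also have "\<dots> = ennreal (C * (1/16) ^ k * (2 ^ i * (1/16) ^ i))"
        using C by (subst ennreal_mult[symmetric]) (auto simp: power_add)
      \<comment> \<open>Since 2^i 16^(-i) = 8^(-i) \<le> 2^(-i), a geometric series with sum 2
        suffices.\<close>
      also have "\<dots> \<le> ennreal (C * (1/16) ^ k * (1/2) ^ i)"
        using C by (intro ennreal_leI mult_left_mono)
          (auto simp flip: power_mult_distrib intro!: power_mono)
      finally show "(\<integral>\<^sup>+x. ennreal (2 ^ i * d (k + i) x) \<partial>M) \<le> ennreal (C * (1/16) ^ k * (1/2) ^ i)" .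
    qed
    also have "\<dots> = ennreal (\<Sum>i. C * (1/16) ^ k * (1/2) ^ i)"
      using C by (intro suminf_ennreal2) auto
    also have "(\<Sum>i. C * (1/16) ^ k * (1/2) ^ i) = 2 * C * (1/16) ^ k"
      by (subst suminf_mult) (auto simp: suminf_geometric)
    finally show ?thesis .
  qed
  have le_E: "ennreal ((norm (h (k + m) x - h k x))\<^sup>2) \<le> 2 * E k x" for k m x
  proof -
    have "ennreal ((norm (h (k + m) x - h k x))\<^sup>2) \<le> ennreal (2 * (\<Sum>i<m. 2 ^ i * d (k + i) x))"
      using norm_telescope_square_le[of "\<lambda>k. h k x" k m] by (intro ennreal_leI) (simp add: d_def)
    also have "\<dots> = 2 * (\<Sum>i<m. ennreal (2 ^ i * d (k + i) x))"
      using d0 by (subst ennreal_mult) (auto simp: sum_nonneg sum_ennreal)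
    also have "\<dots> \<le> 2 * E k x"
      unfolding E_def by (intro mult_left_mono sum_le_suminf) auto
    finally show ?thesis .
  qed
  \<comment> \<open>The weights make the tail \<open>E k\<close> at most 2^(-k) \<open>E 0\<close>,
    which gives a pointwise Cauchy rate wherever \<open>E 0\<close> is finite.\<close>
  have E_shift: "ennreal (2 ^ k) * E k x \<le> E 0 x" for k x
  proof -
    have "ennreal (2 ^ k) * E k x = (\<Sum>i. ennreal (2 ^ (k + i) * d (k + i) x))"
      unfolding E_def by (subst ennreal_suminf_cmult[symmetric])
        (simp add: d0 power_add mult_ac flip: ennreal_mult)
    also have "\<dots> \<le> E 0 x"
      unfolding E_def by (subst (2) suminf_offset[where i=k]) (auto simp: summableI add.commute)
    finally show ?thesis .
  qed
  have "AE x in M. E 0 x \<noteq> \<infinity>"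
  proof (rule nn_integral_PInf_AE)
    show "integral\<^sup>N M (E 0) \<noteq> \<infinity>" using E_int[of 0] by (auto simp: top_unique)
  qed measurable
  then have conv: "AE x in M. (\<lambda>k. h k x) \<longlonglongrightarrow> H x"
  proof eventually_elim
    fix x assume "E 0 x \<noteq> \<infinity>"
    then obtain e where e: "0 \<le> e" "E 0 x = ennreal e" by (cases "E 0 x") auto
    have bd: "(norm (h (k + m) x - h k x))\<^sup>2 \<le> 2 * e * (1/2) ^ k" for k m
    proof -
      have "ennreal (2 ^ k * (norm (h (k + m) x - h k x))\<^sup>2) \<le> ennreal (2 ^ k) * (2 * E k x)"
        by (subst ennreal_mult) (auto intro!: mult_left_mono le_E)
      also have "\<dots> \<le> 2 * ennreal e"
        using mult_left_mono[OF E_shift[of k x], of 2] e by (simp add: mult_ac)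
      also have "\<dots> = ennreal (2 * e)" using e by (simp add: ennreal_mult)
      finally have "2 ^ k * (norm (h (k + m) x - h k x))\<^sup>2 \<le> 2 * e" using e by (simp add: ennreal_le_iff)
      then show ?thesis by (simp add: field_simps power_divide)
    qed
    have "Cauchy (\<lambda>k. h k x)"
    proof (rule metric_CauchyI)
      fix \<epsilon> :: real assume \<epsilon>: "0 < \<epsilon>"
      have "(\<lambda>k. 2 * e * (1/2) ^ k) \<longlonglongrightarrow> 2 * e * 0"
        by (intro tendsto_intros LIMSEQ_realpow_zero) auto
      then have "eventually (\<lambda>k. 2 * e * (1/2) ^ k < (\<epsilon>/2)\<^sup>2) sequentially"
        using \<epsilon> by (intro order_tendstoD(2)) auto
      then obtain k where k: "2 * e * (1/2) ^ k < (\<epsilon>/2)\<^sup>2" by (auto simp: eventually_sequentially)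
      have near: "dist (h n x) (h k x) < \<epsilon>/2" if "n \<ge> k" for n
      proof -
        have "(norm (h n x - h k x))\<^sup>2 < (\<epsilon>/2)\<^sup>2"
          using bd[of k "n - k"] k that by simp
        then show ?thesis unfolding dist_norm by (rule power2_less_imp_less) (use \<epsilon> in simp)
      qed
      show "\<exists>K. \<forall>m\<ge>K. \<forall>n\<ge>K. dist (h m x) (h n x) < \<epsilon>"
        by (intro exI[of _ k] allI impI dist_triangle_half_l[OF near near])
    qed
    then show "(\<lambda>k. h k x) \<longlonglongrightarrow> H x"
      unfolding H_def by (simp add: Cauchy_convergent_iff convergent_LIMSEQ_iff)
  qed
  have close: "L2_sq M (\<lambda>x. h k x - H x) \<le> ennreal (4 * C * (1/16) ^ k)" for k
  proof -
    have "L2_sq M (\<lambda>x. h k x - H x) \<le> (\<integral>\<^sup>+x. 2 * E k x \<partial>M)"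
      unfolding L2_sq_def
    proof (rule nn_integral_mono_AE)
      show "AE x in M. (ennreal (norm (h k x - H x)))\<^sup>2 \<le> 2 * E k x"
        using conv
      proof eventually_elim
        fix x assume "(\<lambda>k. h k x) \<longlonglongrightarrow> H x"
        then have "(\<lambda>m. ennreal ((norm (h (m + k) x - h k x))\<^sup>2)) \<longlonglongrightarrow> ennreal ((norm (H x - h k x))\<^sup>2)"
          by (intro tendsto_intros tendsto_ennrealI LIMSEQ_ignore_initial_segment)
        then have "ennreal ((norm (H x - h k x))\<^sup>2) \<le> 2 * E k x"
          by (rule LIMSEQ_le_const2) (use le_E[of k _ x] in \<open>auto simp: add.commute\<close>)
        then show "(ennreal (norm (h k x - H x)))\<^sup>2 \<le> 2 * E k x"
          by (simp add: ennreal_power norm_minus_commute)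
      qed
    qed
    also have "\<dots> \<le> 2 * ennreal (2 * C * (1/16) ^ k)"
      by (subst nn_integral_cmult) (auto intro!: mult_left_mono E_int)
    also have "\<dots> = ennreal (4 * C * (1/16) ^ k)"
      using C by (subst ennreal_numeral[symmetric], subst ennreal_mult[symmetric]) auto
    finally show ?thesis .
  qed
  have d0L: "(\<lambda>x. h 0 x - H x) \<in> L2 M"
    using close[of 0] by (auto simp: L2_def intro: le_less_trans)
  show thesis
  proof (rule that)
    show "H \<in> L2 M" using L2_diff[OF h[of 0] d0L] by simp
    have "(\<lambda>k. ennreal (4 * C * (1/16) ^ k)) \<longlonglongrightarrow> ennreal (4 * C * 0)"
      by (intro tendsto_ennrealI tendsto_intros LIMSEQ_realpow_zero) auto
    then have lim: "(\<lambda>k. ennreal (4 * C * (1/16) ^ k)) \<longlonglongrightarrow> 0" by simp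
    show "(\<lambda>k. L2_sq M (\<lambda>x. h k x - H x)) \<longlonglongrightarrow> 0"
      by (rule tendsto_sandwich[OF _ _ tendsto_const lim]) (simp_all add: close)
  qed
qed

section \<open>Truncation to bounded functions of bounded support\<close>

definition bounded_support :: "(real ^ 'n::finite \<Rightarrow> complex) \<Rightarrow> bool" where
  "bounded_support f \<longleftrightarrow> f \<in> borel_measurable borel \<and>
     (\<exists>N. \<forall>x. norm (f x) \<le> N \<and> (N < norm x \<longrightarrow> f x = 0))"

definition trunc :: "nat \<Rightarrow> (real ^ 'n::finite \<Rightarrow> complex) \<Rightarrow> real ^ 'n \<Rightarrow> complex" where
  "trunc N f x = (if norm (f x) \<le> real N \<and> norm x \<le> real N then f x else 0)"

lemma trunc_measurable [measurable]:
  assumes [measurable]: "f \<in> borel_measurable borel"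
  shows "trunc N f \<in> borel_measurable borel"
  unfolding trunc_def by measurable

lemma bounded_support_trunc: "f \<in> borel_measurable borel \<Longrightarrow> bounded_support (trunc N f)"
  unfolding bounded_support_def by (auto simp: trunc_def intro!: exI[of _ "real N"])

lemma norm_trunc_le: "norm (trunc N f x) \<le> norm (f x)"
  by (simp add: trunc_def)

lemma eventually_trunc_eq: "eventually (\<lambda>N. trunc N f x = f x) sequentially"
proof -
  obtain N where N: "max (norm (f x)) (norm x) \<le> real N" using real_arch_simple by blast
  show ?thesis
    unfolding eventually_sequentially
    by (rule exI[of _ N]) (use N in \<open>auto simp: trunc_def\<close>)
qed

lemma bounded_supportE:
  assumes "bounded_support f"
  obtains N where "f \<in> borel_measurable borel" "\<And>x. norm (f x) \<le> N" "\<And>x. N < norm x \<Longrightarrow> f x = 0" "0 \<le> N"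
proof -
  from assms obtain N where N: "f \<in> borel_measurable borel" "\<And>x. norm (f x) \<le> N" "\<And>x. N < norm x \<Longrightarrow> f x = 0"
    by (auto simp: bounded_support_def)
  with order_trans[OF norm_ge_zero N(2)[of 0]] that show thesis by blast
qed

lemma bounded_support_integrable:
  fixes f :: "real ^ 'n::finite \<Rightarrow> complex"
  assumes "bounded_support f" shows "integrable lborel f"
  using assms
proof (rule bounded_supportE)
  fix N assume N: "f \<in> borel_measurable borel" "\<And>x. norm (f x) \<le> N" "\<And>x. N < norm x \<Longrightarrow> f x = 0" "0 \<le> N"
  have "integrable lborel (\<lambda>x :: real ^ 'n. N * indicator (cball 0 N) x :: real)"
    by (intro integrable_mult_right integrable_real_indicator)
      (use emeasure_lborel_cball_finite[of "0 :: real ^ 'n" N] in auto)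
  then show ?thesis
    by (rule Bochner_Integration.integrable_bound)
       (use N in \<open>auto simp: indicator_def intro!: AE_I2\<close>)
qed

lemma bounded_support_L2:
  assumes "bounded_support f" shows "f \<in> L2 lborel"
  using assms
proof (rule bounded_supportE)
  fix N assume N: "f \<in> borel_measurable borel" "\<And>x. norm (f x) \<le> N" "\<And>x. N < norm x \<Longrightarrow> f x = 0" "0 \<le> N"
  then have "integrable lborel (\<lambda>x. N * norm (f x))"
    using bounded_support_integrable[OF assms] by (intro integrable_mult_right integrable_norm)
  then have "integrable lborel (\<lambda>x. (norm (f x))\<^sup>2)"
    by (rule Bochner_Integration.integrable_bound)
       (use N in \<open>auto simp: power2_eq_square intro!: AE_I2 mult_right_mono\<close>)
  then show ?thesis using N by (simp add: L2_iff_integrable)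
qed

lemma trunc_L2_tendsto:
  fixes f :: "real ^ 'n::finite \<Rightarrow> complex"
  assumes f: "f \<in> L2 lborel"
  shows "(\<lambda>N. L2_sq lborel (\<lambda>x. trunc N f x - f x)) \<longlonglongrightarrow> 0"
proof -
  have [measurable]: "f \<in> borel_measurable borel" using f by (simp add: L2_def)
  have "(\<lambda>N. L2_sq lborel (\<lambda>x. trunc N f x - f x)) \<longlonglongrightarrow> (\<integral>\<^sup>+x. 0 \<partial>(lborel :: (real ^ 'n) measure))"
    unfolding L2_sq_def
  proof (rule nn_integral_dominated_convergence[where w="\<lambda>x. (ennreal (norm (f x)))\<^sup>2"])
    show "(\<integral>\<^sup>+x. (ennreal (norm (f x)))\<^sup>2 \<partial>lborel) < \<infinity>"
      using L2_sq_finite[OF f] by (simp add: L2_sq_def)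
    show "AE x in lborel. (\<lambda>N. (ennreal (norm (trunc N f x - f x)))\<^sup>2) \<longlonglongrightarrow> 0"
    proof (rule AE_I2)
      fix x
      have "eventually (\<lambda>N. (ennreal (norm (trunc N f x - f x)))\<^sup>2 = 0) sequentially"
        using eventually_trunc_eq[of f x] by eventually_elim simp
      then show "(\<lambda>N. (ennreal (norm (trunc N f x - f x)))\<^sup>2) \<longlonglongrightarrow> 0"
        by (rule tendsto_eventually)
    qed
    show "AE x in lborel. (ennreal (norm (trunc N f x - f x)))\<^sup>2 \<le> (ennreal (norm (f x)))\<^sup>2" for N
      by (auto simp: trunc_def intro!: AE_I2)
  qed measurable
  then show ?thesis by simp
qed

section \<open>Reflection, conjugation and the inverse transform on L^2\<close>

lemma lborel_reflect: "distr lborel borel uminus = (lborel :: 'a::euclidean_space measure)"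
proof -
  show ?thesis
    using lborel_affine[of "-1" "0 :: 'a"] by (simp add: density_1)
qed

lemma nn_integral_reflect:
  fixes f :: "'a::euclidean_space \<Rightarrow> ennreal"
  assumes "f \<in> borel_measurable borel"
  shows "(\<integral>\<^sup>+x. f (- x) \<partial>lborel) = (\<integral>\<^sup>+x. f x \<partial>lborel)"
  by (subst (2) lborel_reflect[symmetric], subst nn_integral_distr) (use assms in auto)

lemma integral_reflect_lborel:
  fixes f :: "'a::euclidean_space \<Rightarrow> complex"
  assumes "f \<in> borel_measurable borel"
  shows "(\<integral>x. f (- x) \<partial>lborel) = (\<integral>x. f x \<partial>lborel)"
  by (subst (2) lborel_reflect[symmetric], subst integral_distr) (use assms in auto)

lemma integrable_reflect_lborel:
  fixes f :: "'a::euclidean_space \<Rightarrow> complex"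
  assumes "integrable lborel f"
  shows "integrable lborel (\<lambda>x. f (- x))"
  using assms by (subst (asm) lborel_reflect[symmetric], subst (asm) integrable_distr_eq) auto

lemma L2_sq_reflect:
  fixes f :: "'a::euclidean_space \<Rightarrow> complex"
  assumes [measurable]: "f \<in> borel_measurable borel"
  shows "L2_sq lborel (\<lambda>x. f (- x)) = L2_sq lborel f"
  unfolding L2_sq_def by (rule nn_integral_reflect[where f="\<lambda>x. (ennreal (norm (f x)))\<^sup>2"]) measurable

lemma L2_reflect:
  fixes f :: "'a::euclidean_space \<Rightarrow> complex"
  assumes "f \<in> L2 lborel"
  shows "(\<lambda>x. f (- x)) \<in> L2 lborel"
proof -
  have [measurable]: "f \<in> borel_measurable borel" using assms by (simp add: L2_def)
  show ?thesis using assms by (simp add: L2_def L2_sq_reflect)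
qed

lemma fourier_reflect:
  assumes "f \<in> borel_measurable borel"
  shows "fourier (\<lambda>x. f (- x)) \<xi> = fourier f (- \<xi>)"
  unfolding fourier_def
  by (subst integral_reflect_lborel[symmetric]) (use assms in auto)

lemma fourier_cnj:
  "fourier (\<lambda>x. cnj (f x)) \<xi> = cnj (fourier f (- \<xi>))"
  unfolding fourier_def Bochner_Integration.integral_cnj[symmetric] by (simp add: exp_cnj del: Bochner_Integration.integral_cnj)

lemma fourier_measurable [measurable]:
  "f \<in> borel_measurable borel \<Longrightarrow> fourier f \<in> borel_measurable borel"
  unfolding fourier_eq_ft using vec.ft_measurable[of f] by simp

lemma fourier_diff:
  assumes "integrable lborel f" "integrable lborel g"
  shows "fourier (\<lambda>x. f x - g x) \<xi> = fourier f \<xi> - fourier g \<xi>"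
  unfolding fourier_eq_ft vec.ft_def right_diff_distrib
  using assms by (intro Bochner_Integration.integral_diff vec.ft_integrand_integrable) auto

text \<open>The inverse transform on L^2, described by its two duality formulas. The first, against
  transforms of integrable functions, serves the norm estimates and the weak derivative; the second
  is the one that \<open>has_fourier\<close> asks for. Both are recorded because each is inherited
  from the approximations separately.\<close>

definition L2_inverse_fourier :: "(real ^ 'n::finite \<Rightarrow> complex) \<Rightarrow> (real ^ 'n \<Rightarrow> complex) \<Rightarrow> bool" where
  "L2_inverse_fourier G u \<longleftrightarrow> G \<in> L2 lborel \<and> u \<in> L2 lborel \<and>
    (\<forall>h. integrable lborel h \<and> h \<in> L2 lborel \<longrightarrow>
      complex_of_real ((2 * pi) ^ CARD('n)) * (\<integral>x. u x * h x \<partial>lborel) = (\<integral>\<xi>. G \<xi> * fourier h (- \<xi>) \<partial>lborel)) \<and>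
    (\<forall>\<phi>. integrable lborel \<phi> \<and> continuous_on UNIV \<phi> \<and> bounded (range \<phi>) \<and> \<phi> \<in> L2 lborel \<longrightarrow>
      (\<integral>x. u x * fourier \<phi> x \<partial>lborel) = (\<integral>\<xi>. G \<xi> * \<phi> \<xi> \<partial>lborel))"

lemma fourier_L2: "integrable lborel f \<Longrightarrow> f \<in> L2 lborel \<Longrightarrow> fourier f \<in> L2 lborel"
  unfolding fourier_eq_ft by (rule vec.ft_L2)

lemma fourier_bessel:
  fixes f :: "real ^ 'n::finite \<Rightarrow> complex"
  shows "integrable lborel f \<Longrightarrow> f \<in> L2 lborel \<Longrightarrow>
    L2_sq lborel (fourier f) \<le> ennreal ((2 * pi) ^ CARD('n)) * L2_sq lborel f"
  unfolding fourier_eq_ft by (rule vec.bessel)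

lemma fourier_multiplication_formula:
  "integrable lborel f \<Longrightarrow> integrable lborel g \<Longrightarrow>
    (\<integral>\<xi>. fourier f \<xi> * g \<xi> \<partial>lborel) = (\<integral>x. f x * fourier g x \<partial>lborel)"
  unfolding fourier_eq_ft by (rule vec.multiplication_formula) (auto simp: vec_pairing_eq inner_commute)

lemma L2_fast_truncations:
  fixes G :: "real ^ 'n::finite \<Rightarrow> complex"
  assumes G: "G \<in> L2 lborel"
  obtains N where "\<And>k. L2_sq lborel (\<lambda>x. trunc (N k) G x - G x) \<le> ennreal ((1/16) ^ k)"
proof -
  have "\<exists>N. L2_sq lborel (\<lambda>x. trunc N G x - G x) \<le> ennreal ((1/16) ^ k)" for k
  proof -
    have "eventually (\<lambda>N. L2_sq lborel (\<lambda>x. trunc N G x - G x) < ennreal ((1/16) ^ k)) sequentially"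
      by (rule order_tendstoD(2)[OF trunc_L2_tendsto[OF G]]) simp
    then show ?thesis by (auto simp: eventually_sequentially intro: less_imp_le)
  qed
  then show thesis using that by metis
qed

text \<open>Bessel's inequality turns fast truncations of \<open>G\<close> into a fast Cauchy
  sequence of inverse transforms. For the truncations the first duality formula is the
  multiplication formula and the second is Parseval's, and both survive the limit.\<close>

lemma L2_inverse_fourier_exists:
  fixes G :: "real ^ 'n::finite \<Rightarrow> complex"
  assumes G: "G \<in> L2 lborel"
  shows "\<exists>u. L2_inverse_fourier G u"
proof -
  define c :: real where "c = (2 * pi) ^ CARD('n)"
  have c: "0 < c" by (simp add: c_def)
  have [measurable]: "G \<in> borel_measurable borel" using G by (simp add: L2_def)
  obtain N where N: "\<And>k. L2_sq lborel (\<lambda>x. trunc (N k) G x - G x) \<le> ennreal ((1/16) ^ k)"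
    using L2_fast_truncations[OF G] by blast
  define g where "g k = trunc (N k) G" for k
  have gs: "bounded_support (g k)" for k unfolding g_def by (rule bounded_support_trunc) measurable
  have [measurable]: "g k \<in> borel_measurable borel" for k unfolding g_def by measurable
  note gi = bounded_support_integrable[OF gs] and g2 = bounded_support_L2[OF gs]
  have g_lim: "(\<lambda>k. L2_sq lborel (\<lambda>x. g k x - G x)) \<longlonglongrightarrow> 0"
  proof -
    have "(\<lambda>k. ennreal ((1/16) ^ k)) \<longlonglongrightarrow> ennreal 0"
      by (intro tendsto_ennrealI LIMSEQ_realpow_zero) auto
    then have lim: "(\<lambda>k. ennreal ((1/16) ^ k)) \<longlonglongrightarrow> 0" by simp
    show ?thesis
      by (rule tendsto_sandwich[OF _ _ tendsto_const lim]) (simp_all add: N g_def)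
  qed
  define u where "u k x = complex_of_real (1 / c) * fourier (g k) (- x)" for k x
  have u2: "u k \<in> L2 lborel" for k
    unfolding u_def by (intro L2_cmult L2_reflect fourier_L2 gi g2)
  have fast: "L2_sq lborel (\<lambda>x. u (Suc k) x - u k x) \<le> ennreal (4 / c * (1/16) ^ k)" for k
  proof -
    define D where "D = (\<lambda>x. g (Suc k) x - g k x)"
    have Di: "integrable lborel D" and D2: "D \<in> L2 lborel"
      unfolding D_def using gi g2 by (auto intro: L2_diff)
    have [measurable]: "D \<in> borel_measurable borel" using Di by auto
    have "L2_sq lborel (\<lambda>x. u (Suc k) x - u k x) = L2_sq lborel (\<lambda>x. complex_of_real (1 / c) * fourier D (- x))"
      unfolding u_def D_def fourier_diff[OF gi gi] by (simp add: right_diff_distrib)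
    also have "\<dots> = ennreal ((1 / c)\<^sup>2) * L2_sq lborel (fourier D)"
      using c by (subst L2_sq_cmult) (simp_all add: L2_sq_reflect ennreal_power norm_divide)
    also have "\<dots> \<le> ennreal ((1 / c)\<^sup>2) * (ennreal c * L2_sq lborel D)"
      unfolding c_def by (intro mult_left_mono fourier_bessel Di D2) simp
    also have "\<dots> = ennreal (1 / c) * L2_sq lborel D"
      using c by (simp add: mult.assoc[symmetric] power2_eq_square flip: ennreal_mult)
    \<comment> \<open>Passing through \<open>G\<close> costs 2 (16^(-k-1) + 16^(-k)), which is at
      most 4 times 16^(-k).\<close>
    also have "L2_sq lborel D \<le> ennreal (4 * (1/16) ^ k)"
    proof -
      have "L2_sq lborel D = L2_sq lborel (\<lambda>x. (g (Suc k) x - G x) + (-1) * (g k x - G x))"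
        by (simp add: D_def)
      also have "\<dots> \<le> 2 * L2_sq lborel (\<lambda>x. g (Suc k) x - G x) + 2 * L2_sq lborel (\<lambda>x. (-1) * (g k x - G x))"
        by (rule L2_sq_add_le) measurable
      also have "L2_sq lborel (\<lambda>x. (-1) * (g k x - G x)) = L2_sq lborel (\<lambda>x. g k x - G x)"
        by (subst L2_sq_cmult) simp_all
      also have "2 * L2_sq lborel (\<lambda>x. g (Suc k) x - G x) + 2 * L2_sq lborel (\<lambda>x. g k x - G x)
         \<le> 2 * ennreal ((1/16) ^ Suc k) + 2 * ennreal ((1/16) ^ k)"
        unfolding g_def by (intro add_mono mult_left_mono N) auto
      also have "\<dots> = ennreal (2 * (1/16) ^ Suc k + 2 * (1/16) ^ k)"
        proof -
          have "2 * ennreal a = ennreal (2 * a)" if "0 \<le> a" for a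
            using that by (subst ennreal_mult) auto
          then show ?thesis by (subst ennreal_plus) auto
        qed
      also have "\<dots> \<le> ennreal (4 * (1/16) ^ k)"
        by (intro ennreal_leI) simp
      finally show ?thesis .
    qed
    then have "ennreal (1 / c) * L2_sq lborel D \<le> ennreal (1 / c) * ennreal (4 * (1/16) ^ k)"
      by (intro mult_left_mono) auto
    also have "\<dots> = ennreal (4 / c * (1/16) ^ k)"
      using c by (subst ennreal_mult[symmetric]) auto
    finally show ?thesis .
  qed
  obtain U where U: "U \<in> L2 lborel" and U_lim: "(\<lambda>k. L2_sq lborel (\<lambda>x. u k x - U x)) \<longlonglongrightarrow> 0"
    using L2_fast_Cauchy_limit[OF u2 fast] c by auto
  have "L2_inverse_fourier G U"
    unfolding L2_inverse_fourier_def c_def[symmetric]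
  proof (intro conjI allI impI G U; elim conjE)
    fix h :: "real ^ 'n \<Rightarrow> complex" assume hi: "integrable lborel h" and h2: "h \<in> L2 lborel"
    have [measurable]: "h \<in> borel_measurable borel" using hi by auto
    have "complex_of_real c * (\<integral>x. u k x * h x \<partial>lborel) = (\<integral>\<xi>. g k \<xi> * fourier h (- \<xi>) \<partial>lborel)" for k
    proof -
      have "complex_of_real c * (\<integral>x. u k x * h x \<partial>lborel) = (\<integral>x. fourier (g k) (- x) * h x \<partial>lborel)"
        unfolding u_def using c
        by (subst Bochner_Integration.integral_mult_right_zero[symmetric]) (simp add: mult.assoc[symmetric])
      also have "\<dots> = (\<integral>x. fourier (g k) x * h (- x) \<partial>lborel)"
        by (subst integral_reflect_lborel[symmetric]) simp_all
      also have "\<dots> = (\<integral>x. g k x * fourier (\<lambda>x. h (- x)) x \<partial>lborel)"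
        by (rule fourier_multiplication_formula[OF gi integrable_reflect_lborel[OF hi]])
      finally show ?thesis by (simp add: fourier_reflect)
    qed
    moreover have "(\<lambda>k. complex_of_real c * (\<integral>x. u k x * h x \<partial>lborel)) \<longlonglongrightarrow> complex_of_real c * (\<integral>x. U x * h x \<partial>lborel)"
      by (intro tendsto_intros L2_pairing_tendsto u2 U h2 U_lim)
    moreover have "(\<lambda>k. \<integral>\<xi>. g k \<xi> * fourier h (- \<xi>) \<partial>lborel) \<longlonglongrightarrow> (\<integral>\<xi>. G \<xi> * fourier h (- \<xi>) \<partial>lborel)"
      by (intro L2_pairing_tendsto g2 G g_lim L2_reflect fourier_L2 hi h2)
    ultimately show "complex_of_real c * (\<integral>x. U x * h x \<partial>lborel) = (\<integral>\<xi>. G \<xi> * fourier h (- \<xi>) \<partial>lborel)"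
      by (simp add: LIMSEQ_unique)
  next
    fix \<phi> :: "real ^ 'n \<Rightarrow> complex"
    assume i: "integrable lborel \<phi>" and cont: "continuous_on UNIV \<phi>" and bd: "bounded (range \<phi>)" and p2: "\<phi> \<in> L2 lborel"
    have [measurable]: "\<phi> \<in> borel_measurable borel" using i by auto
    obtain B where B: "\<And>x. norm (\<phi> x) \<le> B" using bd by (auto simp: bounded_iff)
    have c2: "(\<lambda>x. cnj (\<phi> x)) \<in> L2 lborel" using p2 by (auto simp: L2_def L2_sq_def)
    have "(\<integral>x. u k x * fourier \<phi> x \<partial>lborel) = (\<integral>\<xi>. g k \<xi> * \<phi> \<xi> \<partial>lborel)" for k
    proof -
      have "complex_of_real c * (\<integral>x. u k x * fourier \<phi> x \<partial>lborel) = (\<integral>x. fourier (g k) (- x) * fourier \<phi> x \<partial>lborel)"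
        unfolding u_def using c
        by (subst Bochner_Integration.integral_mult_right_zero[symmetric]) (simp add: mult.assoc[symmetric])
      also have "\<dots> = (\<integral>x. fourier (g k) x * fourier \<phi> (- x) \<partial>lborel)"
        by (subst integral_reflect_lborel[symmetric]) simp_all
      also have "\<dots> = (\<integral>x. fourier (g k) x * cnj (fourier (\<lambda>x. cnj (\<phi> x)) x) \<partial>lborel)"
        by (simp add: fourier_cnj)
      also have "\<dots> = complex_of_real c * (\<integral>x. g k x * cnj (cnj (\<phi> x)) \<partial>lborel)"
        unfolding fourier_eq_ft c_def
      proof (rule vec.parseval[OF gi g2 _ c2, where B=B])
        show "integrable lborel (\<lambda>x. cnj (\<phi> x))" using i by simp
        show "(\<lambda>n. \<integral>y. cnj (\<phi> y) * complex_of_real (vec.kernel n x y) \<partial>lborel)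
            \<longlonglongrightarrow> complex_of_real ((2 * pi) ^ CARD('n)) * cnj (\<phi> x)" for x
          by (rule gauss_approximation) (use cont B in \<open>auto intro!: continuous_intros\<close>)
      qed (use B in auto)
      finally show ?thesis using c by simp
    qed
    moreover have "(\<lambda>k. \<integral>x. u k x * fourier \<phi> x \<partial>lborel) \<longlonglongrightarrow> (\<integral>x. U x * fourier \<phi> x \<partial>lborel)"
      by (intro L2_pairing_tendsto u2 U fourier_L2 i p2 U_lim)
    moreover have "(\<lambda>k. \<integral>\<xi>. g k \<xi> * \<phi> \<xi> \<partial>lborel) \<longlonglongrightarrow> (\<integral>\<xi>. G \<xi> * \<phi> \<xi> \<partial>lborel)"
      by (intro L2_pairing_tendsto g2 G g_lim p2)
    ultimately show "(\<integral>x. U x * fourier \<phi> x \<partial>lborel) = (\<integral>\<xi>. G \<xi> * \<phi> \<xi> \<partial>lborel)"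
      by (simp add: LIMSEQ_unique)
  qed
  then show ?thesis by blast
qed

section \<open>Schwartz functions and weak derivatives\<close>

lemma integrable_inverse_1_plus_square':
  "integrable lborel (\<lambda>t::real. inverse (1 + t\<^sup>2))"
  "(\<integral>t. inverse (1 + t\<^sup>2) \<partial>(lborel :: real measure)) = pi"
  using integrable_inverse_1_plus_square LBINT_inverse_1_plus_square
  by (simp_all add: set_integrable_def interval_lebesgue_integral_def set_lebesgue_integral_def)

text \<open>An integrable majorant that factors over the coordinates, so that a function bounded by
  it is controlled on every slice x_j = t and not only on almost every one.\<close>

definition prod_weight :: "real ^ 'n::finite \<Rightarrow> real" where
  "prod_weight x = (\<Prod>i\<in>UNIV. inverse (1 + (x $ i)\<^sup>2))"

lemma prod_weight_integrable: "integrable lborel (prod_weight :: real ^ 'n::finite \<Rightarrow> real)"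
  unfolding prod_weight_def by (rule vec.integrable_prod) (rule integrable_inverse_1_plus_square')

lemma inverse_1_plus_square_bounds: "0 < inverse (1 + t\<^sup>2)" "inverse (1 + t\<^sup>2) \<le> 1" for t :: real
  by (simp_all add: add_pos_nonneg inverse_le_1_iff)

lemma prod_weight_bounds: "0 < prod_weight x" "prod_weight x \<le> 1"
  unfolding prod_weight_def
  using inverse_1_plus_square_bounds less_imp_le[OF inverse_1_plus_square_bounds(1)]
  by (blast intro: prod_pos, blast intro: prod_le_1)

text \<open>Each factor 1 + x_i^2 is at most (1 + |x|)^2, so 2n powers of decay reach the product
  weight.\<close>

lemma prod_weight_ge: "1 \<le> (1 + norm x) ^ (2 * CARD('n)) * prod_weight x" for x :: "real ^ 'n::finite"
proof -
  have "1 \<le> (1 + norm x)\<^sup>2 * inverse (1 + (x $ i)\<^sup>2)" for i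
  proof -
    have "\<bar>x $ i\<bar> \<le> norm x" by (rule component_le_norm_cart)
    then have "(x $ i)\<^sup>2 \<le> (norm x)\<^sup>2" by (metis abs_ge_zero power2_abs power_mono)
    also have "1 + (norm x)\<^sup>2 \<le> (1 + norm x)\<^sup>2" by (simp add: power2_eq_square algebra_simps)
    finally have "1 + (x $ i)\<^sup>2 \<le> (1 + norm x)\<^sup>2" by simp
    moreover have "0 < 1 + (x $ i)\<^sup>2" by (simp add: add_pos_nonneg)
    ultimately show ?thesis by (simp add: field_simps)
  qed
  then have "1 \<le> (\<Prod>i\<in>(UNIV::'n set). (1 + norm x)\<^sup>2 * inverse (1 + (x $ i)\<^sup>2))"
    by (intro prod_ge_1) auto
  also have "\<dots> = (1 + norm x) ^ (2 * CARD('n)) * prod_weight x"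
    unfolding prod.distrib prod_weight_def by (simp add: power_mult)
  finally show ?thesis .
qed

text \<open>The only decay of Schwartz functions that is used. One power of 1 + |x| beyond the
  product weight makes room for pairing with functions g for which g / (1 + |\<xi>|) is square
  integrable.\<close>

definition rapid :: "(real ^ 'n::finite \<Rightarrow> complex) \<Rightarrow> bool" where
  "rapid \<phi> \<longleftrightarrow> continuous_on UNIV \<phi> \<and> (\<exists>C. \<forall>x. (1 + norm x) * norm (\<phi> x) \<le> C * prod_weight x)"

lemma schwartz_differentiable:
  "\<phi> \<in> schwartz \<Longrightarrow> pderivs ks \<phi> differentiable (at x)"
  by (simp add: schwartz_def smooth_on_def)

lemma schwartz_rapid:
  fixes \<phi> :: "real ^ 'n::finite \<Rightarrow> complex"
  assumes "\<phi> \<in> schwartz"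
  shows "rapid (pderivs ks \<phi>)"
  unfolding rapid_def
proof
  show "continuous_on UNIV (pderivs ks \<phi>)"
    using schwartz_differentiable[OF assms, of ks]
    by (simp add: continuous_at_imp_continuous_on differentiable_imp_continuous_within)
  have "bounded (range (\<lambda>x. (1 + norm x) ^ (2 * CARD('n) + 1) *\<^sub>R pderivs ks \<phi> x))"
    using assms unfolding schwartz_def by blast
  then obtain C where C: "\<And>x. norm ((1 + norm x) ^ (2 * CARD('n) + 1) *\<^sub>R pderivs ks \<phi> x) \<le> C"
    by (auto simp: bounded_iff)
  have "(1 + norm x) * norm (pderivs ks \<phi> x) \<le> C * prod_weight x" for x
  proof -
    have "(1 + norm x) * norm (pderivs ks \<phi> x) * 1
        \<le> (1 + norm x) * norm (pderivs ks \<phi> x) * ((1 + norm x) ^ (2 * CARD('n)) * prod_weight x)"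
      by (intro mult_left_mono prod_weight_ge) auto
    also have "\<dots> = norm ((1 + norm x) ^ (2 * CARD('n) + 1) *\<^sub>R pderivs ks \<phi> x) * prod_weight x"
      by (simp add: mult_ac)
    also have "\<dots> \<le> C * prod_weight x"
      using prod_weight_bounds(1)[of x] by (intro mult_right_mono C) auto
    finally show ?thesis by simp
  qed
  then show "\<exists>C. \<forall>x. (1 + norm x) * norm (pderivs ks \<phi> x) \<le> C * prod_weight x" by blast
qed

lemma rapidE:
  fixes \<phi> :: "real ^ 'n::finite \<Rightarrow> complex"
  assumes "rapid \<phi>"
  obtains C where "0 \<le> C" "\<And>x. (1 + norm x) * norm (\<phi> x) \<le> C * prod_weight x"
    "\<And>x. norm (\<phi> x) \<le> C * prod_weight x" "\<And>x. norm (\<phi> x) \<le> C" "\<And>x. (1 + norm x) * norm (\<phi> x) \<le> C"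
proof -
  obtain C where C: "\<And>x. (1 + norm x) * norm (\<phi> x) \<le> C * prod_weight x"
    using assms by (auto simp: rapid_def)
  have C0: "0 \<le> C"
  proof -
    have "0 \<le> C * prod_weight (0 :: real ^ 'n)" by (rule order_trans[OF norm_ge_zero[of "\<phi> 0"]]) (use C[of 0] in simp)
    then show ?thesis using prod_weight_bounds(1)[of "0 :: real ^ 'n"] by (simp add: zero_le_mult_iff)
  qed
  have 1: "norm (\<phi> x) \<le> (1 + norm x) * norm (\<phi> x)" for x
    by (simp add: distrib_right)
  have 2: "C * prod_weight x \<le> C" for x :: "real ^ 'n"
    using C0 prod_weight_bounds(2)[of x] by (simp add: mult_left_le)
  show thesis
  proof (rule that[OF C0 C])
    show "norm (\<phi> x) \<le> C * prod_weight x" for x by (rule order_trans[OF 1 C])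
    show "(1 + norm x) * norm (\<phi> x) \<le> C" for x by (rule order_trans[OF C 2])
    show "norm (\<phi> x) \<le> C" for x by (rule order_trans[OF order_trans[OF 1 C] 2])
  qed
qed

lemma rapid_measurable: "rapid \<phi> \<Longrightarrow> \<phi> \<in> borel_measurable borel"
  by (intro borel_measurable_continuous_onI) (simp add: rapid_def)

lemma rapid_integrable:
  assumes "rapid \<phi>" shows "integrable lborel \<phi>"
  using assms
proof (rule rapidE)
  fix C assume C: "0 \<le> C" "\<And>x. norm (\<phi> x) \<le> C * prod_weight x"
  show ?thesis
  proof (rule Bochner_Integration.integrable_bound)
    show "integrable lborel (\<lambda>x. C * prod_weight x)" by (intro integrable_mult_right prod_weight_integrable)
    show "AE x in lborel. norm (\<phi> x) \<le> norm (C * prod_weight x)"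
      using C order_trans[OF _ abs_ge_self] by auto
  qed (use rapid_measurable[OF assms] in simp)
qed

lemma rapid_weighted_L2:
  assumes "rapid \<phi>" shows "(\<lambda>x. complex_of_real (1 + norm x) * \<phi> x) \<in> L2 lborel"
  using assms
proof (rule rapidE)
  have [measurable]: "\<phi> \<in> borel_measurable borel" by (rule rapid_measurable[OF assms])
  fix C assume C: "0 \<le> C" "\<And>x. (1 + norm x) * norm (\<phi> x) \<le> C * prod_weight x" "\<And>x. (1 + norm x) * norm (\<phi> x) \<le> C"
  show ?thesis
    unfolding L2_iff_integrable
  proof
    show "integrable lborel (\<lambda>x. (norm (complex_of_real (1 + norm x) * \<phi> x))\<^sup>2)"
    proof (rule Bochner_Integration.integrable_bound)
      show "integrable lborel (\<lambda>x. C * (C * prod_weight x))" by (intro integrable_mult_right prod_weight_integrable)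
      show "AE x in lborel. norm ((norm (complex_of_real (1 + norm x) * \<phi> x))\<^sup>2) \<le> norm (C * (C * prod_weight x))"
      proof (rule AE_I2)
        fix x
        have "norm (complex_of_real (1 + norm x) * \<phi> x) = (1 + norm x) * norm (\<phi> x)"
          unfolding norm_mult norm_of_real by simp
        moreover have "((1 + norm x) * norm (\<phi> x)) * ((1 + norm x) * norm (\<phi> x)) \<le> C * (C * prod_weight x)"
          by (rule mult_mono[OF C(3) C(2)]) (use C(1) in auto)
        ultimately show "norm ((norm (complex_of_real (1 + norm x) * \<phi> x))\<^sup>2) \<le> norm (C * (C * prod_weight x))"
          by (simp add: power2_eq_square)
      qed
    qed measurable
  qed measurable
qed

lemma rapid_L2:
  assumes "rapid \<phi>" shows "\<phi> \<in> L2 lborel"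
proof (rule L2_bound[OF rapid_weighted_L2[OF assms]])
  show "norm (\<phi> x) \<le> norm (complex_of_real (1 + norm x) * \<phi> x)" for x
    unfolding norm_mult norm_of_real by (simp add: distrib_right)
qed (use rapid_measurable[OF assms] in simp)

lemma rapid_bounded: "rapid \<phi> \<Longrightarrow> bounded (range \<phi>)"
  by (erule rapidE) (auto simp: bounded_iff)

text \<open>The weight 1 + |\<xi>| moves from \<open>g\<close> to the rapidly decreasing factor,
  leaving a product of two L^2 functions.\<close>

lemma weighted_L2_rapid_integrable:
  assumes g: "g \<in> borel_measurable borel" "(\<lambda>\<xi>. g \<xi> / complex_of_real (1 + norm \<xi>)) \<in> L2 lborel"
    and \<phi>: "rapid \<phi>"
  shows "integrable lborel (\<lambda>\<xi>. g \<xi> * \<phi> \<xi>)"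
proof -
  have nz: "complex_of_real (1 + norm \<xi>) \<noteq> 0" for \<xi> :: "real ^ 'a"
  proof -
    have "1 + norm \<xi> \<noteq> 0" using norm_ge_zero[of \<xi>] by linarith
    then show ?thesis by (metis of_real_eq_0_iff)
  qed
  have "integrable lborel (\<lambda>\<xi>. (g \<xi> / complex_of_real (1 + norm \<xi>)) * (complex_of_real (1 + norm \<xi>) * \<phi> \<xi>))"
    by (rule L2_mult_integrable[OF g(2) rapid_weighted_L2[OF \<phi>]])
  moreover have "a / b * (b * c) = a * c" if "b \<noteq> 0" for a b c :: complex
    using that by simp
  ultimately show ?thesis by (simp only: nz not_False_eq_True)
qed

lemma tempered_fun_weighted_L2:
  assumes "g \<in> borel_measurable borel" "(\<lambda>\<xi>. g \<xi> / complex_of_real (1 + norm \<xi>)) \<in> L2 lborel"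
  shows "tempered_fun g"
  unfolding tempered_fun_def
  using assms weighted_L2_rapid_integrable[OF assms] schwartz_rapid[where ks="[]"] by auto

lemma tempered_fun_L2:
  assumes "u \<in> L2 lborel" shows "tempered_fun u"
  unfolding tempered_fun_def
  using assms L2_mult_integrable[OF assms rapid_L2] schwartz_rapid[where ks="[]"] by (auto simp: L2_def)

lemma L2_inverse_fourier_has_fourier:
  assumes "L2_inverse_fourier G u"
  shows "has_fourier u G"
proof -
  have "rapid \<phi>" if "\<phi> \<in> schwartz" for \<phi> :: "real ^ 'a \<Rightarrow> complex"
    using schwartz_rapid[OF that, of "[]"] by simp
  then show ?thesis
    using assms unfolding has_fourier_def L2_inverse_fourier_def
    by (auto intro: tempered_fun_L2 simp: rapid_integrable rapid_bounded rapid_L2 rapid_def[THEN iffD1])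
qed

section \<open>Differentiation along coordinate lines\<close>

lemma join_coord_line: "join_coord j t y = join_coord j 0 y + t *\<^sub>R axis j 1"
  by (simp add: vec_eq_iff join_coord_def axis_def)

lemma has_vector_derivative_line:
  fixes f :: "real ^ 'n::finite \<Rightarrow> 'b::real_normed_vector"
  assumes "f differentiable (at (join_coord j t y))"
  shows "((\<lambda>s. f (join_coord j s y)) has_vector_derivative pderiv_at j f (join_coord j t y)) (at t)"
proof -
  define f' where "f' = frechet_derivative f (at (join_coord j t y))"
  have f': "(f has_derivative f') (at (join_coord j t y))"
    using assms by (simp add: f'_def frechet_derivative_works)
  have eq: "(\<lambda>s. join_coord j s y) = (\<lambda>s. join_coord j 0 y + s *\<^sub>R axis j 1)"
    by (rule ext) (rule join_coord_line)
  have l: "((\<lambda>s. join_coord j s y) has_derivative (\<lambda>s. s *\<^sub>R axis j 1)) (at t)"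
    unfolding eq by (auto intro!: derivative_eq_intros)
  have "((\<lambda>s. f (join_coord j s y)) has_derivative (\<lambda>s. f' (s *\<^sub>R axis j 1))) (at t)"
    using has_derivative_compose[OF l f'] .
  moreover have "f' (s *\<^sub>R axis j 1) = s *\<^sub>R f' (axis j 1)" for s
    using f' by (simp add: linear_cmul has_derivative_linear)
  ultimately show ?thesis
    by (simp add: has_vector_derivative_def pderiv_at_def f'_def)
qed

lemma join_coord_continuous: "continuous_on UNIV (\<lambda>t. join_coord j t y)"
proof -
  have "(\<lambda>s. join_coord j s y) = (\<lambda>s. join_coord j 0 y + s *\<^sub>R axis j 1)"
    by (rule ext) (rule join_coord_line)
  then show ?thesis by (simp only:) (intro continuous_intros)
qed

lemma has_vector_derivative_cis: "((\<lambda>t. cis (a * t + b)) has_vector_derivative (\<i> * complex_of_real a * cis (a * t + b))) (at t)"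
  unfolding cis_conv_exp
  by (rule has_vector_derivative_real_field[where f="\<lambda>z. exp (\<i> * (complex_of_real a * z + complex_of_real b))", THEN has_vector_derivative_eq_rhs, unfolded of_real_mult[symmetric] of_real_add[symmetric]])
     (auto intro!: derivative_eq_intros)

lemma norm_join_ge: "\<bar>t\<bar> \<le> norm (join_coord j t y)"
  using component_le_norm_cart[of "join_coord j t y" j] by (simp add: join_coord_def)

text \<open>Integration by parts on each line in direction k: the difference \<open>H\<close> of the
  two integrands is the derivative of the exponential times \<phi>, and this product tends to 0 at
  both ends.\<close>

lemma fourier_pderiv:
  fixes \<phi> :: "real ^ 'n::finite \<Rightarrow> complex"
  assumes \<phi>: "\<phi> \<in> schwartz"
  shows "fourier (pderiv_at k \<phi>) \<xi> = \<i> * complex_of_real (\<xi> $ k) * fourier \<phi> \<xi>"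
proof -
  have r0: "rapid \<phi>" and r1: "rapid (pderiv_at k \<phi>)"
    using schwartz_rapid[OF \<phi>, of "[]"] schwartz_rapid[OF \<phi>, of "[k]"] by auto
  define H where "H x = cis (- (x \<bullet> \<xi>)) * pderiv_at k \<phi> x - \<i> * complex_of_real (\<xi> $ k) * (cis (- (x \<bullet> \<xi>)) * \<phi> x)" for x
  have i0: "integrable lborel (\<lambda>x. cis (- (x \<bullet> \<xi>)) * \<phi> x)" "integrable lborel (\<lambda>x. cis (- (x \<bullet> \<xi>)) * pderiv_at k \<phi> x)"
    using vec.ft_integrand_integrable[OF rapid_integrable[OF r0], of \<xi>]
      vec.ft_integrand_integrable[OF rapid_integrable[OF r1], of \<xi>] by (simp_all add: vec_pairing_eq)
  have Hi: "integrable lborel H"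
    unfolding H_def using i0 by (intro Bochner_Integration.integrable_diff integrable_mult_right)
  interpret pair_sigma_finite lborel "hat_measure k"
    by (simp add: pair_sigma_finite_def hat.sf_M lborel.sigma_finite_measure_axioms)
  have "AE y in hat_measure k. integrable lborel (\<lambda>t. H (join_coord k t y))"
    using AE_integrable_snd[OF integral_join(1)[OF Hi, of k]] by simp
  then have "AE y in hat_measure k. (\<integral>t. H (join_coord k t y) \<partial>lborel) = 0"
  proof eventually_elim
    fix y assume i: "integrable lborel (\<lambda>t. H (join_coord k t y))"
    define F where "F t = cis (- (join_coord k t y \<bullet> \<xi>)) * \<phi> (join_coord k t y)" for t
    have F: "(F has_vector_derivative H (join_coord k t y)) (at t)" for t
    proof -
      have d: "((\<lambda>s. \<phi> (join_coord k s y)) has_vector_derivative pderiv_at k \<phi> (join_coord k t y)) (at t)"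
        by (rule has_vector_derivative_line) (use schwartz_differentiable[OF \<phi>, of "[]"] in simp)
      have a: "- (join_coord k s y \<bullet> \<xi>) = (- \<xi> $ k) * s + (- (join_coord k 0 y \<bullet> \<xi>))" for s
        by (subst join_coord_line) (simp add: inner_add_left inner_axis')
      have c: "((\<lambda>s. cis (- (join_coord k s y \<bullet> \<xi>))) has_vector_derivative
           (\<i> * complex_of_real (- \<xi> $ k) * cis (- (join_coord k t y \<bullet> \<xi>)))) (at t)"
        using has_vector_derivative_cis[of "- \<xi> $ k" "- (join_coord k 0 y \<bullet> \<xi>)" t]
        unfolding a[symmetric] .
      show ?thesis
        unfolding F_def H_def
        by (rule has_vector_derivative_mult[OF c d, THEN has_vector_derivative_eq_rhs]) simp
    qed
    have cont: "isCont (\<lambda>t. H (join_coord k t y)) t" for t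
    proof -
      have "continuous_on UNIV H"
        unfolding H_def using r0 r1 by (intro continuous_intros) (auto simp: rapid_def)
      then have "continuous_on UNIV (\<lambda>t. H (join_coord k t y))"
        using continuous_on_compose2[OF _ join_coord_continuous[of k y]] by blast
      then show ?thesis by (simp add: continuous_on_eq_continuous_at)
    qed
    obtain C where C: "\<And>x. (1 + norm x) * norm (\<phi> x) \<le> C" using r0 by (rule rapidE) (rule that)
    have Fb: "norm (F t) \<le> C / (1 + \<bar>t\<bar>)" for t
    proof -
      have "(1 + \<bar>t\<bar>) * norm (F t) \<le> (1 + norm (join_coord k t y)) * norm (\<phi> (join_coord k t y))"
        unfolding F_def norm_mult by (intro mult_mono) (auto simp: norm_join_ge)
      also have "\<dots> \<le> C" by (rule C)
      finally show ?thesis by (simp add: field_simps)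
    qed
    have abs_top: "filterlim (\<lambda>t::real. 1 + \<bar>t\<bar>) at_top at_top"
      by (intro filterlim_tendsto_add_at_top[OF tendsto_const] filterlim_abs_real)
    then have abs_bot: "filterlim (\<lambda>t::real. 1 + \<bar>t\<bar>) at_top at_bot"
      by (simp add: filterlim_at_bot_mirror)
    have "((\<lambda>t. C / (1 + \<bar>t\<bar>)) \<longlongrightarrow> 0) at_top" "((\<lambda>t. C / (1 + \<bar>t\<bar>)) \<longlongrightarrow> 0) at_bot"
      using abs_top abs_bot
      by (auto intro!: tendsto_divide_0[OF tendsto_const] filterlim_at_top_imp_at_infinity)
    then have lim: "(F \<longlongrightarrow> 0) at_top" "(F \<longlongrightarrow> 0) at_bot"
      by (auto elim!: Lim_null_comparison[rotated] intro!: always_eventually Fb)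
    have "(LBINT t=-\<infinity>..\<infinity>. H (join_coord k t y)) = 0 - 0"
    proof (rule interval_integral_FTC_integrable[where F=F])
      show "set_integrable lborel (einterval (-\<infinity>) \<infinity>) (\<lambda>t. H (join_coord k t y))"
        using i by (simp add: set_integrable_def)
      show "((F \<circ> real_of_ereal) \<longlongrightarrow> 0) (at_right (-\<infinity>))" "((F \<circ> real_of_ereal) \<longlongrightarrow> 0) (at_left \<infinity>)"
        using lim by (simp_all add: ereal_tendsto_simps)
    qed (use F cont in auto)
    then show "(\<integral>t. H (join_coord k t y) \<partial>lborel) = 0"
      by (simp add: interval_lebesgue_integral_def set_lebesgue_integral_def)
  qed
  then have "(\<integral>y. \<integral>t. H (join_coord k t y) \<partial>lborel \<partial>hat_measure k) = (\<integral>y. 0 \<partial>hat_measure k)"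
    using borel_measurable_integrable[OF integrable_snd[OF integral_join(1)[OF Hi, of k]]]
    by (intro integral_cong_AE) auto
  then have "(\<integral>x. H x \<partial>lborel) = 0"
    by (simp add: integral_join(3)[OF Hi, of k])
  then show ?thesis
    unfolding H_def fourier_eq_ft vec.ft_def vec_pairing_eq using i0
    by (subst (asm) Bochner_Integration.integral_diff) (auto simp: mult.assoc)
qed

text \<open>In the first duality formula the test function is transformed at -\<xi>, so
  differentiating it produces -i \<xi>_k; this is the minus sign in the definition of the weak
  derivative.\<close>

lemma L2_inverse_fourier_weak_pderiv:
  assumes v: "L2_inverse_fourier G v" and w: "L2_inverse_fourier (\<lambda>\<xi>. \<i> * complex_of_real (\<xi> $ k) * G \<xi>) w"
  shows "weak_pderiv k v w"
  unfolding weak_pderiv_def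
proof (intro conjI ballI)
  show "tempered_fun v" "tempered_fun w"
    using v w by (auto intro!: tempered_fun_L2 simp: L2_inverse_fourier_def)
  fix \<phi> :: "real ^ 'a \<Rightarrow> complex" assume \<phi>: "\<phi> \<in> schwartz"
  have r0: "rapid \<phi>" and r1: "rapid (pderiv_at k \<phi>)"
    using schwartz_rapid[OF \<phi>, of "[]"] schwartz_rapid[OF \<phi>, of "[k]"] by auto
  define c where "c = complex_of_real ((2 * pi) ^ CARD('a))"
  have "c * (\<integral>x. w x * \<phi> x \<partial>lborel) = (\<integral>\<xi>. \<i> * complex_of_real (\<xi> $ k) * G \<xi> * fourier \<phi> (- \<xi>) \<partial>lborel)"
    using w r0 unfolding L2_inverse_fourier_def c_def by (simp add: rapid_integrable rapid_L2)
  also have "\<dots> = (\<integral>\<xi>. - (G \<xi> * fourier (pderiv_at k \<phi>) (- \<xi>)) \<partial>lborel)"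
    by (simp add: fourier_pderiv[OF \<phi>] mult_ac)
  also have "\<dots> = - (c * (\<integral>x. v x * pderiv_at k \<phi> x \<partial>lborel))"
    using v r1 unfolding L2_inverse_fourier_def c_def by (simp add: rapid_integrable rapid_L2)
  finally have *: "c * (\<integral>x. w x * \<phi> x \<partial>lborel) = c * (- (\<integral>x. v x * pderiv_at k \<phi> x \<partial>lborel))" by simp
  show "(\<integral>x. w x * \<phi> x \<partial>lborel) = - (\<integral>x. v x * pderiv_at k \<phi> x \<partial>lborel)"
  proof -
    have "c \<noteq> 0" by (simp add: c_def)
    from iffD1[OF mult_left_cancel[OF this] *] show ?thesis .
  qed
qed

section \<open>Mixed norms\<close>

abbreviation esqrt :: "ennreal \<Rightarrow> ennreal" where
  "esqrt a \<equiv> enn_powr a (1/2)"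

lemma esqrt_ennreal: "0 \<le> r \<Longrightarrow> esqrt (ennreal r) = ennreal (sqrt r)"
  by (simp add: enn_powr_def powr_half_sqrt)

lemma esqrt_top: "esqrt \<top> = \<top>"
  by (simp add: enn_powr_def)

lemma esqrt_square: "(esqrt a)\<^sup>2 = a"
proof (cases a)
  case (real r)
  then show ?thesis by (simp add: esqrt_ennreal ennreal_power)
next
  case top
  then show ?thesis by (simp add: esqrt_top power2_eq_square ennreal_top_mult)
qed

text \<open>Squaring is an order embedding of [0, \<infinity>], so every inequality about
  \<open>esqrt\<close> reduces to one without roots, including the value \<infinity>.\<close>

lemma ennreal_square_le_iff: "a\<^sup>2 \<le> b\<^sup>2 \<longleftrightarrow> a \<le> (b::ennreal)"
proof (cases a; cases b)
  fix r s assume "a = ennreal r" "b = ennreal s" "0 \<le> r" "0 \<le> s"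
  then show ?thesis
    by (simp add: ennreal_power power2_le_iff_abs_le)
qed (auto simp: power2_eq_square ennreal_top_mult ennreal_mult_eq_top_iff ennreal_mult[symmetric] top_unique)

lemma le_esqrt_iff: "a \<le> esqrt b \<longleftrightarrow> a\<^sup>2 \<le> b"
  using ennreal_square_le_iff[of a "esqrt b"] by (simp add: esqrt_square)

lemma esqrt_le_iff: "esqrt a \<le> b \<longleftrightarrow> a \<le> b\<^sup>2"
  using ennreal_square_le_iff[of "esqrt a" b] by (simp add: esqrt_square)

lemma esqrt_mono: "a \<le> b \<Longrightarrow> esqrt a \<le> esqrt b"
  by (simp add: le_esqrt_iff esqrt_square)

lemma esqrt_mult: "esqrt (a * b) = esqrt a * esqrt b"
  by (rule antisym; simp add: le_esqrt_iff esqrt_le_iff power_mult_distrib esqrt_square)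

lemma esqrt_measurable [measurable (raw)]:
  assumes [measurable]: "f \<in> borel_measurable M"
  shows "(\<lambda>x. esqrt (f x)) \<in> borel_measurable M"
  unfolding enn_powr_def by measurable

lemma esqrt_finite_iff: "esqrt a < \<top> \<longleftrightarrow> a < \<top>"
  by (cases a) (simp_all add: esqrt_ennreal esqrt_top)

lemma esqrt_tendsto_0:
  assumes "(f \<longlongrightarrow> 0) F" shows "((\<lambda>x. esqrt (f x)) \<longlongrightarrow> 0) F"
proof (rule order_tendstoI)
  fix a :: ennreal assume a: "0 < a"
  then have "0 < a\<^sup>2" by (simp add: power2_eq_square ennreal_zero_less_mult_iff)
  from order_tendstoD(2)[OF assms this] show "eventually (\<lambda>x. esqrt (f x) < a) F"
    by eventually_elim (simp add: not_le[symmetric] le_esqrt_iff)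
qed simp

definition slice_norm :: "'n \<Rightarrow> (real ^ 'n::finite \<Rightarrow> complex) \<Rightarrow> real \<Rightarrow> ennreal" where
  "slice_norm j f t = esqrt (L2_sq (hat_measure j) (\<lambda>y. f (join_coord j t y)))"

lemma enn_powr_one: "enn_powr a 1 = a"
  by (cases a) (auto simp: enn_powr_def)

lemma enn_powr_two: "0 \<le> r \<Longrightarrow> enn_powr (ennreal r) 2 = (ennreal r)\<^sup>2"
  by (simp add: enn_powr_def ennreal_power)

lemma Lp_norm_2_slice:
  "Lp_norm 2 (hat_measure j) (\<lambda>y. ennreal (norm (f (join_coord j t y)))) = slice_norm j f t"
  by (simp add: Lp_norm_def slice_norm_def L2_sq_def enn_powr_two)

lemma mixed_norm_12: "mixed_norm 1 2 j f = (\<integral>\<^sup>+t. slice_norm j f t \<partial>lborel)"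
  unfolding mixed_norm_def Lp_norm_2_slice by (simp add: Lp_norm_def enn_powr_one)

lemma mixed_norm_inf2: "mixed_norm \<infinity> 2 j f = esssup lborel (slice_norm j f)"
  unfolding mixed_norm_def Lp_norm_2_slice by (simp add: Lp_norm_def)

interpretation hat_pair: pair_sigma_finite lborel "hat_measure j"
  by (simp add: pair_sigma_finite_def hat.sf_M lborel.sigma_finite_measure_axioms)

lemma L2_sq_slice_measurable [measurable]:
  assumes [measurable]: "f \<in> borel_measurable borel"
  shows "(\<lambda>t. L2_sq (hat_measure j) (\<lambda>y. f (join_coord j t y))) \<in> borel_measurable borel"
proof -
  have "(\<lambda>t. \<integral>\<^sup>+y. (ennreal (norm (f (join_coord j t y))))\<^sup>2 \<partial>hat_measure j) \<in> borel_measurable lborel"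
    by (rule sigma_finite_measure.borel_measurable_nn_integral[OF hat.sf_M]) measurable
  then show ?thesis by (simp add: L2_sq_def)
qed

lemma slice_norm_measurable [measurable]:
  assumes [measurable]: "f \<in> borel_measurable borel"
  shows "slice_norm j f \<in> borel_measurable borel"
  unfolding slice_norm_def by measurable

lemma slice_norm_mono:
  "(\<And>x. norm (f x) \<le> norm (g x)) \<Longrightarrow> slice_norm j f t \<le> slice_norm j g t"
  unfolding slice_norm_def by (intro esqrt_mono L2_sq_mono)

lemma mixed_norm_12_mono:
  "(\<And>x. norm (f x) \<le> norm (g x)) \<Longrightarrow> mixed_norm 1 2 j f \<le> mixed_norm 1 2 j g"
  unfolding mixed_norm_12 by (intro nn_integral_mono slice_norm_mono)

lemma mixed_norm_cong_norm:
  "(\<And>x. norm (f x) = norm (g x)) \<Longrightarrow> mixed_norm p q j f = mixed_norm p q j g"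
  by (simp add: mixed_norm_def)

lemma nn_Cauchy_Schwarz_esqrt:
  assumes [measurable]: "f \<in> borel_measurable M" "g \<in> borel_measurable M"
  shows "(\<integral>\<^sup>+x. ennreal (norm (f x)) * ennreal (norm (g x)) \<partial>M) \<le> esqrt (L2_sq M f) * esqrt (L2_sq M g)"
  unfolding esqrt_mult[symmetric] le_esqrt_iff
  using nn_Cauchy_Schwarz_L2[OF assms] by (simp add: norm_mult ennreal_mult)

section \<open>Functions dominated by a product weight\<close>

definition hat_weight :: "'n \<Rightarrow> ('n::finite \<Rightarrow> real) \<Rightarrow> real" where
  "hat_weight j y = (\<Prod>i\<in>UNIV - {j}. inverse (1 + (y i)\<^sup>2))"

lemma prod_weight_join: "prod_weight (join_coord j t y) = inverse (1 + t\<^sup>2) * hat_weight j y"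
  unfolding prod_weight_def hat_weight_def
  by (simp add: prod.remove[of UNIV j] join_coord_def)

lemma hat_weight_integrable: "integrable (hat_measure j) (hat_weight j)"
  unfolding hat_weight_def by (rule hat.integrable_prod) (rule integrable_inverse_1_plus_square')

lemma hat_weight_bounds: "0 \<le> hat_weight j y" "hat_weight j y \<le> 1"
  unfolding hat_weight_def using inverse_1_plus_square_bounds less_imp_le[OF inverse_1_plus_square_bounds(1)]
  by (blast intro: prod_nonneg, blast intro: prod_le_1)

definition hat_mass :: "'n::finite \<Rightarrow> real" where
  "hat_mass j = (\<integral>y. hat_weight j y \<partial>hat_measure j)"

lemma hat_mass_nonneg: "0 \<le> hat_mass j"
  unfolding hat_mass_def by (rule integral_nonneg_AE) (simp add: hat_weight_bounds)

text \<open>The weight lies between 0 and 1 and so dominates its own square; one majorant therefore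
  yields membership in both L^1 and L^2.\<close>

lemma hat_weight_dominated:
  fixes f :: "('n::finite \<Rightarrow> real) \<Rightarrow> complex"
  assumes [measurable]: "f \<in> borel_measurable (hat_measure j)"
    and le: "\<And>y. y \<in> space (hat_measure j) \<Longrightarrow> norm (f y) \<le> C * hat_weight j y" and C: "0 \<le> C"
  shows "integrable (hat_measure j) f" "f \<in> L2 (hat_measure j)"
    "L2_sq (hat_measure j) f \<le> ennreal (C\<^sup>2 * hat_mass j)"
proof -
  show "integrable (hat_measure j) f"
    by (rule Bochner_Integration.integrable_bound[OF integrable_mult_right[of C, OF hat_weight_integrable]])
       (auto intro!: AE_I2 order_trans[OF le])
  have "L2_sq (hat_measure j) f \<le> (\<integral>\<^sup>+y. ennreal (C\<^sup>2 * hat_weight j y) \<partial>hat_measure j)"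
    unfolding L2_sq_def
  proof (rule nn_integral_mono)
    fix y assume y: "y \<in> space (hat_measure j)"
    have "(norm (f y))\<^sup>2 \<le> (C * hat_weight j y)\<^sup>2"
      by (intro power_mono le y) simp
    also have "\<dots> = C\<^sup>2 * (hat_weight j y * hat_weight j y)" by (simp add: power2_eq_square)
    also have "\<dots> \<le> C\<^sup>2 * hat_weight j y"
      using hat_weight_bounds[of j y] by (intro mult_left_mono mult_left_le) auto
    finally show "(ennreal (norm (f y)))\<^sup>2 \<le> ennreal (C\<^sup>2 * hat_weight j y)"
      by (simp add: ennreal_power ennreal_leI)
  qed
  also have "\<dots> = ennreal (C\<^sup>2 * hat_mass j)"
    unfolding hat_mass_def
    by (subst nn_integral_eq_integral) (auto intro!: hat_weight_integrable simp: hat_weight_bounds)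
  finally show le2: "L2_sq (hat_measure j) f \<le> ennreal (C\<^sup>2 * hat_mass j)" .
  then show "f \<in> L2 (hat_measure j)"
    by (auto simp: L2_def intro: le_less_trans)
qed

text \<open>A common class for Schwartz functions and for bounded functions of bounded support. All
  slices of its members lie in L^1 and L^2, so the partial transforms are defined for every
  t.\<close>

definition dominated :: "(real ^ 'n::finite \<Rightarrow> complex) \<Rightarrow> bool" where
  "dominated f \<longleftrightarrow> f \<in> borel_measurable borel \<and> (\<exists>C\<ge>0. \<forall>x. norm (f x) \<le> C * prod_weight x)"

lemma rapid_dominated: "rapid \<phi> \<Longrightarrow> dominated \<phi>"
  unfolding dominated_def by (auto simp: rapid_measurable elim!: rapidE)

lemma bounded_support_dominated:
  fixes f :: "real ^ 'n::finite \<Rightarrow> complex"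
  assumes "bounded_support f" shows "dominated f"
  using assms
proof (rule bounded_supportE)
  fix N assume N: "f \<in> borel_measurable borel" "\<And>x. norm (f x) \<le> N" "\<And>x. N < norm x \<Longrightarrow> f x = 0" "0 \<le> N"
  have "norm (f x) \<le> N * (1 + N) ^ (2 * CARD('n)) * prod_weight x" for x
  proof (cases "N < norm x")
    case True
    then show ?thesis using N prod_weight_bounds(1)[of x] by simp
  next
    case False
    have "norm (f x) * 1 \<le> N * ((1 + norm x) ^ (2 * CARD('n)) * prod_weight x)"
      using N by (intro mult_mono prod_weight_ge) auto
    also have "\<dots> \<le> N * ((1 + N) ^ (2 * CARD('n)) * prod_weight x)"
      using N False prod_weight_bounds(1)[of x] by (intro mult_left_mono mult_right_mono power_mono) auto
    finally show ?thesis by (simp add: mult.assoc)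
  qed
  moreover have "0 \<le> N * (1 + N) ^ (2 * CARD('n))" using N by simp
  ultimately show ?thesis using N unfolding dominated_def by blast
qed

lemma dominatedE:
  assumes "dominated f"
  obtains C where "f \<in> borel_measurable borel" "0 \<le> C" "\<And>x. norm (f x) \<le> C * prod_weight x"
    "\<And>j t y. norm (f (join_coord j t y)) \<le> (C * inverse (1 + t\<^sup>2)) * hat_weight j y"
    "\<And>j t y. norm (f (join_coord j t y)) \<le> C * hat_weight j y"
proof -
  obtain C where C: "f \<in> borel_measurable borel" "0 \<le> C" "\<And>x. norm (f x) \<le> C * prod_weight x"
    using assms by (auto simp: dominated_def)
  have 1: "norm (f (join_coord j t y)) \<le> (C * inverse (1 + t\<^sup>2)) * hat_weight j y" for j t y
    using C(3)[of "join_coord j t y"] by (simp add: prod_weight_join mult.assoc)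
  have 2: "norm (f (join_coord j t y)) \<le> C * hat_weight j y" for j t y
    by (rule order_trans[OF 1], intro mult_right_mono mult_left_le)
      (use C(2) inverse_1_plus_square_bounds[of t] hat_weight_bounds[of j y] in auto)
  show thesis by (rule that[OF C(1) C(2) C(3) 1 2])
qed

lemma dominated_slice:
  assumes "dominated f"
  shows "integrable (hat_measure j) (\<lambda>y. f (join_coord j t y))" "(\<lambda>y. f (join_coord j t y)) \<in> L2 (hat_measure j)"
proof -
  obtain C where C: "f \<in> borel_measurable borel" "0 \<le> C"
    "\<And>j t y. norm (f (join_coord j t y)) \<le> C * hat_weight j y"
    by (rule dominatedE[OF assms]) (rule that)
  note [measurable] = C(1)
  have m: "(\<lambda>y. f (join_coord j t y)) \<in> borel_measurable (hat_measure j)" by measurable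
  show "integrable (hat_measure j) (\<lambda>y. f (join_coord j t y))" "(\<lambda>y. f (join_coord j t y)) \<in> L2 (hat_measure j)"
    using hat_weight_dominated[OF m C(3) C(2)] by auto
qed

lemma dominated_integrable:
  assumes "dominated f" shows "integrable lborel f"
  using assms
proof (rule dominatedE)
  fix C assume C: "f \<in> borel_measurable borel" "0 \<le> C" "\<And>x. norm (f x) \<le> C * prod_weight x"
  show ?thesis
    by (rule Bochner_Integration.integrable_bound[OF integrable_mult_right[of C, OF prod_weight_integrable]])
      (use C in \<open>auto intro!: AE_I2 order_trans[OF C(3)]\<close>)
qed

section \<open>Multipliers with bounded one-dimensional kernels\<close>

definition partial_ft :: "'n \<Rightarrow> (real ^ 'n::finite \<Rightarrow> complex) \<Rightarrow> real \<Rightarrow> ('n \<Rightarrow> real) \<Rightarrow> complex" where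
  "partial_ft j f t \<eta> = hat.ft j (\<lambda>y. f (join_coord j t y)) \<eta>"

lemma partial_ft_measurable:
  assumes [measurable]: "f \<in> borel_measurable borel"
  shows "(\<lambda>z. partial_ft j f (fst z) (snd z)) \<in> borel_measurable (lborel \<Otimes>\<^sub>M hat_measure j)"
  unfolding partial_ft_def hat.ft_def
  by (rule sigma_finite_measure.borel_measurable_lebesgue_integral[OF hat.sf_M]) measurable

lemma partial_ft_measurable' [measurable (raw)]:
  assumes "f \<in> borel_measurable borel" "a \<in> borel_measurable M" "b \<in> measurable M (hat_measure j)"
  shows "(\<lambda>x. partial_ft j f (a x) (b x)) \<in> borel_measurable M"
  using measurable_compose[OF measurable_Pair[of a M lborel b "hat_measure j"] partial_ft_measurable[OF assms(1)]] assms
  by simp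

lemma norm_partial_ft_le:
  assumes "dominated f"
  obtains C where "0 \<le> C" "\<And>t \<eta>. norm (partial_ft j f t \<eta>) \<le> C * inverse (1 + t\<^sup>2)"
  using assms
proof (rule dominatedE)
  fix C assume C: "f \<in> borel_measurable borel" "0 \<le> C"
    "\<And>j t y. norm (f (join_coord j t y)) \<le> (C * inverse (1 + t\<^sup>2)) * hat_weight j y"
  note [measurable] = C(1)
  have "norm (partial_ft j f t \<eta>) \<le> (C * hat_mass j) * inverse (1 + t\<^sup>2)" for t \<eta>
  proof -
    have "norm (partial_ft j f t \<eta>) \<le> (\<integral>y. norm (f (join_coord j t y)) \<partial>hat_measure j)"
      unfolding partial_ft_def by (rule hat.norm_ft_le)
    also have "\<dots> \<le> (\<integral>y. (C * inverse (1 + t\<^sup>2)) * hat_weight j y \<partial>hat_measure j)"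
      by (intro integral_mono integrable_norm dominated_slice assms integrable_mult_right hat_weight_integrable C)
    finally show ?thesis by (simp add: hat_mass_def mult_ac)
  qed
  then show thesis using C hat_mass_nonneg[of j] that[of "C * hat_mass j"] by simp
qed

lemma partial_ft_integrable:
  assumes "dominated f" "\<eta> \<in> space (hat_measure j)"
  shows "integrable lborel (\<lambda>t. partial_ft j f t \<eta>)"
proof -
  have [measurable]: "f \<in> borel_measurable borel" using assms by (simp add: dominated_def)
  obtain C where C: "0 \<le> C" "\<And>t \<eta>. norm (partial_ft j f t \<eta>) \<le> C * inverse (1 + t\<^sup>2)"
    by (rule norm_partial_ft_le[OF assms(1), of j]) (rule that)
  show ?thesis
    by (rule Bochner_Integration.integrable_bound[OF integrable_mult_right[of C, OF integrable_inverse_1_plus_square'(1)]])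
       (use assms(2) in \<open>auto intro!: AE_I2 order_trans[OF C(2)]\<close>)
qed

lemma fourier_join:
  assumes f: "dominated f"
  shows "fourier f (join_coord j \<tau> \<eta>) = (\<integral>t. cis (- (t * \<tau>)) * partial_ft j f t \<eta> \<partial>lborel)"
proof -
  have i: "integrable lborel (\<lambda>x. cis (- (x \<bullet> join_coord j \<tau> \<eta>)) * f x)"
    using vec.ft_integrand_integrable[OF dominated_integrable[OF f], of "join_coord j \<tau> \<eta>"] by (simp add: vec_pairing_eq)
  have "fourier f (join_coord j \<tau> \<eta>) = (\<integral>t. \<integral>y. cis (- (join_coord j t y \<bullet> join_coord j \<tau> \<eta>)) * f (join_coord j t y) \<partial>hat_measure j \<partial>lborel)"
    unfolding fourier_eq_ft vec.ft_def vec_pairing_eq by (rule integral_join(2)[OF i])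
  also have "\<dots> = (\<integral>t. \<integral>y. cis (- (t * \<tau>)) * (cis (- hat.pairing j y \<eta>) * f (join_coord j t y)) \<partial>hat_measure j \<partial>lborel)"
    by (simp add: inner_join mult.assoc[symmetric] cis_mult)
  also have "\<dots> = (\<integral>t. cis (- (t * \<tau>)) * partial_ft j f t \<eta> \<partial>lborel)"
    by (simp add: partial_ft_def hat.ft_def)
  finally show ?thesis .
qed

lemma L2_sq_partial_ft_le:
  fixes f :: "real ^ 'n::finite \<Rightarrow> complex"
  assumes "dominated f"
  shows "L2_sq (hat_measure j) (partial_ft j f t)
    \<le> ennreal ((2 * pi) ^ (CARD('n) - 1)) * L2_sq (hat_measure j) (\<lambda>y. f (join_coord j t y))"
  using hat.bessel[OF dominated_slice[OF assms], of j t]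
  by (simp add: partial_ft_def[abs_def] card_Diff_singleton)

text \<open>The line as a space with a single coordinate: \<open>weighted_parseval\<close> in the
  variable x_j becomes an instance of the general one.\<close>

lemma coordinates_line: "coordinates (lborel :: real measure) (UNIV :: unit set) (\<lambda>_ x. x)"
  by (rule coordinates.intro) (auto simp: UNIV_unit lborel.sigma_finite_measure_axioms)

text \<open>By \<open>weighted_parseval\<close> the form has the convolution kernel k(t - s), where
  k is the transform of \<open>w\<close>; a bound on |k| by \<open>A\<close> leaves the product of
  the L^1 norms.\<close>

lemma sesquilinear_line_bound:
  fixes a b w :: "real \<Rightarrow> complex"
  assumes a: "integrable lborel a" and b: "integrable lborel b" and w: "integrable lborel w"
    and A: "\<And>t. norm (\<integral>\<tau>. cis (t * \<tau>) * w \<tau> \<partial>lborel) \<le> A"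
  shows "norm (\<integral>\<tau>. (\<integral>t. cis (- (t * \<tau>)) * a t \<partial>lborel) * cnj (\<integral>t. cis (- (t * \<tau>)) * b t \<partial>lborel) * w \<tau> \<partial>lborel)
    \<le> A * ((\<integral>t. norm (a t) \<partial>lborel) * (\<integral>t. norm (b t) \<partial>lborel))"
proof -
  interpret line: coordinates "lborel :: real measure" "UNIV :: unit set" "\<lambda>_ x. x"
    by (rule coordinates_line)
  have p: "line.pairing t \<tau> = t * \<tau>" for t \<tau>
    by (simp add: line.pairing_def)
  have [measurable]: "a \<in> borel_measurable borel" "b \<in> borel_measurable borel" "w \<in> borel_measurable borel"
    using a b w by auto
  have i: "integrable (lborel \<Otimes>\<^sub>M lborel) (\<lambda>(s, t). complex_of_real (norm (a s)) * complex_of_real (norm (b t)))"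
    using a b by (intro integrable_times_pair lborel.sigma_finite_measure_axioms) auto
  have "norm (\<integral>\<tau>. (\<integral>t. cis (- (t * \<tau>)) * a t \<partial>lborel) * cnj (\<integral>t. cis (- (t * \<tau>)) * b t \<partial>lborel) * w \<tau> \<partial>lborel)
    = norm (\<integral>z. a (fst z) * cnj (b (snd z)) * (\<integral>\<tau>. cis ((snd z - fst z) * \<tau>) * w \<tau> \<partial>lborel) \<partial>(lborel \<Otimes>\<^sub>M lborel))"
    using line.weighted_parseval[OF a b w] by (simp add: line.ft_def p left_diff_distrib)
  also have "\<dots> \<le> (\<integral>z. A * (norm (a (fst z)) * norm (b (snd z))) \<partial>(lborel \<Otimes>\<^sub>M lborel))"
  proof (rule order_trans[OF integral_norm_bound], rule integral_mono_AE')
    have "integrable (lborel \<Otimes>\<^sub>M lborel) (\<lambda>z. Re ((\<lambda>(s, t). complex_of_real (norm (a s)) * complex_of_real (norm (b t))) z))"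
      using i by (rule integrable_Re)
    then show "integrable (lborel \<Otimes>\<^sub>M lborel) (\<lambda>z. A * (norm (a (fst z)) * norm (b (snd z))))"
      by (intro integrable_mult_right) (simp add: split_beta')
    show "AE z in lborel \<Otimes>\<^sub>M lborel. norm (a (fst z) * cnj (b (snd z)) * (\<integral>\<tau>. cis ((snd z - fst z) * \<tau>) * w \<tau> \<partial>lborel)) \<le> A * (norm (a (fst z)) * norm (b (snd z)))"
      by (auto simp: norm_mult mult.commute[of A] intro!: AE_I2 mult_left_mono A)
    have "0 \<le> A" using order_trans[OF norm_ge_zero A] .
    then show "AE z in lborel \<Otimes>\<^sub>M lborel. 0 \<le> A * (norm (a (fst z)) * norm (b (snd z)))" by simp
  qed
  also have "\<dots> = A * (\<integral>z. norm (a (fst z)) * norm (b (snd z)) \<partial>(lborel \<Otimes>\<^sub>M lborel))"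
    by simp
  also have "(\<integral>z. norm (a (fst z)) * norm (b (snd z)) \<partial>(lborel \<Otimes>\<^sub>M lborel))
     = (\<integral>t. norm (a t) \<partial>lborel) * (\<integral>t. norm (b t) \<partial>lborel)"
  proof -
    have "complex_of_real (\<integral>z. norm (a (fst z)) * norm (b (snd z)) \<partial>(lborel \<Otimes>\<^sub>M lborel))
      = (\<integral>z. (\<lambda>(s, t). complex_of_real (norm (a s)) * complex_of_real (norm (b t))) z \<partial>(lborel \<Otimes>\<^sub>M lborel))"
      unfolding integral_complex_of_real[symmetric] by (simp add: split_beta')
    also have "\<dots> = (\<integral>s. \<integral>t. complex_of_real (norm (a s)) * complex_of_real (norm (b t)) \<partial>lborel \<partial>lborel)"
      by (subst lborel_pair.integral_fst'[OF i, symmetric]) simp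
    also have "\<dots> = complex_of_real ((\<integral>t. norm (a t) \<partial>lborel) * (\<integral>t. norm (b t) \<partial>lborel))"
      by (simp add: integral_complex_of_real)
    finally show ?thesis by (simp only: of_real_eq_iff)
  qed
  finally show ?thesis .
qed

text \<open>The inverse transform of the symbol in the variable \<tau> alone, in the principal value
  sense, bounded uniformly in position and in the other frequencies. The symmetric truncation admits
  symbols that decay only like 1/\<tau>; the threshold \<open>M0\<close> is free because only the
  limit of large M is taken.\<close>

definition kernel_bounded :: "'n \<Rightarrow> real \<Rightarrow> (real ^ 'n::finite \<Rightarrow> complex) \<Rightarrow> bool" where
  "kernel_bounded j A m \<longleftrightarrow> (\<exists>M0. \<forall>M\<ge>M0. \<forall>\<eta> t.
     norm (\<integral>\<tau>. cis (t * \<tau>) * (indicator {-M..M} \<tau> * m (join_coord j \<tau> \<eta>)) \<partial>lborel) \<le> A)"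

text \<open>For fixed \<eta> the bound on the line gives A times the L^1 norms in x_j of the two
  partial transforms. Integrating in \<eta> for fixed t and s, Cauchy-Schwarz and Bessel's
  inequality produce the slice norms, and the integrals over t and s produce the mixed
  norms.\<close>

lemma sesquilinear_mixed_bound:
  fixes f g m :: "real ^ 'n::finite \<Rightarrow> complex"
  assumes f: "bounded_support f" and g: "bounded_support g"
    and [measurable]: "m \<in> borel_measurable borel" and B: "\<And>\<xi>. norm (m \<xi>) \<le> B"
    and A: "kernel_bounded j A m"
  shows "ennreal (norm (\<integral>\<xi>. fourier f \<xi> * cnj (fourier g \<xi>) * m \<xi> \<partial>lborel))
    \<le> ennreal (A * (2 * pi) ^ (CARD('n) - 1)) * (mixed_norm 1 2 j f * mixed_norm 1 2 j g)"
proof -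
  note df = bounded_support_dominated[OF f] and dg = bounded_support_dominated[OF g]
  have [measurable]: "f \<in> borel_measurable borel" "g \<in> borel_measurable borel"
    using df dg by (auto simp: dominated_def)
  obtain M0 where M0: "\<And>M \<eta> t. M0 \<le> M \<Longrightarrow> norm (\<integral>\<tau>. cis (t * \<tau>) * (indicator {-M..M} \<tau> * m (join_coord j \<tau> \<eta>)) \<partial>lborel) \<le> A"
    using A unfolding kernel_bounded_def by blast
  have A0: "0 \<le> A" using order_trans[OF norm_ge_zero M0[OF order_refl]] .
  define R where "R \<xi> = fourier f \<xi> * cnj (fourier g \<xi>) * m \<xi>" for \<xi>
  have cnj_L2: "(\<lambda>x. cnj (h x)) \<in> L2 M" if "h \<in> L2 M" for h and M :: "(real ^ 'n) measure"
    using that by (auto simp: L2_def L2_sq_def)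
  have fg: "integrable lborel (\<lambda>\<xi>. fourier f \<xi> * cnj (fourier g \<xi>))"
    by (intro L2_mult_integrable cnj_L2 fourier_L2 bounded_support_integrable bounded_support_L2 f g)
  have R: "integrable lborel R"
  proof (rule Bochner_Integration.integrable_bound)
    show "integrable lborel (\<lambda>\<xi>. B * norm (fourier f \<xi> * cnj (fourier g \<xi>)))"
      using fg by (intro integrable_mult_right integrable_norm)
    show "AE \<xi> in lborel. norm (R \<xi>) \<le> norm (B * norm (fourier f \<xi> * cnj (fourier g \<xi>)))"
      using B order_trans[OF norm_ge_zero B]
      by (auto simp: R_def norm_mult mult.commute[of B] intro!: AE_I2 mult_left_mono)
  qed (simp add: R_def[abs_def])
  define c where "c = (2 * pi) ^ (CARD('n) - 1)"
  have c: "0 \<le> c" by (simp add: c_def)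
  have bd: "ennreal (norm (\<integral>\<xi>. indicator {-M..M} (\<xi> $ j) * R \<xi> \<partial>lborel))
      \<le> ennreal (A * c) * (mixed_norm 1 2 j f * mixed_norm 1 2 j g)" if M: "M0 \<le> M" for M
  proof -
    define RM where "RM \<xi> = indicator {-M..M} (\<xi> $ j) * R \<xi>" for \<xi>
    have RM: "integrable lborel RM"
      by (rule Bochner_Integration.integrable_bound[OF R]) (auto simp: RM_def[abs_def] indicator_def R_def)
    have line: "norm (\<integral>\<tau>. RM (join_coord j \<tau> \<eta>) \<partial>lborel)
       \<le> A * ((\<integral>t. norm (partial_ft j f t \<eta>) \<partial>lborel) * (\<integral>t. norm (partial_ft j g t \<eta>) \<partial>lborel))"
      if \<eta>: "\<eta> \<in> space (hat_measure j)" for \<eta>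
    proof -
      define w where "w \<tau> = indicator {-M..M} \<tau> * m (join_coord j \<tau> \<eta>)" for \<tau> :: real
      have mj: "(\<lambda>\<tau>. m (join_coord j \<tau> \<eta>)) \<in> borel_measurable borel"
        by (rule measurable_compose[OF join_line_measurable]) simp
      have wm: "w \<in> borel_measurable borel"
        unfolding w_def by (rule borel_measurable_times[OF borel_measurable_indicator mj]) simp
      have "integrable lborel (\<lambda>\<tau>. B * indicator {-M..M} \<tau> :: real)"
        by (intro integrable_mult_right integrable_real_indicator) (auto simp: emeasure_lborel_Icc_eq)
      then have w: "integrable lborel w"
      proof (rule Bochner_Integration.integrable_bound)
        show "AE \<tau> in lborel. norm (w \<tau>) \<le> norm (B * indicator {-M..M} \<tau> :: real)"
          using B order_trans[OF norm_ge_zero B] by (intro AE_I2) (simp add: w_def indicator_def)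
      qed (simp add: wm)
      have "RM (join_coord j \<tau> \<eta>) = (\<integral>t. cis (- (t * \<tau>)) * partial_ft j f t \<eta> \<partial>lborel) *
          cnj (\<integral>t. cis (- (t * \<tau>)) * partial_ft j g t \<eta> \<partial>lborel) * w \<tau>" for \<tau>
        unfolding RM_def R_def w_def fourier_join[OF df] fourier_join[OF dg]
        by (simp add: join_coord_def[of j \<tau> \<eta>, THEN arg_cong[where f="\<lambda>v. v $ j"]] mult_ac)
      then show ?thesis
        using sesquilinear_line_bound[OF partial_ft_integrable[OF df \<eta>] partial_ft_integrable[OF dg \<eta>] w, of A] M0[OF M]
        by (simp add: w_def)
    qed
    have "ennreal (norm (\<integral>\<xi>. RM \<xi> \<partial>lborel)) \<le> (\<integral>\<^sup>+\<eta>. ennreal (norm (\<integral>\<tau>. RM (join_coord j \<tau> \<eta>) \<partial>lborel)) \<partial>hat_measure j)"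
      unfolding integral_join(3)[OF RM, of j]
      by (rule integral_norm_bound_ennreal) (rule hat_pair.integrable_snd[OF integral_join(1)[OF RM]])
    also have "\<dots> \<le> (\<integral>\<^sup>+\<eta>. ennreal A * ((\<integral>\<^sup>+t. ennreal (norm (partial_ft j f t \<eta>)) \<partial>lborel) *
        (\<integral>\<^sup>+s. ennreal (norm (partial_ft j g s \<eta>)) \<partial>lborel)) \<partial>hat_measure j)"
    proof (rule nn_integral_mono)
      fix \<eta> assume \<eta>: "\<eta> \<in> space (hat_measure j)"
      have e: "(\<integral>\<^sup>+t. ennreal (norm (partial_ft j h t \<eta>)) \<partial>lborel) = ennreal (\<integral>t. norm (partial_ft j h t \<eta>) \<partial>lborel)"
        if "dominated h" for h
        using partial_ft_integrable[OF that \<eta>] by (intro nn_integral_eq_integral) auto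
      show "ennreal (norm (\<integral>\<tau>. RM (join_coord j \<tau> \<eta>) \<partial>lborel)) \<le> ennreal A *
        ((\<integral>\<^sup>+t. ennreal (norm (partial_ft j f t \<eta>)) \<partial>lborel) * (\<integral>\<^sup>+s. ennreal (norm (partial_ft j g s \<eta>)) \<partial>lborel))"
        unfolding e[OF df] e[OF dg] using line[OF \<eta>] A0
        by (simp add: ennreal_leI flip: ennreal_mult)
    qed
    also have "\<dots> = (\<integral>\<^sup>+\<eta>. ennreal A * (\<integral>\<^sup>+t. \<integral>\<^sup>+s. ennreal (norm (partial_ft j f t \<eta>)) *
        ennreal (norm (partial_ft j g s \<eta>)) \<partial>lborel \<partial>lborel) \<partial>hat_measure j)"
    proof (rule nn_integral_cong)
      fix \<eta> assume \<eta>: "\<eta> \<in> space (hat_measure j)"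
      have pm: "(\<lambda>t. ennreal (norm (partial_ft j h t \<eta>))) \<in> borel_measurable lborel" if "dominated h" for h
        using borel_measurable_integrable[OF partial_ft_integrable[OF that \<eta>]] by simp
      show "ennreal A * ((\<integral>\<^sup>+t. ennreal (norm (partial_ft j f t \<eta>)) \<partial>lborel) *
          (\<integral>\<^sup>+s. ennreal (norm (partial_ft j g s \<eta>)) \<partial>lborel))
        = ennreal A * (\<integral>\<^sup>+t. \<integral>\<^sup>+s. ennreal (norm (partial_ft j f t \<eta>)) * ennreal (norm (partial_ft j g s \<eta>)) \<partial>lborel \<partial>lborel)"
        unfolding nn_integral_cmult[OF pm[OF dg]] nn_integral_multc[OF pm[OF df]] ..
    qed
    also have "\<dots> = ennreal A * (\<integral>\<^sup>+\<eta>. \<integral>\<^sup>+t. \<integral>\<^sup>+s. ennreal (norm (partial_ft j f t \<eta>)) *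
        ennreal (norm (partial_ft j g s \<eta>)) \<partial>lborel \<partial>lborel \<partial>hat_measure j)"
      by (rule nn_integral_cmult) measurable
    \<comment> \<open>The integral over \<eta> has to become the innermost one, so that
      Cauchy-Schwarz applies to a single pair of slices.\<close>
    also have "(\<integral>\<^sup>+\<eta>. \<integral>\<^sup>+t. \<integral>\<^sup>+s. ennreal (norm (partial_ft j f t \<eta>)) * ennreal (norm (partial_ft j g s \<eta>)) \<partial>lborel \<partial>lborel \<partial>hat_measure j)
       = (\<integral>\<^sup>+t. \<integral>\<^sup>+\<eta>. \<integral>\<^sup>+s. ennreal (norm (partial_ft j f t \<eta>)) * ennreal (norm (partial_ft j g s \<eta>)) \<partial>lborel \<partial>hat_measure j \<partial>lborel)"
      by (rule hat_pair.Fubini') measurable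
    also have "\<dots> = (\<integral>\<^sup>+t. \<integral>\<^sup>+s. \<integral>\<^sup>+\<eta>. ennreal (norm (partial_ft j f t \<eta>)) * ennreal (norm (partial_ft j g s \<eta>)) \<partial>hat_measure j \<partial>lborel \<partial>lborel)"
      by (intro nn_integral_cong hat_pair.Fubini') measurable
    also have "\<dots> \<le> (\<integral>\<^sup>+t. \<integral>\<^sup>+s. (ennreal c * slice_norm j f t) * slice_norm j g s \<partial>lborel \<partial>lborel)"
    proof (intro nn_integral_mono)
      fix t s
      have "(\<integral>\<^sup>+\<eta>. ennreal (norm (partial_ft j f t \<eta>)) * ennreal (norm (partial_ft j g s \<eta>)) \<partial>hat_measure j)
        \<le> esqrt (L2_sq (hat_measure j) (partial_ft j f t)) * esqrt (L2_sq (hat_measure j) (partial_ft j g s))"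
        by (rule nn_Cauchy_Schwarz_esqrt) measurable
      also have "\<dots> \<le> esqrt (ennreal c * L2_sq (hat_measure j) (\<lambda>y. f (join_coord j t y)))
          * esqrt (ennreal c * L2_sq (hat_measure j) (\<lambda>y. g (join_coord j s y)))"
        unfolding c_def by (intro mult_mono esqrt_mono L2_sq_partial_ft_le df dg) auto
      also have "\<dots> = (esqrt (ennreal c))\<^sup>2 * slice_norm j f t * slice_norm j g s"
        unfolding esqrt_mult slice_norm_def by (simp add: power2_eq_square mult_ac)
      finally show "(\<integral>\<^sup>+\<eta>. ennreal (norm (partial_ft j f t \<eta>)) * ennreal (norm (partial_ft j g s \<eta>)) \<partial>hat_measure j)
        \<le> (ennreal c * slice_norm j f t) * slice_norm j g s"
        unfolding esqrt_square .
    qed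
    also have "\<dots> = ennreal c * (mixed_norm 1 2 j f * mixed_norm 1 2 j g)"
      unfolding mixed_norm_12 by (simp add: nn_integral_cmult nn_integral_multc mult.assoc)
    finally have "ennreal (norm (\<integral>\<xi>. RM \<xi> \<partial>lborel)) \<le> ennreal A * (ennreal c * (mixed_norm 1 2 j f * mixed_norm 1 2 j g))"
      by (simp add: mult_left_mono)
    then show ?thesis
      using A0 c by (simp add: RM_def ennreal_mult mult.assoc)
  qed
  \<comment> \<open>The bound for the truncated symbol does not depend on M, and the full integrand
    is integrable because \<open>m\<close> is bounded; so the truncation can be let go.\<close>
  have "(\<lambda>k. \<integral>\<xi>. indicator {- real k..real k} (\<xi> $ j) * R \<xi> \<partial>lborel) \<longlonglongrightarrow> (\<integral>\<xi>. R \<xi> \<partial>lborel)"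
  proof (rule integral_dominated_convergence[where w="\<lambda>\<xi>. norm (R \<xi>)"])
    show "AE \<xi> in lborel. (\<lambda>k. indicator {- real k..real k} (\<xi> $ j) * R \<xi>) \<longlonglongrightarrow> R \<xi>"
    proof (rule AE_I2)
      fix \<xi> :: "real ^ 'n"
      obtain N where N: "\<bar>\<xi> $ j\<bar> \<le> real N" using real_arch_simple by blast
      have "eventually (\<lambda>k. indicator {- real k..real k} (\<xi> $ j) * R \<xi> = R \<xi>) sequentially"
        unfolding eventually_sequentially by (rule exI[of _ N]) (use N in \<open>auto simp: indicator_def\<close>)
      then show "(\<lambda>k. indicator {- real k..real k} (\<xi> $ j) * R \<xi>) \<longlonglongrightarrow> R \<xi>"
        by (rule tendsto_eventually)
    qed
  qed (use R in \<open>auto simp: indicator_def intro!: AE_I2\<close>)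
  then have "(\<lambda>k. ennreal (norm (\<integral>\<xi>. indicator {- real k..real k} (\<xi> $ j) * R \<xi> \<partial>lborel))) \<longlonglongrightarrow> ennreal (norm (\<integral>\<xi>. R \<xi> \<partial>lborel))"
    by (intro tendsto_ennrealI tendsto_norm)
  then show ?thesis
    unfolding c_def[symmetric] R_def[symmetric]
  proof (rule LIMSEQ_le_const2)
    obtain N where N: "M0 \<le> real N" using real_arch_simple by blast
    show "\<exists>N. \<forall>k\<ge>N. ennreal (norm (\<integral>\<xi>. indicator {- real k..real k} (\<xi> $ j) * R \<xi> \<partial>lborel))
        \<le> ennreal (A * c) * (mixed_norm 1 2 j f * mixed_norm 1 2 j g)"
      by (rule exI[of _ N]) (use N in \<open>auto intro!: bd\<close>)
  qed
qed

lemma esqrt_of_square: "esqrt (a\<^sup>2) = a"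
  by (rule antisym) (simp_all add: esqrt_le_iff le_esqrt_iff)

lemma esqrt_0: "esqrt 0 = 0"
  by (simp add: enn_powr_def)

lemma mixed_pairing_le:
  fixes f g :: "real ^ 'n::finite \<Rightarrow> complex"
  assumes [measurable]: "f \<in> borel_measurable borel" "g \<in> borel_measurable borel"
    and K: "\<And>t. L2_sq (hat_measure j) (\<lambda>y. g (join_coord j t y)) \<le> K"
  shows "(\<integral>\<^sup>+x. ennreal (norm (f x * g x)) \<partial>lborel) \<le> mixed_norm 1 2 j f * esqrt K"
proof -
  have "(\<integral>\<^sup>+x. ennreal (norm (f x * g x)) \<partial>lborel)
    = (\<integral>\<^sup>+t. \<integral>\<^sup>+y. ennreal (norm (f (join_coord j t y))) * ennreal (norm (g (join_coord j t y))) \<partial>hat_measure j \<partial>lborel)"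
    by (subst nn_integral_join(1)[of _ j]) (simp_all add: norm_mult ennreal_mult)
  also have "\<dots> \<le> (\<integral>\<^sup>+t. slice_norm j f t * esqrt K \<partial>lborel)"
  proof (rule nn_integral_mono)
    fix t
    have "(\<integral>\<^sup>+y. ennreal (norm (f (join_coord j t y))) * ennreal (norm (g (join_coord j t y))) \<partial>hat_measure j)
      \<le> esqrt (L2_sq (hat_measure j) (\<lambda>y. f (join_coord j t y))) * esqrt (L2_sq (hat_measure j) (\<lambda>y. g (join_coord j t y)))"
      by (rule nn_Cauchy_Schwarz_esqrt) measurable
    also have "\<dots> \<le> slice_norm j f t * esqrt K"
      unfolding slice_norm_def by (intro mult_left_mono esqrt_mono K) simp
    finally show "(\<integral>\<^sup>+y. ennreal (norm (f (join_coord j t y))) * ennreal (norm (g (join_coord j t y))) \<partial>hat_measure j)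
      \<le> slice_norm j f t * esqrt K" .
  qed
  also have "\<dots> = mixed_norm 1 2 j f * esqrt K"
    unfolding mixed_norm_12 by (rule nn_integral_multc) (simp add: slice_norm_measurable)
  finally show ?thesis .
qed

lemma dominated_slice_bound:
  fixes f :: "real ^ 'n::finite \<Rightarrow> complex"
  assumes "dominated f"
  obtains K where "0 \<le> K" "\<And>t. L2_sq (hat_measure j) (\<lambda>y. f (join_coord j t y)) \<le> ennreal K"
proof (rule dominatedE[OF assms])
  fix C assume C: "f \<in> borel_measurable borel" "0 \<le> C" "\<And>j t y. norm (f (join_coord j t y)) \<le> C * hat_weight j y"
  note [measurable] = C(1)
  have "L2_sq (hat_measure j) (\<lambda>y. f (join_coord j t y)) \<le> ennreal (C\<^sup>2 * hat_mass j)" for t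
    by (rule hat_weight_dominated(3)[OF _ C(3) C(2)]) measurable
  then show thesis
    by (rule that[rotated]) (simp add: hat_mass_nonneg)
qed

text \<open>Integrating out x_j first leaves a function of the other variables that is bounded by
  their weight uniformly in \<tau>, and Bessel's inequality transforms it. This is what makes f
  times the transform of a Schwartz function integrable for f in L^1L^2.\<close>

lemma dominated_fourier_slice_bound:
  fixes f :: "real ^ 'n::finite \<Rightarrow> complex"
  assumes f: "dominated f"
  obtains K where "0 \<le> K" "\<And>\<tau>. L2_sq (hat_measure j) (\<lambda>\<eta>. fourier f (join_coord j \<tau> \<eta>)) \<le> ennreal K"
proof (rule dominatedE[OF f])
  fix C assume C: "f \<in> borel_measurable borel" "0 \<le> C"
    "\<And>j t y. norm (f (join_coord j t y)) \<le> (C * inverse (1 + t\<^sup>2)) * hat_weight j y"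
  note [measurable] = C(1)
  define c where "c = (2 * pi) ^ (CARD('n) - 1)"
  have "L2_sq (hat_measure j) (\<lambda>\<eta>. fourier f (join_coord j \<tau> \<eta>)) \<le> ennreal (c * ((C * pi)\<^sup>2 * hat_mass j))" for \<tau>
  proof -
    define \<psi> where "\<psi> y = (\<integral>t. cis (- (t * \<tau>)) * f (join_coord j t y) \<partial>lborel)" for y
    have m\<psi>: "\<psi> \<in> borel_measurable (hat_measure j)"
      unfolding \<psi>_def by (rule lborel.borel_measurable_lebesgue_integral) measurable
    have \<psi>_le: "norm (\<psi> y) \<le> (C * pi) * hat_weight j y" for y
    proof -
      have "norm (\<psi> y) \<le> (\<integral>t. (C * hat_weight j y) * inverse (1 + t\<^sup>2) \<partial>lborel)"
        unfolding \<psi>_def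
      proof (rule order_trans[OF integral_norm_bound], rule integral_mono_AE')
        show "integrable lborel (\<lambda>t. (C * hat_weight j y) * inverse (1 + t\<^sup>2))"
          by (intro integrable_mult_right integrable_inverse_1_plus_square')
        show "AE t in lborel. norm (cis (- (t * \<tau>)) * f (join_coord j t y)) \<le> (C * hat_weight j y) * inverse (1 + t\<^sup>2)"
          using C(3)[of j _ y] by (intro AE_I2) (simp add: norm_mult mult_ac)
        show "AE t in lborel. 0 \<le> (C * hat_weight j y) * inverse (1 + t\<^sup>2)"
          using C(2) hat_weight_bounds[of j y] inverse_1_plus_square_bounds
          by (intro AE_I2 mult_nonneg_nonneg) (auto intro: less_imp_le)
      qed
      then show ?thesis by (simp add: integrable_inverse_1_plus_square' mult_ac)
    qed
    have "0 \<le> C * pi" using C(2) by simp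
    note dom = hat_weight_dominated[OF m\<psi> \<psi>_le this]
    have eq: "fourier f (join_coord j \<tau> \<eta>) = hat.ft j \<psi> \<eta>" for \<eta>
    proof -
      have i: "integrable lborel (\<lambda>x. cis (- (x \<bullet> join_coord j \<tau> \<eta>)) * f x)"
        using vec.ft_integrand_integrable[OF dominated_integrable[OF f], of "join_coord j \<tau> \<eta>"] by (simp add: vec_pairing_eq)
      have "fourier f (join_coord j \<tau> \<eta>) = (\<integral>y. \<integral>t. cis (- (join_coord j t y \<bullet> join_coord j \<tau> \<eta>)) * f (join_coord j t y) \<partial>lborel \<partial>hat_measure j)"
        unfolding fourier_eq_ft vec.ft_def vec_pairing_eq by (rule integral_join(3)[OF i])
      also have "\<dots> = (\<integral>y. \<integral>t. cis (- hat.pairing j y \<eta>) * (cis (- (t * \<tau>)) * f (join_coord j t y)) \<partial>lborel \<partial>hat_measure j)"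
      proof -
        have "cis (- (join_coord j t y \<bullet> join_coord j \<tau> \<eta>)) = cis (- hat.pairing j y \<eta>) * cis (- (t * \<tau>))" for t y
          by (simp add: inner_join cis_mult algebra_simps)
        then show ?thesis by (simp only: mult.assoc)
      qed
      also have "\<dots> = hat.ft j \<psi> \<eta>"
        by (simp add: hat.ft_def \<psi>_def)
      finally show ?thesis .
    qed
    have "L2_sq (hat_measure j) (hat.ft j \<psi>) \<le> ennreal c * L2_sq (hat_measure j) \<psi>"
      using hat.bessel[OF dom(1,2)] unfolding c_def by (simp only: card_Diff_singleton[OF UNIV_I])
    also have "\<dots> \<le> ennreal c * ennreal ((C * pi)\<^sup>2 * hat_mass j)"
      by (intro mult_left_mono dom(3)) simp
    also have "\<dots> = ennreal (c * ((C * pi)\<^sup>2 * hat_mass j))"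
      by (rule ennreal_mult[symmetric]) (auto simp: c_def hat_mass_nonneg)
    finally show ?thesis by (simp add: eq)
  qed
  then show thesis
    by (rule that[rotated]) (simp add: hat_mass_nonneg c_def)
qed

lemma mixed_space_pairing_integrable:
  assumes f: "f \<in> mixed_space 1 2 j" and [measurable]: "g \<in> borel_measurable borel"
    and K: "\<And>t. L2_sq (hat_measure j) (\<lambda>y. g (join_coord j t y)) \<le> ennreal K" "0 \<le> K"
  shows "integrable lborel (\<lambda>x. f x * g x)"
proof -
  have [measurable]: "f \<in> borel_measurable borel" using f by (simp add: mixed_space_def)
  have "(\<integral>\<^sup>+x. ennreal (norm (f x * g x)) \<partial>lborel) \<le> mixed_norm 1 2 j f * esqrt (ennreal K)"
    by (rule mixed_pairing_le[OF _ _ K(1)]) measurable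
  also have "\<dots> < \<infinity>"
    using f K(2) by (simp add: mixed_space_def ennreal_mult_less_top esqrt_ennreal)
  finally show ?thesis by (simp add: integrable_iff_bounded)
qed

lemma mixed_space_tempered:
  assumes f: "f \<in> mixed_space 1 2 j"
  shows "tempered_fun f"
  unfolding tempered_fun_def
proof (intro conjI ballI)
  show "f \<in> borel_measurable lborel" using f by (simp add: mixed_space_def)
  fix \<phi> :: "real ^ 'a \<Rightarrow> complex" assume "\<phi> \<in> schwartz"
  then have d: "dominated \<phi>" using schwartz_rapid[of \<phi> "[]"] by (simp add: rapid_dominated)
  obtain K where K: "0 \<le> K" "\<And>t. L2_sq (hat_measure j) (\<lambda>y. \<phi> (join_coord j t y)) \<le> ennreal K"
    by (rule dominated_slice_bound[OF d, of j]) (rule that)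
  show "integrable lborel (\<lambda>x. f x * \<phi> x)"
    by (rule mixed_space_pairing_integrable[OF f _ K(2) K(1)]) (use d in \<open>simp add: dominated_def\<close>)
qed

section \<open>The Fourier transform on the mixed space\<close>

lemma mixed_trunc_tendsto:
  fixes f :: "real ^ 'n::finite \<Rightarrow> complex"
  assumes f: "f \<in> mixed_space 1 2 j"
  shows "(\<lambda>N. mixed_norm 1 2 j (\<lambda>x. trunc N f x - f x)) \<longlonglongrightarrow> 0"
proof -
  have [measurable, simp]: "f \<in> borel_measurable borel" using f by (simp add: mixed_space_def)
  have fin: "(\<integral>\<^sup>+t. slice_norm j f t \<partial>lborel) < \<infinity>"
    using f by (simp add: mixed_space_def mixed_norm_12)
  have le: "norm (trunc N f x - f x) \<le> norm (f x)" for N x by (simp add: trunc_def)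
  have "(\<lambda>N. mixed_norm 1 2 j (\<lambda>x. trunc N f x - f x)) \<longlonglongrightarrow> (\<integral>\<^sup>+t. 0 \<partial>(lborel :: real measure))"
    unfolding mixed_norm_12
  proof (rule nn_integral_dominated_convergence[where w="slice_norm j f"])
    show "AE t in lborel. slice_norm j (\<lambda>x. trunc N f x - f x) t \<le> slice_norm j f t" for N
      by (intro AE_I2 slice_norm_mono le)
    have "AE t in lborel. slice_norm j f t \<noteq> \<infinity>"
      using fin by (intro nn_integral_PInf_AE) auto
    then show "AE t in lborel. (\<lambda>N. slice_norm j (\<lambda>x. trunc N f x - f x) t) \<longlonglongrightarrow> 0"
    proof eventually_elim
      fix t assume "slice_norm j f t \<noteq> \<infinity>"
      then have sf: "L2_sq (hat_measure j) (\<lambda>y. f (join_coord j t y)) < \<infinity>"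
        by (simp add: slice_norm_def less_top esqrt_finite_iff)
      have "(\<lambda>N. L2_sq (hat_measure j) (\<lambda>y. trunc N f (join_coord j t y) - f (join_coord j t y))) \<longlonglongrightarrow> (\<integral>\<^sup>+y. 0 \<partial>hat_measure j)"
        unfolding L2_sq_def
      proof (rule nn_integral_dominated_convergence[where w="\<lambda>y. (ennreal (norm (f (join_coord j t y))))\<^sup>2"])
        show "(\<integral>\<^sup>+y. (ennreal (norm (f (join_coord j t y))))\<^sup>2 \<partial>hat_measure j) < \<infinity>"
          using sf by (simp add: L2_sq_def)
        show "AE y in hat_measure j. (ennreal (norm (trunc N f (join_coord j t y) - f (join_coord j t y))))\<^sup>2
            \<le> (ennreal (norm (f (join_coord j t y))))\<^sup>2" for N
          by (intro AE_I2 power_mono ennreal_leI le) simp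
        show "AE y in hat_measure j. (\<lambda>N. (ennreal (norm (trunc N f (join_coord j t y) - f (join_coord j t y))))\<^sup>2) \<longlonglongrightarrow> 0"
        proof (rule AE_I2)
          fix y
          have "eventually (\<lambda>N. (ennreal (norm (trunc N f (join_coord j t y) - f (join_coord j t y))))\<^sup>2 = 0) sequentially"
            using eventually_trunc_eq[of f "join_coord j t y"] by eventually_elim simp
          then show "(\<lambda>N. (ennreal (norm (trunc N f (join_coord j t y) - f (join_coord j t y))))\<^sup>2) \<longlonglongrightarrow> 0"
            by (rule tendsto_eventually)
        qed
      qed measurable
      then have "(\<lambda>N. L2_sq (hat_measure j) (\<lambda>y. trunc N f (join_coord j t y) - f (join_coord j t y))) \<longlonglongrightarrow> 0"
        by simp
      then show "(\<lambda>N. slice_norm j (\<lambda>x. trunc N f x - f x) t) \<longlonglongrightarrow> 0"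
        unfolding slice_norm_def by (rule esqrt_tendsto_0)
    qed
  qed (use fin in \<open>simp_all add: slice_norm_measurable borel_measurable_diff trunc_measurable\<close>)
  then show ?thesis by simp
qed

lemma one_plus_norm_pos: "0 < 1 + norm x"
  using norm_ge_zero[of x] by linarith

text \<open>The sesquilinear bound on the diagonal: the symbol is the square of the weight 1 / (1 +
  |\<xi>|), and on every line it is at most 1 / (1 + \<tau>^2), whose integral is \<pi>.\<close>

lemma weighted_fourier_le:
  fixes f :: "real ^ 'n::finite \<Rightarrow> complex"
  assumes f: "bounded_support f"
  shows "L2_sq lborel (\<lambda>\<xi>. fourier f \<xi> / complex_of_real (1 + norm \<xi>))
    \<le> ennreal (pi * (2 * pi) ^ (CARD('n) - 1)) * (mixed_norm 1 2 j f)\<^sup>2"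
proof -
  have [measurable]: "f \<in> borel_measurable borel" using f by (simp add: bounded_support_def)
  define m where "m \<xi> = complex_of_real (1 / (1 + norm \<xi>)\<^sup>2)" for \<xi> :: "real ^ 'n"
  have m1: "norm (m \<xi>) \<le> 1" for \<xi>
  proof -
    have *: "1 \<le> (1 + norm \<xi>)\<^sup>2" by (rule one_le_power) simp
    then have "0 < (1 + norm \<xi>)\<^sup>2" by linarith
    then have "1 / (1 + norm \<xi>)\<^sup>2 \<le> 1" using * by (simp only: divide_le_eq_1_pos)
    then show ?thesis unfolding m_def norm_of_real by simp
  qed
  have m_le: "norm (m (join_coord j \<tau> \<eta>)) \<le> inverse (1 + \<tau>\<^sup>2)" for \<tau> \<eta>
  proof -
    have "1 + \<tau>\<^sup>2 \<le> (1 + \<bar>\<tau>\<bar>)\<^sup>2" by (simp add: power2_eq_square algebra_simps)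
    also have "\<dots> \<le> (1 + norm (join_coord j \<tau> \<eta>))\<^sup>2"
      by (intro power_mono) (auto simp: norm_join_ge)
    finally have "inverse ((1 + norm (join_coord j \<tau> \<eta>))\<^sup>2) \<le> inverse (1 + \<tau>\<^sup>2)"
      by (rule le_imp_inverse_le) (simp add: add_pos_nonneg)
    then show ?thesis unfolding m_def norm_of_real by (simp add: inverse_eq_divide)
  qed
  have kb: "kernel_bounded j pi m"
    unfolding kernel_bounded_def
  proof (intro exI[of _ 0] allI impI)
    fix M t :: real and \<eta>
    have "norm (\<integral>\<tau>. cis (t * \<tau>) * (indicator {- M..M} \<tau> * m (join_coord j \<tau> \<eta>)) \<partial>lborel) \<le> (\<integral>\<tau>. inverse (1 + \<tau>\<^sup>2) \<partial>lborel)"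
    proof (rule order_trans[OF integral_norm_bound], rule integral_mono_AE'[OF integrable_inverse_1_plus_square'(1)])
      show "AE \<tau> in lborel. norm (cis (t * \<tau>) * (indicator {- M..M} \<tau> * m (join_coord j \<tau> \<eta>))) \<le> inverse (1 + \<tau>\<^sup>2)"
        using m_le[of _ \<eta>] inverse_1_plus_square_bounds(1)
        by (intro AE_I2) (auto simp: norm_mult indicator_def less_imp_le)
      show "AE \<tau> in lborel. (0::real) \<le> inverse (1 + \<tau>\<^sup>2)"
        using inverse_1_plus_square_bounds(1) by (intro AE_I2) (auto simp: less_imp_le)
    qed
    then show "norm (\<integral>\<tau>. cis (t * \<tau>) * (indicator {- M..M} \<tau> * m (join_coord j \<tau> \<eta>)) \<partial>lborel) \<le> pi"
      by (simp only: integrable_inverse_1_plus_square'(2))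
  qed
  define h where "h \<xi> = fourier f \<xi> / complex_of_real (1 + norm \<xi>)" for \<xi>
  have [measurable]: "h \<in> borel_measurable borel" unfolding h_def by measurable
  have h2: "h \<in> L2 lborel"
  proof (rule L2_bound)
    show "fourier f \<in> L2 lborel"
      by (intro fourier_L2 bounded_support_integrable bounded_support_L2 f)
    show "norm (h \<xi>) \<le> norm (fourier f \<xi>)" for \<xi>
      unfolding h_def norm_divide norm_of_real using one_plus_norm_pos[of \<xi>]
      by (simp add: divide_le_eq mult_le_cancel_left1 mult_ge1_I)
  qed measurable
  have hh: "fourier f \<xi> * cnj (fourier f \<xi>) * m \<xi> = complex_of_real ((norm (h \<xi>))\<^sup>2)" for \<xi>
    unfolding h_def m_def norm_divide norm_of_real complex_norm_square[symmetric] of_real_mult[symmetric]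
    by (simp add: power_divide)
  have i: "integrable lborel (\<lambda>\<xi>. (norm (h \<xi>))\<^sup>2)" using h2 by (simp add: L2_iff_integrable)
  have "L2_sq lborel h = ennreal (\<integral>\<xi>. (norm (h \<xi>))\<^sup>2 \<partial>lborel)"
    unfolding L2_sq_def by (subst nn_integral_eq_integral[OF i, symmetric]) (auto simp: ennreal_power)
  also have "\<dots> = ennreal (norm (\<integral>\<xi>. fourier f \<xi> * cnj (fourier f \<xi>) * m \<xi> \<partial>lborel))"
    unfolding hh integral_complex_of_real norm_of_real by (simp add: integral_nonneg_AE)
  also have "\<dots> \<le> ennreal (pi * (2 * pi) ^ (CARD('n) - 1)) * (mixed_norm 1 2 j f * mixed_norm 1 2 j f)"
    by (rule sesquilinear_mixed_bound[OF f f _ m1 kb]) (simp add: m_def[abs_def])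
  finally show ?thesis unfolding h_def power2_eq_square .
qed

text \<open>The rate 4^(-k) becomes the 16^(-k) of \<open>L2_fast_Cauchy_limit\<close> after
  squaring, and the levels increase so that consecutive truncations can be compared.\<close>

lemma fast_mixed_truncations:
  fixes f :: "real ^ 'n::finite \<Rightarrow> complex"
  assumes f: "f \<in> mixed_space 1 2 j"
  obtains N :: "nat \<Rightarrow> nat" where "\<And>k. k \<le> N k" "\<And>k. N k \<le> N (Suc k)"
    "\<And>k. mixed_norm 1 2 j (\<lambda>x. trunc (N k) f x - f x) \<le> ennreal ((1/4) ^ k)"
proof -
  have "\<exists>K. \<forall>N\<ge>K. mixed_norm 1 2 j (\<lambda>x. trunc N f x - f x) < ennreal ((1/4) ^ k)" for k
    using order_tendstoD(2)[OF mixed_trunc_tendsto[OF f], of "ennreal ((1/4) ^ k)"]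
    by (simp add: eventually_sequentially)
  then obtain K where K: "\<And>k N. K k \<le> N \<Longrightarrow> mixed_norm 1 2 j (\<lambda>x. trunc N f x - f x) < ennreal ((1/4) ^ k)"
    by metis
  \<comment> \<open>The summand k makes the levels tend to infinity, and the partial sums make them
    increasing and at least \<open>K k\<close>.\<close>
  define N where "N k = k + (\<Sum>i\<le>k. K i)" for k
  show thesis
  proof (rule that[of N])
    have "K k \<le> N k" for k
      unfolding N_def by (rule trans_le_add2) (rule member_le_sum, auto)
    then show "mixed_norm 1 2 j (\<lambda>x. trunc (N k) f x - f x) \<le> ennreal ((1/4) ^ k)" for k
      using less_imp_le[OF K[of k "N k"]] by blast
  qed (simp_all add: N_def)
qed

text \<open>Consecutive truncations differ by a bounded function of bounded support, so
  \<open>weighted_fourier_le\<close> makes their weighted transforms a fast Cauchy sequence. The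
  multiplication formula passes to the limit by L^2 convergence on the frequency side and by
  dominated convergence on the other.\<close>

lemma fourier_mixed_space:
  fixes f :: "real ^ 'n::finite \<Rightarrow> complex"
  assumes f: "f \<in> mixed_space 1 2 j"
  obtains g N where "g \<in> borel_measurable borel" "has_fourier f g"
    "\<And>k. (\<lambda>\<xi>. fourier (trunc (N k) f) \<xi> / complex_of_real (1 + norm \<xi>)) \<in> L2 lborel"
    "(\<lambda>\<xi>. g \<xi> / complex_of_real (1 + norm \<xi>)) \<in> L2 lborel"
    "(\<lambda>k. L2_sq lborel (\<lambda>\<xi>. fourier (trunc (N k) f) \<xi> / complex_of_real (1 + norm \<xi>)
        - g \<xi> / complex_of_real (1 + norm \<xi>))) \<longlonglongrightarrow> 0"
proof -
  have [measurable]: "f \<in> borel_measurable borel" using f by (simp add: mixed_space_def)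
  obtain N where Nk: "\<And>k. k \<le> N k" and N_mono: "\<And>k. N k \<le> N (Suc k)"
    and N: "\<And>k. mixed_norm 1 2 j (\<lambda>x. trunc (N k) f x - f x) \<le> ennreal ((1/4) ^ k)"
    using fast_mixed_truncations[OF f] by blast
  define F where "F k = trunc (N k) f" for k
  have Fs: "bounded_support (F k)" for k unfolding F_def by (rule bounded_support_trunc) measurable
  have [measurable]: "F k \<in> borel_measurable borel" for k unfolding F_def by measurable
  define h where "h k \<xi> = fourier (F k) \<xi> / complex_of_real (1 + norm \<xi>)" for k \<xi>
  define c where "c = pi * (2 * pi) ^ (CARD('n) - 1)"
  have c: "0 \<le> c" by (simp add: c_def)
  have h2: "h k \<in> L2 lborel" for k
  proof (rule L2_bound)
    show "fourier (F k) \<in> L2 lborel"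
      by (intro fourier_L2 bounded_support_integrable bounded_support_L2 Fs)
    show "norm (h k \<xi>) \<le> norm (fourier (F k) \<xi>)" for \<xi>
      unfolding h_def norm_divide norm_of_real using one_plus_norm_pos[of \<xi>]
      by (simp add: divide_le_eq) (simp add: distrib_left)
  qed (simp add: h_def[abs_def])
  have fast: "L2_sq lborel (\<lambda>\<xi>. h (Suc k) \<xi> - h k \<xi>) \<le> ennreal (c * (1/16) ^ k)" for k
  proof -
    define D where "D = (\<lambda>x. F (Suc k) x - F k x)"
    have Ds: "bounded_support D"
      unfolding bounded_support_def
    proof (intro conjI exI[of _ "2 * real (N (Suc k))"] allI impI)
      show "D \<in> borel_measurable borel" unfolding D_def by measurable
      fix x
      show "norm (D x) \<le> 2 * real (N (Suc k))"
        using N_mono[of k] by (auto simp: D_def F_def trunc_def)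
      show "D x = 0" if "2 * real (N (Suc k)) < norm x"
        using that N_mono[of k] by (auto simp: D_def F_def trunc_def)
    qed
    \<comment> \<open>Truncation at the higher level only restores values of f that the lower level
      had replaced by 0, so the difference is dominated by what the lower level removed.\<close>
    have "mixed_norm 1 2 j D \<le> mixed_norm 1 2 j (\<lambda>x. trunc (N k) f x - f x)"
      using N_mono[of k] by (intro mixed_norm_12_mono) (auto simp: D_def F_def trunc_def)
    also have "\<dots> \<le> ennreal ((1/4) ^ k)" by (rule N)
    finally have "(mixed_norm 1 2 j D)\<^sup>2 \<le> (ennreal ((1/4) ^ k))\<^sup>2" by (rule power_mono) simp
    also have "\<dots> = ennreal ((1/16) ^ k)"
    proof -
      have "((1/4) ^ k)\<^sup>2 = ((1/16) ^ k :: real)"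
        by (simp add: power2_eq_square flip: power_mult_distrib)
      then show ?thesis by (subst ennreal_power) simp_all
    qed
    finally have D: "(mixed_norm 1 2 j D)\<^sup>2 \<le> ennreal ((1/16) ^ k)" .
    have "L2_sq lborel (\<lambda>\<xi>. h (Suc k) \<xi> - h k \<xi>) = L2_sq lborel (\<lambda>\<xi>. fourier D \<xi> / complex_of_real (1 + norm \<xi>))"
      unfolding h_def D_def by (simp only: fourier_diff[OF bounded_support_integrable[OF Fs] bounded_support_integrable[OF Fs]] diff_divide_distrib)
    also have "\<dots> \<le> ennreal c * (mixed_norm 1 2 j D)\<^sup>2"
      unfolding c_def by (rule weighted_fourier_le[OF Ds])
    also have "\<dots> \<le> ennreal c * ennreal ((1/16) ^ k)"
      by (rule mult_left_mono[OF D]) simp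
    also have "\<dots> = ennreal (c * (1/16) ^ k)"
      using c by (subst ennreal_mult) auto
    finally show ?thesis .
  qed
  obtain H where H: "H \<in> L2 lborel" and H_lim: "(\<lambda>k. L2_sq lborel (\<lambda>\<xi>. h k \<xi> - H \<xi>)) \<longlonglongrightarrow> 0"
    by (rule L2_fast_Cauchy_limit[OF h2 fast c]) (rule that)
  have [measurable]: "H \<in> borel_measurable borel" using H by (simp add: L2_def)
  define g where "g \<xi> = complex_of_real (1 + norm \<xi>) * H \<xi>" for \<xi>
  have [measurable]: "g \<in> borel_measurable borel" unfolding g_def by measurable
  have nz: "complex_of_real (1 + norm \<xi>) \<noteq> 0" for \<xi> :: "real ^ 'n"
    unfolding of_real_eq_0_iff using one_plus_norm_pos[of \<xi>] by simp
  have gH: "g \<xi> / complex_of_real (1 + norm \<xi>) = H \<xi>" for \<xi>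
    unfolding g_def by (rule nonzero_mult_div_cancel_left[OF nz])
  have gw: "(\<lambda>\<xi>. g \<xi> / complex_of_real (1 + norm \<xi>)) \<in> L2 lborel"
    unfolding gH by (rule H)
  have cancel: "a / b * (b * d) = a * d" if "b \<noteq> 0" for a b d :: complex
    using that by simp
  have "has_fourier f g"
    unfolding has_fourier_def
  proof (intro conjI ballI)
    show "tempered_fun f" by (rule mixed_space_tempered[OF f])
    show "tempered_fun g" by (rule tempered_fun_weighted_L2[OF _ gw]) measurable
    fix \<phi> :: "real ^ 'n \<Rightarrow> complex" assume "\<phi> \<in> schwartz"
    then have r: "rapid \<phi>" using schwartz_rapid[of \<phi> "[]"] by simp
    have [measurable]: "\<phi> \<in> borel_measurable borel" by (rule rapid_measurable[OF r])
    note d = rapid_dominated[OF r]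
    obtain K where K: "0 \<le> K" "\<And>\<tau>. L2_sq (hat_measure j) (\<lambda>\<eta>. fourier \<phi> (join_coord j \<tau> \<eta>)) \<le> ennreal K"
      by (rule dominated_fourier_slice_bound[OF d, of j]) (rule that)
    have "(\<lambda>k. \<integral>\<xi>. h k \<xi> * (complex_of_real (1 + norm \<xi>) * \<phi> \<xi>) \<partial>lborel)
       \<longlonglongrightarrow> (\<integral>\<xi>. H \<xi> * (complex_of_real (1 + norm \<xi>) * \<phi> \<xi>) \<partial>lborel)"
      by (rule L2_pairing_tendsto[OF h2 H rapid_weighted_L2[OF r] H_lim])
    moreover have "(\<integral>\<xi>. h k \<xi> * (complex_of_real (1 + norm \<xi>) * \<phi> \<xi>) \<partial>lborel) = (\<integral>x. F k x * fourier \<phi> x \<partial>lborel)" for k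
      unfolding h_def cancel[OF nz]
      by (rule fourier_multiplication_formula[OF bounded_support_integrable[OF Fs] rapid_integrable[OF r]])
    moreover have "(\<integral>\<xi>. H \<xi> * (complex_of_real (1 + norm \<xi>) * \<phi> \<xi>) \<partial>lborel) = (\<integral>\<xi>. g \<xi> * \<phi> \<xi> \<partial>lborel)"
      unfolding gH[symmetric] cancel[OF nz] ..
    moreover have "(\<lambda>k. \<integral>x. F k x * fourier \<phi> x \<partial>lborel) \<longlonglongrightarrow> (\<integral>x. f x * fourier \<phi> x \<partial>lborel)"
    proof (rule integral_dominated_convergence[where w="\<lambda>x. norm (f x * fourier \<phi> x)"])
      show "integrable lborel (\<lambda>x. norm (f x * fourier \<phi> x))"
        by (intro integrable_norm mixed_space_pairing_integrable[OF f _ K(2) K(1)]) measurable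
      show "AE x in lborel. (\<lambda>k. F k x * fourier \<phi> x) \<longlonglongrightarrow> f x * fourier \<phi> x"
      proof (rule AE_I2)
        fix x
        obtain n where n: "\<forall>m\<ge>n. trunc m f x = f x"
          using eventually_trunc_eq[of f x] by (auto simp: eventually_sequentially)
        have "eventually (\<lambda>k. F k x * fourier \<phi> x = f x * fourier \<phi> x) sequentially"
          unfolding eventually_sequentially
        proof (intro exI[of _ n] allI impI)
          fix k assume "n \<le> k"
          then have "n \<le> N k" using Nk[of k] by (rule order_trans)
          then show "F k x * fourier \<phi> x = f x * fourier \<phi> x" using n by (simp add: F_def)
        qed
        then show "(\<lambda>k. F k x * fourier \<phi> x) \<longlonglongrightarrow> f x * fourier \<phi> x" by (rule tendsto_eventually)
      qed
      show "AE x in lborel. norm (F k x * fourier \<phi> x) \<le> norm (f x * fourier \<phi> x)" for k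
        by (auto simp: F_def norm_mult intro!: AE_I2 mult_right_mono norm_trunc_le)
    qed measurable
    ultimately show "(\<integral>\<xi>. g \<xi> * \<phi> \<xi> \<partial>lborel) = (\<integral>x. f x * fourier \<phi> x \<partial>lborel)"
      by (simp add: LIMSEQ_unique)
  qed
  show thesis
    by (rule that[OF _ \<open>has_fourier f g\<close> _ gw, of N, unfolded gH F_def[symmetric] h_def[symmetric], OF _ h2 H_lim]) measurable
qed

text \<open>Converse to Hoelder's inequality: a violation of the bound on a set \<open>E\<close> of values of \<open>x\<^sub>j\<close>
  is detected by the test function \<open>1\<^sub>E(x\<^sub>j) u\<^sub>N\<close>, where \<open>u\<^sub>N\<close> is a truncation of \<open>u\<close>.\<close>

lemma mixed_norm_inf2_le:
  fixes u :: "real ^ 'n::finite \<Rightarrow> complex"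
  assumes u: "u \<in> L2 lborel"
    and dual: "\<And>g. bounded_support g \<Longrightarrow> ennreal (norm (\<integral>x. u x * cnj (g x) \<partial>lborel)) \<le> A * mixed_norm 1 2 j g"
    and A: "A < \<infinity>"
  shows "mixed_norm \<infinity> 2 j u \<le> A"
proof -
  have [measurable]: "u \<in> borel_measurable borel" using u by (simp add: L2_def)
  have slice_le: "AE t in lborel. slice_norm j (trunc N u) t \<le> A" for N
  proof -
    define S where "S = slice_norm j (trunc N u)"
    have [measurable]: "S \<in> borel_measurable borel" unfolding S_def by measurable
    define E where "E = {t. A < S t}"
    have [measurable]: "E \<in> sets borel" unfolding E_def by measurable
    define g where "g x = indicator E (x $ j) * trunc N u x" for x
    have gm [measurable]: "g \<in> borel_measurable borel" unfolding g_def by measurable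
    have gs: "bounded_support g"
      unfolding bounded_support_def
      by (auto intro!: exI[of _ "real N"] gm simp: g_def trunc_def indicator_def)
    have sl: "L2_sq (hat_measure j) (\<lambda>y. g (join_coord j t y)) = indicator E t * (S t)\<^sup>2" for t
      unfolding S_def slice_norm_def esqrt_square
      by (cases "t \<in> E") (simp_all add: g_def L2_sq_def join_coord_def)
    have sg: "slice_norm j g t = indicator E t * S t" for t
      unfolding slice_norm_def[of j g] sl
      by (cases "t \<in> E") (simp_all add: esqrt_of_square esqrt_0)
    have mg: "mixed_norm 1 2 j g = (\<integral>\<^sup>+t. indicator E t * S t \<partial>lborel)"
      unfolding mixed_norm_12 sg ..
    \<comment> \<open>Finiteness is what later lets an inequality of integrals be turned into one
      almost everywhere.\<close>
    have fin: "mixed_norm 1 2 j g < \<infinity>"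
    proof -
      obtain C where C: "0 \<le> C" "\<And>t y. norm (g (join_coord j t y)) \<le> (C * inverse (1 + t\<^sup>2)) * hat_weight j y"
        by (rule dominatedE[OF bounded_support_dominated[OF gs]]) (rule that)
      have "slice_norm j g t \<le> ennreal (C * inverse (1 + t\<^sup>2) * sqrt (hat_mass j))" for t
      proof -
        have p: "0 \<le> C * inverse (1 + t\<^sup>2)"
          using C(1) inverse_1_plus_square_bounds[of t] by simp
        have "L2_sq (hat_measure j) (\<lambda>y. g (join_coord j t y)) \<le> ennreal ((C * inverse (1 + t\<^sup>2))\<^sup>2 * hat_mass j)"
          by (rule hat_weight_dominated(3)[OF _ C(2) p]) measurable
        then show ?thesis
          unfolding slice_norm_def
          by (rule order_trans[OF esqrt_mono])
             (use p in \<open>simp add: esqrt_ennreal hat_mass_nonneg real_sqrt_mult\<close>)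
      qed
      then have "mixed_norm 1 2 j g \<le> (\<integral>\<^sup>+t. ennreal (C * inverse (1 + t\<^sup>2) * sqrt (hat_mass j)) \<partial>lborel)"
        unfolding mixed_norm_12 by (intro nn_integral_mono)
      also have "\<dots> < \<infinity>"
      proof -
        have "integrable lborel (\<lambda>t::real. C * inverse (1 + t\<^sup>2) * sqrt (hat_mass j))"
          by (intro integrable_mult_left integrable_mult_right integrable_inverse_1_plus_square')
        then show ?thesis
          using C(1) inverse_1_plus_square_bounds(1) hat_mass_nonneg[of j]
          by (subst nn_integral_eq_integral) (auto intro!: AE_I2 mult_nonneg_nonneg less_imp_le)
      qed
      finally show ?thesis .
    qed
    have "L2_sq lborel g = (\<integral>\<^sup>+t. indicator E t * (S t)\<^sup>2 \<partial>lborel)"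
      unfolding sl[symmetric] L2_sq_def by (rule nn_integral_join(1)) measurable
    moreover have "L2_sq lborel g = ennreal (norm (\<integral>x. u x * cnj (g x) \<partial>lborel))"
    proof -
      \<comment> \<open>At each point the test function is either u or 0, so the pairing is the
        square of its own L^2 norm.\<close>
      have "u x * cnj (g x) = complex_of_real ((norm (g x))\<^sup>2)" for x
        unfolding complex_norm_square by (simp add: g_def trunc_def indicator_def)
      moreover have "integrable lborel (\<lambda>x. (norm (g x))\<^sup>2)"
        using bounded_support_L2[OF gs] by (simp add: L2_iff_integrable)
      ultimately have "norm (\<integral>x. u x * cnj (g x) \<partial>lborel) = (\<integral>x. (norm (g x))\<^sup>2 \<partial>lborel)"
        and "integrable lborel (\<lambda>x. (norm (g x))\<^sup>2)"
        by (simp_all only: integral_complex_of_real norm_of_real) (simp add: integral_nonneg_AE)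
      then show ?thesis
        unfolding L2_sq_def by (simp add: ennreal_power nn_integral_eq_integral)
    qed
    ultimately have le: "(\<integral>\<^sup>+t. indicator E t * (S t)\<^sup>2 \<partial>lborel) \<le> (\<integral>\<^sup>+t. A * (indicator E t * S t) \<partial>lborel)"
      using dual[OF gs] by (simp add: mg nn_integral_cmult)
    have pt: "A * (indicator E t * S t) \<le> indicator E t * (S t)\<^sup>2" for t
      by (cases "t \<in> E") (auto simp: E_def power2_eq_square intro!: mult_right_mono)
    \<comment> \<open>On \<open>E\<close> the integrand A S is pointwise at most S^2, yet its finite
      integral is not smaller; so the two agree almost everywhere, which is impossible where A < S <
      \<infinity>.\<close>
    have "AE t in lborel. indicator E t * (S t)\<^sup>2 \<le> A * (indicator E t * S t)"
    proof (rule ccontr)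
      assume "\<not> ?thesis"
      then have "(\<integral>\<^sup>+t. A * (indicator E t * S t) \<partial>lborel) < (\<integral>\<^sup>+t. indicator E t * (S t)\<^sup>2 \<partial>lborel)"
        using fin A pt by (intro nn_integral_less) (auto simp: nn_integral_cmult mg[symmetric] ennreal_mult_eq_top_iff)
      with le show False by simp
    qed
    moreover have "AE t in lborel. indicator E t * S t \<noteq> \<infinity>"
      using fin unfolding mg by (intro nn_integral_PInf_AE) auto
    ultimately show ?thesis
    proof eventually_elim
      fix t assume 1: "indicator E t * (S t)\<^sup>2 \<le> A * (indicator E t * S t)" and 2: "indicator E t * S t \<noteq> \<infinity>"
      show "slice_norm j (trunc N u) t \<le> A"
      proof (rule ccontr)
        assume "\<not> ?thesis"
        then have lt: "A < S t" by (simp add: S_def)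
        then have "S t * S t \<le> S t * A" "S t \<noteq> \<top>" "S t \<noteq> 0"
          using 1 2 by (auto simp: E_def power2_eq_square mult.commute)
        then have "S t \<le> A" by (simp add: ennreal_mult_le_mult_iff)
        with lt show False by simp
      qed
    qed
  qed
  \<comment> \<open>One null set serves all truncation levels; Fatou's lemma on the slice then
    removes the truncation.\<close>
  have "AE t in lborel. \<forall>N. slice_norm j (trunc N u) t \<le> A"
    unfolding AE_all_countable using slice_le by blast
  then have "AE t in lborel. slice_norm j u t \<le> A"
  proof eventually_elim
    fix t assume le: "\<forall>N. slice_norm j (trunc N u) t \<le> A"
    have "L2_sq (hat_measure j) (\<lambda>y. u (join_coord j t y))
      = (\<integral>\<^sup>+y. liminf (\<lambda>N. (ennreal (norm (trunc N u (join_coord j t y))))\<^sup>2) \<partial>hat_measure j)"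
      unfolding L2_sq_def
    proof (rule nn_integral_cong)
      fix y
      have "eventually (\<lambda>N. (ennreal (norm (trunc N u (join_coord j t y))))\<^sup>2 = (ennreal (norm (u (join_coord j t y))))\<^sup>2) sequentially"
        using eventually_trunc_eq[of u "join_coord j t y"] by eventually_elim simp
      then have "(\<lambda>N. (ennreal (norm (trunc N u (join_coord j t y))))\<^sup>2) \<longlonglongrightarrow> (ennreal (norm (u (join_coord j t y))))\<^sup>2"
        by (rule tendsto_eventually)
      then show "(ennreal (norm (u (join_coord j t y))))\<^sup>2 = liminf (\<lambda>N. (ennreal (norm (trunc N u (join_coord j t y))))\<^sup>2)"
        by (simp add: lim_imp_Liminf)
    qed
    also have "\<dots> \<le> liminf (\<lambda>N. L2_sq (hat_measure j) (\<lambda>y. trunc N u (join_coord j t y)))"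
      unfolding L2_sq_def by (rule nn_integral_liminf) measurable
    also have "\<dots> \<le> A\<^sup>2"
      by (rule Liminf_le) (use le in \<open>auto simp: slice_norm_def esqrt_le_iff\<close>)
    finally show "slice_norm j u t \<le> A" by (simp add: slice_norm_def esqrt_le_iff)
  qed
  then show ?thesis
    unfolding mixed_norm_inf2 by (intro esssup_I) auto
qed

text \<open>A single \<open>g\<close>, built from one index \<open>j0\<close>, serves all symbols
  and all directions, so that compositions of multipliers and sums over j refer to the same
  transform. The weighted bound on \<open>m\<close> places m g in L^2, while the size of the output
  depends only on the constant \<open>A\<close> of the line integrals.\<close>

theorem mixed_multiplier_estimate:
  fixes f :: "real ^ 'n::finite \<Rightarrow> complex"
  assumes f: "f \<in> mixed_space 1 2 j0"
  obtains g where "g \<in> borel_measurable borel" "has_fourier f g"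
    "\<And>m B. m \<in> borel_measurable borel \<Longrightarrow> (\<And>\<xi>. norm (m \<xi>) * (1 + norm \<xi>) \<le> B) \<Longrightarrow> (\<lambda>\<xi>. m \<xi> * g \<xi>) \<in> L2 lborel"
    "\<And>m B u j A. m \<in> borel_measurable borel \<Longrightarrow> (\<And>\<xi>. norm (m \<xi>) * (1 + norm \<xi>) \<le> B) \<Longrightarrow>
      L2_inverse_fourier (\<lambda>\<xi>. m \<xi> * g \<xi>) u \<Longrightarrow> kernel_bounded j A m \<Longrightarrow> f \<in> mixed_space 1 2 j \<Longrightarrow>
      mixed_norm \<infinity> 2 j u \<le> ennreal A * mixed_norm 1 2 j f"
proof -
  have [measurable]: "f \<in> borel_measurable borel" using f by (simp add: mixed_space_def)
  obtain g N where gm [measurable]: "g \<in> borel_measurable borel" and fg: "has_fourier f g"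
    and h2: "\<And>k. (\<lambda>\<xi>. fourier (trunc (N k) f) \<xi> / complex_of_real (1 + norm \<xi>)) \<in> L2 lborel"
    and H2: "(\<lambda>\<xi>. g \<xi> / complex_of_real (1 + norm \<xi>)) \<in> L2 lborel"
    and lim: "(\<lambda>k. L2_sq lborel (\<lambda>\<xi>. fourier (trunc (N k) f) \<xi> / complex_of_real (1 + norm \<xi>)
        - g \<xi> / complex_of_real (1 + norm \<xi>))) \<longlonglongrightarrow> 0"
    by (rule fourier_mixed_space[OF f]) (rule that)
  have nz: "complex_of_real (1 + norm \<xi>) \<noteq> 0" for \<xi> :: "real ^ 'n"
    unfolding of_real_eq_0_iff using one_plus_norm_pos[of \<xi>] by simp
  have cancel: "a / b * (d * b) = a * d" if "b \<noteq> 0" for a b d :: complex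
    using that by simp
  have nw: "norm (m \<xi> * complex_of_real (1 + norm \<xi>)) = norm (m \<xi>) * (1 + norm \<xi>)" for m :: "real ^ 'n \<Rightarrow> complex" and \<xi>
    unfolding norm_mult norm_of_real by simp
  show thesis
  proof (rule that[OF gm fg])
    fix m :: "real ^ 'n \<Rightarrow> complex" and B
    assume [measurable]: "m \<in> borel_measurable borel" and B: "\<And>\<xi>. norm (m \<xi>) * (1 + norm \<xi>) \<le> B"
    show "(\<lambda>\<xi>. m \<xi> * g \<xi>) \<in> L2 lborel"
    proof (rule L2_bound[OF L2_cmult[OF H2, of "complex_of_real B"]])
      fix \<xi> :: "real ^ 'n"
      have "norm (m \<xi> * g \<xi>) = norm (g \<xi> / complex_of_real (1 + norm \<xi>)) * norm (m \<xi> * complex_of_real (1 + norm \<xi>))"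
        unfolding norm_mult[symmetric] cancel[OF nz] by (simp add: mult.commute)
      also have "\<dots> \<le> norm (g \<xi> / complex_of_real (1 + norm \<xi>)) * norm (complex_of_real B)"
        unfolding nw norm_of_real using B[of \<xi>] by (intro mult_left_mono) auto
      finally show "norm (m \<xi> * g \<xi>) \<le> norm (complex_of_real B * (g \<xi> / complex_of_real (1 + norm \<xi>)))"
        by (simp only: norm_mult mult.commute)
    qed measurable
  next
    fix m :: "real ^ 'n \<Rightarrow> complex" and B u j A
    assume [measurable]: "m \<in> borel_measurable borel" and B: "\<And>\<xi>. norm (m \<xi>) * (1 + norm \<xi>) \<le> B"
      and u: "L2_inverse_fourier (\<lambda>\<xi>. m \<xi> * g \<xi>) u" and A: "kernel_bounded j A m" and fj: "f \<in> mixed_space 1 2 j"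
    have A0: "0 \<le> A" using A order_trans[OF norm_ge_zero] unfolding kernel_bounded_def by blast
    have u2: "u \<in> L2 lborel" using u by (simp add: L2_inverse_fourier_def)
    \<comment> \<open>The inversion formula contributes 1/c and Bessel's inequality in the remaining
      variables contributes c'; since c' \<le> c, the constant \<open>A\<close> is not
      enlarged.\<close>
    define c where "c = (2 * pi) ^ CARD('n)"
    define c' where "c' = (2 * pi) ^ (CARD('n) - 1)"
    have cc: "0 < c" "0 < c'" "c' \<le> c"
    proof -
      show "0 < c" "0 < c'" by (simp_all add: c_def c'_def)
      show "c' \<le> c"
        unfolding c_def c'_def by (rule power_increasing) (use pi_ge_two in auto)
    qed
    have mB: "norm (m \<xi>) \<le> B" for \<xi>
      using order_trans[OF _ B[of \<xi>], of "norm (m \<xi>)"] by (simp add: distrib_left)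
    show "mixed_norm \<infinity> 2 j u \<le> ennreal A * mixed_norm 1 2 j f"
    proof (rule mixed_norm_inf2_le[OF u2])
      show "ennreal A * mixed_norm 1 2 j f < \<infinity>"
        using fj by (simp add: mixed_space_def ennreal_mult_less_top)
      fix h :: "real ^ 'n \<Rightarrow> complex" assume h: "bounded_support h"
      have [measurable]: "h \<in> borel_measurable borel" using h by (simp add: bounded_support_def)
      note hi = bounded_support_integrable[OF h] and hh2 = bounded_support_L2[OF h]
      have cnj_L2: "(\<lambda>x. cnj (v x)) \<in> L2 lborel" if "v \<in> L2 lborel" for v :: "real ^ 'n \<Rightarrow> complex"
        using that by (auto simp: L2_def L2_sq_def)
      have w2: "(\<lambda>\<xi>. (cnj (fourier h \<xi>) * m \<xi>) * complex_of_real (1 + norm \<xi>)) \<in> L2 lborel"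
      proof (rule L2_bound[OF L2_cmult[OF cnj_L2[OF fourier_L2[OF hi hh2]], of "complex_of_real B"]])
        fix \<xi> :: "real ^ 'n"
        show "norm ((cnj (fourier h \<xi>) * m \<xi>) * complex_of_real (1 + norm \<xi>)) \<le> norm (complex_of_real B * cnj (fourier h \<xi>))"
          using B[of \<xi>] unfolding mult.assoc norm_mult[of "cnj _"] nw norm_mult[of "complex_of_real B"] norm_of_real
          by (subst mult.commute) (auto intro!: mult_right_mono)
      qed measurable
      have "complex_of_real c * (\<integral>x. u x * cnj (h x) \<partial>lborel) = (\<integral>\<xi>. m \<xi> * g \<xi> * fourier (\<lambda>x. cnj (h x)) (- \<xi>) \<partial>lborel)"
        using u hi cnj_L2[OF hh2] unfolding L2_inverse_fourier_def c_def by simp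
      also have "\<dots> = (\<integral>\<xi>. (g \<xi> / complex_of_real (1 + norm \<xi>)) * ((cnj (fourier h \<xi>) * m \<xi>) * complex_of_real (1 + norm \<xi>)) \<partial>lborel)"
        unfolding cancel[OF nz] by (simp add: fourier_cnj mult_ac)
      finally have eq: "complex_of_real c * (\<integral>x. u x * cnj (h x) \<partial>lborel)
        = (\<integral>\<xi>. (g \<xi> / complex_of_real (1 + norm \<xi>)) * ((cnj (fourier h \<xi>) * m \<xi>) * complex_of_real (1 + norm \<xi>)) \<partial>lborel)" .
      \<comment> \<open>The weight 1 + |\<xi>| is divided out of the transform of f and multiplied
        into the bounded symbol, so both factors lie in L^2 and the truncations of f can be replaced
        by their limit.\<close>
      have "(\<lambda>k. \<integral>\<xi>. (fourier (trunc (N k) f) \<xi> / complex_of_real (1 + norm \<xi>)) * ((cnj (fourier h \<xi>) * m \<xi>) * complex_of_real (1 + norm \<xi>)) \<partial>lborel)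
         \<longlonglongrightarrow> complex_of_real c * (\<integral>x. u x * cnj (h x) \<partial>lborel)"
        unfolding eq by (rule L2_pairing_tendsto[OF h2 H2 w2 lim])
      then have "(\<lambda>k. ennreal (norm (\<integral>\<xi>. fourier (trunc (N k) f) \<xi> * cnj (fourier h \<xi>) * m \<xi> \<partial>lborel)))
         \<longlonglongrightarrow> ennreal (norm (complex_of_real c * (\<integral>x. u x * cnj (h x) \<partial>lborel)))"
        unfolding cancel[OF nz] by (intro tendsto_ennrealI tendsto_norm) (simp only: mult.assoc)
      then have "ennreal (norm (complex_of_real c * (\<integral>x. u x * cnj (h x) \<partial>lborel)))
         \<le> ennreal (A * c') * (mixed_norm 1 2 j f * mixed_norm 1 2 j h)"
      proof (rule LIMSEQ_le_const2, intro exI[of _ 0] allI impI)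
        fix k
        have "ennreal (norm (\<integral>\<xi>. fourier (trunc (N k) f) \<xi> * cnj (fourier h \<xi>) * m \<xi> \<partial>lborel))
          \<le> ennreal (A * c') * (mixed_norm 1 2 j (trunc (N k) f) * mixed_norm 1 2 j h)"
          unfolding c'_def by (rule sesquilinear_mixed_bound[OF _ h _ mB A]) (auto intro: bounded_support_trunc)
        also have "\<dots> \<le> ennreal (A * c') * (mixed_norm 1 2 j f * mixed_norm 1 2 j h)"
          by (intro mult_left_mono mult_right_mono mixed_norm_12_mono norm_trunc_le) auto
        finally show "ennreal (norm (\<integral>\<xi>. fourier (trunc (N k) f) \<xi> * cnj (fourier h \<xi>) * m \<xi> \<partial>lborel))
          \<le> ennreal (A * c') * (mixed_norm 1 2 j f * mixed_norm 1 2 j h)" .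
      qed
      also have "ennreal (norm (complex_of_real c * (\<integral>x. u x * cnj (h x) \<partial>lborel))) = ennreal c * ennreal (norm (\<integral>x. u x * cnj (h x) \<partial>lborel))"
        using cc by (simp add: norm_mult ennreal_mult)
      also have "ennreal (A * c') * (mixed_norm 1 2 j f * mixed_norm 1 2 j h) \<le> ennreal (c * A) * (mixed_norm 1 2 j f * mixed_norm 1 2 j h)"
        using cc A0 by (intro mult_right_mono ennreal_leI) (auto simp: mult.commute[of c] intro!: mult_left_mono)
      also have "\<dots> = ennreal c * (ennreal A * mixed_norm 1 2 j f * mixed_norm 1 2 j h)"
        using cc A0 by (simp add: ennreal_mult mult.assoc)
      finally show "ennreal (norm (\<integral>x. u x * cnj (h x) \<partial>lborel)) \<le> ennreal A * mixed_norm 1 2 j f * mixed_norm 1 2 j h"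
        using cc by (simp add: ennreal_mult_le_mult_iff)
    qed
  qed
qed

section \<open>One-dimensional oscillatory integrals\<close>

text \<open>The real part of 1 / (s - i b), which is \<pi> times the conjugate Poisson
  kernel.\<close>

definition conj_poisson :: "real \<Rightarrow> real \<Rightarrow> real" where
  "conj_poisson b s = s / (s\<^sup>2 + b\<^sup>2)"

lemma sq_plus_pos: "b \<noteq> 0 \<Longrightarrow> 0 < s\<^sup>2 + b\<^sup>2" for b s :: real
  by (simp add: add_nonneg_pos)

lemma conj_poisson_continuous: "b \<noteq> 0 \<Longrightarrow> continuous_on A (conj_poisson b)"
  unfolding conj_poisson_def by (intro continuous_intros) (auto dest: sq_plus_pos[of b])

lemma conj_poisson_minus: "conj_poisson b (- s) = - conj_poisson b s"
  by (simp add: conj_poisson_def)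

lemma conj_poisson_le: "0 < s \<Longrightarrow> b \<noteq> 0 \<Longrightarrow> \<bar>conj_poisson b s\<bar> \<le> 1 / s"
  using sq_plus_pos[of b s] by (simp add: conj_poisson_def abs_div_pos field_simps power2_eq_square)

text \<open>Integration by parts against -cos(t s)/t. The two boundary terms and the integral with
  the derivative, which is at most 1/s^2 for every b, contribute at most 1/(t a) each.\<close>

lemma sin_conj_poisson_tail:
  assumes t: "0 < t" and b: "b \<noteq> 0" and a: "0 < a" "a \<le> L"
  shows "\<bar>integral {a..L} (\<lambda>s. sin (t * s) * conj_poisson b s)\<bar> \<le> 3 / (t * a)"
proof -
  define P where "P s = - cos (t * s) * conj_poisson b s / t" for s
  define f' where "f' s = (b\<^sup>2 - s\<^sup>2) / (s\<^sup>2 + b\<^sup>2)\<^sup>2" for s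
  have f': "(conj_poisson b has_real_derivative f' s) (at s within A)" for s A
    unfolding conj_poisson_def f'_def
    using sq_plus_pos[OF b, of s]
    by (auto intro!: derivative_eq_intros simp: power2_eq_square algebra_simps)
  have f'_le: "\<bar>f' s\<bar> \<le> 1 / s\<^sup>2" if "0 < s" for s
  proof -
    have "\<bar>b\<^sup>2 - s\<^sup>2\<bar> \<le> s\<^sup>2 + b\<^sup>2" by (rule abs_leI) auto
    then have "\<bar>f' s\<bar> \<le> (s\<^sup>2 + b\<^sup>2) / (s\<^sup>2 + b\<^sup>2)\<^sup>2"
      unfolding f'_def abs_divide by (intro divide_mono) (use sq_plus_pos[OF b, of s] in auto)
    also have "\<dots> = 1 / (s\<^sup>2 + b\<^sup>2)" using sq_plus_pos[OF b, of s] by (simp add: power2_eq_square)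
    also have "\<dots> \<le> 1 / s\<^sup>2" using that by (intro divide_left_mono) (auto simp: sq_plus_pos[OF b])
    finally show ?thesis .
  qed
  have f'_cont: "continuous_on A f'" for A
    unfolding f'_def by (intro continuous_intros) (use sq_plus_pos[OF b] in \<open>auto simp: less_imp_neq[symmetric]\<close>)
  have dP: "(P has_vector_derivative (sin (t * s) * conj_poisson b s - cos (t * s) * f' s / t)) (at s within {a..L})" for s
    unfolding P_def has_real_derivative_iff_has_vector_derivative[symmetric]
    using t by (auto intro!: derivative_eq_intros f' simp: field_simps)
  have 1: "((\<lambda>s. sin (t * s) * conj_poisson b s - cos (t * s) * f' s / t) has_integral (P L - P a)) {a..L}"
    by (rule fundamental_theorem_of_calculus[OF a(2) dP])
  have 2: "(\<lambda>s. cos (t * s) * f' s / t) integrable_on {a..L}"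
    by (rule integrable_continuous_interval) (intro continuous_intros f'_cont, use t in auto)
  have "integral {a..L} (\<lambda>s. sin (t * s) * conj_poisson b s)
    = integral {a..L} (\<lambda>s. (sin (t * s) * conj_poisson b s - cos (t * s) * f' s / t) + cos (t * s) * f' s / t)"
    by simp
  also have "\<dots> = (P L - P a) + integral {a..L} (\<lambda>s. cos (t * s) * f' s / t)"
    using has_integral_add[OF 1 integrable_integral[OF 2]] by (rule integral_unique)
  finally have eq: "integral {a..L} (\<lambda>s. sin (t * s) * conj_poisson b s)
    = (P L - P a) + integral {a..L} (\<lambda>s. cos (t * s) * f' s / t)" .
  have 3: "((\<lambda>s. 1 / s\<^sup>2 / t) has_integral (- (1 / L) / t - (- (1 / a) / t))) {a..L}"
  proof (rule fundamental_theorem_of_calculus[OF a(2)])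
    fix s assume "s \<in> {a..L}"
    then have "s \<noteq> 0" using a by auto
    then show "((\<lambda>s. - (1 / s) / t) has_vector_derivative (1 / s\<^sup>2 / t)) (at s within {a..L})"
      unfolding has_real_derivative_iff_has_vector_derivative[symmetric]
      using t by (auto intro!: derivative_eq_intros simp: power2_eq_square field_simps)
  qed
  have "norm (integral {a..L} (\<lambda>s. cos (t * s) * f' s / t)) \<le> integral {a..L} (\<lambda>s. 1 / s\<^sup>2 / t)"
  proof (rule Henstock_Kurzweil_Integration.integral_norm_bound_integral[OF 2])
    show "(\<lambda>s. 1 / s\<^sup>2 / t) integrable_on {a..L}" using 3 by blast
    fix s assume "s \<in> {a..L}"
    then have "0 < s" using a by auto
    have "\<bar>cos (t * s)\<bar> * \<bar>f' s\<bar> \<le> 1 * (1 / s\<^sup>2)"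
      by (intro mult_mono f'_le \<open>0 < s\<close>) auto
    then show "norm (cos (t * s) * f' s / t) \<le> 1 / s\<^sup>2 / t"
      using t divide_right_mono[of "\<bar>cos (t * s)\<bar> * \<bar>f' s\<bar>" "1 * (1 / s\<^sup>2)" t] by (simp add: abs_mult)
  qed
  also have "\<dots> = - (1 / L) / t - (- (1 / a) / t)" using 3 by (rule integral_unique)
  also have "\<dots> \<le> 1 / (t * a)" using t a by (simp add: field_simps)
  finally have tail: "\<bar>integral {a..L} (\<lambda>s. cos (t * s) * f' s / t)\<bar> \<le> 1 / (t * a)" by simp
  have P_le: "\<bar>P s\<bar> \<le> 1 / (t * a)" if "a \<le> s" for s
  proof -
    have "\<bar>cos (t * s)\<bar> * \<bar>conj_poisson b s\<bar> \<le> 1 * (1 / s)"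
      using that a by (intro mult_mono conj_poisson_le b) auto
    also have "\<dots> \<le> 1 / a" using that a by (simp add: frac_le)
    finally show ?thesis
      using t divide_right_mono[of "\<bar>cos (t * s)\<bar> * \<bar>conj_poisson b s\<bar>" "1 / a" t]
      by (simp add: P_def abs_mult mult.commute)
  qed
  have "\<bar>x - y + z\<bar> \<le> 3 * d" if "\<bar>x\<bar> \<le> d" "\<bar>y\<bar> \<le> d" "\<bar>z\<bar> \<le> d" for x y z d :: real
    using that by linarith
  from this[OF P_le[OF a(2)] P_le[OF order_refl] tail] show ?thesis unfolding eq by simp
qed

text \<open>The integral is split at s = 1/t. Below this point |sin(t s)| \<le> t s compensates 1/s
  and gives at most 1; the tail gives at most 3.\<close>

lemma sin_conj_poisson_bound_pos:
  assumes t: "0 < t" and b: "b \<noteq> 0" and L: "0 \<le> L"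
  shows "\<bar>integral {0..L} (\<lambda>s. sin (t * s) * conj_poisson b s)\<bar> \<le> 4"
proof -
  have cont: "continuous_on A (\<lambda>s. sin (t * s) * conj_poisson b s)" for A
    by (intro continuous_intros conj_poisson_continuous b)
  have near: "\<bar>integral {0..c} (\<lambda>s. sin (t * s) * conj_poisson b s)\<bar> \<le> 1" if c: "0 \<le> c" "c \<le> 1 / t" for c
  proof -
    have "norm (integral {0..c} (\<lambda>s. sin (t * s) * conj_poisson b s)) \<le> t * (c - 0)"
    proof (rule integral_bound[OF c(1) cont])
      fix s assume s: "s \<in> {0..c}"
      show "norm (sin (t * s) * conj_poisson b s) \<le> t"
      proof (cases "s = 0")
        case False
        then have "0 < s" using s by auto
        have "\<bar>sin (t * s)\<bar> * \<bar>conj_poisson b s\<bar> \<le> (t * s) * (1 / s)"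
          using \<open>0 < s\<close> t abs_sin_x_le_abs_x[of "t * s"] by (intro mult_mono conj_poisson_le b) (auto simp: abs_mult)
        then show ?thesis using \<open>0 < s\<close> by (simp add: abs_mult)
      qed (use t in simp)
    qed
    also have "\<dots> \<le> 1" using c t by (simp add: field_simps)
    finally show ?thesis by simp
  qed
  show ?thesis
  proof (cases "L \<le> 1 / t")
    case True
    then show ?thesis using near[OF L True] by simp
  next
    case False
    have "integral {0..1/t} (\<lambda>s. sin (t * s) * conj_poisson b s) + integral {1/t..L} (\<lambda>s. sin (t * s) * conj_poisson b s)
        = integral {0..L} (\<lambda>s. sin (t * s) * conj_poisson b s)"
      using False t by (intro Henstock_Kurzweil_Integration.integral_combine integrable_continuous_interval cont) auto
    moreover have "\<bar>integral {1/t..L} (\<lambda>s. sin (t * s) * conj_poisson b s)\<bar> \<le> 3 / (t * (1 / t))"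
      by (rule sin_conj_poisson_tail[OF t b]) (use False t in auto)
    ultimately show ?thesis using near[of "1/t"] t by simp
  qed
qed

lemma sin_conj_poisson_bound:
  assumes b: "b \<noteq> 0" and L: "0 \<le> L"
  shows "\<bar>integral {0..L} (\<lambda>s. sin (t * s) * conj_poisson b s)\<bar> \<le> 4"
proof -
  consider "t = 0" | "0 < t" | "t < 0" by linarith
  then show ?thesis
  proof cases
    case 3
    have "integral {0..L} (\<lambda>s. sin (t * s) * conj_poisson b s) = - integral {0..L} (\<lambda>s. sin ((- t) * s) * conj_poisson b s)"
      by (subst integral_neg[symmetric]) simp
    then show ?thesis using sin_conj_poisson_bound_pos[of "- t" b L] 3 b L by simp
  qed (use sin_conj_poisson_bound_pos[OF _ b L] in auto)
qed

section \<open>Truncated Fourier integrals of conjugate Poisson kernels and of simple poles\<close>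

lemma integrable_indicator_interval:
  fixes f :: "real \<Rightarrow> complex"
  assumes [measurable]: "f \<in> borel_measurable borel" and B: "\<And>s. s \<in> {a..b} \<Longrightarrow> norm (f s) \<le> B"
  shows "integrable lborel (\<lambda>s. indicator {a..b} s * f s)"
    and "norm (\<integral>s. indicator {a..b} s * f s \<partial>lborel) \<le> \<bar>B\<bar> * \<bar>b - a\<bar>"
proof -
  have i: "integrable lborel (\<lambda>s. \<bar>B\<bar> * indicator {a..b} s :: real)"
    by (intro integrable_mult_right integrable_real_indicator) (auto simp: emeasure_lborel_Icc_eq)
  have le: "norm (indicator {a..b} s * f s) \<le> \<bar>B\<bar> * indicator {a..b} s" for s
    using B[of s] by (auto simp: indicator_def)
  show "integrable lborel (\<lambda>s. indicator {a..b} s * f s)"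
    by (rule Bochner_Integration.integrable_bound[OF i]) (use le in \<open>auto intro!: AE_I2 order_trans[OF le]\<close>)
  have "norm (\<integral>s. indicator {a..b} s * f s \<partial>lborel) \<le> (\<integral>s. \<bar>B\<bar> * indicator {a..b} s \<partial>lborel)"
    by (rule order_trans[OF integral_norm_bound], rule integral_mono_AE'[OF i]) (use le in auto)
  also have "\<dots> = \<bar>B\<bar> * measure lborel {a..b}" by simp
  also have "\<dots> \<le> \<bar>B\<bar> * \<bar>b - a\<bar>" by (intro mult_left_mono) (auto simp: measure_def emeasure_lborel_Icc_eq)
  finally show "norm (\<integral>s. indicator {a..b} s * f s \<partial>lborel) \<le> \<bar>B\<bar> * \<bar>b - a\<bar>" .
qed

lemma borel_measurable_conj_poisson [measurable]: "conj_poisson b \<in> borel_measurable borel"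
  unfolding conj_poisson_def by measurable

text \<open>The kernel is odd and the interval symmetric, so only the sine part of the exponential
  survives, as twice the integral over [0, L]; hence 8 = 2 * 4.\<close>

lemma fourier_conj_poisson_bound:
  assumes b: "b \<noteq> 0" and L: "0 \<le> L"
  shows "integrable lborel (\<lambda>s. indicator {-L..L} s * (cis (t * s) * complex_of_real (conj_poisson b s)))"
    and "norm (\<integral>s. indicator {-L..L} s * (cis (t * s) * complex_of_real (conj_poisson b s)) \<partial>lborel) \<le> 8"
proof -
  have "bounded (conj_poisson b ` {-L..L})"
    by (intro compact_imp_bounded compact_continuous_image conj_poisson_continuous b) simp
  then obtain B where "\<forall>x\<in>conj_poisson b ` {-L..L}. norm x \<le> B"
    unfolding bounded_iff by blast
  then have B: "\<bar>conj_poisson b s\<bar> \<le> B" if "s \<in> {-L..L}" for s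
    using that by simp
  show i: "integrable lborel (\<lambda>s. indicator {-L..L} s * (cis (t * s) * complex_of_real (conj_poisson b s)))"
    by (rule integrable_indicator_interval(1)[where B=B]) (measurable, simp add: norm_mult B)
  define I where "I = (\<integral>s. indicator {-L..L} s * (cis (t * s) * complex_of_real (conj_poisson b s)) \<partial>lborel)"
  \<comment> \<open>Adding the integral to its reflection replaces the exponential by the
    sine.\<close>
  have "I = \<bar>-1\<bar> *\<^sub>R (\<integral>s. indicator {-L..L} (0 + (-1) * s) * (cis (t * (0 + (-1) * s)) * complex_of_real (conj_poisson b (0 + (-1) * s))) \<partial>lborel)"
    unfolding I_def by (rule lborel_integral_real_affine) simp
  also have "\<dots> = (\<integral>s. indicator {-L..L} s * (- cis (- (t * s)) * complex_of_real (conj_poisson b s)) \<partial>lborel)"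
    by (auto simp: conj_poisson_minus indicator_def intro!: Bochner_Integration.integral_cong)
  finally have I2: "I = (\<integral>s. indicator {-L..L} s * (- cis (- (t * s)) * complex_of_real (conj_poisson b s)) \<partial>lborel)" .
  have i2: "integrable lborel (\<lambda>s. indicator {-L..L} s * (- cis (- (t * s)) * complex_of_real (conj_poisson b s)))"
    by (rule integrable_indicator_interval(1)[where B=B]) (measurable, simp add: norm_mult B)
  have "I + I = (\<integral>s. indicator {-L..L} s * (cis (t * s) * complex_of_real (conj_poisson b s))
      + indicator {-L..L} s * (- cis (- (t * s)) * complex_of_real (conj_poisson b s)) \<partial>lborel)"
    unfolding Bochner_Integration.integral_add[OF i i2] I2[symmetric] I_def[symmetric] ..
  also have "\<dots> = (\<integral>s. (2 * \<i>) * complex_of_real (indicator {-L..L} s * (sin (t * s) * conj_poisson b s)) \<partial>lborel)"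
  proof (rule Bochner_Integration.integral_cong[OF refl])
    fix s
    have "cis (t * s) - cis (- (t * s)) = (2 * \<i>) * complex_of_real (sin (t * s))"
      by (simp add: complex_eq_iff)
    then show "indicator {-L..L} s * (cis (t * s) * complex_of_real (conj_poisson b s))
      + indicator {-L..L} s * (- cis (- (t * s)) * complex_of_real (conj_poisson b s))
      = (2 * \<i>) * complex_of_real (indicator {-L..L} s * (sin (t * s) * conj_poisson b s))"
      by (cases "s \<in> {-L..L}") (auto simp flip: left_diff_distrib)
  qed
  also have "\<dots> = (2 * \<i>) * complex_of_real (\<integral>s. indicator {-L..L} s * (sin (t * s) * conj_poisson b s) \<partial>lborel)"
    by (simp only: Bochner_Integration.integral_mult_right_zero integral_complex_of_real)
  finally have "2 * norm I = 2 * \<bar>\<integral>s. indicator {-L..L} s * (sin (t * s) * conj_poisson b s) \<partial>lborel\<bar>"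
    by (metis mult_2 norm_mult norm_numeral norm_of_real norm_ii mult_1_right)
  moreover have "(\<integral>s. indicator {-L..L} s * (sin (t * s) * conj_poisson b s) \<partial>lborel) = 2 * integral {0..L} (\<lambda>s. sin (t * s) * conj_poisson b s)"
  proof -
    have cont: "continuous_on A (\<lambda>s. sin (t * s) * conj_poisson b s)" for A
      by (intro continuous_intros conj_poisson_continuous b)
    have si: "set_integrable lborel {-L..L} (\<lambda>s. sin (t * s) * conj_poisson b s)"
      by (rule borel_integrable_atLeastAtMost') (rule cont)
    have "(\<integral>s. indicator {-L..L} s * (sin (t * s) * conj_poisson b s) \<partial>lborel) = integral {-L..L} (\<lambda>s. sin (t * s) * conj_poisson b s)"
      using set_borel_integral_eq_integral(2)[OF si] by (simp add: set_lebesgue_integral_def)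
    also have "\<dots> = integral {-L..0} (\<lambda>s. sin (t * s) * conj_poisson b s) + integral {0..L} (\<lambda>s. sin (t * s) * conj_poisson b s)"
      using L by (intro Henstock_Kurzweil_Integration.integral_combine[symmetric] integrable_continuous_interval cont) auto
    also have "integral {-L..0} (\<lambda>s. sin (t * s) * conj_poisson b s) = integral {-L..-0} (\<lambda>s. sin (t * (- s)) * conj_poisson b (- s))"
      by (simp add: conj_poisson_minus)
    also have "\<dots> = integral {0..L} (\<lambda>s. sin (t * s) * conj_poisson b s)"
      by (rule Henstock_Kurzweil_Integration.integral_reflect_real)
    finally show ?thesis by simp
  qed
  ultimately show "norm I \<le> 8"
    using sin_conj_poisson_bound[OF b L, of t] by simp
qed

lemma poisson_integral:
  assumes b: "b \<noteq> 0"
  shows "integrable lborel (\<lambda>s. \<bar>b\<bar> / (s\<^sup>2 + b\<^sup>2))" "(\<integral>s. \<bar>b\<bar> / (s\<^sup>2 + b\<^sup>2) \<partial>lborel) = pi"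
proof -
  have eq: "\<bar>b\<bar> * (\<bar>b\<bar> / ((0 + \<bar>b\<bar> * s)\<^sup>2 + b\<^sup>2)) = inverse (1 + s\<^sup>2)" for s
  proof -
    have "(0 + \<bar>b\<bar> * s)\<^sup>2 + b\<^sup>2 = b\<^sup>2 * (1 + s\<^sup>2)" by (simp add: power_mult_distrib algebra_simps)
    then show ?thesis using b by (simp add: power2_eq_square[of b] inverse_eq_divide flip: abs_mult)
  qed
  have cancel: "x = (1 / \<bar>b\<bar>) * (\<bar>b\<bar> * x)" for x :: real using b by simp
  have "(\<lambda>s. \<bar>b\<bar> / ((0 + \<bar>b\<bar> * s)\<^sup>2 + b\<^sup>2)) = (\<lambda>s. (1 / \<bar>b\<bar>) * inverse (1 + s\<^sup>2))"
    unfolding eq[symmetric] by (rule ext) (rule cancel)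
  then have "integrable lborel (\<lambda>s. \<bar>b\<bar> / ((0 + \<bar>b\<bar> * s)\<^sup>2 + b\<^sup>2))"
    by (simp only:) (intro integrable_mult_right integrable_inverse_1_plus_square')
  then show "integrable lborel (\<lambda>s. \<bar>b\<bar> / (s\<^sup>2 + b\<^sup>2))"
    using b by (subst (asm) lborel_integrable_real_affine_iff[where f="\<lambda>s. \<bar>b\<bar> / (s\<^sup>2 + b\<^sup>2)"]) auto
  have "(\<integral>s. \<bar>b\<bar> / (s\<^sup>2 + b\<^sup>2) \<partial>lborel) = \<bar>\<bar>b\<bar>\<bar> *\<^sub>R (\<integral>s. \<bar>b\<bar> / ((0 + \<bar>b\<bar> * s)\<^sup>2 + b\<^sup>2) \<partial>lborel)"
    by (rule lborel_integral_real_affine) (use b in simp)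
  also have "\<dots> = (\<integral>s. \<bar>b\<bar> * (\<bar>b\<bar> / ((0 + \<bar>b\<bar> * s)\<^sup>2 + b\<^sup>2)) \<partial>lborel)"
    by (subst Bochner_Integration.integral_mult_right_zero) simp
  also have "\<dots> = pi" unfolding eq by (rule integrable_inverse_1_plus_square'(2))
  finally show "(\<integral>s. \<bar>b\<bar> / (s\<^sup>2 + b\<^sup>2) \<partial>lborel) = pi" .
qed

text \<open>The pole is the conjugate Poisson kernel plus i times the Poisson kernel, whose integral
  has modulus at most \<pi> for every b. Thus 8 + \<pi> \<le> 12, however close the pole is to the
  real axis.\<close>

lemma fourier_pole_bound:
  assumes b: "b \<noteq> 0" and L: "0 \<le> L"
  shows "norm (\<integral>s. indicator {-L..L} s * (cis (t * s) / (complex_of_real s - \<i> * complex_of_real b)) \<partial>lborel) \<le> 12"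
proof -
  define q where "q s = indicator {-L..L} s * (cis (t * s) * (\<i> * complex_of_real (b / (s\<^sup>2 + b\<^sup>2))))" for s
  have q_le: "norm (q s) \<le> \<bar>b\<bar> / (s\<^sup>2 + b\<^sup>2)" for s
  proof -
    have "norm (complex_of_real (b / (s\<^sup>2 + b\<^sup>2))) = \<bar>b\<bar> / (s\<^sup>2 + b\<^sup>2)"
      unfolding norm_of_real abs_divide using sq_plus_pos[OF b, of s] by (simp only: abs_of_pos)
    moreover have "0 \<le> \<bar>b\<bar> / (s\<^sup>2 + b\<^sup>2)" using sq_plus_pos[OF b, of s] by simp
    ultimately show ?thesis
      by (simp add: q_def indicator_def norm_mult del: of_real_divide)
  qed
  have q: "integrable lborel q"
  proof (rule Bochner_Integration.integrable_bound[OF poisson_integral(1)[OF b]])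
    show "AE s in lborel. norm (q s) \<le> norm (\<bar>b\<bar> / (s\<^sup>2 + b\<^sup>2))"
      using order_trans[OF q_le abs_ge_self] by (intro AE_I2) (simp only: real_norm_def)
    show "q \<in> borel_measurable lborel" unfolding q_def[abs_def] by measurable
  qed
  have q_int: "norm (\<integral>s. q s \<partial>lborel) \<le> pi"
  proof -
    have "norm (\<integral>s. q s \<partial>lborel) \<le> (\<integral>s. \<bar>b\<bar> / (s\<^sup>2 + b\<^sup>2) \<partial>lborel)"
      by (rule order_trans[OF integral_norm_bound], rule integral_mono_AE'[OF poisson_integral(1)[OF b]])
         (use q_le in auto)
    then show ?thesis by (simp only: poisson_integral(2)[OF b])
  qed
  have "indicator {-L..L} s * (cis (t * s) / (complex_of_real s - \<i> * complex_of_real b))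
      = indicator {-L..L} s * (cis (t * s) * complex_of_real (conj_poisson b s)) + q s" for s
  proof -
    have "(complex_of_real s - \<i> * complex_of_real b) * (complex_of_real s + \<i> * complex_of_real b) = complex_of_real (s\<^sup>2 + b\<^sup>2)"
      by (simp add: complex_eq_iff power2_eq_square)
    moreover have "1 / x = y / (x * y)" if "y \<noteq> 0" for x y :: complex
      using that by simp
    moreover have "complex_of_real s + \<i> * complex_of_real b \<noteq> 0" using b by (simp add: complex_eq_iff)
    ultimately have "1 / (complex_of_real s - \<i> * complex_of_real b) = (complex_of_real s + \<i> * complex_of_real b) / complex_of_real (s\<^sup>2 + b\<^sup>2)"
      by metis
    also have "\<dots> = complex_of_real (conj_poisson b s) + \<i> * complex_of_real (b / (s\<^sup>2 + b\<^sup>2))"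
      by (simp add: conj_poisson_def add_divide_distrib)
    finally have e: "1 / (complex_of_real s - \<i> * complex_of_real b) = complex_of_real (conj_poisson b s) + \<i> * complex_of_real (b / (s\<^sup>2 + b\<^sup>2))" .
    have "cis (t * s) / (complex_of_real s - \<i> * complex_of_real b) = cis (t * s) * (1 / (complex_of_real s - \<i> * complex_of_real b))"
      by simp
    then show ?thesis unfolding e q_def by (simp only: distrib_left)
  qed
  then have "(\<integral>s. indicator {-L..L} s * (cis (t * s) / (complex_of_real s - \<i> * complex_of_real b)) \<partial>lborel)
    = (\<integral>s. indicator {-L..L} s * (cis (t * s) * complex_of_real (conj_poisson b s)) \<partial>lborel) + (\<integral>s. q s \<partial>lborel)"
    by (simp only: Bochner_Integration.integral_add[OF fourier_conj_poisson_bound(1)[OF b L] q])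
  then show ?thesis
    using norm_triangle_mono[OF fourier_conj_poisson_bound(2)[OF b L, of t] q_int] pi_less_4 by simp
qed

text \<open>On the interval centred at \<open>Re \<kappa>\<close>, subtracting the value of \<open>\<psi>\<close> there leaves a bounded
  integrand, and what is left is the truncated Fourier transform of a simple pole.\<close>

lemma resolvent_line_bound:
  fixes \<psi> :: "real \<Rightarrow> complex"
  assumes [measurable]: "\<psi> \<in> borel_measurable borel"
    and supp: "\<And>\<tau>. \<tau> \<notin> {0..T} \<Longrightarrow> \<psi> \<tau> = 0"
    and bound: "\<And>\<tau>. norm (\<psi> \<tau>) \<le> B"
    and lip: "\<And>\<tau>. \<bar>\<tau> - Re \<kappa>\<bar> \<le> 2 * T \<Longrightarrow> norm (\<psi> \<tau> - \<psi> (Re \<kappa>)) \<le> B * \<bar>\<tau> - Re \<kappa>\<bar>"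
    and \<kappa>: "0 \<le> Re \<kappa>" "Re \<kappa> \<le> T" "Im \<kappa> \<noteq> 0" "c \<le> norm \<kappa>" "0 < c"
  shows "norm (\<integral>\<tau>. cis (t * \<tau>) * (\<psi> \<tau> / (complex_of_real (\<tau>\<^sup>2) - \<kappa>\<^sup>2)) \<partial>lborel)
    \<le> (B * (4 * T) + B * 12 + B / c * T) / (2 * c)"
proof -
  define \<alpha> where "\<alpha> = Re \<kappa>"
  have T: "0 \<le> T" using \<kappa> by linarith
  have B: "0 \<le> B" using order_trans[OF norm_ge_zero bound] .
  have \<kappa>0: "\<kappa> \<noteq> 0" using \<kappa> by auto
  have ne: "complex_of_real \<tau> - \<kappa> \<noteq> 0" "complex_of_real \<tau> + \<kappa> \<noteq> 0" for \<tau>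
    using \<kappa>(3) by (auto simp: complex_eq_iff)
  \<comment> \<open>Partial fractions: 1/(\<tau>^2 - \<kappa>^2) is 1/(\<tau> - \<kappa>) -
    1/(\<tau> + \<kappa>) divided by 2 \<kappa>. The first pole is split into \<open>f1\<close>,
    with \<psi>(\<alpha>) subtracted, and \<open>f2\<close>; the second goes into \<open>f3\<close>.
    The interval of radius 2T about \<alpha> contains [0, T] because \<alpha> lies in
    [0, T].\<close>
  define f1 where "f1 \<tau> = indicator {\<alpha> - 2 * T..\<alpha> + 2 * T} \<tau> * (cis (t * \<tau>) * ((\<psi> \<tau> - \<psi> \<alpha>) / (complex_of_real \<tau> - \<kappa>)))" for \<tau>
  define f2 where "f2 \<tau> = indicator {\<alpha> - 2 * T..\<alpha> + 2 * T} \<tau> * (cis (t * \<tau>) / (complex_of_real \<tau> - \<kappa>))" for \<tau>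
  define f3 where "f3 \<tau> = indicator {0..T} \<tau> * (cis (t * \<tau>) * (\<psi> \<tau> / (complex_of_real \<tau> + \<kappa>)))" for \<tau>
  have dist_le: "\<bar>\<tau> - \<alpha>\<bar> \<le> norm (complex_of_real \<tau> - \<kappa>)" for \<tau>
    using abs_Re_le_cmod[of "complex_of_real \<tau> - \<kappa>"] by (simp add: \<alpha>_def)
  have b1: "norm (cis (t * \<tau>) * ((\<psi> \<tau> - \<psi> \<alpha>) / (complex_of_real \<tau> - \<kappa>))) \<le> B" if "\<tau> \<in> {\<alpha> - 2 * T..\<alpha> + 2 * T}" for \<tau>
  proof -
    have "norm (\<psi> \<tau> - \<psi> \<alpha>) \<le> B * \<bar>\<tau> - \<alpha>\<bar>" using lip[of \<tau>] that by (auto simp: \<alpha>_def)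
    also have "\<dots> \<le> B * norm (complex_of_real \<tau> - \<kappa>)" by (intro mult_left_mono dist_le B)
    finally show ?thesis using ne(1)[of \<tau>] by (simp add: norm_mult norm_divide divide_le_eq)
  qed
  have b3: "norm (cis (t * \<tau>) * (\<psi> \<tau> / (complex_of_real \<tau> + \<kappa>))) \<le> B / c" if "\<tau> \<in> {0..T}" for \<tau>
  proof -
    \<comment> \<open>Since \<tau> and Re \<kappa> are both nonnegative, adding \<tau> cannot
      decrease the modulus of \<kappa>; the second pole is harmless on the support.\<close>
    have "(norm \<kappa>)\<^sup>2 \<le> (norm (complex_of_real \<tau> + \<kappa>))\<^sup>2"
      using that \<kappa>(1) by (simp add: cmod_power2 power_mono)
    then have "norm \<kappa> \<le> norm (complex_of_real \<tau> + \<kappa>)" by (rule power2_le_imp_le) simp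
    then have "c \<le> norm (complex_of_real \<tau> + \<kappa>)" using \<kappa>(4) by linarith
    then show ?thesis
      unfolding norm_mult norm_divide using bound[of \<tau>] \<kappa>(5) B by (simp add: frac_le)
  qed
  have m1: "(\<lambda>\<tau>. cis (t * \<tau>) * ((\<psi> \<tau> - \<psi> \<alpha>) / (complex_of_real \<tau> - \<kappa>))) \<in> borel_measurable borel"
    and m3: "(\<lambda>\<tau>. cis (t * \<tau>) * (\<psi> \<tau> / (complex_of_real \<tau> + \<kappa>))) \<in> borel_measurable borel"
    by measurable
  have i1: "integrable lborel f1" "norm (\<integral>\<tau>. f1 \<tau> \<partial>lborel) \<le> B * (4 * T)"
    unfolding f1_def using integrable_indicator_interval[where a="\<alpha> - 2 * T" and b="\<alpha> + 2 * T", OF m1 b1] B T by simp_all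
  have i3: "integrable lborel f3" "norm (\<integral>\<tau>. f3 \<tau> \<partial>lborel) \<le> B / c * T"
    unfolding f3_def using integrable_indicator_interval[where a=0 and b=T, OF m3 b3] B T \<kappa>(5) by simp_all
  have b2: "norm (cis (t * \<tau>) / (complex_of_real \<tau> - \<kappa>)) \<le> 1 / \<bar>Im \<kappa>\<bar>" for \<tau>
    using abs_Im_le_cmod[of "complex_of_real \<tau> - \<kappa>"] \<kappa>(3) by (simp add: norm_divide frac_le)
  have i2: "integrable lborel f2"
    unfolding f2_def by (rule integrable_indicator_interval(1)[OF _ b2]) measurable
  have n2: "norm (\<integral>\<tau>. f2 \<tau> \<partial>lborel) \<le> 12"
  proof -
    have "(\<integral>\<tau>. f2 \<tau> \<partial>lborel) = \<bar>1\<bar> *\<^sub>R (\<integral>s. f2 (\<alpha> + 1 * s) \<partial>lborel)"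
      by (rule lborel_integral_real_affine) simp
    also have "\<dots> = (\<integral>s. cis (t * \<alpha>) * (indicator {- (2 * T)..2 * T} s * (cis (t * s) / (complex_of_real s - \<i> * complex_of_real (Im \<kappa>)))) \<partial>lborel)"
    proof -
      have "complex_of_real (\<alpha> + s) - \<kappa> = complex_of_real s - \<i> * complex_of_real (Im \<kappa>)" for s
        by (simp add: complex_eq_iff \<alpha>_def)
      then have "f2 (\<alpha> + 1 * s) = cis (t * \<alpha>) * (indicator {- (2 * T)..2 * T} s * (cis (t * s) / (complex_of_real s - \<i> * complex_of_real (Im \<kappa>))))" for s
        unfolding f2_def by (auto simp: indicator_def distrib_left simp flip: cis_mult)
      then show ?thesis by simp
    qed
    also have "\<dots> = cis (t * \<alpha>) * (\<integral>s. indicator {- (2 * T)..2 * T} s * (cis (t * s) / (complex_of_real s - \<i> * complex_of_real (Im \<kappa>))) \<partial>lborel)"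
      by (rule Bochner_Integration.integral_mult_right_zero)
    finally show ?thesis
      using fourier_pole_bound[OF \<kappa>(3), of "2 * T" t] T by (simp add: norm_mult)
  qed
  have "cis (t * \<tau>) * (\<psi> \<tau> / (complex_of_real (\<tau>\<^sup>2) - \<kappa>\<^sup>2)) = (f1 \<tau> + \<psi> \<alpha> * f2 \<tau> - f3 \<tau>) / (2 * \<kappa>)" for \<tau>
  proof (cases "\<tau> \<in> {0..T}")
    case True
    have "\<alpha> - 2 * T \<le> \<tau>" "\<tau> \<le> \<alpha> + 2 * T" using True \<kappa>(1,2) by (auto simp: \<alpha>_def)
    then have "f1 \<tau> + \<psi> \<alpha> * f2 \<tau> - f3 \<tau> = cis (t * \<tau>) * (\<psi> \<tau> * (1 / (complex_of_real \<tau> - \<kappa>) - 1 / (complex_of_real \<tau> + \<kappa>)))"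
      using True by (simp add: f1_def f2_def f3_def diff_divide_distrib algebra_simps)
    also have "1 / (complex_of_real \<tau> - \<kappa>) - 1 / (complex_of_real \<tau> + \<kappa>) = 2 * \<kappa> / (complex_of_real (\<tau>\<^sup>2) - \<kappa>\<^sup>2)"
    proof -
      have "complex_of_real (\<tau>\<^sup>2) - \<kappa>\<^sup>2 = (complex_of_real \<tau> - \<kappa>) * (complex_of_real \<tau> + \<kappa>)"
        by (simp add: power2_eq_square algebra_simps)
      then show ?thesis using ne[of \<tau>] by (simp add: diff_frac_eq)
    qed
    finally show ?thesis using \<kappa>0 by simp
  next
    case False
    \<comment> \<open>Off the support of \<psi> the subtracted value in \<open>f1\<close> cancels
      against \<psi>(\<alpha>) \<open>f2\<close>.\<close>
    then have "\<psi> \<tau> = 0" by (rule supp)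
    then show ?thesis using False by (simp add: f1_def f2_def f3_def algebra_simps)
  qed
  then have "(\<integral>\<tau>. cis (t * \<tau>) * (\<psi> \<tau> / (complex_of_real (\<tau>\<^sup>2) - \<kappa>\<^sup>2)) \<partial>lborel)
    = (\<integral>\<tau>. (f1 \<tau> + \<psi> \<alpha> * f2 \<tau> - f3 \<tau>) / (2 * \<kappa>) \<partial>lborel)" by (simp only:)
  also have "\<dots> = ((\<integral>\<tau>. f1 \<tau> \<partial>lborel) + \<psi> \<alpha> * (\<integral>\<tau>. f2 \<tau> \<partial>lborel) - (\<integral>\<tau>. f3 \<tau> \<partial>lborel)) / (2 * \<kappa>)"
    using i1(1) i2 i3(1) by simp
  finally have "norm (\<integral>\<tau>. cis (t * \<tau>) * (\<psi> \<tau> / (complex_of_real (\<tau>\<^sup>2) - \<kappa>\<^sup>2)) \<partial>lborel)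
    = norm ((\<integral>\<tau>. f1 \<tau> \<partial>lborel) + \<psi> \<alpha> * (\<integral>\<tau>. f2 \<tau> \<partial>lborel) - (\<integral>\<tau>. f3 \<tau> \<partial>lborel)) / (2 * norm \<kappa>)"
    by (simp add: norm_divide norm_mult)
  also have "\<dots> \<le> (B * (4 * T) + B * 12 + B / c * T) / (2 * c)"
  proof (rule frac_le)
    have "norm (\<psi> \<alpha> * (\<integral>\<tau>. f2 \<tau> \<partial>lborel)) \<le> B * 12"
      unfolding norm_mult by (intro mult_mono bound n2 B) auto
    then show "norm ((\<integral>\<tau>. f1 \<tau> \<partial>lborel) + \<psi> \<alpha> * (\<integral>\<tau>. f2 \<tau> \<partial>lborel) - (\<integral>\<tau>. f3 \<tau> \<partial>lborel)) \<le> B * (4 * T) + B * 12 + B / c * T"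
      using i1(2) i3(2) norm_triangle_ineq4[of "(\<integral>\<tau>. f1 \<tau> \<partial>lborel) + \<psi> \<alpha> * (\<integral>\<tau>. f2 \<tau> \<partial>lborel)" "\<integral>\<tau>. f3 \<tau> \<partial>lborel"]
        norm_triangle_ineq[of "\<integral>\<tau>. f1 \<tau> \<partial>lborel" "\<psi> \<alpha> * (\<integral>\<tau>. f2 \<tau> \<partial>lborel)"] by linarith
    show "0 \<le> B * (4 * T) + B * 12 + B / c * T" using B T \<kappa>(5) by simp
  qed (use \<kappa> in auto)
  finally show ?thesis .
qed

section \<open>The kernels of the localized resolvent\<close>

definition hat_sq :: "'n \<Rightarrow> ('n::finite \<Rightarrow> real) \<Rightarrow> real" where
  "hat_sq j \<eta> = (\<Sum>i\<in>UNIV - {j}. (\<eta> i)\<^sup>2)"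

lemma hat_sq_nonneg: "0 \<le> hat_sq j \<eta>"
  unfolding hat_sq_def by (rule sum_nonneg) simp

lemma join_nth: "join_coord j \<tau> \<eta> $ i = (if i = j then \<tau> else \<eta> i)"
  by (simp add: join_coord_def)

lemma norm_join_sq: "(norm (join_coord j \<tau> \<eta>))\<^sup>2 = \<tau>\<^sup>2 + hat_sq j \<eta>"
proof -
  have "(norm (join_coord j \<tau> \<eta>))\<^sup>2 = (\<Sum>i\<in>UNIV. (join_coord j \<tau> \<eta> $ i)\<^sup>2)"
    by (simp add: norm_vec_def L2_set_def sum_nonneg)
  also have "\<dots> = \<tau>\<^sup>2 + (\<Sum>i\<in>UNIV - {j}. (join_coord j \<tau> \<eta> $ i)\<^sup>2)"
    by (subst sum.remove[of _ j]) (simp_all add: join_nth)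
  also have "(\<Sum>i\<in>UNIV - {j}. (join_coord j \<tau> \<eta> $ i)\<^sup>2) = hat_sq j \<eta>"
    unfolding hat_sq_def by (rule sum.cong) (simp_all add: join_nth)
  finally show ?thesis .
qed

lemma hat_norm_join: "hat_norm j (join_coord j \<tau> \<eta>) = sqrt (hat_sq j \<eta>)"
  unfolding hat_norm_def L2_set_def hat_sq_def
  by (intro arg_cong[where f=sqrt] sum.cong) (simp_all add: join_nth)

lemma norm_join_diff: "norm (join_coord j \<tau> \<eta> - join_coord j \<alpha> \<eta>) = \<bar>\<tau> - \<alpha>\<bar>"
proof -
  have "join_coord j \<tau> \<eta> - join_coord j \<alpha> \<eta> = (\<tau> - \<alpha>) *\<^sub>R axis j 1"
    by (simp add: vec_eq_iff join_nth axis_def)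
  then show ?thesis by simp
qed

text \<open>The partition is controlled only off the origin. The value 0 there makes its members
  measurable and bounded on the whole space.\<close>

definition punct :: "(real ^ 'n::finite \<Rightarrow> real) \<Rightarrow> real ^ 'n \<Rightarrow> real" where
  "punct g \<xi> = (if \<xi> = 0 then 0 else g \<xi>)"

lemma smooth_on_differentiable:
  "smooth_on U g \<Longrightarrow> x \<in> U \<Longrightarrow> g differentiable (at x)"
  "smooth_on U g \<Longrightarrow> x \<in> U \<Longrightarrow> pderiv_at j g differentiable (at x)"
  unfolding smooth_on_def by (metis pderivs.simps(1), metis pderivs.simps)

lemma punct_measurable:
  assumes "smooth_on (- {0}) g"
  shows "punct g \<in> borel_measurable borel"
proof -
  have "continuous_on (- {0}) g"
    using smooth_on_differentiable(1)[OF assms]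
    by (intro continuous_at_imp_continuous_on ballI) (simp add: differentiable_imp_continuous_within)
  then have "(\<lambda>x. if x \<in> {0} then 0 else g x) \<in> borel_measurable borel"
    by (intro borel_measurable_continuous_on_if) auto
  then show ?thesis by (simp add: punct_def[abs_def])
qed

text \<open>A segment that comes close to the origin is long, so there the bound on \<open>g\<close> suffices.\<close>

lemma punct_line_lipschitz:
  fixes g :: "real ^ 'n::finite \<Rightarrow> real"
  assumes smooth: "smooth_on (- {0}) g" and bounds: "\<And>\<xi>. \<xi> \<noteq> 0 \<Longrightarrow> 0 \<le> g \<xi> \<and> g \<xi> \<le> 1" and T: "0 \<le> T"
  obtains B where "0 \<le> B" "\<And>\<eta> \<tau> \<alpha>. hat_sq j \<eta> \<le> 1 \<Longrightarrow> \<bar>\<tau>\<bar> \<le> T \<Longrightarrow> \<bar>\<alpha>\<bar> \<le> T \<Longrightarrow>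
    1/2 \<le> norm (join_coord j \<alpha> \<eta>) \<Longrightarrow>
    \<bar>punct g (join_coord j \<tau> \<eta>) - punct g (join_coord j \<alpha> \<eta>)\<bar> \<le> B * \<bar>\<tau> - \<alpha>\<bar>"
proof -
  \<comment> \<open>This annulus is compact and avoids the origin, so the derivative of
    \<open>g\<close> along direction j is bounded on it.\<close>
  define K where "K = cball (0 :: real ^ 'n) (T + 1) - ball 0 (1/4)"
  have K0: "x \<in> - {0}" if "x \<in> K" for x using that by (auto simp: K_def)
  have "compact K" unfolding K_def by (intro compact_diff compact_cball open_ball)
  moreover have "continuous_on K (pderiv_at j g)"
    using smooth_on_differentiable(2)[OF smooth K0, of _ j]
    by (intro continuous_at_imp_continuous_on ballI) (simp add: differentiable_imp_continuous_within)
  ultimately have "bounded (pderiv_at j g ` K)"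
    by (intro compact_imp_bounded compact_continuous_image)
  then obtain B1 where B1: "\<forall>x\<in>pderiv_at j g ` K. norm x \<le> B1" unfolding bounded_iff by blast
  have p01: "0 \<le> punct g \<xi>" "punct g \<xi> \<le> 1" for \<xi> using bounds[of \<xi>] by (auto simp: punct_def)
  show thesis
  \<comment> \<open>\<open>B1\<close> covers segments inside the annulus; 4 = 1 / (1/2 - 1/4) covers
    those that come within 1/4 of the origin, where the oscillation is at most 1.\<close>
  proof (rule that[of "\<bar>B1\<bar> + 4"])
    fix \<eta> \<tau> \<alpha>
    assume q: "hat_sq j \<eta> \<le> 1" and \<tau>: "\<bar>\<tau>\<bar> \<le> T" and \<alpha>: "\<bar>\<alpha>\<bar> \<le> T" and half: "1/2 \<le> norm (join_coord j \<alpha> \<eta>)"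
    have seg: "\<bar>s\<bar> \<le> T \<and> \<bar>s - \<alpha>\<bar> \<le> \<bar>\<tau> - \<alpha>\<bar>" if "s \<in> closed_segment \<alpha> \<tau>" for s
      using that \<tau> \<alpha> by (auto simp: closed_segment_eq_real_ivl split: if_splits)
    show "\<bar>punct g (join_coord j \<tau> \<eta>) - punct g (join_coord j \<alpha> \<eta>)\<bar> \<le> (\<bar>B1\<bar> + 4) * \<bar>\<tau> - \<alpha>\<bar>"
    proof (cases "\<forall>s\<in>closed_segment \<alpha> \<tau>. 1/4 \<le> norm (join_coord j s \<eta>)")
      case True
      have inK: "join_coord j s \<eta> \<in> K" if "s \<in> closed_segment \<alpha> \<tau>" for s
      proof -
        have "s\<^sup>2 \<le> T\<^sup>2" using seg[OF that] by (metis abs_ge_zero power2_abs power_mono)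
        then have "(norm (join_coord j s \<eta>))\<^sup>2 \<le> (T + 1)\<^sup>2"
          unfolding norm_join_sq using q T by (simp add: power2_eq_square algebra_simps)
        then have "norm (join_coord j s \<eta>) \<le> T + 1" by (rule power2_le_imp_le) (use T in simp)
        then show ?thesis using True that by (auto simp: K_def not_less)
      qed
      have "norm (g (join_coord j \<tau> \<eta>) - g (join_coord j \<alpha> \<eta>)) \<le> \<bar>B1\<bar> * norm (\<tau> - \<alpha>)"
      proof (rule field_differentiable_bound[where S="closed_segment \<alpha> \<tau>" and f="\<lambda>s. g (join_coord j s \<eta>)"
            and f'="\<lambda>s. pderiv_at j g (join_coord j s \<eta>)"])
        fix s assume s: "s \<in> closed_segment \<alpha> \<tau>"
        have "((\<lambda>s. g (join_coord j s \<eta>)) has_vector_derivative pderiv_at j g (join_coord j s \<eta>)) (at s)"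
          by (rule has_vector_derivative_line) (rule smooth_on_differentiable(1)[OF smooth K0[OF inK[OF s]]])
        then show "((\<lambda>s. g (join_coord j s \<eta>)) has_field_derivative pderiv_at j g (join_coord j s \<eta>)) (at s within closed_segment \<alpha> \<tau>)"
          unfolding has_real_derivative_iff_has_vector_derivative by (rule has_vector_derivative_at_within)
        have "norm (pderiv_at j g (join_coord j s \<eta>)) \<le> B1" using B1 inK[OF s] by blast
        then show "norm (pderiv_at j g (join_coord j s \<eta>)) \<le> \<bar>B1\<bar>" by linarith
      qed auto
      moreover have "punct g (join_coord j s \<eta>) = g (join_coord j s \<eta>)" if "s \<in> closed_segment \<alpha> \<tau>" for s
        using K0[OF inK[OF that]] by (simp add: punct_def)
      ultimately have "\<bar>punct g (join_coord j \<tau> \<eta>) - punct g (join_coord j \<alpha> \<eta>)\<bar> \<le> \<bar>B1\<bar> * \<bar>\<tau> - \<alpha>\<bar>" by simp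
      also have "\<dots> \<le> (\<bar>B1\<bar> + 4) * \<bar>\<tau> - \<alpha>\<bar>" by (intro mult_right_mono) auto
      finally show ?thesis .
    next
      case False
      then obtain s where s: "s \<in> closed_segment \<alpha> \<tau>" "norm (join_coord j s \<eta>) < 1/4" by (auto simp: not_le)
      have "1/4 \<le> norm (join_coord j \<alpha> \<eta>) - norm (join_coord j s \<eta>)" using half s(2) by linarith
      also have "\<dots> \<le> \<bar>\<alpha> - s\<bar>" unfolding norm_join_diff[of j \<alpha> \<eta> s, symmetric] by (rule norm_triangle_ineq2)
      finally have "1/4 \<le> \<bar>\<tau> - \<alpha>\<bar>" using seg[OF s(1)] by linarith
      then have "1 \<le> 4 * \<bar>\<tau> - \<alpha>\<bar>" by simp
      also have "\<dots> \<le> (\<bar>B1\<bar> + 4) * \<bar>\<tau> - \<alpha>\<bar>" by (intro mult_right_mono) auto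
      finally show ?thesis
        using p01[of "join_coord j \<tau> \<eta>"] p01[of "join_coord j \<alpha> \<eta>"] by linarith
    qed
  qed simp
qed

text \<open>The numerators \<open>1\<close> and \<open>\<xi>\<^sub>k\<close> of the two multipliers are treated together.\<close>

primrec symbol_factor :: "'n option \<Rightarrow> real ^ 'n::finite \<Rightarrow> real" where
  "symbol_factor None \<xi> = 1"
| "symbol_factor (Some k) \<xi> = \<xi> $ k"

lemma symbol_factor_bounds:
  "\<bar>symbol_factor o' \<xi>\<bar> \<le> 1 + norm \<xi>"
  "\<bar>symbol_factor o' \<xi> - symbol_factor o' \<xi>'\<bar> \<le> norm (\<xi> - \<xi>')"
proof -
  show "\<bar>symbol_factor o' \<xi>\<bar> \<le> 1 + norm \<xi>"
  proof (cases o')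
    case (Some k)
    then show ?thesis using component_le_norm_cart[of \<xi> k] by simp
  qed simp
  show "\<bar>symbol_factor o' \<xi> - symbol_factor o' \<xi>'\<bar> \<le> norm (\<xi> - \<xi>')"
  proof (cases o')
    case (Some k)
    then show ?thesis using component_le_norm_cart[of "\<xi> - \<xi>'" k] by simp
  qed simp
qed

lemma symbol_factor_measurable [measurable]: "symbol_factor o' \<in> borel_measurable borel"
proof (cases o')
  case None
  then have "symbol_factor o' = (\<lambda>_. 1)" by (simp add: fun_eq_iff)
  then show ?thesis by simp
next
  case (Some k)
  then have "symbol_factor o' = (\<lambda>\<xi>. \<xi> $ k)" by (simp add: fun_eq_iff)
  then show ?thesis by simp
qed

text \<open>The principal branch gives Re \<kappa> \<ge> 0. If \<kappa> were real, then \<zeta>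
  would be a nonnegative real number of modulus 1, which is excluded. The bounds on |\<kappa>|^2 =
  |\<zeta> - q| are triangle inequalities.\<close>

lemma csqrt_shift:
  fixes \<zeta> :: complex
  assumes \<zeta>: "norm \<zeta> = 1" "\<zeta> \<noteq> 1" and q: "0 \<le> q"
  defines "\<kappa> \<equiv> csqrt (\<zeta> - complex_of_real q)"
  shows "\<kappa>\<^sup>2 = \<zeta> - complex_of_real q" "0 \<le> Re \<kappa>" "Im \<kappa> \<noteq> 0"
    "1 - q \<le> (norm \<kappa>)\<^sup>2" "(norm \<kappa>)\<^sup>2 \<le> 1 + q"
proof -
  show sq: "\<kappa>\<^sup>2 = \<zeta> - complex_of_real q" by (simp add: \<kappa>_def)
  show "0 \<le> Re \<kappa>" unfolding \<kappa>_def using csqrt_principal[of "\<zeta> - complex_of_real q"] by linarith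
  show "Im \<kappa> \<noteq> 0"
  proof
    assume "Im \<kappa> = 0"
    then have "\<kappa> = complex_of_real (Re \<kappa>)" by (simp add: complex_eq_iff)
    then have *: "\<zeta> = complex_of_real ((Re \<kappa>)\<^sup>2 + q)"
      using sq by (metis diff_add_cancel of_real_add of_real_power)
    then have "\<bar>(Re \<kappa>)\<^sup>2 + q\<bar> = 1" using \<zeta>(1) by (metis norm_of_real)
    then have "(Re \<kappa>)\<^sup>2 + q = 1" using q by simp
    then show False using \<zeta>(2) * by (metis of_real_1)
  qed
  have n: "(norm \<kappa>)\<^sup>2 = norm (\<zeta> - complex_of_real q)" using sq by (metis norm_power)
  show "1 - q \<le> (norm \<kappa>)\<^sup>2" "(norm \<kappa>)\<^sup>2 \<le> 1 + q"
    unfolding n using norm_triangle_ineq2[of \<zeta> "complex_of_real q"] norm_triangle_ineq4[of \<zeta> "complex_of_real q"] \<zeta>(1) q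
    by auto
qed

text \<open>Replacing \<tau> by \<sigma> \<tau> puts the support on the positive half line, where
  only the pole at \<kappa> is close. A nonempty support on the line forces |\<eta>|^2 < \<rho> < 1,
  hence |\<kappa>|^2 > 1 - \<rho>, whatever \<zeta> is.\<close>

lemma cone_kernel_bound:
  fixes g :: "real ^ 'n::finite \<Rightarrow> real" and R \<delta> \<sigma> :: real
  assumes smooth: "smooth_on (- {0}) g" and bounds: "\<And>\<xi>. \<xi> \<noteq> 0 \<Longrightarrow> 0 \<le> g \<xi> \<and> g \<xi> \<le> 1"
    and supp: "\<And>\<xi>. \<xi> \<noteq> 0 \<Longrightarrow> g \<xi> \<noteq> 0 \<Longrightarrow> \<delta> * hat_norm j \<xi> < \<sigma> * \<xi> $ j \<and> norm \<xi> < R"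
    and \<sigma>: "\<sigma> = 1 \<or> \<sigma> = -1" and R: "1 < R" and \<delta>: "sqrt (R\<^sup>2 - 1) < \<delta>"
  obtains C where "\<And>\<zeta> \<eta> t. norm \<zeta> = 1 \<Longrightarrow> \<zeta> \<noteq> 1 \<Longrightarrow>
    norm (\<integral>\<tau>. cis (t * \<tau>) * (complex_of_real (symbol_factor o' (join_coord j \<tau> \<eta>) * punct g (join_coord j \<tau> \<eta>))
      / (complex_of_real ((norm (join_coord j \<tau> \<eta>))\<^sup>2) - \<zeta>)) \<partial>lborel) \<le> C"
proof -
  have R2: "1 < R\<^sup>2" using R by (simp add: one_less_power)
  have \<delta>0: "0 < \<delta>" using \<delta> R2 by (meson le_less_trans real_sqrt_ge_zero diff_ge_0_iff_ge less_imp_le)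
  have "(sqrt (R\<^sup>2 - 1))\<^sup>2 < \<delta>\<^sup>2" using \<delta> R2 by (intro power_strict_mono) auto
  then have \<delta>2: "R\<^sup>2 < 1 + \<delta>\<^sup>2" using R2 by simp
  \<comment> \<open>On the support \<delta>^2 |\<eta>|^2 \<le> \<tau>^2 and \<tau>^2 + |\<eta>|^2 <
    R^2, so |\<eta>|^2 < R^2 / (1 + \<delta>^2). The hypothesis on \<delta> says exactly that this
    quotient is less than 1.\<close>
  define \<rho> where "\<rho> = R\<^sup>2 / (1 + \<delta>\<^sup>2)"
  have \<rho>: "\<rho> < 1" using \<delta>2 R2 by (simp add: \<rho>_def divide_less_eq)
  define c where "c = sqrt (1 - \<rho>)"
  have c: "0 < c" using \<rho> by (simp add: c_def)
  \<comment> \<open>Large enough for the support, which lies in [0, R], and for Re \<kappa> \<le>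
    |\<kappa>| \<le> 2; points within 2T of Re \<kappa> then stay in [-3T, 3T].\<close>
  define T where "T = R + 2"
  have T: "0 \<le> T" "2 \<le> T" using R by (auto simp: T_def)
  obtain Bl where Bl: "0 \<le> Bl" "\<And>\<eta> \<tau> \<alpha>. hat_sq j \<eta> \<le> 1 \<Longrightarrow> \<bar>\<tau>\<bar> \<le> 3 * T \<Longrightarrow> \<bar>\<alpha>\<bar> \<le> 3 * T \<Longrightarrow>
    1/2 \<le> norm (join_coord j \<alpha> \<eta>) \<Longrightarrow>
    \<bar>punct g (join_coord j \<tau> \<eta>) - punct g (join_coord j \<alpha> \<eta>)\<bar> \<le> Bl * \<bar>\<tau> - \<alpha>\<bar>"
    by (rule punct_line_lipschitz[OF smooth bounds, of "3 * T" j]) (use T in auto)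
  \<comment> \<open>Product rule: 3T + 2 bounds the numerator, \<open>Bl\<close> is the Lipschitz
    constant of the cut-off, and the last summand pays for the variation of the numerator and for
    the bound 1 + R.\<close>
  define B where "B = (3 * T + 2) * Bl + (3 * T + 2)"
  have B: "0 \<le> B" "1 + R \<le> B" using T Bl(1) by (auto simp: B_def T_def)
  define C1 where "C1 = (B * (4 * T) + B * 12 + B / c * T) / (2 * c)"
  define C2 where "C2 = \<bar>B * (4/3)\<bar> * \<bar>T - 0\<bar>"
  have C12: "0 \<le> C1" "0 \<le> C2" using B T c by (auto simp: C1_def C2_def)
  have p01: "0 \<le> punct g \<xi>" "punct g \<xi> \<le> 1" for \<xi> using bounds[of \<xi>] by (auto simp: punct_def)
  show thesis
  proof (rule that[of "C1 + C2"])
    fix \<zeta> :: complex and \<eta> t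
    assume \<zeta>: "norm \<zeta> = 1" "\<zeta> \<noteq> 1"
    define q where "q = hat_sq j \<eta>"
    have q0: "0 \<le> q" by (simp add: q_def hat_sq_nonneg)
    define \<kappa> where "\<kappa> = csqrt (\<zeta> - complex_of_real q)"
    note \<kappa> = csqrt_shift[OF \<zeta> q0, folded \<kappa>_def]
    define X where "X \<tau> = join_coord j (\<sigma> * \<tau>) \<eta>" for \<tau>
    define \<psi>r where "\<psi>r \<tau> = symbol_factor o' (X \<tau>) * punct g (X \<tau>)" for \<tau>
    define \<psi> where "\<psi> \<tau> = complex_of_real (\<psi>r \<tau>)" for \<tau>
    have \<sigma>2: "\<sigma> * \<sigma> = 1" "\<bar>\<sigma>\<bar> = 1" using \<sigma> by auto
    have nX: "(norm (X \<tau>))\<^sup>2 = \<tau>\<^sup>2 + q" for \<tau>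
      unfolding X_def norm_join_sq q_def using \<sigma> by auto
    have dX: "norm (X \<tau> - X \<alpha>) = \<bar>\<tau> - \<alpha>\<bar>" for \<tau> \<alpha>
      unfolding X_def norm_join_diff using \<sigma>2(2) by (simp add: abs_mult flip: right_diff_distrib)
    have supp_X: "0 \<le> \<tau> \<and> \<delta> * sqrt q < \<tau> \<and> \<tau>\<^sup>2 + q < R\<^sup>2" if "punct g (X \<tau>) \<noteq> 0" for \<tau>
    proof -
      have "X \<tau> \<noteq> 0" "g (X \<tau>) \<noteq> 0" using that by (auto simp: punct_def split: if_splits)
      from supp[OF this] have 1: "\<delta> * sqrt q < \<sigma> * (\<sigma> * \<tau>)" and 2: "norm (X \<tau>) < R"
        by (simp_all add: X_def hat_norm_join q_def join_nth)
      have "(norm (X \<tau>))\<^sup>2 < R\<^sup>2" by (rule power_strict_mono[OF 2]) auto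
      moreover have "\<delta> * sqrt q < \<tau>" using 1 \<sigma>2(1) by (simp flip: mult.assoc)
      moreover have "0 \<le> \<delta> * sqrt q" using \<delta>0 q0 by simp
      ultimately show ?thesis by (simp add: nX)
    qed
    have \<psi>_supp: "\<psi> \<tau> = 0" if "\<tau> \<notin> {0..T}" for \<tau>
    proof (rule ccontr)
      assume "\<psi> \<tau> \<noteq> 0"
      then have "punct g (X \<tau>) \<noteq> 0" by (auto simp: \<psi>_def \<psi>r_def)
      from supp_X[OF this] have "0 \<le> \<tau>" "\<tau>\<^sup>2 < R\<^sup>2" using q0 by auto
      then have "\<tau> < R" using R by (metis power2_less_imp_less less_imp_le order_trans zero_le_one)
      then show False using that \<open>0 \<le> \<tau>\<close> by (auto simp: T_def)
    qed
    have \<psi>_bound: "norm (\<psi> \<tau>) \<le> B" for \<tau>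
    proof (cases "punct g (X \<tau>) = 0")
      case True
      then show ?thesis using B by (simp add: \<psi>_def \<psi>r_def)
    next
      case False
      then have "(norm (X \<tau>))\<^sup>2 \<le> R\<^sup>2" using supp_X[OF False] by (simp add: nX)
      then have "norm (X \<tau>) \<le> R" by (rule power2_le_imp_le) (use R in simp)
      then have "\<bar>symbol_factor o' (X \<tau>)\<bar> * \<bar>punct g (X \<tau>)\<bar> \<le> (1 + R) * 1"
        using symbol_factor_bounds(1)[of o' "X \<tau>"] p01[of "X \<tau>"] R by (intro mult_mono) auto
      then show ?thesis using B by (simp add: \<psi>_def \<psi>r_def norm_mult)
    qed
    have [measurable]: "\<psi> \<in> borel_measurable borel"
    proof -
      have "(\<lambda>\<xi>. symbol_factor o' \<xi> * punct g \<xi>) \<in> borel_measurable borel"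
        by (intro borel_measurable_times symbol_factor_measurable punct_measurable smooth)
      moreover have "X \<in> borel_measurable borel"
        unfolding X_def by (rule measurable_compose[OF _ join_line_measurable]) simp
      ultimately have "\<psi>r \<in> borel_measurable borel"
        unfolding \<psi>r_def by (rule measurable_compose[rotated])
      then show ?thesis unfolding \<psi>_def by simp
    qed
    have "(\<integral>\<tau>. cis (t * \<tau>) * (complex_of_real (symbol_factor o' (join_coord j \<tau> \<eta>) * punct g (join_coord j \<tau> \<eta>))
      / (complex_of_real ((norm (join_coord j \<tau> \<eta>))\<^sup>2) - \<zeta>)) \<partial>lborel)
      = \<bar>\<sigma>\<bar> *\<^sub>R (\<integral>\<tau>. cis (t * (0 + \<sigma> * \<tau>)) * (complex_of_real (symbol_factor o' (join_coord j (0 + \<sigma> * \<tau>) \<eta>) * punct g (join_coord j (0 + \<sigma> * \<tau>) \<eta>))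
      / (complex_of_real ((norm (join_coord j (0 + \<sigma> * \<tau>) \<eta>))\<^sup>2) - \<zeta>)) \<partial>lborel)"
      by (rule lborel_integral_real_affine) (use \<sigma> in auto)
    also have "\<dots> = (\<integral>\<tau>. cis ((t * \<sigma>) * \<tau>) * (\<psi> \<tau> / (complex_of_real (\<tau>\<^sup>2) - \<kappa>\<^sup>2)) \<partial>lborel)"
    proof -
      have "complex_of_real ((norm (X \<tau>))\<^sup>2) - \<zeta> = complex_of_real (\<tau>\<^sup>2) - \<kappa>\<^sup>2" for \<tau>
        unfolding nX \<kappa>(1) by simp
      then show ?thesis
        unfolding \<sigma>2(2) scaleR_one add_0 X_def[symmetric] \<psi>_def \<psi>r_def by (simp only: mult.assoc)
    qed
    finally have eq: "(\<integral>\<tau>. cis (t * \<tau>) * (complex_of_real (symbol_factor o' (join_coord j \<tau> \<eta>) * punct g (join_coord j \<tau> \<eta>))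
      / (complex_of_real ((norm (join_coord j \<tau> \<eta>))\<^sup>2) - \<zeta>)) \<partial>lborel)
      = (\<integral>\<tau>. cis ((t * \<sigma>) * \<tau>) * (\<psi> \<tau> / (complex_of_real (\<tau>\<^sup>2) - \<kappa>\<^sup>2)) \<partial>lborel)" .
    have "norm (\<integral>\<tau>. cis ((t * \<sigma>) * \<tau>) * (\<psi> \<tau> / (complex_of_real (\<tau>\<^sup>2) - \<kappa>\<^sup>2)) \<partial>lborel) \<le> C1 + C2"
    proof (cases "\<forall>\<tau>. \<psi> \<tau> = 0")
      case True
      then show ?thesis using C12 by simp
    next
      case False
      then obtain \<tau>0 where "punct g (X \<tau>0) \<noteq> 0" by (auto simp: \<psi>_def \<psi>r_def)
      from supp_X[OF this] have s0: "\<delta> * sqrt q < \<tau>0" "\<tau>0\<^sup>2 + q < R\<^sup>2" by auto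
      have "(\<delta> * sqrt q)\<^sup>2 \<le> \<tau>0\<^sup>2" using s0(1) \<delta>0 q0 by (intro power_mono) auto
      then have "\<delta>\<^sup>2 * q + q < R\<^sup>2" using s0(2) q0 by (simp add: power_mult_distrib)
      then have q\<rho>: "q < \<rho>"
        unfolding \<rho>_def by (simp add: pos_less_divide_eq add_pos_nonneg algebra_simps)
      have q1: "q \<le> 1" using q\<rho> \<rho> by simp
      have cn: "c \<le> norm \<kappa>"
      proof (rule power2_le_imp_le)
        have "c\<^sup>2 = 1 - \<rho>" using \<rho> by (simp add: c_def)
        then show "c\<^sup>2 \<le> (norm \<kappa>)\<^sup>2" using \<kappa>(4) q\<rho> by linarith
      qed simp
      have "(norm \<kappa>)\<^sup>2 \<le> 2\<^sup>2" using \<kappa>(5) q1 by simp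
      then have "norm \<kappa> \<le> 2" by (rule power2_le_imp_le) simp
      then have ReT: "Re \<kappa> \<le> T" using complex_Re_le_cmod[of \<kappa>] T by linarith
      show ?thesis
      \<comment> \<open>The question is whether the base point (Re \<kappa>, \<eta>) keeps distance
        1/2 from the origin. If not, |\<kappa>|^2 \<ge> 1 - q forces (Im \<kappa>)^2 \<ge> 3/4, and
        the denominator is bounded below on the whole line.\<close>
      proof (cases "1/4 \<le> (Re \<kappa>)\<^sup>2 + q")
        case True
        have half: "1/2 \<le> norm (X (Re \<kappa>))"
        proof (rule power2_le_imp_le)
          show "(1/2)\<^sup>2 \<le> (norm (X (Re \<kappa>)))\<^sup>2" unfolding nX using True by (simp add: power2_eq_square)
        qed simp
        have lip: "norm (\<psi> \<tau> - \<psi> (Re \<kappa>)) \<le> B * \<bar>\<tau> - Re \<kappa>\<bar>" if \<tau>: "\<bar>\<tau> - Re \<kappa>\<bar> \<le> 2 * T" for \<tau>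
        proof -
          let ?\<alpha> = "Re \<kappa>"
          have ab: "\<bar>\<sigma> * \<tau>\<bar> \<le> 3 * T" "\<bar>\<sigma> * ?\<alpha>\<bar> \<le> 3 * T"
            using \<tau> ReT \<kappa>(2) \<sigma>2(2) by (auto simp: abs_mult)
          have "\<bar>punct g (X \<tau>) - punct g (X ?\<alpha>)\<bar> \<le> Bl * \<bar>\<sigma> * \<tau> - \<sigma> * ?\<alpha>\<bar>"
            unfolding X_def by (rule Bl(2)[OF _ ab]) (use q1 half in \<open>auto simp: q_def X_def\<close>)
          also have "\<bar>\<sigma> * \<tau> - \<sigma> * ?\<alpha>\<bar> = \<bar>\<tau> - ?\<alpha>\<bar>"
            using \<sigma>2(2) by (simp add: abs_mult flip: right_diff_distrib)
          finally have l: "\<bar>punct g (X \<tau>) - punct g (X ?\<alpha>)\<bar> \<le> Bl * \<bar>\<tau> - ?\<alpha>\<bar>" .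
          have "(norm (X \<tau>))\<^sup>2 \<le> (3 * T + 1)\<^sup>2"
          proof -
            have "\<tau>\<^sup>2 \<le> (3 * T)\<^sup>2" using ab(1) \<sigma>2(2) power_mono[of "\<bar>\<tau>\<bar>" "3 * T" 2] by (simp add: abs_mult)
            then show ?thesis unfolding nX using q1 T by (simp add: power2_eq_square algebra_simps)
          qed
          then have "norm (X \<tau>) \<le> 3 * T + 1" by (rule power2_le_imp_le) (use T in simp)
          then have s: "\<bar>symbol_factor o' (X \<tau>)\<bar> \<le> 3 * T + 2" using symbol_factor_bounds(1)[of o' "X \<tau>"] by linarith
          have "\<psi>r \<tau> - \<psi>r ?\<alpha> = symbol_factor o' (X \<tau>) * (punct g (X \<tau>) - punct g (X ?\<alpha>))
              + (symbol_factor o' (X \<tau>) - symbol_factor o' (X ?\<alpha>)) * punct g (X ?\<alpha>)"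
            by (simp add: \<psi>r_def algebra_simps)
          then have "\<bar>\<psi>r \<tau> - \<psi>r ?\<alpha>\<bar> \<le> \<bar>symbol_factor o' (X \<tau>)\<bar> * \<bar>punct g (X \<tau>) - punct g (X ?\<alpha>)\<bar>
              + \<bar>symbol_factor o' (X \<tau>) - symbol_factor o' (X ?\<alpha>)\<bar> * \<bar>punct g (X ?\<alpha>)\<bar>"
            unfolding abs_mult[symmetric] by linarith
          also have "\<dots> \<le> (3 * T + 2) * (Bl * \<bar>\<tau> - ?\<alpha>\<bar>) + \<bar>\<tau> - ?\<alpha>\<bar> * 1"
            using s l symbol_factor_bounds(2)[of o' "X \<tau>" "X ?\<alpha>"] p01[of "X ?\<alpha>"] T
            by (intro add_mono mult_mono) (auto simp: dX)
          also have "\<dots> \<le> B * \<bar>\<tau> - ?\<alpha>\<bar>"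
          proof -
            have "((3 * T + 2) * Bl + 1) * \<bar>\<tau> - ?\<alpha>\<bar> \<le> B * \<bar>\<tau> - ?\<alpha>\<bar>"
              using T by (intro mult_right_mono) (auto simp: B_def)
            then show ?thesis by (simp add: algebra_simps)
          qed
          finally show ?thesis by (simp add: \<psi>_def flip: of_real_diff)
        qed
        have "norm (\<integral>\<tau>. cis ((t * \<sigma>) * \<tau>) * (\<psi> \<tau> / (complex_of_real (\<tau>\<^sup>2) - \<kappa>\<^sup>2)) \<partial>lborel) \<le> C1"
          unfolding C1_def by (rule resolvent_line_bound[OF _ \<psi>_supp \<psi>_bound lip \<kappa>(2) ReT \<kappa>(3) cn c]) measurable
        then show ?thesis using C12 by linarith
      next
        case False
        have n2: "(norm \<kappa>)\<^sup>2 = (Re \<kappa>)\<^sup>2 + (Im \<kappa>)\<^sup>2" by (simp add: cmod_power2)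
        have Im2: "3/4 \<le> (Im \<kappa>)\<^sup>2"
          using \<kappa>(4) False unfolding n2 by linarith
        have den: "3/4 \<le> norm (complex_of_real (\<tau>\<^sup>2) - \<kappa>\<^sup>2)" for \<tau>
        proof -
          have "complex_of_real (\<tau>\<^sup>2) - \<kappa>\<^sup>2 = (complex_of_real \<tau> - \<kappa>) * (complex_of_real \<tau> + \<kappa>)"
            by (simp add: power2_eq_square algebra_simps)
          then have "norm (complex_of_real (\<tau>\<^sup>2) - \<kappa>\<^sup>2) = norm (complex_of_real \<tau> - \<kappa>) * norm (complex_of_real \<tau> + \<kappa>)"
            by (simp only: norm_mult)
          moreover have "\<bar>Im \<kappa>\<bar> * \<bar>Im \<kappa>\<bar> \<le> norm (complex_of_real \<tau> - \<kappa>) * norm (complex_of_real \<tau> + \<kappa>)"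
            using abs_Im_le_cmod[of "complex_of_real \<tau> - \<kappa>"] abs_Im_le_cmod[of "complex_of_real \<tau> + \<kappa>"]
            by (intro mult_mono) auto
          ultimately show ?thesis using Im2 by (simp add: power2_eq_square)
        qed
        have le: "norm (cis ((t * \<sigma>) * \<tau>) * (\<psi> \<tau> / (complex_of_real (\<tau>\<^sup>2) - \<kappa>\<^sup>2))) \<le> B * (4/3)" for \<tau>
        proof -
          have "norm (\<psi> \<tau>) / norm (complex_of_real (\<tau>\<^sup>2) - \<kappa>\<^sup>2) \<le> B / (3/4)"
            by (intro frac_le \<psi>_bound den) (use B in auto)
          then show ?thesis unfolding norm_mult norm_divide norm_cis by simp
        qed
        have m: "(\<lambda>\<tau>. cis ((t * \<sigma>) * \<tau>) * (\<psi> \<tau> / (complex_of_real (\<tau>\<^sup>2) - \<kappa>\<^sup>2))) \<in> borel_measurable borel" by measurable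
        have "(\<integral>\<tau>. cis ((t * \<sigma>) * \<tau>) * (\<psi> \<tau> / (complex_of_real (\<tau>\<^sup>2) - \<kappa>\<^sup>2)) \<partial>lborel)
          = (\<integral>\<tau>. indicator {0..T} \<tau> * (cis ((t * \<sigma>) * \<tau>) * (\<psi> \<tau> / (complex_of_real (\<tau>\<^sup>2) - \<kappa>\<^sup>2))) \<partial>lborel)"
        proof (rule Bochner_Integration.integral_cong[OF refl])
          fix \<tau>
          show "cis ((t * \<sigma>) * \<tau>) * (\<psi> \<tau> / (complex_of_real (\<tau>\<^sup>2) - \<kappa>\<^sup>2))
            = indicator {0..T} \<tau> * (cis ((t * \<sigma>) * \<tau>) * (\<psi> \<tau> / (complex_of_real (\<tau>\<^sup>2) - \<kappa>\<^sup>2)))"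
          proof (cases "\<tau> \<in> {0..T}")
            case False
            then show ?thesis using \<psi>_supp[OF False] by simp
          qed simp
        qed
        then have "norm (\<integral>\<tau>. cis ((t * \<sigma>) * \<tau>) * (\<psi> \<tau> / (complex_of_real (\<tau>\<^sup>2) - \<kappa>\<^sup>2)) \<partial>lborel) \<le> C2"
          unfolding C2_def using integrable_indicator_interval(2)[OF m le, of 0 T] by simp
        then show ?thesis using C12 by linarith
      qed
    qed
    then show "norm (\<integral>\<tau>. cis (t * \<tau>) * (complex_of_real (symbol_factor o' (join_coord j \<tau> \<eta>) * punct g (join_coord j \<tau> \<eta>))
      / (complex_of_real ((norm (join_coord j \<tau> \<eta>))\<^sup>2) - \<zeta>)) \<partial>lborel) \<le> C1 + C2"
      unfolding eq .
  qed
qed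

text \<open>The numerator decides. The numerator 1 leaves decay like 1/(1 + \<tau>^2); \<xi>_k with
  k \<noteq> j leaves a Poisson kernel of width |\<xi>_k|, whose integral does not depend on the
  width; \<xi>_j decays only like 1/\<tau> and needs cancellation.\<close>

lemma outer_kernel_bound:
  fixes g :: "real ^ 'n::finite \<Rightarrow> real" and r R :: real
  assumes smooth: "smooth_on (- {0}) g" and bounds: "\<And>\<xi>. \<xi> \<noteq> 0 \<Longrightarrow> 0 \<le> g \<xi> \<and> g \<xi> \<le> 1"
    and supp: "\<And>\<xi>. \<xi> \<noteq> 0 \<Longrightarrow> g \<xi> \<noteq> 0 \<Longrightarrow> r < norm \<xi>"
    and one: "\<And>\<xi>. R \<le> norm \<xi> \<Longrightarrow> g \<xi> = 1"
    and r: "1 < r" and R: "r < R"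
  obtains C where "\<And>\<zeta> \<eta> t M. norm \<zeta> = 1 \<Longrightarrow> \<zeta> \<noteq> 1 \<Longrightarrow> 0 \<le> M \<Longrightarrow>
    norm (\<integral>\<tau>. cis (t * \<tau>) * (indicator {-M..M} \<tau> * (complex_of_real (symbol_factor o' (join_coord j \<tau> \<eta>) * punct g (join_coord j \<tau> \<eta>))
      / (complex_of_real ((norm (join_coord j \<tau> \<eta>))\<^sup>2) - \<zeta>))) \<partial>lborel) \<le> C"
proof -
  \<comment> \<open>For |\<xi>| > r the denominator is at least |\<xi>|^2 - 1, hence at least c
    |\<xi>|^2.\<close>
  define c where "c = 1 - 1 / r\<^sup>2"
  have r2: "1 < r\<^sup>2" using r by (simp add: one_less_power)
  have "1 / r\<^sup>2 < 1 / 1" by (rule divide_strict_left_mono) (use r2 in auto)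
  then have c: "0 < c" by (simp add: c_def)
  have den: "c * (norm \<xi>)\<^sup>2 \<le> norm (complex_of_real ((norm \<xi>)\<^sup>2) - \<zeta>)" if "norm \<zeta> = 1" "r < norm \<xi>" for \<zeta> and \<xi> :: "real ^ 'n"
  proof -
    have "r\<^sup>2 \<le> (norm \<xi>)\<^sup>2" using that(2) r by (intro power_mono) auto
    then have "1 \<le> (norm \<xi>)\<^sup>2 / r\<^sup>2" using r2 r by (simp add: le_divide_eq)
    then have "c * (norm \<xi>)\<^sup>2 \<le> (norm \<xi>)\<^sup>2 - 1" by (simp add: c_def left_diff_distrib)
    also have "\<dots> \<le> norm (complex_of_real ((norm \<xi>)\<^sup>2) - \<zeta>)"
      using norm_triangle_ineq2[of "complex_of_real ((norm \<xi>)\<^sup>2)" \<zeta>] that(1) by (simp add: norm_power)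
    finally show ?thesis .
  qed
  have p01: "0 \<le> punct g \<xi>" "punct g \<xi> \<le> 1" for \<xi> using bounds[of \<xi>] by (auto simp: punct_def)
  have quot: "norm (complex_of_real (a * punct g \<xi>) / (complex_of_real ((norm \<xi>)\<^sup>2) - \<zeta>)) \<le> \<bar>a\<bar> / (c * (norm \<xi>)\<^sup>2)"
    and gt1: "punct g \<xi> \<noteq> 0 \<Longrightarrow> 1 < norm \<xi>"
    if "norm \<zeta> = 1" for a \<zeta> and \<xi> :: "real ^ 'n"
  proof -
    show "1 < norm \<xi>" if "punct g \<xi> \<noteq> 0"
      using that supp[of \<xi>] r by (auto simp: punct_def split: if_splits)
    show "norm (complex_of_real (a * punct g \<xi>) / (complex_of_real ((norm \<xi>)\<^sup>2) - \<zeta>)) \<le> \<bar>a\<bar> / (c * (norm \<xi>)\<^sup>2)"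
    proof (cases "punct g \<xi> = 0")
      case True
      then show ?thesis using c by simp
    next
      case False
      then have rx: "r < norm \<xi>" using supp[of \<xi>] by (auto simp: punct_def split: if_splits)
      then have "0 < norm \<xi>" using r by linarith
      then have "0 < c * (norm \<xi>)\<^sup>2" using c by simp
      moreover have "\<bar>a\<bar> * \<bar>punct g \<xi>\<bar> \<le> \<bar>a\<bar> * 1" using p01[of \<xi>] by (intro mult_left_mono) auto
      ultimately show ?thesis
        unfolding norm_divide norm_of_real abs_mult using den[OF \<open>norm \<zeta> = 1\<close> rx]
        by (intro frac_le) auto
    qed
  qed
  have int_le: "norm (\<integral>\<tau>. cis (t * \<tau>) * F \<tau> \<partial>lborel) \<le> (\<integral>\<tau>. w \<tau> \<partial>lborel)"
    if "integrable lborel w" "\<And>\<tau>. norm (F \<tau>) \<le> w \<tau>" for t and F :: "real \<Rightarrow> complex" and w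
  proof (rule order_trans[OF integral_norm_bound], rule integral_mono_AE'[OF that(1)])
    show "AE \<tau> in lborel. norm (cis (t * \<tau>) * F \<tau>) \<le> w \<tau>" using that(2) by (simp add: norm_mult)
    show "AE \<tau> in lborel. 0 \<le> w \<tau>" using order_trans[OF norm_ge_zero that(2)] by simp
  qed
  define P where "P \<tau> = inverse (1 + \<tau>\<^sup>2)" for \<tau> :: real
  note P_int = integrable_inverse_1_plus_square'[folded P_def]
  have P_le: "1 / (norm \<xi>)\<^sup>2 \<le> 2 * P (\<xi> $ j)" if "1 < norm \<xi>" for \<xi> :: "real ^ 'n"
  proof -
    have "(\<xi> $ j)\<^sup>2 \<le> (norm \<xi>)\<^sup>2" using component_le_norm_cart[of \<xi> j] by (metis abs_ge_zero power2_abs power_mono)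
    moreover have "1 \<le> (norm \<xi>)\<^sup>2" using that by (simp add: one_le_power)
    ultimately have "(1 + (\<xi> $ j)\<^sup>2) / 2 \<le> (norm \<xi>)\<^sup>2" by simp
    moreover have "0 < 1 + (\<xi> $ j)\<^sup>2" by (simp add: add_pos_nonneg)
    ultimately have "1 / (norm \<xi>)\<^sup>2 \<le> 1 / ((1 + (\<xi> $ j)\<^sup>2) / 2)" by (intro frac_le) auto
    then show ?thesis by (simp add: P_def inverse_eq_divide)
  qed
  have ind_le: "norm (indicator {-M..M} \<tau> * z :: complex) \<le> norm z" for M \<tau> :: real and z
    by (simp add: indicator_def)
  consider "o' = None" | k where "o' = Some k" "k \<noteq> j" | "o' = Some j" by (cases o') auto
  then show thesis
  proof cases
    case 1
    show thesis
    proof (rule that[of "2 / c * pi"])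
      fix \<zeta> :: complex and \<eta> :: "'n \<Rightarrow> real" and t M assume \<zeta>: "norm \<zeta> = 1" "\<zeta> \<noteq> 1" "0 \<le> (M :: real)"
      have le: "norm (indicator {-M..M} \<tau> * (complex_of_real (symbol_factor o' (join_coord j \<tau> \<eta>) * punct g (join_coord j \<tau> \<eta>))
        / (complex_of_real ((norm (join_coord j \<tau> \<eta>))\<^sup>2) - \<zeta>))) \<le> 2 / c * P \<tau>" for \<tau>
      proof (rule order_trans[OF ind_le], cases "punct g (join_coord j \<tau> \<eta>) = 0")
        case True
        then show "norm (complex_of_real (symbol_factor o' (join_coord j \<tau> \<eta>) * punct g (join_coord j \<tau> \<eta>))
          / (complex_of_real ((norm (join_coord j \<tau> \<eta>))\<^sup>2) - \<zeta>)) \<le> 2 / c * P \<tau>"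
          using c inverse_1_plus_square_bounds(1)[of \<tau>] by (simp add: P_def)
      next
        case False
        note quot[OF \<zeta>(1), of "symbol_factor o' (join_coord j \<tau> \<eta>)" "join_coord j \<tau> \<eta>"]
        also have "\<bar>symbol_factor o' (join_coord j \<tau> \<eta>)\<bar> / (c * (norm (join_coord j \<tau> \<eta>))\<^sup>2) = 1 / c * (1 / (norm (join_coord j \<tau> \<eta>))\<^sup>2)"
          using 1 by simp
        also have "\<dots> \<le> 1 / c * (2 * P \<tau>)"
          using P_le[OF gt1[OF \<zeta>(1) False]] c by (intro mult_left_mono) (auto simp: join_nth)
        finally show "norm (complex_of_real (symbol_factor o' (join_coord j \<tau> \<eta>) * punct g (join_coord j \<tau> \<eta>))
          / (complex_of_real ((norm (join_coord j \<tau> \<eta>))\<^sup>2) - \<zeta>)) \<le> 2 / c * P \<tau>" by simp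
      qed
      show "norm (\<integral>\<tau>. cis (t * \<tau>) * (indicator {-M..M} \<tau> * (complex_of_real (symbol_factor o' (join_coord j \<tau> \<eta>) * punct g (join_coord j \<tau> \<eta>))
        / (complex_of_real ((norm (join_coord j \<tau> \<eta>))\<^sup>2) - \<zeta>))) \<partial>lborel) \<le> 2 / c * pi"
      proof -
        have i: "integrable lborel (\<lambda>\<tau>. 2 / c * P \<tau>)" by (intro integrable_mult_right P_int)
        show ?thesis
          using int_le[OF i le] unfolding Bochner_Integration.integral_mult_right_zero P_int(2) .
      qed
    qed
  next
    case (2 k)
    show thesis
    proof (rule that[of "1 / c * pi"])
      fix \<zeta> :: complex and \<eta> :: "'n \<Rightarrow> real" and t M assume \<zeta>: "norm \<zeta> = 1" "\<zeta> \<noteq> 1" "0 \<le> (M :: real)"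
      \<comment> \<open>The k-th coordinate is constant on the line. If it is 0, then so is the
        integrand; otherwise the majorant is a Poisson kernel with integral \<pi>.\<close>
      define b where "b = \<eta> k"
      have le: "norm (indicator {-M..M} \<tau> * (complex_of_real (symbol_factor o' (join_coord j \<tau> \<eta>) * punct g (join_coord j \<tau> \<eta>))
        / (complex_of_real ((norm (join_coord j \<tau> \<eta>))\<^sup>2) - \<zeta>))) \<le> 1 / c * (\<bar>b\<bar> / (\<tau>\<^sup>2 + b\<^sup>2))" for \<tau>
      proof (rule order_trans[OF ind_le], cases "b = 0")
        case True
        then show "norm (complex_of_real (symbol_factor o' (join_coord j \<tau> \<eta>) * punct g (join_coord j \<tau> \<eta>))
          / (complex_of_real ((norm (join_coord j \<tau> \<eta>))\<^sup>2) - \<zeta>)) \<le> 1 / c * (\<bar>b\<bar> / (\<tau>\<^sup>2 + b\<^sup>2))"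
          using 2 by (simp add: join_nth b_def)
      next
        case False
        have "b\<^sup>2 \<le> hat_sq j \<eta>"
          unfolding hat_sq_def b_def by (rule member_le_sum) (use 2 in auto)
        then have "\<tau>\<^sup>2 + b\<^sup>2 \<le> (norm (join_coord j \<tau> \<eta>))\<^sup>2" by (simp add: norm_join_sq)
        then have d: "c * (\<tau>\<^sup>2 + b\<^sup>2) \<le> c * (norm (join_coord j \<tau> \<eta>))\<^sup>2" using c by simp
        have p: "0 < c * (\<tau>\<^sup>2 + b\<^sup>2)" using c sq_plus_pos[OF False] by simp
        note quot[OF \<zeta>(1), of "symbol_factor o' (join_coord j \<tau> \<eta>)" "join_coord j \<tau> \<eta>"]
        also have "\<bar>symbol_factor o' (join_coord j \<tau> \<eta>)\<bar> / (c * (norm (join_coord j \<tau> \<eta>))\<^sup>2) \<le> \<bar>b\<bar> / (c * (\<tau>\<^sup>2 + b\<^sup>2))"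
          using 2 d p by (intro frac_le) (auto simp: join_nth b_def)
        finally show "norm (complex_of_real (symbol_factor o' (join_coord j \<tau> \<eta>) * punct g (join_coord j \<tau> \<eta>))
          / (complex_of_real ((norm (join_coord j \<tau> \<eta>))\<^sup>2) - \<zeta>)) \<le> 1 / c * (\<bar>b\<bar> / (\<tau>\<^sup>2 + b\<^sup>2))" by simp
      qed
      show "norm (\<integral>\<tau>. cis (t * \<tau>) * (indicator {-M..M} \<tau> * (complex_of_real (symbol_factor o' (join_coord j \<tau> \<eta>) * punct g (join_coord j \<tau> \<eta>))
        / (complex_of_real ((norm (join_coord j \<tau> \<eta>))\<^sup>2) - \<zeta>))) \<partial>lborel) \<le> 1 / c * pi"
      proof (cases "b = 0")
        case True
        then show ?thesis using order_trans[OF int_le[OF _ le]] c by simp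
      next
        case False
        have i: "integrable lborel (\<lambda>\<tau>. 1 / c * (\<bar>b\<bar> / (\<tau>\<^sup>2 + b\<^sup>2)))"
          by (intro integrable_mult_right poisson_integral(1) False)
        show ?thesis
          using int_le[OF i le] unfolding Bochner_Integration.integral_mult_right_zero poisson_integral(2)[OF False] .
      qed
    qed
  next
    case 3
    \<comment> \<open>Beyond radius R the error is at most 2/c times \<open>P\<close>; inside it is
      at most 1/c + 1, and there \<open>P\<close> is at least 1/(1 + R^2).\<close>
    define C1 where "C1 = (2 / c + 1) * (1 + R\<^sup>2)"
    show thesis
    proof (rule that[of "8 + C1 * pi"])
      fix \<zeta> :: complex and \<eta> :: "'n \<Rightarrow> real" and t M assume \<zeta>: "norm \<zeta> = 1" "\<zeta> \<noteq> 1" "0 \<le> (M :: real)"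
      \<comment> \<open>With this width \<tau>^2 + b^2 = |\<xi>|^2 + 1: the comparison kernel is the
        symbol of the derivative of the resolvent at the spectral parameter -1, up to the factor i.
        The difference of the two symbols gains two orders of decay.\<close>
      define b where "b = sqrt (1 + hat_sq j \<eta>)"
      have b2: "b\<^sup>2 = 1 + hat_sq j \<eta>" and b: "b \<noteq> 0" using hat_sq_nonneg[of j \<eta>] by (auto simp: b_def)
      define Q where "Q \<tau> = complex_of_real (\<tau> * punct g (join_coord j \<tau> \<eta>)) / (complex_of_real ((norm (join_coord j \<tau> \<eta>))\<^sup>2) - \<zeta>)" for \<tau>
      define E where "E \<tau> = Q \<tau> - complex_of_real (conj_poisson b \<tau>)" for \<tau>
      have cp: "conj_poisson b \<tau> = \<tau> / ((norm (join_coord j \<tau> \<eta>))\<^sup>2 + 1)" for \<tau>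
        unfolding conj_poisson_def b2 norm_join_sq by (simp add: add_ac)
      have E_le: "norm (E \<tau>) \<le> C1 * P \<tau>" for \<tau>
      proof -
        define N where "N = norm (join_coord j \<tau> \<eta>)"
        have \<tau>N: "\<bar>\<tau>\<bar> \<le> N" unfolding N_def by (rule norm_join_ge)
        have \<tau>N2: "\<tau>\<^sup>2 \<le> N\<^sup>2" using \<tau>N by (metis abs_ge_zero power2_abs power_mono)
        have Ppos: "0 < 1 + \<tau>\<^sup>2" by (simp add: add_pos_nonneg)
        show ?thesis
        \<comment> \<open>Beyond radius R the cut-off is 1, so the difference of the symbols is an
          explicit fraction. Within radius R boundedness of both symbols is enough.\<close>
        proof (cases "R \<le> N")
          case True
          then have N1: "1 < N" and rN: "r < N" using r R by auto
          then have "join_coord j \<tau> \<eta> \<noteq> 0" by (auto simp: N_def)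
          then have g1: "punct g (join_coord j \<tau> \<eta>) = 1" using one True by (simp add: punct_def N_def)
          have dN: "c * N\<^sup>2 \<le> norm (complex_of_real (N\<^sup>2) - \<zeta>)" using den[OF \<zeta>(1), of "join_coord j \<tau> \<eta>"] rN by (simp add: N_def)
          have cN: "0 < c * N\<^sup>2" using c N1 by simp
          have nz: "complex_of_real (N\<^sup>2) - \<zeta> \<noteq> 0" using dN cN by auto
          have nz2: "complex_of_real (N\<^sup>2 + 1) \<noteq> 0"
            unfolding of_real_eq_0_iff using zero_le_power2[of N] by linarith
          have "E \<tau> = complex_of_real \<tau> / (complex_of_real (N\<^sup>2) - \<zeta>) - complex_of_real \<tau> / complex_of_real (N\<^sup>2 + 1)"
            unfolding E_def Q_def cp N_def[symmetric] g1 by simp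
          also have "\<dots> = complex_of_real \<tau> * (1 + \<zeta>) / ((complex_of_real (N\<^sup>2) - \<zeta>) * complex_of_real (N\<^sup>2 + 1))"
            using nz nz2 by (subst diff_frac_eq) (auto simp: algebra_simps)
          finally have "norm (E \<tau>) = \<bar>\<tau>\<bar> * norm (1 + \<zeta>) / (norm (complex_of_real (N\<^sup>2) - \<zeta>) * (N\<^sup>2 + 1))"
            by (simp only: norm_divide norm_mult norm_of_real) simp
          also have "\<dots> \<le> (N\<^sup>2 * 2) / (c * N\<^sup>2 * (1 + \<tau>\<^sup>2))"
          proof (rule frac_le)
            have "norm (1 + \<zeta>) \<le> 2" using norm_triangle_ineq[of 1 \<zeta>] \<zeta>(1) by simp
            moreover have "\<bar>\<tau>\<bar> \<le> N\<^sup>2"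
            proof -
              have "N * 1 \<le> N * N" using N1 by (intro mult_left_mono) auto
              then show ?thesis using \<tau>N by (simp add: power2_eq_square)
            qed
            ultimately show "\<bar>\<tau>\<bar> * norm (1 + \<zeta>) \<le> N\<^sup>2 * 2" by (intro mult_mono) auto
            show "0 < c * N\<^sup>2 * (1 + \<tau>\<^sup>2)" using cN Ppos by simp
            show "c * N\<^sup>2 * (1 + \<tau>\<^sup>2) \<le> norm (complex_of_real (N\<^sup>2) - \<zeta>) * (N\<^sup>2 + 1)"
              using \<tau>N2 dN Ppos by (intro mult_mono) auto
          qed simp
          also have "\<dots> = 2 / c * P \<tau>" using N1 by (simp add: P_def inverse_eq_divide)
          also have "\<dots> \<le> C1 * P \<tau>"
          proof (rule mult_right_mono)
            have "2 / c * 1 \<le> (2 / c + 1) * (1 + R\<^sup>2)" using c by (intro mult_mono) auto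
            then show "2 / c \<le> C1" by (simp add: C1_def)
          qed (use inverse_1_plus_square_bounds(1)[of \<tau>] in \<open>simp add: P_def\<close>)
          finally show ?thesis .
        next
          case False
          have "norm (Q \<tau>) \<le> 1 / c"
          proof (cases "punct g (join_coord j \<tau> \<eta>) = 0")
            case True then show ?thesis using c by (simp add: Q_def)
          next
            case nz: False
            have N1: "1 < N" unfolding N_def by (rule gt1[OF \<zeta>(1) nz])
            have "\<bar>\<tau>\<bar> \<le> N\<^sup>2"
            proof -
              have "N * 1 \<le> N * N" using N1 by (intro mult_left_mono) auto
              then show ?thesis using \<tau>N by (simp add: power2_eq_square)
            qed
            then have "\<bar>\<tau>\<bar> / (c * N\<^sup>2) \<le> N\<^sup>2 / (c * N\<^sup>2)" using c by (intro divide_right_mono) auto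
            also have "\<dots> = 1 / c" using N1 by simp
            finally show ?thesis using quot[OF \<zeta>(1), of \<tau> "join_coord j \<tau> \<eta>"] unfolding Q_def N_def by linarith
          qed
          moreover have "\<bar>conj_poisson b \<tau>\<bar> \<le> 1"
          proof -
            have "\<bar>\<tau>\<bar> \<le> \<tau>\<^sup>2 + 1" using zero_le_power2[of "\<bar>\<tau>\<bar> - 1"] by (simp add: power2_eq_square algebra_simps)
            also have "\<dots> \<le> N\<^sup>2 + 1" using \<tau>N2 by simp
            finally have "\<bar>\<tau>\<bar> \<le> N\<^sup>2 + 1" .
            moreover have "0 < N\<^sup>2 + 1" by (simp add: add_nonneg_pos)
            ultimately show ?thesis unfolding cp N_def[symmetric] abs_divide
              by (simp only: abs_of_pos divide_le_eq_1_pos)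
          qed
          ultimately have "norm (E \<tau>) \<le> 1 / c + 1"
            unfolding E_def using norm_triangle_ineq4[of "Q \<tau>" "complex_of_real (conj_poisson b \<tau>)"] by simp
          also have "\<dots> \<le> (2 / c + 1) * ((1 + R\<^sup>2) * P \<tau>)"
          proof -
            have "N\<^sup>2 \<le> R\<^sup>2" using False by (intro power_mono) (auto simp: N_def)
            then have "1 + \<tau>\<^sup>2 \<le> 1 + R\<^sup>2" using \<tau>N2 by linarith
            then have "1 \<le> (1 + R\<^sup>2) * P \<tau>" using Ppos by (simp add: P_def inverse_eq_divide)
            moreover have "1 / c + 1 \<le> 2 / c + 1" using c by (simp add: divide_right_mono)
            ultimately have "(1 / c + 1) * 1 \<le> (2 / c + 1) * ((1 + R\<^sup>2) * P \<tau>)" using c by (intro mult_mono) auto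
            then show ?thesis by simp
          qed
          finally show ?thesis by (simp add: C1_def mult.assoc)
        qed
      qed
      have CP: "integrable lborel (\<lambda>\<tau>. C1 * P \<tau>)" using P_int by simp
      have Qm: "Q \<in> borel_measurable borel"
      proof -
        have "(\<lambda>\<xi>. complex_of_real (\<xi> $ j * punct g \<xi>) / (complex_of_real ((norm \<xi>)\<^sup>2) - \<zeta>)) \<in> borel_measurable borel"
          using punct_measurable[OF smooth] by simp
        from measurable_compose[OF join_line_measurable this, of j \<eta>] show ?thesis
          unfolding Q_def by (simp add: join_nth)
      qed
      have iE: "integrable lborel (\<lambda>\<tau>. indicator {-M..M} \<tau> * (cis (t * \<tau>) * E \<tau>))"
      proof (rule Bochner_Integration.integrable_bound[OF CP])
        show "AE \<tau> in lborel. norm (indicator {-M..M} \<tau> * (cis (t * \<tau>) * E \<tau>)) \<le> norm (C1 * P \<tau>)"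
        proof (rule AE_I2)
          fix \<tau>
          have "norm (indicator {-M..M} \<tau> * (cis (t * \<tau>) * E \<tau>)) \<le> norm (E \<tau>)"
            using ind_le[of M \<tau> "cis (t * \<tau>) * E \<tau>"] by (simp add: norm_mult)
          also have "\<dots> \<le> C1 * P \<tau>" by (rule E_le)
          finally show "norm (indicator {-M..M} \<tau> * (cis (t * \<tau>) * E \<tau>)) \<le> norm (C1 * P \<tau>)" by simp
        qed
        show "(\<lambda>\<tau>. indicator {-M..M} \<tau> * (cis (t * \<tau>) * E \<tau>)) \<in> borel_measurable lborel"
          unfolding E_def using Qm by simp
      qed
      have split: "cis (t * \<tau>) * (indicator {-M..M} \<tau> * Q \<tau>)
          = indicator {-M..M} \<tau> * (cis (t * \<tau>) * complex_of_real (conj_poisson b \<tau>)) + indicator {-M..M} \<tau> * (cis (t * \<tau>) * E \<tau>)" for \<tau>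
        by (simp add: E_def algebra_simps)
      have "(\<integral>\<tau>. cis (t * \<tau>) * (indicator {-M..M} \<tau> * Q \<tau>) \<partial>lborel)
        = (\<integral>\<tau>. indicator {-M..M} \<tau> * (cis (t * \<tau>) * complex_of_real (conj_poisson b \<tau>)) \<partial>lborel)
        + (\<integral>\<tau>. indicator {-M..M} \<tau> * (cis (t * \<tau>) * E \<tau>) \<partial>lborel)"
        unfolding split by (rule Bochner_Integration.integral_add[OF fourier_conj_poisson_bound(1)[OF b \<zeta>(3)] iE])
      moreover have "norm (\<integral>\<tau>. indicator {-M..M} \<tau> * (cis (t * \<tau>) * E \<tau>) \<partial>lborel) \<le> C1 * pi"
      proof -
        have "norm (\<integral>\<tau>. cis (t * \<tau>) * (indicator {-M..M} \<tau> * E \<tau>) \<partial>lborel) \<le> (\<integral>\<tau>. C1 * P \<tau> \<partial>lborel)"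
          by (rule int_le[OF CP order_trans[OF ind_le E_le]])
        also have "(\<integral>\<tau>. C1 * P \<tau> \<partial>lborel) = C1 * pi" using P_int by simp
        finally show ?thesis by (simp only: mult.left_commute[of "indicator _ _"])
      qed
      ultimately have "norm (\<integral>\<tau>. cis (t * \<tau>) * (indicator {-M..M} \<tau> * Q \<tau>) \<partial>lborel) \<le> 8 + C1 * pi"
        using norm_triangle_mono[OF fourier_conj_poisson_bound(2)[OF b \<zeta>(3), of t]] by simp
      then show "norm (\<integral>\<tau>. cis (t * \<tau>) * (indicator {-M..M} \<tau> * (complex_of_real (symbol_factor o' (join_coord j \<tau> \<eta>) * punct g (join_coord j \<tau> \<eta>))
        / (complex_of_real ((norm (join_coord j \<tau> \<eta>))\<^sup>2) - \<zeta>))) \<partial>lborel) \<le> 8 + C1 * pi"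
        using 3 by (simp add: Q_def join_nth)
    qed
  qed
qed

text \<open>A lower bound that degenerates as z approaches the spectrum. It secures integrability
  and membership in L^2 for fixed z and never enters a uniform constant.\<close>

lemma resolvent_denominator_lower:
  assumes z: "z \<notin> \<real>\<^sub>\<ge>\<^sub>0"
  obtains d where "0 < d" "\<And>s. 0 \<le> s \<Longrightarrow> d * (1 + s) \<le> norm (complex_of_real s - z)"
proof -
  obtain d0 where d0: "0 < d0" "\<And>s. 0 \<le> s \<Longrightarrow> d0 \<le> norm (complex_of_real s - z)"
  proof (cases "Im z = 0")
    case False
    show ?thesis
    proof (rule that[of "\<bar>Im z\<bar>"])
      show "\<bar>Im z\<bar> \<le> norm (complex_of_real s - z)" for s
        using abs_Im_le_cmod[of "complex_of_real s - z"] by simp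
    qed (use False in simp)
  next
    case True
    then have "Re z < 0" using z by (auto simp: complex_nonneg_Reals_iff)
    show ?thesis
    proof (rule that[of "- Re z"])
      show "- Re z \<le> norm (complex_of_real s - z)" if "0 \<le> s" for s
        using complex_Re_le_cmod[of "complex_of_real s - z"] that by simp
    qed (use \<open>Re z < 0\<close> in simp)
  qed
  \<comment> \<open>For s \<ge> 2|z| + 1 the distance |s - z| is at least (1 + s)/2; for smaller s
    it is at least \<open>d0\<close>, while 1 + s \<le> 2|z| + 2.\<close>
  define d where "d = min (1/2) (d0 / (2 * norm z + 2))"
  have zp: "0 < 2 * norm z + 2" using norm_ge_zero[of z] by linarith
  show thesis
  proof (rule that[of d])
    show "0 < d" using d0(1) zp by (simp add: d_def)
    fix s :: real assume s: "0 \<le> s"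
    show "d * (1 + s) \<le> norm (complex_of_real s - z)"
    proof (cases "2 * norm z + 1 \<le> s")
      case True
      have "d \<le> 1/2" unfolding d_def by (rule min.cobounded1)
      then have "d * (1 + s) \<le> 1/2 * (1 + s)" using s by (intro mult_right_mono) auto
      also have "\<dots> \<le> s - norm z" using True by simp
      also have "\<dots> \<le> norm (complex_of_real s - z)"
        using norm_triangle_ineq2[of "complex_of_real s" z] s by simp
      finally show ?thesis .
    next
      case False
      have "d * (1 + s) \<le> d0 / (2 * norm z + 2) * (2 * norm z + 2)"
        using False s d0(1) zp by (intro mult_mono) (auto simp: d_def)
      also have "\<dots> = d0" using zp by simp
      also have "\<dots> \<le> norm (complex_of_real s - z)" by (rule d0(2)[OF s])
      finally show ?thesis .
    qed
  qed
qed

section \<open>The partition of unity and the kernel of the localized symbol\<close>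

lemma norm_one_not_one_nonneg: "norm (\<zeta> :: complex) = 1 \<Longrightarrow> \<zeta> \<noteq> 1 \<Longrightarrow> \<zeta> \<notin> \<real>\<^sub>\<ge>\<^sub>0"
  by (auto elim!: nonneg_Reals_cases)

lemma subordinate_onD:
  assumes "subordinate_on U S g" "\<xi> \<in> U"
  shows "0 \<le> g \<xi>" "g \<xi> \<noteq> 0 \<Longrightarrow> \<xi> \<in> S"
  using assms closure_subset[of "support_on U g"]
  by (auto simp: subordinate_on_def support_on_def)

text \<open>Positivity and the sum condition bound every member by 1. Beyond radius R all the cones
  are left behind, so the outer function must be 1 there. The factors 1 and -1 in front of the j-th
  coordinate are the signs \<sigma> of \<open>cone_kernel_bound\<close>.\<close>

lemma frequency_partitionD:
  fixes chip chim :: "'n::finite \<Rightarrow> real ^ 'n \<Rightarrow> real"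
  assumes part: "frequency_partition r R \<delta> chip chim chiinf"
  shows "smooth_on (- {0}) (chip j)" "smooth_on (- {0}) (chim j)" "smooth_on (- {0}) chiinf"
    and "\<xi> \<noteq> 0 \<Longrightarrow> 0 \<le> chip j \<xi> \<and> chip j \<xi> \<le> 1" "\<xi> \<noteq> 0 \<Longrightarrow> 0 \<le> chim j \<xi> \<and> chim j \<xi> \<le> 1"
      "\<xi> \<noteq> 0 \<Longrightarrow> 0 \<le> chiinf \<xi> \<and> chiinf \<xi> \<le> 1"
    and "\<xi> \<noteq> 0 \<Longrightarrow> chip j \<xi> \<noteq> 0 \<Longrightarrow> \<delta> * hat_norm j \<xi> < 1 * \<xi> $ j \<and> norm \<xi> < R"
      "\<xi> \<noteq> 0 \<Longrightarrow> chim j \<xi> \<noteq> 0 \<Longrightarrow> \<delta> * hat_norm j \<xi> < (-1) * \<xi> $ j \<and> norm \<xi> < R"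
      "\<xi> \<noteq> 0 \<Longrightarrow> chiinf \<xi> \<noteq> 0 \<Longrightarrow> r < norm \<xi>"
    and "\<xi> \<noteq> 0 \<Longrightarrow> R \<le> norm \<xi> \<Longrightarrow> chiinf \<xi> = 1"
    and "\<xi> \<noteq> 0 \<Longrightarrow> (\<Sum>j\<in>UNIV. chi chip chim chiinf j \<xi>) = 1"
    and "\<xi> \<noteq> 0 \<Longrightarrow> 0 \<le> chi chip chim chiinf j \<xi> \<and> chi chip chim chiinf j \<xi> \<le> 1"
proof -
  have sp: "subordinate_on (- {0}) (S_plus R \<delta> j) (chip j)" and sm: "subordinate_on (- {0}) (S_minus R \<delta> j) (chim j)"
    and si: "subordinate_on (- {0}) (S_infty r) chiinf"
    and sum: "\<xi> \<noteq> 0 \<Longrightarrow> chiinf \<xi> + (\<Sum>j\<in>UNIV. chip j \<xi> + chim j \<xi>) = 1" for j \<xi>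
    using part by (auto simp: frequency_partition_def)
  show "smooth_on (- {0}) (chip j)" "smooth_on (- {0}) (chim j)" "smooth_on (- {0}) chiinf"
    using sp sm si by (auto simp: subordinate_on_def)
  have nn: "0 \<le> chip j \<xi>" "0 \<le> chim j \<xi>" "0 \<le> chiinf \<xi>" if "\<xi> \<noteq> 0" for j \<xi>
    using that subordinate_onD(1)[OF sp] subordinate_onD(1)[OF sm] subordinate_onD(1)[OF si] by auto
  have S: "chip j \<xi> \<noteq> 0 \<Longrightarrow> \<xi> \<in> S_plus R \<delta> j" "chim j \<xi> \<noteq> 0 \<Longrightarrow> \<xi> \<in> S_minus R \<delta> j" "chiinf \<xi> \<noteq> 0 \<Longrightarrow> \<xi> \<in> S_infty r"
    if "\<xi> \<noteq> 0" for j \<xi>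
    using that subordinate_onD(2)[OF sp] subordinate_onD(2)[OF sm] subordinate_onD(2)[OF si] by auto
  have le: "chip j \<xi> + chim j \<xi> + chiinf \<xi> \<le> 1" if "\<xi> \<noteq> 0" for j \<xi>
  proof -
    have "chip j \<xi> + chim j \<xi> \<le> (\<Sum>j\<in>UNIV. chip j \<xi> + chim j \<xi>)"
      by (rule member_le_sum) (use nn that in auto)
    then show ?thesis using sum[OF that] by linarith
  qed
  show "0 \<le> chip j \<xi> \<and> chip j \<xi> \<le> 1" "0 \<le> chim j \<xi> \<and> chim j \<xi> \<le> 1" "0 \<le> chiinf \<xi> \<and> chiinf \<xi> \<le> 1" if "\<xi> \<noteq> 0"
    using le[OF that, of j] nn(1)[OF that, of j] nn(2)[OF that, of j] nn(3)[OF that] by auto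
  show "\<delta> * hat_norm j \<xi> < 1 * \<xi> $ j \<and> norm \<xi> < R" if "\<xi> \<noteq> 0" "chip j \<xi> \<noteq> 0"
    using S(1)[OF that] by (simp add: S_plus_def)
  show "\<delta> * hat_norm j \<xi> < (-1) * \<xi> $ j \<and> norm \<xi> < R" if "\<xi> \<noteq> 0" "chim j \<xi> \<noteq> 0"
    using S(2)[OF that] by (simp add: S_minus_def)
  show "r < norm \<xi>" if "\<xi> \<noteq> 0" "chiinf \<xi> \<noteq> 0"
    using S(3)[OF that] by (simp add: S_infty_def)
  show "chiinf \<xi> = 1" if "\<xi> \<noteq> 0" "R \<le> norm \<xi>"
  proof -
    have "chip j \<xi> = 0 \<and> chim j \<xi> = 0" for j
      using S(1,2)[OF that(1), of j] that(2) by (auto simp: S_plus_def S_minus_def)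
    then show ?thesis using sum[OF that(1)] by simp
  qed
  show "(\<Sum>j\<in>UNIV. chi chip chim chiinf j \<xi>) = 1" if "\<xi> \<noteq> 0"
    using sum[OF that] by (simp add: chi_def sum.distrib)
  show "0 \<le> chi chip chim chiinf j \<xi> \<and> chi chip chim chiinf j \<xi> \<le> 1" if "\<xi> \<noteq> 0"
  proof -
    have "1 / real CARD('n) * chiinf \<xi> \<le> 1 * chiinf \<xi>"
      using nn(3)[OF that] by (intro mult_right_mono) (auto simp: divide_le_eq Suc_le_eq)
    moreover have "0 \<le> 1 / real CARD('n) * chiinf \<xi>" using nn(3)[OF that] by simp
    ultimately show ?thesis
      unfolding chi_def using le[OF that, of j] nn(1)[OF that, of j] nn(2)[OF that, of j] nn(3)[OF that] by linarith
  qed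
qed

lemma chi_measurable:
  fixes chip chim :: "'n::finite \<Rightarrow> real ^ 'n \<Rightarrow> real"
  assumes part: "frequency_partition r R \<delta> chip chim chiinf"
  shows "chi chip chim chiinf j \<in> borel_measurable borel"
proof -
  note part_facts = frequency_partitionD[OF part]
  have "(\<lambda>\<xi>. if \<xi> \<in> {0} then chi chip chim chiinf j 0 else punct (chip j) \<xi> + punct (chim j) \<xi> + 1 / real CARD('n) * punct chiinf \<xi>) \<in> borel_measurable borel"
    using punct_measurable[OF part_facts(1)] punct_measurable[OF part_facts(2)] punct_measurable[OF part_facts(3)]
    by (intro measurable_If_set) simp_all
  also have "(\<lambda>\<xi>. if \<xi> \<in> {0} then chi chip chim chiinf j 0 else punct (chip j) \<xi> + punct (chim j) \<xi> + 1 / real CARD('n) * punct chiinf \<xi>) = chi chip chim chiinf j"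
    by (auto simp: fun_eq_iff chi_def punct_def)
  finally show ?thesis .
qed

text \<open>A truncation at M \<ge> R does not affect the pieces supported in |\<xi>| < R, so the
  untruncated estimates for the two cones apply; only the outer piece feels it.\<close>

lemma chi_kernel_bound:
  fixes chip chim :: "'n::finite \<Rightarrow> real ^ 'n \<Rightarrow> real" and r R \<delta> :: real
  assumes part: "frequency_partition r R \<delta> chip chim chiinf"
    and r: "1 < r" and R: "r < R" and \<delta>: "sqrt (R\<^sup>2 - 1) < \<delta>"
  obtains C where "\<And>\<zeta> \<eta> t M. norm \<zeta> = 1 \<Longrightarrow> \<zeta> \<noteq> 1 \<Longrightarrow> R \<le> M \<Longrightarrow>
    norm (\<integral>\<tau>. cis (t * \<tau>) * (indicator {-M..M} \<tau> * (complex_of_real (symbol_factor o' (join_coord j \<tau> \<eta>) * chi chip chim chiinf j (join_coord j \<tau> \<eta>))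
      / (complex_of_real ((norm (join_coord j \<tau> \<eta>))\<^sup>2) - \<zeta>))) \<partial>lborel) \<le> C"
proof -
  note part_facts = frequency_partitionD[OF part]
  have R1: "1 < R" using r R by linarith
  define K where "K g \<zeta> \<eta> M \<tau> = indicator {-M..M} \<tau> * (complex_of_real (symbol_factor o' (join_coord j \<tau> \<eta>) * punct g (join_coord j \<tau> \<eta>))
      / (complex_of_real ((norm (join_coord j \<tau> \<eta>))\<^sup>2) - \<zeta>))" for g \<zeta> \<eta> and M \<tau> :: real
  obtain C1 where C1: "\<And>\<zeta> \<eta> t. norm \<zeta> = 1 \<Longrightarrow> \<zeta> \<noteq> 1 \<Longrightarrow>
    norm (\<integral>\<tau>. cis (t * \<tau>) * (complex_of_real (symbol_factor o' (join_coord j \<tau> \<eta>) * punct (chip j) (join_coord j \<tau> \<eta>))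
      / (complex_of_real ((norm (join_coord j \<tau> \<eta>))\<^sup>2) - \<zeta>)) \<partial>lborel) \<le> C1"
    by (rule cone_kernel_bound[where o'=o' and j=j, OF part_facts(1) part_facts(4) part_facts(7) _ R1 \<delta>]) auto
  obtain C2 where C2: "\<And>\<zeta> \<eta> t. norm \<zeta> = 1 \<Longrightarrow> \<zeta> \<noteq> 1 \<Longrightarrow>
    norm (\<integral>\<tau>. cis (t * \<tau>) * (complex_of_real (symbol_factor o' (join_coord j \<tau> \<eta>) * punct (chim j) (join_coord j \<tau> \<eta>))
      / (complex_of_real ((norm (join_coord j \<tau> \<eta>))\<^sup>2) - \<zeta>)) \<partial>lborel) \<le> C2"
    by (rule cone_kernel_bound[where o'=o' and j=j, OF part_facts(2) part_facts(5) part_facts(8) _ R1 \<delta>]) auto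
  have one: "chiinf \<xi> = 1" if "R \<le> norm \<xi>" for \<xi>
    using part_facts(10)[of \<xi>] that R1 by force
  obtain C3 where C3: "\<And>\<zeta> \<eta> t M. norm \<zeta> = 1 \<Longrightarrow> \<zeta> \<noteq> 1 \<Longrightarrow> 0 \<le> M \<Longrightarrow>
    norm (\<integral>\<tau>. cis (t * \<tau>) * (indicator {-M..M} \<tau> * (complex_of_real (symbol_factor o' (join_coord j \<tau> \<eta>) * punct chiinf (join_coord j \<tau> \<eta>))
      / (complex_of_real ((norm (join_coord j \<tau> \<eta>))\<^sup>2) - \<zeta>))) \<partial>lborel) \<le> C3"
    by (rule outer_kernel_bound[where o'=o' and j=j, OF part_facts(3) part_facts(6) part_facts(9) one r R]) auto
  show thesis
  proof (rule that[of "C1 + C2 + 1 / real CARD('n) * C3"])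
    fix \<zeta> :: complex and \<eta> :: "'n \<Rightarrow> real" and t M assume \<zeta>: "norm \<zeta> = 1" "\<zeta> \<noteq> 1" and M: "R \<le> M"
    obtain d where d: "0 < d" "\<And>s. 0 \<le> s \<Longrightarrow> d * (1 + s) \<le> norm (complex_of_real s - \<zeta>)"
      by (rule resolvent_denominator_lower[OF norm_one_not_one_nonneg[OF \<zeta>]]) (rule that)
    \<comment> \<open>The majorant depends on \<zeta> through \<open>d\<close>; it only justifies
      splitting the integral into its three parts.\<close>
    have int: "integrable lborel (\<lambda>\<tau>. cis (t * \<tau>) * K g \<zeta> \<eta> M \<tau>)"
      if g: "smooth_on (- {0}) g" "\<And>\<xi>. \<xi> \<noteq> 0 \<Longrightarrow> 0 \<le> g \<xi> \<and> g \<xi> \<le> 1" for g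
    proof -
      define F where "F \<tau> = cis (t * \<tau>) * (complex_of_real (symbol_factor o' (join_coord j \<tau> \<eta>) * punct g (join_coord j \<tau> \<eta>))
        / (complex_of_real ((norm (join_coord j \<tau> \<eta>))\<^sup>2) - \<zeta>))" for \<tau>
      have F_le: "norm (F \<tau>) \<le> 2 / d" for \<tau>
      proof -
        define N where "N = norm (join_coord j \<tau> \<eta>)"
        have p: "\<bar>punct g (join_coord j \<tau> \<eta>)\<bar> \<le> 1" using g(2)[of "join_coord j \<tau> \<eta>"] by (auto simp: punct_def)
        have s: "\<bar>symbol_factor o' (join_coord j \<tau> \<eta>)\<bar> \<le> 1 + N" unfolding N_def by (rule symbol_factor_bounds)
        have sp: "\<bar>symbol_factor o' (join_coord j \<tau> \<eta>)\<bar> * \<bar>punct g (join_coord j \<tau> \<eta>)\<bar> \<le> (1 + N) * 1"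
          by (intro mult_mono s p) (auto simp: N_def add_nonneg_nonneg)
        have N2: "1 + N \<le> 2 * (1 + N\<^sup>2)"
        proof -
          have "N * 1 \<le> 1 + N * N"
          proof (cases "N \<le> 1")
            case False
            then have "N * 1 \<le> N * N" by (intro mult_left_mono) auto
            then show ?thesis by simp
          qed (simp add: add_increasing2)
          moreover have "1 \<le> 1 + N * N" by simp
          ultimately have "1 + N * 1 \<le> (1 + N * N) + (1 + N * N)" by (rule add_mono[rotated])
          then have "1 + N \<le> (1 + N * N) + (1 + N * N)" by (simp only: mult_1_right)
          then show ?thesis unfolding power2_eq_square mult_2 .
        qed
        have "norm (F \<tau>) = \<bar>symbol_factor o' (join_coord j \<tau> \<eta>)\<bar> * \<bar>punct g (join_coord j \<tau> \<eta>)\<bar> / norm (complex_of_real (N\<^sup>2) - \<zeta>)"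
          unfolding F_def N_def norm_mult norm_divide norm_of_real norm_cis abs_mult by simp
        also have "\<dots> \<le> (2 * (1 + N\<^sup>2)) / (d * (1 + N\<^sup>2))"
        proof (rule frac_le)
          show "\<bar>symbol_factor o' (join_coord j \<tau> \<eta>)\<bar> * \<bar>punct g (join_coord j \<tau> \<eta>)\<bar> \<le> 2 * (1 + N\<^sup>2)"
            by (rule order_trans[OF sp]) (use N2 in simp)
          show "0 < d * (1 + N\<^sup>2)" using d(1) by (intro mult_pos_pos add_pos_nonneg) auto
          show "d * (1 + N\<^sup>2) \<le> norm (complex_of_real (N\<^sup>2) - \<zeta>)" by (rule d(2)) simp
        qed simp
        also have "\<dots> = 2 / d"
          using zero_le_power2[of N] by (metis add_nonneg_eq_0_iff mult_divide_mult_cancel_right zero_le_one zero_neq_one)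
        finally show ?thesis .
      qed
      have Fm: "F \<in> borel_measurable borel"
      proof -
        have "(\<lambda>\<xi>. complex_of_real (symbol_factor o' \<xi> * punct g \<xi>) / (complex_of_real ((norm \<xi>)\<^sup>2) - \<zeta>)) \<in> borel_measurable borel"
          using punct_measurable[OF g(1)] symbol_factor_measurable by simp
        from measurable_compose[OF join_line_measurable this, of j \<eta>] show ?thesis
          unfolding F_def by (intro borel_measurable_times) simp_all
      qed
      have "integrable lborel (\<lambda>\<tau>. indicator {-M..M} \<tau> * F \<tau>)"
        by (rule integrable_indicator_interval(1)[OF Fm F_le])
      then show ?thesis by (simp add: K_def F_def mult.left_commute[of "cis _"])
    qed
    have drop: "cis (t * \<tau>) * K g \<zeta> \<eta> M \<tau> = cis (t * \<tau>) * (complex_of_real (symbol_factor o' (join_coord j \<tau> \<eta>) * punct g (join_coord j \<tau> \<eta>))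
      / (complex_of_real ((norm (join_coord j \<tau> \<eta>))\<^sup>2) - \<zeta>))" if g: "\<And>\<xi>. \<xi> \<noteq> 0 \<Longrightarrow> g \<xi> \<noteq> 0 \<Longrightarrow> norm \<xi> < R" for g \<tau>
    proof (cases "\<tau> \<in> {-M..M}")
      case False
      then have "R \<le> norm (join_coord j \<tau> \<eta>)" using norm_join_ge[of \<tau> j \<eta>] M by auto
      then have "punct g (join_coord j \<tau> \<eta>) = 0" using g[of "join_coord j \<tau> \<eta>"] by (auto simp: punct_def)
      then show ?thesis by (simp add: K_def)
    qed (simp add: K_def)
    have n1: "norm (\<integral>\<tau>. cis (t * \<tau>) * K (chip j) \<zeta> \<eta> M \<tau> \<partial>lborel) \<le> C1"
      using C1[OF \<zeta>, of t \<eta>] part_facts(7) by (subst drop) auto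
    have n2: "norm (\<integral>\<tau>. cis (t * \<tau>) * K (chim j) \<zeta> \<eta> M \<tau> \<partial>lborel) \<le> C2"
      using C2[OF \<zeta>, of t \<eta>] part_facts(8) by (subst drop) auto
    have n3: "norm (\<integral>\<tau>. cis (t * \<tau>) * K chiinf \<zeta> \<eta> M \<tau> \<partial>lborel) \<le> C3"
      unfolding K_def using C3[OF \<zeta>, of M t \<eta>] M R1 by simp
    have i1: "integrable lborel (\<lambda>\<tau>. cis (t * \<tau>) * K (chip j) \<zeta> \<eta> M \<tau>)"
      and i2: "integrable lborel (\<lambda>\<tau>. cis (t * \<tau>) * K (chim j) \<zeta> \<eta> M \<tau>)"
      and i3: "integrable lborel (\<lambda>\<tau>. cis (t * \<tau>) * K chiinf \<zeta> \<eta> M \<tau>)"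
      using int part_facts by auto
    define e where "e = complex_of_real (1 / real CARD('n))"
    have "(\<integral>\<tau>. cis (t * \<tau>) * (indicator {-M..M} \<tau> * (complex_of_real (symbol_factor o' (join_coord j \<tau> \<eta>) * chi chip chim chiinf j (join_coord j \<tau> \<eta>))
      / (complex_of_real ((norm (join_coord j \<tau> \<eta>))\<^sup>2) - \<zeta>))) \<partial>lborel)
      = (\<integral>\<tau>. cis (t * \<tau>) * K (chip j) \<zeta> \<eta> M \<tau> + cis (t * \<tau>) * K (chim j) \<zeta> \<eta> M \<tau> + e * (cis (t * \<tau>) * K chiinf \<zeta> \<eta> M \<tau>) \<partial>lborel)"
    \<comment> \<open>For \<eta> = 0 the line meets the origin at \<tau> = 0, where the partition
      has arbitrary values and differs from its punctured version; this single point is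
      discarded.\<close>
    proof (rule integral_cong_AE)
      show "AE \<tau> in lborel. cis (t * \<tau>) * (indicator {-M..M} \<tau> * (complex_of_real (symbol_factor o' (join_coord j \<tau> \<eta>) * chi chip chim chiinf j (join_coord j \<tau> \<eta>))
        / (complex_of_real ((norm (join_coord j \<tau> \<eta>))\<^sup>2) - \<zeta>)))
        = cis (t * \<tau>) * K (chip j) \<zeta> \<eta> M \<tau> + cis (t * \<tau>) * K (chim j) \<zeta> \<eta> M \<tau> + e * (cis (t * \<tau>) * K chiinf \<zeta> \<eta> M \<tau>)"
        using AE_lborel_singleton[of "0::real"]
      proof eventually_elim
        fix \<tau> :: real assume "\<tau> \<noteq> 0"
        then have nz: "join_coord j \<tau> \<eta> \<noteq> 0" by (metis join_nth zero_index)
        show "cis (t * \<tau>) * (indicator {-M..M} \<tau> * (complex_of_real (symbol_factor o' (join_coord j \<tau> \<eta>) * chi chip chim chiinf j (join_coord j \<tau> \<eta>))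
          / (complex_of_real ((norm (join_coord j \<tau> \<eta>))\<^sup>2) - \<zeta>)))
          = cis (t * \<tau>) * K (chip j) \<zeta> \<eta> M \<tau> + cis (t * \<tau>) * K (chim j) \<zeta> \<eta> M \<tau> + e * (cis (t * \<tau>) * K chiinf \<zeta> \<eta> M \<tau>)"
          using nz by (simp add: K_def punct_def chi_def e_def add_divide_distrib algebra_simps)
      qed
      show "(\<lambda>\<tau>. cis (t * \<tau>) * K (chip j) \<zeta> \<eta> M \<tau> + cis (t * \<tau>) * K (chim j) \<zeta> \<eta> M \<tau> + e * (cis (t * \<tau>) * K chiinf \<zeta> \<eta> M \<tau>)) \<in> borel_measurable lborel"
        using i1 i2 i3 by (intro borel_measurable_integrable) simp
      note chi_m = chi_measurable[OF part, of j]
      have "(\<lambda>\<xi>. complex_of_real (symbol_factor o' \<xi> * chi chip chim chiinf j \<xi>) / (complex_of_real ((norm \<xi>)\<^sup>2) - \<zeta>)) \<in> borel_measurable borel"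
        using chi_m symbol_factor_measurable by simp
      from measurable_compose[OF join_line_measurable this, of j \<eta>]
      show "(\<lambda>\<tau>. cis (t * \<tau>) * (indicator {-M..M} \<tau> * (complex_of_real (symbol_factor o' (join_coord j \<tau> \<eta>) * chi chip chim chiinf j (join_coord j \<tau> \<eta>))
        / (complex_of_real ((norm (join_coord j \<tau> \<eta>))\<^sup>2) - \<zeta>)))) \<in> borel_measurable lborel"
        by (intro borel_measurable_times) simp_all
    qed
    also have "\<dots> = (\<integral>\<tau>. cis (t * \<tau>) * K (chip j) \<zeta> \<eta> M \<tau> \<partial>lborel) + (\<integral>\<tau>. cis (t * \<tau>) * K (chim j) \<zeta> \<eta> M \<tau> \<partial>lborel)
      + e * (\<integral>\<tau>. cis (t * \<tau>) * K chiinf \<zeta> \<eta> M \<tau> \<partial>lborel)"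
      using i1 i2 i3 by simp
    also have "norm \<dots> \<le> C1 + C2 + 1 / real CARD('n) * C3"
    proof (intro norm_triangle_mono n1 n2)
      show "norm (e * (\<integral>\<tau>. cis (t * \<tau>) * K chiinf \<zeta> \<eta> M \<tau> \<partial>lborel)) \<le> 1 / real CARD('n) * C3"
        unfolding norm_mult by (intro mult_mono n3) (auto simp: e_def norm_divide)
    qed
    finally show "norm (\<integral>\<tau>. cis (t * \<tau>) * (indicator {-M..M} \<tau> * (complex_of_real (symbol_factor o' (join_coord j \<tau> \<eta>) * chi chip chim chiinf j (join_coord j \<tau> \<eta>))
      / (complex_of_real ((norm (join_coord j \<tau> \<eta>))\<^sup>2) - \<zeta>))) \<partial>lborel) \<le> C1 + C2 + 1 / real CARD('n) * C3" .
  qed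
qed

text \<open>There are only finitely many pairs of a direction and a numerator, so the constants can
  be added; the summand 1 makes the total positive.\<close>

lemma uniform_chi_kernel_bound:
  fixes chip chim :: "'n::finite \<Rightarrow> real ^ 'n \<Rightarrow> real" and r R \<delta> :: real
  assumes part: "frequency_partition r R \<delta> chip chim chiinf"
    and r: "1 < r" and R: "r < R" and \<delta>: "sqrt (R\<^sup>2 - 1) < \<delta>"
  obtains C where "0 < C" "\<And>j o' \<zeta> \<eta> t M. norm \<zeta> = 1 \<Longrightarrow> \<zeta> \<noteq> 1 \<Longrightarrow> R \<le> M \<Longrightarrow>
    norm (\<integral>\<tau>. cis (t * \<tau>) * (indicator {-M..M} \<tau> * (complex_of_real (symbol_factor o' (join_coord j \<tau> \<eta>) * chi chip chim chiinf j (join_coord j \<tau> \<eta>))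
      / (complex_of_real ((norm (join_coord j \<tau> \<eta>))\<^sup>2) - \<zeta>))) \<partial>lborel) \<le> C"
proof -
  define Q where "Q x C \<longleftrightarrow> (\<forall>\<zeta> \<eta> t M. norm \<zeta> = 1 \<longrightarrow> \<zeta> \<noteq> 1 \<longrightarrow> R \<le> M \<longrightarrow>
    norm (\<integral>\<tau>. cis (t * \<tau>) * (indicator {-M..M} \<tau> * (complex_of_real (symbol_factor (snd x) (join_coord (fst x) \<tau> \<eta>) * chi chip chim chiinf (fst x) (join_coord (fst x) \<tau> \<eta>))
      / (complex_of_real ((norm (join_coord (fst x) \<tau> \<eta>))\<^sup>2) - \<zeta>))) \<partial>lborel) \<le> C)" for x :: "'n \<times> 'n option" and C
  have "\<exists>C. Q x C" for x
    unfolding Q_def by (rule chi_kernel_bound[where j="fst x" and o'="snd x", OF part r R \<delta>]) blast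
  then have "\<exists>C. \<forall>x. Q x (C x)" by (intro choice) blast
  then obtain C where Q: "\<forall>x. Q x (C x)" by blast
  have C: "norm (\<integral>\<tau>. cis (t * \<tau>) * (indicator {-M..M} \<tau> * (complex_of_real (symbol_factor (snd x) (join_coord (fst x) \<tau> \<eta>) * chi chip chim chiinf (fst x) (join_coord (fst x) \<tau> \<eta>))
      / (complex_of_real ((norm (join_coord (fst x) \<tau> \<eta>))\<^sup>2) - \<zeta>))) \<partial>lborel) \<le> C x"
    if "norm \<zeta> = 1" "\<zeta> \<noteq> 1" "R \<le> M" for x \<zeta> \<eta> t M
    using Q[rule_format, of x, unfolded Q_def, rule_format, OF that] .
  have le: "C x \<le> (\<Sum>x\<in>UNIV. \<bar>C x\<bar>) + 1" for x
    using member_le_sum[of x UNIV "\<lambda>x. \<bar>C x\<bar>"] by auto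
  show thesis
  proof (rule that[of "(\<Sum>x\<in>UNIV. \<bar>C x\<bar>) + 1"])
    show "0 < (\<Sum>x\<in>UNIV. \<bar>C x\<bar>) + 1" by (intro add_nonneg_pos sum_nonneg) auto
    fix j o' and \<zeta> :: complex and \<eta> t M assume "norm \<zeta> = 1" "\<zeta> \<noteq> 1" "R \<le> M"
    from order_trans[OF C[OF this, where t=t and x="(j, o')" and \<eta>=\<eta>] le]
    show "norm (\<integral>\<tau>. cis (t * \<tau>) * (indicator {-M..M} \<tau> * (complex_of_real (symbol_factor o' (join_coord j \<tau> \<eta>) * chi chip chim chiinf j (join_coord j \<tau> \<eta>))
      / (complex_of_real ((norm (join_coord j \<tau> \<eta>))\<^sup>2) - \<zeta>))) \<partial>lborel) \<le> (\<Sum>x\<in>UNIV. \<bar>C x\<bar>) + 1"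
      by simp
  qed
qed

section \<open>Scaling and superposition\<close>

definition symbol_scale :: "'n option \<Rightarrow> real \<Rightarrow> real" where
  "symbol_scale o' L = (case o' of None \<Rightarrow> 1 | Some k \<Rightarrow> L)"

lemma symbol_factor_scale: "symbol_factor o' (L *\<^sub>R \<xi>) = symbol_scale o' L * symbol_factor o' \<xi>"
  by (cases o') (simp_all add: symbol_scale_def)

text \<open>With \<open>\<xi> = \<bar>z\<bar>\<^bsup>1/2\<^esup> \<xi>'\<close> the spectral parameter becomes \<open>z / \<bar>z\<bar>\<close>.\<close>

lemma scaled_kernel_bounded:
  fixes \<phi> :: "real ^ 'n::finite \<Rightarrow> real" and z :: complex
  assumes base: "\<And>\<zeta> \<eta> t M. norm \<zeta> = 1 \<Longrightarrow> \<zeta> \<noteq> 1 \<Longrightarrow> R \<le> M \<Longrightarrow>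
    norm (\<integral>\<tau>. cis (t * \<tau>) * (indicator {-M..M} \<tau> * (complex_of_real (symbol_factor o' (join_coord j \<tau> \<eta>) * \<phi> (join_coord j \<tau> \<eta>))
      / (complex_of_real ((norm (join_coord j \<tau> \<eta>))\<^sup>2) - \<zeta>))) \<partial>lborel) \<le> C"
    and z: "z \<notin> \<real>\<^sub>\<ge>\<^sub>0"
  shows "kernel_bounded j (symbol_scale o' (cmod z powr (1/2)) * cmod z powr (-1/2) * C)
    (\<lambda>\<xi>. complex_of_real (symbol_factor o' \<xi> * \<phi> (cmod z powr (-1/2) *\<^sub>R \<xi>)) / (complex_of_real ((norm \<xi>)\<^sup>2) - z))"
proof -
  have z0: "z \<noteq> 0" using z by auto
  define L where "L = cmod z powr (1/2)"
  have L: "0 < L" using z0 by (simp add: L_def)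
  have L2: "L * L = cmod z" using z0 by (simp add: L_def flip: powr_add)
  have Li: "cmod z powr (-1/2) = 1 / L"
    using z0 by (simp add: L_def powr_minus_divide[of _ "1/2", simplified])
  define \<zeta> where "\<zeta> = z / complex_of_real (cmod z)"
  have \<zeta>1: "norm \<zeta> = 1" using z0 by (simp add: \<zeta>_def norm_divide)
  have z\<zeta>: "z = complex_of_real (L * L) * \<zeta>" using z0 by (simp add: \<zeta>_def L2)
  have \<zeta>n: "\<zeta> \<noteq> 1"
  proof
    assume "\<zeta> = 1"
    then have "z = complex_of_real (L * L)" using z\<zeta> by simp
    then show False using z by (metis nonneg_Reals_of_real_iff zero_le_square)
  qed
  define s where "s = symbol_scale o' L"
  have s0: "0 \<le> s" using L by (cases o') (auto simp: s_def symbol_scale_def)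
  show ?thesis
    unfolding kernel_bounded_def
  \<comment> \<open>In the rescaled variable the truncation is at M / L, which has to be at least
    R.\<close>
  proof (intro exI[of _ "L * R"] allI impI)
    fix M t :: real and \<eta> :: "'n \<Rightarrow> real" assume M: "L * R \<le> M"
    define \<eta>' where "\<eta>' = (\<lambda>i. \<eta> i / L)"
    have join: "join_coord j (0 + L * \<tau>) \<eta> = L *\<^sub>R join_coord j \<tau> \<eta>'" for \<tau>
      using L by (simp add: vec_eq_iff join_nth \<eta>'_def)
    define F where "F \<tau> = complex_of_real (symbol_factor o' (join_coord j \<tau> \<eta>') * \<phi> (join_coord j \<tau> \<eta>'))
      / (complex_of_real ((norm (join_coord j \<tau> \<eta>'))\<^sup>2) - \<zeta>)" for \<tau>
    have eq: "cis (t * (0 + L * \<tau>)) * (indicator {-M..M} (0 + L * \<tau>) *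
        (complex_of_real (symbol_factor o' (join_coord j (0 + L * \<tau>) \<eta>) * \<phi> (cmod z powr (-1/2) *\<^sub>R join_coord j (0 + L * \<tau>) \<eta>))
          / (complex_of_real ((norm (join_coord j (0 + L * \<tau>) \<eta>))\<^sup>2) - z)))
      = complex_of_real (s / (L * L)) * (cis ((t * L) * \<tau>) * (indicator {-(M/L)..M/L} \<tau> * F \<tau>))" for \<tau>
    proof -
      have i: "indicator {-M..M} (0 + L * \<tau>) = (indicator {-(M/L)..M/L} \<tau> :: complex)"
        using L by (auto simp: indicator_def field_simps)
      have u: "cmod z powr (-1/2) *\<^sub>R (L *\<^sub>R \<xi>) = \<xi>" for \<xi> :: "real ^ 'n"
        unfolding Li using L by simp
      have d: "complex_of_real ((norm (L *\<^sub>R \<xi>))\<^sup>2) - z = complex_of_real (L * L) * (complex_of_real ((norm \<xi>)\<^sup>2) - \<zeta>)" for \<xi> :: "real ^ 'n"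
        by (subst z\<zeta>) (use L in \<open>simp add: power_mult_distrib power2_eq_square algebra_simps\<close>)
      show ?thesis
        unfolding join i u d symbol_factor_scale s_def[symmetric] F_def
        using L by (simp add: mult_ac)
    qed
    have "(\<integral>\<tau>. cis (t * \<tau>) * (indicator {-M..M} \<tau> *
        (complex_of_real (symbol_factor o' (join_coord j \<tau> \<eta>) * \<phi> (cmod z powr (-1/2) *\<^sub>R join_coord j \<tau> \<eta>))
          / (complex_of_real ((norm (join_coord j \<tau> \<eta>))\<^sup>2) - z))) \<partial>lborel)
      = \<bar>L\<bar> *\<^sub>R (\<integral>\<tau>. complex_of_real (s / (L * L)) * (cis ((t * L) * \<tau>) * (indicator {-(M/L)..M/L} \<tau> * F \<tau>)) \<partial>lborel)"
      unfolding eq[symmetric] by (rule lborel_integral_real_affine) (use L in simp)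
    also have "\<dots> = \<bar>L\<bar> *\<^sub>R (complex_of_real (s / (L * L)) * (\<integral>\<tau>. cis ((t * L) * \<tau>) * (indicator {-(M/L)..M/L} \<tau> * F \<tau>) \<partial>lborel))"
      by (simp only: Bochner_Integration.integral_mult_right_zero)
    finally have I: "norm (\<integral>\<tau>. cis (t * \<tau>) * (indicator {-M..M} \<tau> *
        (complex_of_real (symbol_factor o' (join_coord j \<tau> \<eta>) * \<phi> (cmod z powr (-1/2) *\<^sub>R join_coord j \<tau> \<eta>))
          / (complex_of_real ((norm (join_coord j \<tau> \<eta>))\<^sup>2) - z))) \<partial>lborel)
      = L * (s / (L * L)) * norm (\<integral>\<tau>. cis ((t * L) * \<tau>) * (indicator {-(M/L)..M/L} \<tau> * F \<tau>) \<partial>lborel)"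
      using L s0 by (simp only: norm_scaleR norm_mult norm_of_real) simp
    have "R \<le> M / L" using M L by (simp add: le_divide_eq mult.commute)
    from base[OF \<zeta>1 \<zeta>n this, of "t * L" \<eta>']
    have "norm (\<integral>\<tau>. cis ((t * L) * \<tau>) * (indicator {-(M/L)..M/L} \<tau> * F \<tau>) \<partial>lborel) \<le> C"
      by (simp only: F_def)
    then have le: "L * (s / (L * L)) * norm (\<integral>\<tau>. cis ((t * L) * \<tau>) * (indicator {-(M/L)..M/L} \<tau> * F \<tau>) \<partial>lborel) \<le> L * (s / (L * L)) * C"
      using L s0 by (intro mult_left_mono) auto
    \<comment> \<open>The substitution contributes L, the denominator L^(-2) and the numerator s,
      which is 1 or L; in total 1/L or 1, the two powers of |z| in the theorem.\<close>
    have Ls: "s * (1 / L) = L * (s / (L * L))" using L by simp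
    show "norm (\<integral>\<tau>. cis (t * \<tau>) * (indicator {-M..M} \<tau> *
        (complex_of_real (symbol_factor o' (join_coord j \<tau> \<eta>) * \<phi> (cmod z powr (-1/2) *\<^sub>R join_coord j \<tau> \<eta>))
          / (complex_of_real ((norm (join_coord j \<tau> \<eta>))\<^sup>2) - z))) \<partial>lborel)
      \<le> symbol_scale o' (cmod z powr (1/2)) * cmod z powr (-1/2) * C"
      unfolding I unfolding L_def[symmetric] Li s_def[symmetric] Ls by (rule le)
  qed
qed

text \<open>The localized symbols add up to the full one only off the origin, so the inverse
  transform has to be insensitive to null sets.\<close>

lemma L2_inverse_fourier_cong_AE:
  assumes u: "L2_inverse_fourier G u" and H: "H \<in> borel_measurable borel" and ae: "AE \<xi> in lborel. G \<xi> = H \<xi>"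
  shows "L2_inverse_fourier H u"
proof -
  have G: "G \<in> L2 lborel" using u by (simp add: L2_inverse_fourier_def)
  have [measurable]: "G \<in> borel_measurable borel" using G by (simp add: L2_def)
  note [measurable] = H
  have "L2_sq lborel H = L2_sq lborel G"
    unfolding L2_sq_def by (rule nn_integral_cong_AE) (use ae in eventually_elim, simp)
  then have H2: "H \<in> L2 lborel" using G H by (simp add: L2_def)
  have e: "(\<integral>\<xi>. H \<xi> * h \<xi> \<partial>lborel) = (\<integral>\<xi>. G \<xi> * h \<xi> \<partial>lborel)" if "h \<in> borel_measurable borel" for h
  proof (rule integral_cong_AE)
    show "AE \<xi> in lborel. H \<xi> * h \<xi> = G \<xi> * h \<xi>" using ae by eventually_elim simp
  qed (use that in simp_all)
  have fm: "(\<lambda>\<xi>. fourier h (- \<xi>)) \<in> borel_measurable borel" if "integrable lborel h" for h :: "real ^ 'a \<Rightarrow> complex"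
    using borel_measurable_integrable[OF that] by simp
  show ?thesis
    using u H2 unfolding L2_inverse_fourier_def
    by (auto simp: e fm borel_measurable_integrable)
qed

lemma L2_inverse_fourier_add:
  assumes u: "L2_inverse_fourier G u" and v: "L2_inverse_fourier H v"
  shows "L2_inverse_fourier (\<lambda>\<xi>. G \<xi> + H \<xi>) (\<lambda>x. u x + v x)"
proof -
  have G: "G \<in> L2 lborel" "u \<in> L2 lborel" "H \<in> L2 lborel" "v \<in> L2 lborel"
    using u v by (auto simp: L2_inverse_fourier_def)
  have add: "(\<integral>x. (a x + b x) * h x \<partial>lborel) = (\<integral>x. a x * h x \<partial>lborel) + (\<integral>x. b x * h x \<partial>lborel)"
    if "a \<in> L2 lborel" "b \<in> L2 lborel" "h \<in> L2 lborel" for a b h :: "real ^ 'a \<Rightarrow> complex"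
    unfolding distrib_right by (intro Bochner_Integration.integral_add L2_mult_integrable that)
  show ?thesis
    unfolding L2_inverse_fourier_def
  proof (intro conjI allI impI L2_add G; elim conjE)
    fix h :: "real ^ 'a \<Rightarrow> complex" assume h: "integrable lborel h" "h \<in> L2 lborel"
    have hf: "(\<lambda>\<xi>. fourier h (- \<xi>)) \<in> L2 lborel" by (intro L2_reflect fourier_L2 h)
    show "complex_of_real ((2 * pi) ^ CARD('a)) * (\<integral>x. (u x + v x) * h x \<partial>lborel) = (\<integral>\<xi>. (G \<xi> + H \<xi>) * fourier h (- \<xi>) \<partial>lborel)"
      unfolding add[OF G(2,4) h(2)] add[OF G(1,3) hf] distrib_left
      using u v h unfolding L2_inverse_fourier_def by simp
  next
    fix \<phi> :: "real ^ 'a \<Rightarrow> complex"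
    assume \<phi>: "integrable lborel \<phi>" "continuous_on UNIV \<phi>" "bounded (range \<phi>)" "\<phi> \<in> L2 lborel"
    show "(\<integral>x. (u x + v x) * fourier \<phi> x \<partial>lborel) = (\<integral>\<xi>. (G \<xi> + H \<xi>) * \<phi> \<xi> \<partial>lborel)"
      unfolding add[OF G(2,4) fourier_L2[OF \<phi>(1,4)]] add[OF G(1,3) \<phi>(4)]
      using u v \<phi> unfolding L2_inverse_fourier_def by simp
  qed
qed

lemma L2_inverse_fourier_cmult:
  assumes u: "L2_inverse_fourier G u"
  shows "L2_inverse_fourier (\<lambda>\<xi>. c * G \<xi>) (\<lambda>x. c * u x)"
  using u unfolding L2_inverse_fourier_def
  by (simp add: L2_cmult mult.assoc mult.left_commute[of _ c])

lemma L2_inverse_fourier_zero: "L2_inverse_fourier (\<lambda>_. 0) (\<lambda>_. 0)"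
  by (simp add: L2_inverse_fourier_def L2_def L2_sq_def)

lemma L2_inverse_fourier_sum:
  assumes "finite J" "\<And>j. j \<in> J \<Longrightarrow> L2_inverse_fourier (G j) (u j)"
  shows "L2_inverse_fourier (\<lambda>\<xi>. \<Sum>j\<in>J. G j \<xi>) (\<lambda>x. \<Sum>j\<in>J. u j x)"
  using assms by (induction J rule: finite_induct) (auto intro: L2_inverse_fourier_zero L2_inverse_fourier_add)

lemma Xstar_norm_sum_le:
  assumes "\<And>j. u j \<in> borel_measurable borel"
  shows "Xstar_norm (\<lambda>x. \<Sum>j\<in>UNIV. u j x) \<le> (\<Sum>j\<in>UNIV. mixed_norm \<infinity> 2 j (u j))"
  unfolding Xstar_norm_def by (rule INF_lower) (use assms in simp)

lemma mixed_norm_le_X_norm: "mixed_norm 1 2 j f \<le> X_norm f"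
  unfolding X_norm_def by (rule Max_ge) auto

text \<open>Numerator and weight together grow at most like (1 + |\<xi>|)^2 \<le> 2 (1 + |\<xi>|^2),
  which the denominator absorbs. The bound depends on z.\<close>

lemma resolvent_symbol_bound:
  fixes \<phi> :: "real ^ 'n::finite \<Rightarrow> real"
  assumes z: "z \<notin> \<real>\<^sub>\<ge>\<^sub>0" and \<phi>: "\<And>\<xi>. \<bar>\<phi> \<xi>\<bar> \<le> b"
  obtains B where "\<And>\<xi>. norm (complex_of_real (symbol_factor o' \<xi> * \<phi> \<xi>) / (complex_of_real ((norm \<xi>)\<^sup>2) - z)) * (1 + norm \<xi>) \<le> B"
proof -
  obtain d where d: "0 < d" "\<And>s. 0 \<le> s \<Longrightarrow> d * (1 + s) \<le> norm (complex_of_real s - z)"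
    by (rule resolvent_denominator_lower[OF z]) (rule that)
  have b0: "0 \<le> b" using order_trans[OF abs_ge_zero \<phi>] .
  show thesis
  proof (rule that[of "2 * b / d"])
    fix \<xi> :: "real ^ 'n"
    define N where "N = norm \<xi>"
    have N0: "0 \<le> N" by (simp add: N_def)
    have "\<bar>symbol_factor o' \<xi>\<bar> * \<bar>\<phi> \<xi>\<bar> * (1 + N) \<le> (1 + N) * b * (1 + N)"
      using symbol_factor_bounds(1)[of o' \<xi>] \<phi>[of \<xi>] N0 by (intro mult_mono) (auto simp: N_def)
    also have "\<dots> = b * (1 + N)\<^sup>2" by (simp add: power2_eq_square mult_ac)
    also have "\<dots> \<le> b * (2 * (1 + N\<^sup>2))"
      using zero_le_power2[of "1 - N"] b0 by (intro mult_left_mono) (simp_all add: power2_eq_square algebra_simps)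
    finally have num: "\<bar>symbol_factor o' \<xi>\<bar> * \<bar>\<phi> \<xi>\<bar> * (1 + N) \<le> b * (2 * (1 + N\<^sup>2))" .
    have N2: "0 < 1 + N\<^sup>2" by (simp add: add_pos_nonneg)
    have "norm (complex_of_real (symbol_factor o' \<xi> * \<phi> \<xi>) / (complex_of_real ((norm \<xi>)\<^sup>2) - z)) * (1 + norm \<xi>)
      = \<bar>symbol_factor o' \<xi>\<bar> * \<bar>\<phi> \<xi>\<bar> * (1 + N) / norm (complex_of_real (N\<^sup>2) - z)"
      unfolding norm_divide norm_of_real abs_mult N_def by simp
    also have "\<dots> \<le> b * (2 * (1 + N\<^sup>2)) / (d * (1 + N\<^sup>2))"
    proof (rule frac_le[OF _ num])
      show "0 \<le> b * (2 * (1 + N\<^sup>2))" using b0 N2 by simp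
      show "0 < d * (1 + N\<^sup>2)" using d(1) N2 by simp
      show "d * (1 + N\<^sup>2) \<le> norm (complex_of_real (N\<^sup>2) - z)" by (rule d(2)) simp
    qed
    also have "\<dots> = 2 * b / d"
    proof -
      have "b * (2 * x) / (d * x) = 2 * b / d" if "x \<noteq> 0" for x using that by simp
      from this[OF less_imp_neq[OF N2, symmetric]] show ?thesis .
    qed
    finally show "norm (complex_of_real (symbol_factor o' \<xi> * \<phi> \<xi>) / (complex_of_real ((norm \<xi>)\<^sup>2) - z)) * (1 + norm \<xi>) \<le> 2 * b / d" .
  qed
qed

text \<open>All outputs stem from one transform \<open>g\<close>: \<open>v\<close> without and
  \<open>u\<close> with the frequency localization. The estimate is conditional on j because f may
  lie in the mixed space of a single direction, while membership in X makes all directions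
  available.\<close>

lemma chi_resolvent_pieces:
  fixes chip chim :: "'n::finite \<Rightarrow> real ^ 'n \<Rightarrow> real" and z :: complex
  assumes part: "frequency_partition r R \<delta> chip chim chiinf"
    and base: "\<And>j o' \<zeta> \<eta> t M. norm \<zeta> = 1 \<Longrightarrow> \<zeta> \<noteq> 1 \<Longrightarrow> R \<le> M \<Longrightarrow>
    norm (\<integral>\<tau>. cis (t * \<tau>) * (indicator {-M..M} \<tau> * (complex_of_real (symbol_factor o' (join_coord j \<tau> \<eta>) * chi chip chim chiinf j (join_coord j \<tau> \<eta>))
      / (complex_of_real ((norm (join_coord j \<tau> \<eta>))\<^sup>2) - \<zeta>))) \<partial>lborel) \<le> C"
    and z: "z \<notin> \<real>\<^sub>\<ge>\<^sub>0" and f: "f \<in> mixed_space 1 2 j0"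
  obtains g v u where "g \<in> borel_measurable borel" "has_fourier f g"
    "\<And>o'. L2_inverse_fourier (\<lambda>\<xi>. complex_of_real (symbol_factor o' \<xi>) / (complex_of_real ((norm \<xi>)\<^sup>2) - z) * g \<xi>) (v o')"
    "\<And>o' j. L2_inverse_fourier (\<lambda>\<xi>. complex_of_real (symbol_factor o' \<xi> * chi chip chim chiinf j (cmod z powr (-1/2) *\<^sub>R \<xi>))
        / (complex_of_real ((norm \<xi>)\<^sup>2) - z) * g \<xi>) (u o' j)"
    "\<forall>o' j. f \<in> mixed_space 1 2 j \<longrightarrow>
      mixed_norm \<infinity> 2 j (u o' j) \<le> ennreal (symbol_scale o' (cmod z powr (1/2)) * cmod z powr (-1/2) * C) * mixed_norm 1 2 j f"
proof (rule mixed_multiplier_estimate[OF f])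
  fix g assume g: "g \<in> borel_measurable borel" "has_fourier f g"
    and gL2: "\<And>m B. m \<in> borel_measurable borel \<Longrightarrow> (\<And>\<xi>. norm (m \<xi>) * (1 + norm \<xi>) \<le> B) \<Longrightarrow> (\<lambda>\<xi>. m \<xi> * g \<xi>) \<in> L2 lborel"
    and est: "\<And>m B u j A. m \<in> borel_measurable borel \<Longrightarrow> (\<And>\<xi>. norm (m \<xi>) * (1 + norm \<xi>) \<le> B) \<Longrightarrow>
      L2_inverse_fourier (\<lambda>\<xi>. m \<xi> * g \<xi>) u \<Longrightarrow> kernel_bounded j A m \<Longrightarrow> f \<in> mixed_space 1 2 j \<Longrightarrow>
      mixed_norm \<infinity> 2 j u \<le> ennreal A * mixed_norm 1 2 j f"
  define m where "m o' \<phi> \<xi> = complex_of_real (symbol_factor o' \<xi> * \<phi> \<xi>) / (complex_of_real ((norm \<xi>)\<^sup>2) - z)"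
    for o' and \<phi> :: "real ^ 'n \<Rightarrow> real" and \<xi>
  have mm: "m o' \<phi> \<in> borel_measurable borel" if "\<phi> \<in> borel_measurable borel" for o' \<phi>
    unfolding m_def using that symbol_factor_measurable by simp
  have mB: "\<exists>B. \<forall>\<xi>. norm (m o' \<phi> \<xi>) * (1 + norm \<xi>) \<le> B" if "\<And>\<xi>. \<bar>\<phi> \<xi>\<bar> \<le> b" for o' \<phi> b
  proof (rule resolvent_symbol_bound[where o'=o' and \<phi>=\<phi> and b=b, OF z])
    show "\<bar>\<phi> \<xi>\<bar> \<le> b" for \<xi> by (rule that)
  next
    fix B assume "\<And>\<xi>. norm (complex_of_real (symbol_factor o' \<xi> * \<phi> \<xi>) / (complex_of_real ((norm \<xi>)\<^sup>2) - z)) * (1 + norm \<xi>) \<le> B"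
    then show ?thesis unfolding m_def by blast
  qed
  have ex: "\<exists>u. L2_inverse_fourier (\<lambda>\<xi>. m o' \<phi> \<xi> * g \<xi>) u"
    if \<phi>: "\<phi> \<in> borel_measurable borel" "\<And>\<xi>. \<bar>\<phi> \<xi>\<bar> \<le> b" for o' \<phi> b
  proof -
    obtain B where B: "\<And>\<xi>. norm (m o' \<phi> \<xi>) * (1 + norm \<xi>) \<le> B"
      using mB[where \<phi>=\<phi> and b=b, OF \<phi>(2)] by blast
    show ?thesis
      by (rule L2_inverse_fourier_exists[OF gL2[OF mm[OF \<phi>(1)] B]])
  qed
  define \<phi> where "\<phi> j \<xi> = chi chip chim chiinf j (cmod z powr (-1/2) *\<^sub>R \<xi>)" for j \<xi>
  have \<phi>m: "\<phi> j \<in> borel_measurable borel" for j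
    unfolding \<phi>_def by (rule measurable_compose[OF _ chi_measurable[OF part]]) simp
  \<comment> \<open>The partition may take any value at the origin, so that value enters the
    bound.\<close>
  have \<phi>b: "\<bar>\<phi> j \<xi>\<bar> \<le> 1 + \<bar>chi chip chim chiinf j 0\<bar>" for j \<xi>
    using frequency_partitionD(12)[OF part, of "cmod z powr (-1/2) *\<^sub>R \<xi>" j]
    by (cases "cmod z powr (-1/2) *\<^sub>R \<xi> = 0") (auto simp: \<phi>_def)
  have "\<exists>v. \<forall>o'. L2_inverse_fourier (\<lambda>\<xi>. m o' (\<lambda>_. 1) \<xi> * g \<xi>) (v o')"
    by (intro choice allI ex[where b=1]) simp_all
  then obtain v where v: "\<And>o'. L2_inverse_fourier (\<lambda>\<xi>. m o' (\<lambda>_. 1) \<xi> * g \<xi>) (v o')" by blast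
  have "\<exists>u. \<forall>o' j. L2_inverse_fourier (\<lambda>\<xi>. m o' (\<phi> j) \<xi> * g \<xi>) (u o' j)"
    using ex[OF \<phi>m \<phi>b] by metis
  then obtain u where u: "\<And>o' j. L2_inverse_fourier (\<lambda>\<xi>. m o' (\<phi> j) \<xi> * g \<xi>) (u o' j)" by blast
  show thesis
  proof (rule that[OF g, of v u])
    show "L2_inverse_fourier (\<lambda>\<xi>. complex_of_real (symbol_factor o' \<xi>) / (complex_of_real ((norm \<xi>)\<^sup>2) - z) * g \<xi>) (v o')" for o'
      using v[of o'] by (simp add: m_def)
    show "L2_inverse_fourier (\<lambda>\<xi>. complex_of_real (symbol_factor o' \<xi> * chi chip chim chiinf j (cmod z powr (-1/2) *\<^sub>R \<xi>))
        / (complex_of_real ((norm \<xi>)\<^sup>2) - z) * g \<xi>) (u o' j)" for o' j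
      using u[of o' j] unfolding m_def \<phi>_def .
    show "\<forall>o' j. f \<in> mixed_space 1 2 j \<longrightarrow>
      mixed_norm \<infinity> 2 j (u o' j) \<le> ennreal (symbol_scale o' (cmod z powr (1/2)) * cmod z powr (-1/2) * C) * mixed_norm 1 2 j f"
    proof (intro allI impI)
      fix o' j assume fj: "f \<in> mixed_space 1 2 j"
      obtain B where B: "\<And>\<xi>. norm (m o' (\<phi> j) \<xi>) * (1 + norm \<xi>) \<le> B"
        using mB[where \<phi>="\<phi> j", OF \<phi>b] by blast
      have "kernel_bounded j (symbol_scale o' (cmod z powr (1/2)) * cmod z powr (-1/2) * C) (m o' (\<phi> j))"
        unfolding m_def \<phi>_def by (rule scaled_kernel_bounded[OF base z])
      from est[OF mm[OF \<phi>m] B u this fj]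
      show "mixed_norm \<infinity> 2 j (u o' j) \<le> ennreal (symbol_scale o' (cmod z powr (1/2)) * cmod z powr (-1/2) * C) * mixed_norm 1 2 j f" .
    qed
  qed
qed

section \<open>Localized estimates and their sum over the directions\<close>

theorem lemma1:
  fixes r R \<delta> :: real
    and chip chim :: "'n::finite \<Rightarrow> real ^ 'n \<Rightarrow> real"
    and chiinf :: "real ^ 'n \<Rightarrow> real"
  assumes "CARD('n) \<ge> 2"
    and "1 < r" and "r < R" and "sqrt (R\<^sup>2 - 1) < \<delta>" and "\<delta> < 1"
    and "frequency_partition r R \<delta> chip chim chiinf"
  shows "\<exists>C>0. \<forall>z. z \<notin> \<real>\<^sub>\<ge>\<^sub>0 \<longrightarrow>
     (\<forall>j k. \<forall>f \<in> mixed_space 1 2 j.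
        (\<exists>u. (resolvent_laplacian z OO scaled_multiplier z (chi chip chim chiinf j)) f u \<and>
             mixed_norm \<infinity> 2 j u \<le> ennreal (C * cmod z powr (-1/2)) * mixed_norm 1 2 j f) \<and>
        (\<exists>u. (resolvent_laplacian z OO weak_pderiv k OO
                scaled_multiplier z (chi chip chim chiinf j)) f u \<and>
             mixed_norm \<infinity> 2 j u \<le> ennreal C * mixed_norm 1 2 j f)) \<and>
     opnorm_X_Xstar (resolvent_laplacian z :: (real ^ 'n \<Rightarrow> complex) \<Rightarrow> _)
       \<le> ennreal (C * cmod z powr (-1/2)) \<and>
     (\<forall>k::'n. opnorm_X_Xstar (resolvent_laplacian z OO weak_pderiv k) \<le> ennreal C)"
proof -
  note part = assms(6)
  obtain C where C: "0 < C" and base: "\<And>j o' \<zeta> \<eta> t M. norm \<zeta> = 1 \<Longrightarrow> \<zeta> \<noteq> 1 \<Longrightarrow> R \<le> M \<Longrightarrow>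
    norm (\<integral>\<tau>. cis (t * \<tau>) * (indicator {-M..M} \<tau> * (complex_of_real (symbol_factor o' (join_coord j \<tau> \<eta>) * chi chip chim chiinf j (join_coord j \<tau> \<eta>))
      / (complex_of_real ((norm (join_coord j \<tau> \<eta>))\<^sup>2) - \<zeta>))) \<partial>lborel) \<le> C"
    by (rule uniform_chi_kernel_bound[OF part assms(2-4)]) (rule that)
  \<comment> \<open>In X^* the n localized pieces are measured each in its own direction and their
    norms add up; the factor n is put into the constant from the start.\<close>
  define n where "n = real CARD('n)"
  have n: "1 \<le> n" using assms(1) by (simp add: n_def)
  have nC: "C \<le> n * C" using n C by simp
  show ?thesis
  proof (intro exI[of _ "n * C"] conjI allI impI ballI)
    show "0 < n * C" using n C by simp
    fix z :: complex assume z: "z \<notin> \<real>\<^sub>\<ge>\<^sub>0"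
    then have z0: "z \<noteq> 0" by auto
    define D where "D \<xi> = complex_of_real ((norm \<xi>)\<^sup>2) - z" for \<xi> :: "real ^ 'n"
    define X where "X j \<xi> = complex_of_real (chi chip chim chiinf j (cmod z powr (-1/2) *\<^sub>R \<xi>))" for j \<xi>
    define A where "A o' = symbol_scale o' (cmod z powr (1/2)) * cmod z powr (-1/2) * C" for o' :: "'n option"
    have A_None: "A None = C * cmod z powr (-1/2)" by (simp add: A_def symbol_scale_def)
    \<comment> \<open>The numerator \<xi>_k scales like |z|^(1/2) and cancels the gain |z|^(-1/2) of
      the resolvent.\<close>
    have A_Some: "A (Some k) = C" for k
      using z0 by (simp add: A_def symbol_scale_def flip: powr_add)
    have X_sum: "AE \<xi> in lborel. (\<Sum>j\<in>UNIV. X j \<xi>) = 1"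
      using AE_lborel_singleton[of "0 :: real ^ 'n"]
    proof eventually_elim
      fix \<xi> :: "real ^ 'n" assume "\<xi> \<noteq> 0"
      then have "cmod z powr (-1/2) *\<^sub>R \<xi> \<noteq> 0" using z0 by simp
      from frequency_partitionD(11)[OF part this] show "(\<Sum>j\<in>UNIV. X j \<xi>) = 1"
        unfolding X_def of_real_sum[symmetric] by simp
    qed
    have pieces: "\<exists>g v w u. g \<in> borel_measurable borel \<and> has_fourier f g \<and>
        L2_inverse_fourier (\<lambda>\<xi>. 1 / D \<xi> * g \<xi>) v \<and>
        (\<forall>k. L2_inverse_fourier (\<lambda>\<xi>. \<i> * complex_of_real (\<xi> $ k) * (1 / D \<xi> * g \<xi>)) (w k)) \<and>
        (\<forall>j. L2_inverse_fourier (\<lambda>\<xi>. X j \<xi> * (1 / D \<xi> * g \<xi>)) (u None j)) \<and>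
        (\<forall>k j. L2_inverse_fourier (\<lambda>\<xi>. X j \<xi> * (\<i> * complex_of_real (\<xi> $ k) * (1 / D \<xi> * g \<xi>))) (u (Some k) j)) \<and>
        (\<forall>o' j. f \<in> mixed_space 1 2 j \<longrightarrow> mixed_norm \<infinity> 2 j (u o' j) \<le> ennreal (A o') * mixed_norm 1 2 j f)"
      if f: "f \<in> mixed_space 1 2 j0" for f :: "real ^ 'n \<Rightarrow> complex" and j0
    proof -
      obtain g v u where g: "g \<in> borel_measurable borel" "has_fourier f g"
        and v: "\<And>o'. L2_inverse_fourier (\<lambda>\<xi>. complex_of_real (symbol_factor o' \<xi>) / D \<xi> * g \<xi>) (v o')"
        and u: "\<And>o' j. L2_inverse_fourier (\<lambda>\<xi>. complex_of_real (symbol_factor o' \<xi> * chi chip chim chiinf j (cmod z powr (-1/2) *\<^sub>R \<xi>)) / D \<xi> * g \<xi>) (u o' j)"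
        and est: "\<forall>o' j. f \<in> mixed_space 1 2 j \<longrightarrow> mixed_norm \<infinity> 2 j (u o' j) \<le> ennreal (A o') * mixed_norm 1 2 j f"
      proof (rule chi_resolvent_pieces[OF part base z f, folded D_def A_def])
        fix g v u assume *: "g \<in> borel_measurable borel" "has_fourier f g"
          "\<And>o'. L2_inverse_fourier (\<lambda>\<xi>. complex_of_real (symbol_factor o' \<xi>) / D \<xi> * g \<xi>) (v o')"
          "\<And>o' j. L2_inverse_fourier (\<lambda>\<xi>. complex_of_real (symbol_factor o' \<xi> * chi chip chim chiinf j (cmod z powr (-1/2) *\<^sub>R \<xi>)) / D \<xi> * g \<xi>) (u o' j)"
          "\<forall>o' j. f \<in> mixed_space 1 2 j \<longrightarrow> mixed_norm \<infinity> 2 j (u o' j) \<le> ennreal (A o') * mixed_norm 1 2 j f"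
        show thesis by (rule that[OF *(1,2)]) (rule *)+
      qed
      \<comment> \<open>The symbol of \<partial>_k is i \<xi>_k, whereas the pieces were built with
        \<xi>_k; the missing factor has modulus 1 and leaves all norms unchanged.\<close>
      define c where "c o' = (case o' of None \<Rightarrow> 1 | Some k \<Rightarrow> \<i>)" for o' :: "'n option"
      have c1: "norm (c o') = 1" for o' by (cases o') (simp_all add: c_def)
      have "L2_inverse_fourier (\<lambda>\<xi>. 1 / D \<xi> * g \<xi>) (v None)"
        using v[of None] by simp
      moreover have "L2_inverse_fourier (\<lambda>\<xi>. \<i> * complex_of_real (\<xi> $ k) * (1 / D \<xi> * g \<xi>)) (\<lambda>x. \<i> * v (Some k) x)" for k
        using L2_inverse_fourier_cmult[OF v[of "Some k"], of \<i>] by (simp add: mult_ac)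
      moreover have "L2_inverse_fourier (\<lambda>\<xi>. X j \<xi> * (1 / D \<xi> * g \<xi>)) (\<lambda>x. c None * u None j x)" for j
        using u[of None j] by (simp add: X_def c_def)
      moreover have "L2_inverse_fourier (\<lambda>\<xi>. X j \<xi> * (\<i> * complex_of_real (\<xi> $ k) * (1 / D \<xi> * g \<xi>))) (\<lambda>x. c (Some k) * u (Some k) j x)" for k j
        using L2_inverse_fourier_cmult[OF u[of "Some k" j], of \<i>] by (simp add: X_def c_def mult_ac)
      moreover have "mixed_norm \<infinity> 2 j (\<lambda>x. c o' * u o' j x) \<le> ennreal (A o') * mixed_norm 1 2 j f" if "f \<in> mixed_space 1 2 j" for o' j
      proof -
        have "mixed_norm \<infinity> 2 j (\<lambda>x. c o' * u o' j x) = mixed_norm \<infinity> 2 j (u o' j)"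
          by (rule mixed_norm_cong_norm) (simp add: norm_mult c1)
        then show ?thesis using est that by simp
      qed
      ultimately show ?thesis
        using g by (intro exI[of _ g] exI[of _ "v None"] exI[of _ "\<lambda>k x. \<i> * v (Some k) x"] exI[of _ "\<lambda>o' j x. c o' * u o' j x"]) blast
    qed
    have scaled: "scaled_multiplier z (chi chip chim chiinf j) v u"
      if "L2_inverse_fourier G v" "L2_inverse_fourier (\<lambda>\<xi>. X j \<xi> * G \<xi>) u" for j G v u
      unfolding scaled_multiplier_def fourier_multiplier_def
      using that[THEN L2_inverse_fourier_has_fourier] by (auto simp: X_def)
    have resolvent: "resolvent_laplacian z f v"
      if "has_fourier f g" "L2_inverse_fourier (\<lambda>\<xi>. 1 / D \<xi> * g \<xi>) v" for f g v
      unfolding resolvent_laplacian_def fourier_multiplier_def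
      using that(1) that(2)[THEN L2_inverse_fourier_has_fourier] by (auto simp: D_def)
    have L2m: "u \<in> borel_measurable borel" if "L2_inverse_fourier G u" for G u
      using that by (simp add: L2_inverse_fourier_def L2_def)
    show "\<exists>u. (resolvent_laplacian z OO scaled_multiplier z (chi chip chim chiinf j)) f u \<and>
             mixed_norm \<infinity> 2 j u \<le> ennreal (n * C * cmod z powr (-1/2)) * mixed_norm 1 2 j f"
      and "\<exists>u. (resolvent_laplacian z OO weak_pderiv k OO scaled_multiplier z (chi chip chim chiinf j)) f u \<and>
             mixed_norm \<infinity> 2 j u \<le> ennreal (n * C) * mixed_norm 1 2 j f"
      if f: "f \<in> mixed_space 1 2 j" for j k and f :: "real ^ 'n \<Rightarrow> complex"
    proof -
      obtain g v w u where g: "has_fourier f g" and v: "L2_inverse_fourier (\<lambda>\<xi>. 1 / D \<xi> * g \<xi>) v"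
        and w: "L2_inverse_fourier (\<lambda>\<xi>. \<i> * complex_of_real (\<xi> $ k) * (1 / D \<xi> * g \<xi>)) (w k)"
        and u0: "L2_inverse_fourier (\<lambda>\<xi>. X j \<xi> * (1 / D \<xi> * g \<xi>)) (u None j)"
        and u1: "L2_inverse_fourier (\<lambda>\<xi>. X j \<xi> * (\<i> * complex_of_real (\<xi> $ k) * (1 / D \<xi> * g \<xi>))) (u (Some k) j)"
        and est: "\<And>o'. mixed_norm \<infinity> 2 j (u o' j) \<le> ennreal (A o') * mixed_norm 1 2 j f"
        using pieces[OF f] f by blast
      have "mixed_norm \<infinity> 2 j (u None j) \<le> ennreal (n * C * cmod z powr (-1/2)) * mixed_norm 1 2 j f"
        using est[of None] unfolding A_None
        by (rule order_trans) (intro mult_right_mono ennreal_leI nC, simp_all)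
      then show "\<exists>u. (resolvent_laplacian z OO scaled_multiplier z (chi chip chim chiinf j)) f u \<and>
             mixed_norm \<infinity> 2 j u \<le> ennreal (n * C * cmod z powr (-1/2)) * mixed_norm 1 2 j f"
        by (intro exI[of _ "u None j"] conjI) (rule relcomppI, rule resolvent[OF g v], rule scaled[OF v u0])
      have "mixed_norm \<infinity> 2 j (u (Some k) j) \<le> ennreal (n * C) * mixed_norm 1 2 j f"
        using est[of "Some k"] unfolding A_Some
        by (rule order_trans) (intro mult_right_mono ennreal_leI nC, simp)
      then show "\<exists>u. (resolvent_laplacian z OO weak_pderiv k OO scaled_multiplier z (chi chip chim chiinf j)) f u \<and>
             mixed_norm \<infinity> 2 j u \<le> ennreal (n * C) * mixed_norm 1 2 j f"
        by (intro exI[of _ "u (Some k) j"] conjI)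
          (rule relcomppI, rule resolvent[OF g v], rule relcomppI, rule L2_inverse_fourier_weak_pderiv[OF v w], rule scaled[OF w u1])
    qed
    \<comment> \<open>The norm in X^* is an infimum over decompositions, so the localized pieces
      give an admissible upper bound; on the unit ball of X every mixed norm of f is at most
      1.\<close>
    have opnorm: "opnorm_X_Xstar T \<le> ennreal (n * a)"
      if ex: "\<And>f. f \<in> X_space \<Longrightarrow> \<exists>u. T f (\<lambda>x. \<Sum>j\<in>UNIV. u j x) \<and> (\<forall>j. u j \<in> borel_measurable borel \<and> mixed_norm \<infinity> 2 j (u j) \<le> ennreal a * mixed_norm 1 2 j f)"
        and a: "0 \<le> a" for T :: "(real ^ 'n \<Rightarrow> complex) \<Rightarrow> (real ^ 'n \<Rightarrow> complex) \<Rightarrow> bool" and a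
      unfolding opnorm_X_Xstar_def
    proof (rule SUP_least)
      fix f :: "real ^ 'n \<Rightarrow> complex" assume f: "f \<in> {f \<in> X_space. X_norm f \<le> 1}"
      then obtain u where T: "T f (\<lambda>x. \<Sum>j\<in>UNIV. u j x)" and u: "\<And>j. u j \<in> borel_measurable borel"
        "\<And>j. mixed_norm \<infinity> 2 j (u j) \<le> ennreal a * mixed_norm 1 2 j f"
        using ex[of f] by blast
      have le1: "mixed_norm 1 2 j f \<le> 1" for j using mixed_norm_le_X_norm[of j f] f by (auto intro: order_trans)
      have "Xstar_norm (\<lambda>x. \<Sum>j\<in>UNIV. u j x) \<le> (\<Sum>j\<in>UNIV. mixed_norm \<infinity> 2 j (u j))"
        by (rule Xstar_norm_sum_le[OF u(1)])
      also have "\<dots> \<le> (\<Sum>j\<in>(UNIV :: 'n set). ennreal a * 1)"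
        by (intro sum_mono order_trans[OF u(2)] mult_left_mono le1) simp
      also have "\<dots> = ennreal (n * a)"
        using a by (simp add: n_def ennreal_mult ennreal_of_nat_eq_real_of_nat)
      finally show "(INF u \<in> {u. T f u}. Xstar_norm u) \<le> ennreal (n * a)"
        using T by (intro INF_lower2[of "\<lambda>x. \<Sum>j\<in>UNIV. u j x"]) auto
    qed
    \<comment> \<open>The sum of the localized outputs is itself an image of f under the unlocalized
      operator, because the cut-offs sum to 1 off the origin.\<close>
    have sum_pieces: "L2_inverse_fourier G (\<lambda>x. \<Sum>j\<in>UNIV. u j x)"
      if u: "\<And>j. L2_inverse_fourier (\<lambda>\<xi>. X j \<xi> * G \<xi>) (u j)" and G: "G \<in> borel_measurable borel" for G u
    proof (rule L2_inverse_fourier_cong_AE[OF L2_inverse_fourier_sum[OF finite u] G])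
      show "AE \<xi> in lborel. (\<Sum>j\<in>UNIV. X j \<xi> * G \<xi>) = G \<xi>"
        using X_sum by eventually_elim (simp flip: sum_distrib_right)
    qed
    have Gm: "G \<in> borel_measurable borel" if "L2_inverse_fourier G v" for G v
      using that by (simp add: L2_inverse_fourier_def L2_def)
    have "opnorm_X_Xstar (resolvent_laplacian z :: (real ^ 'n \<Rightarrow> complex) \<Rightarrow> _) \<le> ennreal (n * (C * cmod z powr (-1/2)))"
    proof (rule opnorm)
      fix f :: "real ^ 'n \<Rightarrow> complex" assume "f \<in> X_space"
      then have f: "f \<in> mixed_space 1 2 j" for j by (simp add: X_space_def)
      obtain g v u where g: "has_fourier f g" and v: "L2_inverse_fourier (\<lambda>\<xi>. 1 / D \<xi> * g \<xi>) v"
        and u: "\<And>j. L2_inverse_fourier (\<lambda>\<xi>. X j \<xi> * (1 / D \<xi> * g \<xi>)) (u None j)"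
        and est: "\<And>j. mixed_norm \<infinity> 2 j (u None j) \<le> ennreal (A None) * mixed_norm 1 2 j f"
        using pieces[OF f] by (elim exE conjE) (rule that, auto simp: f)
      show "\<exists>u. resolvent_laplacian z f (\<lambda>x. \<Sum>j\<in>UNIV. u j x) \<and> (\<forall>j. u j \<in> borel_measurable borel \<and>
          mixed_norm \<infinity> 2 j (u j) \<le> ennreal (C * cmod z powr (-1/2)) * mixed_norm 1 2 j f)"
        using resolvent[OF g sum_pieces[OF u Gm[OF v]]] L2m[OF u] est unfolding A_None by blast
    qed (use C in simp)
    then show "opnorm_X_Xstar (resolvent_laplacian z :: (real ^ 'n \<Rightarrow> complex) \<Rightarrow> _) \<le> ennreal (n * C * cmod z powr (-1/2))"
      by (simp only: mult.assoc)
    show "opnorm_X_Xstar (resolvent_laplacian z OO weak_pderiv k) \<le> ennreal (n * C)" for k :: 'n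
    proof (rule opnorm)
      fix f :: "real ^ 'n \<Rightarrow> complex" assume "f \<in> X_space"
      then have f: "f \<in> mixed_space 1 2 j" for j by (simp add: X_space_def)
      obtain g v w u where g: "has_fourier f g" and v: "L2_inverse_fourier (\<lambda>\<xi>. 1 / D \<xi> * g \<xi>) v"
        and w: "L2_inverse_fourier (\<lambda>\<xi>. \<i> * complex_of_real (\<xi> $ k) * (1 / D \<xi> * g \<xi>)) (w k)"
        and u: "\<And>j. L2_inverse_fourier (\<lambda>\<xi>. X j \<xi> * (\<i> * complex_of_real (\<xi> $ k) * (1 / D \<xi> * g \<xi>))) (u (Some k) j)"
        and est: "\<And>j. mixed_norm \<infinity> 2 j (u (Some k) j) \<le> ennreal (A (Some k)) * mixed_norm 1 2 j f"
        using pieces[OF f] by (elim exE conjE) (rule that, auto simp: f)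
      have "(resolvent_laplacian z OO weak_pderiv k) f (\<lambda>x. \<Sum>j\<in>UNIV. u (Some k) j x)"
        by (rule relcomppI, rule resolvent[OF g v], rule L2_inverse_fourier_weak_pderiv[OF v sum_pieces[OF u Gm[OF w]]])
      then show "\<exists>u. (resolvent_laplacian z OO weak_pderiv k) f (\<lambda>x. \<Sum>j\<in>UNIV. u j x) \<and> (\<forall>j. u j \<in> borel_measurable borel \<and>
          mixed_norm \<infinity> 2 j (u j) \<le> ennreal C * mixed_norm 1 2 j f)"
        using L2m[OF u] est unfolding A_Some by blast
    qed (use C in simp)
  qed
qed

end
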